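(* Let $Q$ be any finite symmetric quiver with set of vertices $I$, and let $(\mathcal{H},\star)$ be its rational Cohomological Hall algebra with the sign-twisted product, regarded as a $(\mathbb{Z}_{\geq 0}^I\times\mathbb{Z})$-graded super-commutative algebra. Then $(\mathcal{H},\star)$ is a free super-commutative algebra generated by a $(\mathbb{Z}_{\geq 0}^I\times\mathbb{Z})$-graded vector space $V$ of the form $V=V^{prim}\otimes\mathbb{Q}[x]$, where $V^{prim}$ is a $(\mathbb{Z}_{\geq 0}^I\times\mathbb{Z})$-graded $\mathbb{Q}$-vector space, $x$ is a variable of bidegree $(0,2)\in\mathbb{Z}_{\geq 0}^I\times\mathbb{Z}$, and for any $\gamma\in\mathbb{Z}_{\geq 0}^I$ the space $V^{prim}_{\gamma,k}$ is non-zero (and finite-dimensional) only for finitely many $k\in\mathbb{Z}$.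
   Context: **Quiver.** $Q$ is a finite quiver with set of vertices $I$ and $a_{ij}\in\mathbb{Z}_{\geq 0}$ arrows from $i$ to $j$ ($i,j\in I$). It is symmetric if $a_{ij}=a_{ji}$ for all $i,j$. The Euler form is $\chi_Q(\gamma_1,\gamma_2)=\sum_{i\in I}\gamma_1^i\gamma_2^i-\sum_{i,j\in I}a_{ij}\gamma_1^i\gamma_2^j$ for $\gamma_1,\gamma_2\in\mathbb{Z}^I$; it is symmetric when $Q$ is. **Cohomological Hall algebra.** For $\gamma=(\gamma^i)_{i\in I}\in\mathbb{Z}_{\geq 0}^I$, let $M_\gamma=\prod_{i,j\in I}\mathbb{C}^{a_{ij}\gamma^i\gamma^j}$ be the affine space of representations of $Q$ in the coordinate spaces $\mathbb{C}^{\gamma^i}$, acted on by conjugation by $G_\gamma=\prod_{i\in I}GL(\gamma^i,\mathbb{C})$. Put $\mathcal{H}=\bigoplus_{\gamma\in\mathbb{Z}_{\geq 0}^I}\mathcal{H}_\gamma$, $\mathcal{H}_\gamma:=H^{\bullet}_{G_\gamma}(M_\gamma,\mathbb{Q})$. For $\gamma=\gamma_1+\gamma_2$, let $M_{\gamma_1,\gamma_2}\subset M_\gamma$ be the subspace of representations for which the standard subspaces $\mathbb{C}^{\gamma_1^i}\subset\mathbb{C}^{\gamma^i}$ form a subrepresentation, and $G_{\gamma_1,\gamma_2}\subset G_\gamma$ the subgroup preserving these subspaces. The product $\mathcal{H}_{\gamma_1}\otimes\mathcal{H}_{\gamma_2}\to\mathcal{H}_{\gamma}$ is the composition of the Künneth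 isomorphism, the isomorphism $H^\bullet_{G_{\gamma_1}\times G_{\gamma_2}}(M_{\gamma_1}\times M_{\gamma_2},\mathbb{Q})\cong H^\bullet_{G_{\gamma_1,\gamma_2}}(M_{\gamma_1,\gamma_2},\mathbb{Q})$ and the natural pushforwards $H^\bullet_{G_{\gamma_1,\gamma_2}}(M_{\gamma_1,\gamma_2},\mathbb{Q})\to H^{\bullet+2c_1}_{G_{\gamma_1,\gamma_2}}(M_{\gamma},\mathbb{Q})\to H^{\bullet+2c_1+2c_2}_{G_{\gamma}}(M_{\gamma},\mathbb{Q})$, where $c_1=\dim_{\mathbb C} M_\gamma-\dim_{\mathbb C} M_{\gamma_1,\gamma_2}$, $c_2=\dim_{\mathbb C} G_{\gamma_1,\gamma_2}-\dim_{\mathbb C} G_\gamma$. This makes $\mathcal{H}$ an associative unital $\mathbb{Z}_{\geq 0}^I$-graded $\mathbb{Q}$-algebra. **Explicit description (Kontsevich–Soibelman).** Equivalently, $\mathcal{H}_\gamma=\mathbb{Q}[\{x_{i,\alpha}\}_{i\in I,\,1\leq\alpha\leq\gamma^i}]^{\prod_{i\in I}S_{\gamma^i}}$ (each $x_{i,\alpha}$ has cohomological degree $2$), and for $f_1\in\mathcal{H}_{\gamma_1}$, $f_2\in\mathcal{H}_{\gamma_2}$ the product $f_1\cdot f_2\in\mathcal{H}_{\gamma_1+\gamma_2}$ is the sum over all shuffles (for each $i\in I$, all ways of distributing the variables $x_{i,1},\dots,x_{i,\gamma_1^i+\gamma_2^i}$ into an increasing list $x'_{i,1},\dots,x'_{i,\gamma_1^i}$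 and a complementary increasing list $x''_{i,1},\dots,x''_{i,\gamma_2^i}$) of $$f_1((x'_{i,\alpha}))\,f_2((x''_{i,\alpha}))\,\frac{\prod_{i,j\in I}\prod_{\alpha_1=1}^{\gamma_1^i}\prod_{\alpha_2=1}^{\gamma_2^j}(x''_{j,\alpha_2}-x'_{i,\alpha_1})^{a_{ij}}}{\prod_{i\in I}\prod_{\alpha_1=1}^{\gamma_1^i}\prod_{\alpha_2=1}^{\gamma_2^i}(x''_{i,\alpha_2}-x'_{i,\alpha_1})}.$$ **Bigrading and twisted product (symmetric $Q$).** A homogeneous polynomial $f\in\mathcal{H}_\gamma$ of polynomial degree $d$ has bidegree $(\gamma,2d+\chi_Q(\gamma,\gamma))\in\mathbb{Z}_{\geq 0}^I\times\mathbb{Z}$; the product respects this bigrading. The super-structure (parity) is induced by the $\mathbb{Z}$-grading, so elements of $\mathcal{H}_{\gamma,k}$ have parity $k\equiv\epsilon(\gamma):=\chi_Q(\gamma,\gamma)\bmod 2$. The form $(\gamma_1,\gamma_2)\mapsto\chi_Q(\gamma_1,\gamma_2)+\epsilon(\gamma_1)\epsilon(\gamma_2)\bmod 2$ induces a symmetric bilinear form $\beta$ on $(\mathbb{Z}/2\mathbb{Z})^I$ with $\beta(\gamma,\gamma)=0$ for all $\gamma$. Fix a bilinear form $\psi$ on $(\mathbb{Z}/2\mathbb{Z})^I$ with $\psi(\gamma_1,\gamma_2)+\psi(\gamma_2,\gamma_1)=\beta(\gamma_1,\gamma_2)$, and set $a\star b=(-1)^{\psi(\gamma,\gamma')}a\cdot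 b$ for $a\in\mathcal{H}_{\gamma,k}$, $b\in\mathcal{H}_{\gamma',k'}$. Then $(\mathcal{H},\star)$ is associative and super-commutative: $a\star b=(-1)^{kk'}b\star a$. **Freeness.** $(\mathcal{H},\star)$ is free super-commutative generated by a bigraded subspace $V\subset\mathcal{H}$ if the canonical map from the free unital super-commutative algebra on $V$ (the symmetric algebra on the even part tensored with the exterior algebra on the odd part) to $(\mathcal{H},\star)$ is an isomorphism. $V^{prim}_{\gamma,k}$ denotes the component of bidegree $(\gamma,k)$. *)

theory Defs
  imports
    "HOL-Library.Poly_Mapping"
    "HOL-Library.Countable"
    "HOL-Library.Z2"
    "HOL-Computational_Algebra.Polynomial_Factorial"
    "HOL-Combinatorics.Permutations"
    "HOL-Analysis.Cartesian_Space"
    "HOL-Algebra.QuotRing"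
begin

section \<open>Quivers and the Euler form\<close>

text \<open>A quiver on the finite vertex type \<open>'i\<close>; \<open>a i j\<close> is the number of arrows from \<open>i\<close> to \<open>j\<close>.\<close>

type_synonym 'i quiver = "'i \<Rightarrow> 'i \<Rightarrow> nat"

type_synonym 'i dimvec = "'i \<Rightarrow> nat"

definition symmetric_quiver :: "'i quiver \<Rightarrow> bool" where
  "symmetric_quiver a \<longleftrightarrow> (\<forall>i j. a i j = a j i)"

definition euler_form :: "'i::finite quiver \<Rightarrow> ('i \<Rightarrow> int) \<Rightarrow> ('i \<Rightarrow> int) \<Rightarrow> int" where
  "euler_form a \<gamma> \<delta> =
     (\<Sum>i\<in>UNIV. \<gamma> i * \<delta> i) - (\<Sum>i\<in>UNIV. \<Sum>j\<in>UNIV. int (a i j) * \<gamma> i * \<delta> j)"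

section \<open>Polynomials in the variables $x_{i,\alpha}$\<close>

text \<open>Variables are numbered from 0, so that the ones belonging to \<open>\<gamma>\<close> are
  \<open>X i \<alpha>\<close> with \<open>\<alpha> < \<gamma> i\<close>. The linear order on variables is an arbitrary one; its only purpose is
  that the library then knows the polynomial ring to be an integral domain.\<close>

datatype 'i var = X 'i nat

instance var :: (countable) countable
  by countable_datatype

instantiation var :: (countable) linorder
begin

definition less_eq_var :: "'a var \<Rightarrow> 'a var \<Rightarrow> bool" where
  "less_eq_var v w \<longleftrightarrow> to_nat v \<le> to_nat w"

definition less_var :: "'a var \<Rightarrow> 'a var \<Rightarrow> bool" where
  "less_var v w \<longleftrightarrow> to_nat v < to_nat w"

instance
  by standard (auto simp: less_eq_var_def less_var_def)

end

type_synonym 'i mpoly = "('i var \<Rightarrow>\<^sub>0 nat) \<Rightarrow>\<^sub>0 rat"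

definition pvar :: "'i \<Rightarrow> nat \<Rightarrow> 'i mpoly" where
  "pvar i \<alpha> = Poly_Mapping.single (Poly_Mapping.single (X i \<alpha>) 1) 1"

definition mono_degree :: "('i var \<Rightarrow>\<^sub>0 nat) \<Rightarrow> nat" where
  "mono_degree m = (\<Sum>v\<in>Poly_Mapping.keys m. Poly_Mapping.lookup m v)"

definition rename_vars :: "('i \<Rightarrow> nat \<Rightarrow> nat) \<Rightarrow> 'i mpoly \<Rightarrow> 'i mpoly" where
  "rename_vars r p =
     (\<Sum>m\<in>Poly_Mapping.keys p. Poly_Mapping.single 0 (Poly_Mapping.lookup p m) *
        (\<Prod>v\<in>Poly_Mapping.keys m. case v of X i \<alpha> \<Rightarrow> pvar i (r i \<alpha>) ^ Poly_Mapping.lookup m v))"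

definition hall_comp :: "'i dimvec \<Rightarrow> 'i mpoly set" where
  "hall_comp \<gamma> =
     {p. (\<forall>m\<in>Poly_Mapping.keys p. Poly_Mapping.keys m \<subseteq> {X i \<alpha> | i \<alpha>. \<alpha> < \<gamma> i}) \<and>
         (\<forall>\<pi>. (\<forall>i. \<pi> i permutes {..<\<gamma> i}) \<longrightarrow> rename_vars \<pi> p = p)}"

section \<open>The shuffle product\<close>

text \<open>A shuffle is given by the positions \<open>S i\<close> of the variables $x'_{i,\cdot}$ among
  $x_{i,0},\ldots,x_{i,\gamma^i+\delta^i-1}$; the $x''_{i,\cdot}$ occupy the remaining positions.\<close>

definition shuffles_of :: "'i dimvec \<Rightarrow> 'i dimvec \<Rightarrow> ('i \<Rightarrow> nat set) set" where
  "shuffles_of \<gamma> \<delta> = {S. \<forall>i. S i \<subseteq> {..<\<gamma> i + \<delta> i} \<and> card (S i) = \<gamma> i}"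

definition pos1 :: "('i \<Rightarrow> nat set) \<Rightarrow> 'i \<Rightarrow> nat \<Rightarrow> nat" where
  "pos1 S i \<alpha> = sorted_list_of_set (S i) ! \<alpha>"

definition pos2 :: "'i dimvec \<Rightarrow> 'i dimvec \<Rightarrow> ('i \<Rightarrow> nat set) \<Rightarrow> 'i \<Rightarrow> nat \<Rightarrow> nat" where
  "pos2 \<gamma> \<delta> S i \<alpha> = sorted_list_of_set ({..<\<gamma> i + \<delta> i} - S i) ! \<alpha>"

definition shuffle_summand ::
  "'i::finite quiver \<Rightarrow> 'i dimvec \<Rightarrow> 'i dimvec \<Rightarrow> 'i mpoly \<Rightarrow> 'i mpoly \<Rightarrow> ('i \<Rightarrow> nat set) \<Rightarrow> 'i mpoly fract"
where
  "shuffle_summand a \<gamma> \<delta> f g S =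
     (let x' = (\<lambda>i \<alpha>. pvar i (pos1 S i \<alpha>)); x'' = (\<lambda>i \<alpha>. pvar i (pos2 \<gamma> \<delta> S i \<alpha>)) in
      to_fract (rename_vars (pos1 S) f * rename_vars (pos2 \<gamma> \<delta> S) g) *
      (to_fract (\<Prod>i\<in>UNIV. \<Prod>j\<in>UNIV. \<Prod>\<alpha><\<gamma> i. \<Prod>\<beta><\<delta> j. (x'' j \<beta> - x' i \<alpha>) ^ a i j) /
       to_fract (\<Prod>i\<in>UNIV. \<Prod>\<alpha><\<gamma> i. \<Prod>\<beta><\<delta> i. x'' i \<beta> - x' i \<alpha>)))"

text \<open>For \<open>f \<in> hall_comp \<gamma>\<close> and \<open>g \<in> hall_comp \<delta>\<close> the sum of fractions is a polynomial.\<close>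

definition shuffle_prod ::
  "'i::finite quiver \<Rightarrow> 'i dimvec \<Rightarrow> 'i dimvec \<Rightarrow> 'i mpoly \<Rightarrow> 'i mpoly \<Rightarrow> 'i mpoly"
where
  "shuffle_prod a \<gamma> \<delta> f g =
     (THE p. to_fract p = (\<Sum>S\<in>shuffles_of \<gamma> \<delta>. shuffle_summand a \<gamma> \<delta> f g S))"

section \<open>The cohomological Hall algebra\<close>

type_synonym 'i coha = "'i dimvec \<Rightarrow>\<^sub>0 'i mpoly"

definition coha_carrier :: "'i coha set" where
  "coha_carrier = {f. \<forall>\<gamma>. Poly_Mapping.lookup f \<gamma> \<in> hall_comp \<gamma>}"

definition coha_scale :: "rat \<Rightarrow> 'i coha \<Rightarrow> 'i coha" where
  "coha_scale c = Poly_Mapping.map (Poly_Mapping.map ((*) c))"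

lemma lookup_coha_scale:
  "Poly_Mapping.lookup (Poly_Mapping.lookup (coha_scale c f) \<gamma>) m =
     c * Poly_Mapping.lookup (Poly_Mapping.lookup f \<gamma>) m"
  by (auto simp: coha_scale_def Poly_Mapping.map.rep_eq when_def)

global_interpretation coha: vector_space coha_scale
  by standard (auto intro!: poly_mapping_eqI simp: lookup_coha_scale lookup_add algebra_simps)

text \<open>The component \<open>\<H>\<^bsub>\<gamma>,k\<^esub>\<close>; it contains 0 for every \<open>(\<gamma>, k)\<close>.\<close>

definition coha_bideg :: "'i::finite quiver \<Rightarrow> 'i dimvec \<Rightarrow> int \<Rightarrow> 'i coha set" where
  "coha_bideg a \<gamma> k =
     {Poly_Mapping.single \<gamma> p | p. p \<in> hall_comp \<gamma> \<and>
        (\<forall>m\<in>Poly_Mapping.keys p.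
           2 * int (mono_degree m) + euler_form a (int \<circ> \<gamma>) (int \<circ> \<gamma>) = k)}"

definition coha_mult :: "'i::finite quiver \<Rightarrow> 'i coha \<Rightarrow> 'i coha \<Rightarrow> 'i coha" where
  "coha_mult a f g =
     (\<Sum>\<gamma>\<in>Poly_Mapping.keys f. \<Sum>\<delta>\<in>Poly_Mapping.keys g.
        Poly_Mapping.single (\<lambda>i. \<gamma> i + \<delta> i)
          (shuffle_prod a \<gamma> \<delta> (Poly_Mapping.lookup f \<gamma>) (Poly_Mapping.lookup g \<delta>)))"

section \<open>The sign twist\<close>

definition mod2 :: "('i::finite \<Rightarrow> int) \<Rightarrow> bit ^ 'i" where
  "mod2 \<gamma> = (\<chi> i. of_int (\<gamma> i))"

definition bilinear_form :: "(bit ^ 'i \<Rightarrow> bit ^ 'i \<Rightarrow> bit) \<Rightarrow> bool" where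
  "bilinear_form \<psi> \<longleftrightarrow>
     (\<forall>u. Vector_Spaces.linear (*s) (*) (\<lambda>v. \<psi> u v)) \<and>
     (\<forall>v. Vector_Spaces.linear (*s) (*) (\<lambda>u. \<psi> u v))"

text \<open>The right-hand side of the second conjunct is \<open>\<beta>\<close>, pulled back along the surjection
  \<open>mod2\<close>, with \<open>\<epsilon>(\<gamma>)\<close> represented by the integer $\chi_Q(\gamma,\gamma)$.\<close>

definition sign_twist :: "'i::finite quiver \<Rightarrow> (bit ^ 'i \<Rightarrow> bit ^ 'i \<Rightarrow> bit) \<Rightarrow> bool" where
  "sign_twist a \<psi> \<longleftrightarrow> bilinear_form \<psi> \<and>
     (\<forall>\<gamma> \<delta>. \<psi> (mod2 \<gamma>) (mod2 \<delta>) + \<psi> (mod2 \<delta>) (mod2 \<gamma>) =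
        of_int (euler_form a \<gamma> \<delta> + euler_form a \<gamma> \<gamma> * euler_form a \<delta> \<delta>))"

definition twisted_mult ::
  "'i::finite quiver \<Rightarrow> (bit ^ 'i \<Rightarrow> bit ^ 'i \<Rightarrow> bit) \<Rightarrow> 'i coha \<Rightarrow> 'i coha \<Rightarrow> 'i coha"
where
  "twisted_mult a \<psi> f g =
     (\<Sum>\<gamma>\<in>Poly_Mapping.keys f. \<Sum>\<delta>\<in>Poly_Mapping.keys g.
        coha_scale (if \<psi> (mod2 (int \<circ> \<gamma>)) (mod2 (int \<circ> \<delta>)) = 1 then -1 else 1)
          (coha_mult a (Poly_Mapping.single \<gamma> (Poly_Mapping.lookup f \<gamma>))
                       (Poly_Mapping.single \<delta> (Poly_Mapping.lookup g \<delta>))))"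

definition coha_one :: "'i coha" where
  "coha_one = Poly_Mapping.single (\<lambda>_. 0) 1"

definition twisted_coha ::
  "'i::finite quiver \<Rightarrow> (bit ^ 'i \<Rightarrow> bit ^ 'i \<Rightarrow> bit) \<Rightarrow> 'i coha ring"
where
  "twisted_coha a \<psi> =
     \<lparr>carrier = coha_carrier, mult = twisted_mult a \<psi>, one = coha_one,
      zero = 0, add = (+)\<rparr>"

section \<open>Bigraded subspaces\<close>

definition bigraded_subspace :: "'i::finite quiver \<Rightarrow> 'i coha set \<Rightarrow> bool" where
  "bigraded_subspace a W \<longleftrightarrow>
     coha.subspace W \<and> W = coha.span (\<Union>\<gamma> k. W \<inter> coha_bideg a \<gamma> k)"

text \<open>\<open>W \<otimes> \<rat>[x]\<close> is realised as the space \<open>W[x]\<close> of polynomials with coefficients in \<open>W\<close>,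
  the tensor \<open>w \<otimes> x ^ n\<close> being \<open>monom w n\<close>. As \<open>x\<close> has bidegree \<open>(0, 2)\<close>, \<open>monom w n\<close> has
  bidegree \<open>(\<gamma>, k + 2 n)\<close> for \<open>w\<close> of bidegree \<open>(\<gamma>, k)\<close>.\<close>

definition tensor_Qx :: "'i coha set \<Rightarrow> 'i coha poly set" where
  "tensor_Qx W = {p. \<forall>n. coeff p n \<in> W}"

definition tensor_Qx_bideg ::
  "'i::finite quiver \<Rightarrow> 'i coha set \<Rightarrow> 'i dimvec \<Rightarrow> int \<Rightarrow> 'i coha poly set"
where
  "tensor_Qx_bideg a W \<gamma> k = {p. \<forall>n. coeff p n \<in> W \<inter> coha_bideg a \<gamma> (k - 2 * int n)}"

definition bigraded_iso_tensor_Qx ::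
  "'i::finite quiver \<Rightarrow> 'i coha set \<Rightarrow> 'i coha set \<Rightarrow> ('i coha poly \<Rightarrow> 'i coha) \<Rightarrow> bool"
where
  "bigraded_iso_tensor_Qx a W V \<phi> \<longleftrightarrow>
     bij_betw \<phi> (tensor_Qx W) V \<and>
     (\<forall>p\<in>tensor_Qx W. \<forall>q\<in>tensor_Qx W. \<phi> (p + q) = \<phi> p + \<phi> q) \<and>
     (\<forall>c. \<forall>p\<in>tensor_Qx W. \<phi> (map_poly (coha_scale c) p) = coha_scale c (\<phi> p)) \<and>
     (\<forall>\<gamma> k. \<phi> ` tensor_Qx_bideg a W \<gamma> k = V \<inter> coha_bideg a \<gamma> k)"

section \<open>Free super-commutative algebras\<close>

text \<open>The free associative unital \<open>\<rat>\<close>-algebra on the set \<open>V\<close>, with basis the words in \<open>V\<close>.\<close>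

definition free_algebra :: "'h set \<Rightarrow> ('h list \<Rightarrow>\<^sub>0 rat) ring" where
  "free_algebra V =
     \<lparr>carrier = {t. \<forall>w\<in>Poly_Mapping.keys t. set w \<subseteq> V},
      mult = (\<lambda>s t. \<Sum>u\<in>Poly_Mapping.keys s. \<Sum>w\<in>Poly_Mapping.keys t.
                Poly_Mapping.single (u @ w) (Poly_Mapping.lookup s u * Poly_Mapping.lookup t w)),
      one = Poly_Mapping.single [] 1,
      zero = 0,
      add = (+)\<rparr>"

text \<open>The first two families make the free algebra on the set \<open>V\<close> into the tensor algebra of the
  vector space \<open>V\<close>; the other two cut the latter down to
  \<open>Sym(V\<^bsub>even\<^esub>) \<otimes> \<Lambda>(V\<^bsub>odd\<^esub>)\<close>.\<close>

definition supercomm_relations ::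
  "'i::finite quiver \<Rightarrow> 'i coha set \<Rightarrow> ('i coha list \<Rightarrow>\<^sub>0 rat) set"
where
  "supercomm_relations a V =
     {Poly_Mapping.single [u + v] 1 - Poly_Mapping.single [u] 1 - Poly_Mapping.single [v] 1 | u v.
        u \<in> V \<and> v \<in> V} \<union>
     {Poly_Mapping.single [coha_scale c u] 1 - Poly_Mapping.single [u] c | c u. u \<in> V} \<union>
     {Poly_Mapping.single [u, v] 1 - Poly_Mapping.single [v, u] ((- 1) powi (k * l)) | u v \<gamma> \<delta> k l.
        u \<in> V \<inter> coha_bideg a \<gamma> k \<and> v \<in> V \<inter> coha_bideg a \<delta> l} \<union>
     {Poly_Mapping.single [u, u] 1 | u \<gamma> k. u \<in> V \<inter> coha_bideg a \<gamma> k \<and> odd k}"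

definition free_supercomm ::
  "'i::finite quiver \<Rightarrow> 'i coha set \<Rightarrow> ('i coha list \<Rightarrow>\<^sub>0 rat) set ring"
where
  "free_supercomm a V =
     free_algebra V Quot (Idl\<^bsub>free_algebra V\<^esub> (supercomm_relations a V))"

definition eval_words ::
  "'i::finite quiver \<Rightarrow> (bit ^ 'i \<Rightarrow> bit ^ 'i \<Rightarrow> bit) \<Rightarrow> ('i coha list \<Rightarrow>\<^sub>0 rat) \<Rightarrow> 'i coha"
where
  "eval_words a \<psi> t =
     (\<Sum>w\<in>Poly_Mapping.keys t.
        coha_scale (Poly_Mapping.lookup t w) (foldr (twisted_mult a \<psi>) w coha_one))"

definition canonical_map ::
  "'i::finite quiver \<Rightarrow> (bit ^ 'i \<Rightarrow> bit ^ 'i \<Rightarrow> bit) \<Rightarrow> ('i coha list \<Rightarrow>\<^sub>0 rat) set \<Rightarrow> 'i coha"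
where
  "canonical_map a \<psi> C = the_elem (eval_words a \<psi> ` C)"

text \<open>The first conjunct says that the canonical map is well defined on residue classes.\<close>

definition freely_generated_by ::
  "'i::finite quiver \<Rightarrow> (bit ^ 'i \<Rightarrow> bit ^ 'i \<Rightarrow> bit) \<Rightarrow> 'i coha set \<Rightarrow> bool"
where
  "freely_generated_by a \<psi> V \<longleftrightarrow>
     (\<forall>C\<in>carrier (free_supercomm a V). is_singleton (eval_words a \<psi> ` C)) \<and>
     canonical_map a \<psi> \<in> ring_iso (free_supercomm a V) (twisted_coha a \<psi>)"

end

theory Submission
  imports Defs
begin

text \<open>Write \<open>f \<star> g\<close> for the twisted product.

  \<^bold>\<open>Values on finite sets.\<close> A symmetric polynomial of dimension vector \<open>\<gamma>\<close> is determined by its values on families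
  \<open>P\<close> of finite sets of rationals with \<open>card (P i) = \<gamma> i\<close> (\<open>cv_ext\<close>). In these terms the product is a convolution: the
  value of \<open>f \<star> g\<close> at \<open>P\<close> is the sum over the subfamilies \<open>A \<le> P\<close> of \<open>twisted_kern A (P - A)\<close> times the values of
  \<open>f\<close> at \<open>A\<close> and of \<open>g\<close> at \<open>P - A\<close> (\<open>cv_mul\<close>). The kernel is multiplicative in both arguments, which gives
  associativity, and exchanging its arguments produces a sign, which gives super-commutativity. That the sum over
  shuffles is a polynomial at all is proved by cancelling one difference of variables after the other.

  \<^bold>\<open>Generators.\<close> Let \<open>Hplus\<close> be the augmentation ideal, \<open>Dec\<close> its square, and \<open>sig\<close> multiplication by the sum of all
  variables, which is a derivation. Translating all the variables by one is an automorphism, and its difference from the identity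
  is locally nilpotent and has an invertible commutator with \<open>sig\<close>; hence \<open>sig\<close> is injective on \<open>Hplus / Dec\<close>
  (\<open>sig_Dec_cancel\<close>). Choose \<open>Vprim\<close> as a bigraded complement of \<open>Dec + sig ` Hplus\<close> in \<open>Hplus\<close>, and let \<open>V\<close> be the sum of the
  spaces \<open>(sig ^^ n) ` Vprim\<close>. By injectivity \<open>V\<close> is isomorphic to \<open>Vprim[x]\<close> (\<open>iso_phi\<close>), it meets \<open>Dec\<close> only in zero
  (\<open>V_Dec\<close>), and together with \<open>Dec\<close> it spans \<open>Hplus\<close> (\<open>Hplus_V_Dec\<close>), so it generates the algebra.

  \<^bold>\<open>Freeness.\<close> Take a homogeneous basis \<open>B\<close> of \<open>V\<close> and a relation between words in \<open>B\<close>. Let \<open>\<gamma>\<close> be a dimension vector of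
  maximal size among those of the letters in it, fix a family \<open>Y\<close>, and restrict the relation to \<open>sup W Y\<close> with \<open>W\<close> variable, of
  dimension vector \<open>\<gamma>\<close>. The terms splitting \<open>W\<close> between several letters are decomposable as functions of \<open>W\<close>, and no letter
  strictly contains \<open>W\<close>. What remains is the sum over the letters \<open>c\<close> of dimension vector \<open>\<gamma>\<close> of
  \<open>c\<close>, evaluated at \<open>W\<close>, times the derivative of the relation with respect to \<open>c\<close>, evaluated at \<open>Y\<close>, times the kernel
  between \<open>W\<close> and \<open>Y\<close>. After clearing denominators the kernel is a function of \<open>W\<close> that does not vanish at the origin, and
  such a factor can be cancelled modulo \<open>Dec\<close> (\<open>mop_Dec_cancel\<close>). As \<open>V\<close> meets \<open>Dec\<close> trivially, all the
  derivatives of the relation are relations (\<open>derivative_relation\<close>). They are shorter, hence consequences of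
  super-commutativity by induction, and Euler's identity for derivatives recovers the relation from them (\<open>kernel_basis\<close>).

  \<^bold>\<open>Finiteness.\<close> Consider the polynomials \<open>f\<close> such that the symmetrizations of all multiples of \<open>f\<close> lie in
  \<open>Dec + sig ` Hplus\<close>. They form an ideal that contains the sum of the variables and, for each division of the variables into two
  nonempty parts, a power of the product of the differences between the parts: products of two elements with these two sets of
  variables symmetrize multiples of the kernel. The common zeros of such an ideal have all coordinates equal with sum zero, so
  each variable is nilpotent modulo the ideal (\<open>variable_nilpotent\<close>). So \<open>Dec + sig ` Hplus\<close> contains everything
  of large degree, and \<open>Vprim\<close> has finitely many nonzero components for each dimension vector.\<close>

section \<open>Polynomials as functions\<close>

abbreviation "keys \<equiv> Poly_Mapping.keys"
abbreviation "lookup \<equiv> Poly_Mapping.lookup"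
abbreviation "single \<equiv> Poly_Mapping.single"

lemma poly_mapping_sum_single: "p = (\<Sum>m\<in>keys p. single m (lookup p m))"
proof (rule poly_mapping_eqI)
  fix k
  have "(\<Sum>m\<in>keys p. lookup (single m (lookup p m)) k) = (\<Sum>m\<in>keys p. if m = k then lookup p m else 0)"
    by (intro sum.cong) (auto simp: lookup_single when_def)
  then show "lookup p k = lookup (\<Sum>m\<in>keys p. single m (lookup p m)) k"
    by (simp add: lookup_sum in_keys_iff)
qed

definition mono_eval :: "('v \<Rightarrow> 'b::comm_monoid_mult) \<Rightarrow> ('v \<Rightarrow>\<^sub>0 nat) \<Rightarrow> 'b" where
  "mono_eval s m = (\<Prod>v\<in>keys m. s v ^ lookup m v)"

lemma mono_eval_superset:
  assumes "finite A" "keys m \<subseteq> A"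
  shows "mono_eval s m = (\<Prod>v\<in>A. s v ^ lookup m v)"
  unfolding mono_eval_def using assms
  by (intro prod.mono_neutral_left) (auto simp: in_keys_iff)

lemma mono_eval_zero [simp]: "mono_eval s 0 = 1"
  by (simp add: mono_eval_def)

lemma mono_eval_add: "mono_eval s (m + n) = mono_eval s m * mono_eval s n"
proof -
  have "keys (m + n) \<subseteq> keys m \<union> keys n" by (rule keys_add)
  then show ?thesis
    by (subst (1 2 3) mono_eval_superset[of "keys m \<union> keys n"])
       (auto simp: lookup_add power_add prod.distrib)
qed

lemma mono_eval_single [simp]: "mono_eval s (single v n) = s v ^ n"
  by (cases "n = 0") (auto simp: mono_eval_def)

definition insertion :: "(rat \<Rightarrow> 'b) \<Rightarrow> ('v \<Rightarrow> 'b) \<Rightarrow> (('v \<Rightarrow>\<^sub>0 nat) \<Rightarrow>\<^sub>0 rat) \<Rightarrow> 'b::comm_ring_1" where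
  "insertion c s p = (\<Sum>m\<in>keys p. c (lookup p m) * mono_eval s m)"

text \<open>The two coefficient maps used below are the identity, for evaluation at rational points, and the inclusion of the
  constants, for substitution of polynomials.\<close>

locale rat_hom =
  fixes c :: "rat \<Rightarrow> 'b::comm_ring_1"
  assumes add: "c (a + b) = c a + c b" and mult: "c (a * b) = c a * c b" and one: "c 1 = 1"
begin

lemma zero: "c 0 = 0"
  using add[of 0 0] by simp

lemma insertion_superset:
  assumes "finite A" "keys p \<subseteq> A"
  shows "insertion c s p = (\<Sum>m\<in>A. c (lookup p m) * mono_eval s m)"
  unfolding insertion_def using assms
  by (intro sum.mono_neutral_left) (auto simp: in_keys_iff zero)

lemma insertion_zero [simp]: "insertion c s 0 = 0"
  by (simp add: insertion_def)

lemma insertion_single [simp]: "insertion c s (single m a) = c a * mono_eval s m"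
  by (cases "a = 0") (auto simp: insertion_def zero)

lemma insertion_one [simp]: "insertion c s 1 = 1"
  by (simp add: insertion_def one)

lemma insertion_add: "insertion c s (p + q) = insertion c s p + insertion c s q"
  using keys_add[of p q]
  by (subst (1 2 3) insertion_superset[of "keys p \<union> keys q"])
     (auto simp: lookup_add add algebra_simps sum.distrib)

lemma insertion_sum: "insertion c s (sum f A) = (\<Sum>x\<in>A. insertion c s (f x))"
  by (induction A rule: infinite_finite_induct) (auto simp: insertion_add)

lemma insertion_mult: "insertion c s (p * q) = insertion c s p * insertion c s q"
proof -
  have "p * q = (\<Sum>m\<in>keys p. single m (lookup p m)) * (\<Sum>n\<in>keys q. single n (lookup q n))"
    using poly_mapping_sum_single[of p] poly_mapping_sum_single[of q] by simp
  also have "\<dots> = (\<Sum>m\<in>keys p. \<Sum>n\<in>keys q. single (m + n) (lookup p m * lookup q n))"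
    by (simp add: sum_product mult_single)
  finally have "insertion c s (p * q) =
      (\<Sum>m\<in>keys p. \<Sum>n\<in>keys q. c (lookup p m * lookup q n) * mono_eval s (m + n))"
    by (simp add: insertion_sum)
  also have "\<dots> = insertion c s p * insertion c s q"
    unfolding insertion_def sum_product
    by (intro sum.cong refl) (simp add: mult mono_eval_add algebra_simps)
  finally show ?thesis .
qed

lemma insertion_power: "insertion c s (p ^ n) = insertion c s p ^ n"
  by (induction n) (auto simp: insertion_mult)

lemma insertion_prod: "insertion c s (prod f A) = (\<Prod>x\<in>A. insertion c s (f x))"
  by (induction A rule: infinite_finite_induct) (auto simp: insertion_mult)

lemma insertion_uminus: "insertion c s (- p) = - insertion c s p"
  using insertion_add[of s p "- p"] by (simp add: eq_neg_iff_add_eq_0 add.commute)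

lemma insertion_diff: "insertion c s (p - q) = insertion c s p - insertion c s q"
  using insertion_add[of s p "- q"] by (simp add: insertion_uminus)

end

lemma insertion_cong:
  assumes "\<And>m v. m \<in> keys p \<Longrightarrow> v \<in> keys m \<Longrightarrow> s v = s' v"
  shows "insertion c s p = insertion c s' p"
  unfolding insertion_def mono_eval_def
  by (intro sum.cong refl arg_cong2[where f="(*)"] prod.cong) (use assms in auto)

global_interpretation id_hom: rat_hom "\<lambda>x. x"
  by standard auto

global_interpretation const_hom: rat_hom "single (0::'v::linorder \<Rightarrow>\<^sub>0 nat) :: rat \<Rightarrow> _"
  by standard (auto simp: single_add mult_single)

definition ev :: "('i \<Rightarrow> nat \<Rightarrow> rat) \<Rightarrow> 'i mpoly \<Rightarrow> rat" where
  "ev x = insertion (\<lambda>x. x) (case_var x)"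

definition subst :: "('i \<Rightarrow> nat \<Rightarrow> 'i mpoly) \<Rightarrow> 'i::countable mpoly \<Rightarrow> 'i mpoly" where
  "subst s = insertion (single 0) (case_var s)"

lemmas ev_simps [simp] =
  id_hom.insertion_add[of "case_var x" for x, folded ev_def]
  id_hom.insertion_diff[of "case_var x" for x, folded ev_def]
  id_hom.insertion_uminus[of "case_var x" for x, folded ev_def]
  id_hom.insertion_mult[of "case_var x" for x, folded ev_def]
  id_hom.insertion_power[of "case_var x" for x, folded ev_def]
  id_hom.insertion_sum[of "case_var x" for x, folded ev_def]
  id_hom.insertion_prod[of "case_var x" for x, folded ev_def]
  id_hom.insertion_zero[of "case_var x" for x, folded ev_def]
  id_hom.insertion_one[of "case_var x" for x, folded ev_def]

lemma ev_single: "ev x (single m c) = c * mono_eval (case_var x) m"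
  unfolding ev_def by simp

lemma ev_const [simp]: "ev x (single 0 c) = c"
  by (simp add: ev_single)

lemma ev_pvar [simp]: "ev x (pvar i \<alpha>) = x i \<alpha>"
  by (simp add: pvar_def ev_single)

lemma subst_simps [simp]:
  "subst s (p + q) = subst s p + subst s q" "subst s (p - q) = subst s p - subst s q"
  "subst s (p * q) = subst s p * subst s q" "subst s (p ^ n) = subst s p ^ n"
  "subst s (sum h A) = (\<Sum>z\<in>A. subst s (h z))" "subst s (prod h A) = (\<Prod>z\<in>A. subst s (h z))"
  "subst s 0 = 0" "subst s 1 = 1"
  by (simp_all add: subst_def const_hom.insertion_add const_hom.insertion_diff const_hom.insertion_mult
      const_hom.insertion_power const_hom.insertion_sum const_hom.insertion_prod)

lemma subst_pvar [simp]: "subst s (pvar i \<alpha>) = s i \<alpha>"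
  unfolding subst_def pvar_def by simp

lemma ev_subst [simp]: "ev x (subst s p) = ev (\<lambda>i \<alpha>. ev x (s i \<alpha>)) p"
proof -
  have "case_var (\<lambda>i \<alpha>. ev x (s i \<alpha>)) v = ev x (case_var s v)" for v :: "'a var"
    by (cases v) auto
  then show ?thesis
    by (simp add: subst_def insertion_def mono_eval_def ev_def[of "\<lambda>i \<alpha>. ev x (s i \<alpha>)"])
qed

lemma rename_vars_eq_subst: "rename_vars r = subst (\<lambda>i \<alpha>. pvar i (r i \<alpha>))"
proof
  fix p
  have "(case v of X i \<alpha> \<Rightarrow> pvar i (r i \<alpha>) ^ k) = (case v of X i \<alpha> \<Rightarrow> pvar i (r i \<alpha>)) ^ k" for v k
    by (cases v) auto
  then show "rename_vars r p = subst (\<lambda>i \<alpha>. pvar i (r i \<alpha>)) p"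
    by (simp add: rename_vars_def subst_def insertion_def mono_eval_def)
qed

lemma digits_unique:
  fixes d e :: "nat \<Rightarrow> nat"
  assumes "\<And>k. d k < N" "\<And>k. e k < N" "(\<Sum>k<n. d k * N ^ k) = (\<Sum>k<n. e k * N ^ k)" "k < n"
  shows "d k = e k"
  using assms
proof (induction n arbitrary: d e k)
  case (Suc n)
  have *: "(\<Sum>k<Suc n. d k * N ^ k) = d 0 + N * (\<Sum>k<n. d (Suc k) * N ^ k)" for d :: "nat \<Rightarrow> nat"
    by (subst sum.lessThan_Suc_shift) (simp add: sum_distrib_left algebra_simps)
  have eq: "d 0 + N * (\<Sum>k<n. d (Suc k) * N ^ k) = e 0 + N * (\<Sum>k<n. e (Suc k) * N ^ k)"
    using Suc.prems(3) by (simp only: *)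
  have less: "d 0 < N" "e 0 < N" using Suc.prems(1,2) by blast+
  have "d 0 = e 0"
    using arg_cong[OF eq, of "\<lambda>z. z mod N"] by (simp only: mod_mult_self2 mod_less less)
  have "N * (\<Sum>k<n. d (Suc k) * N ^ k) = N * (\<Sum>k<n. e (Suc k) * N ^ k)"
    using eq unfolding \<open>d 0 = e 0\<close> by (rule add_left_imp_eq)
  then have eq': "(\<Sum>k<n. d (Suc k) * N ^ k) = (\<Sum>k<n. e (Suc k) * N ^ k)"
    using less(1) by (simp only: mult_cancel1) linarith
  have "d (Suc k) = e (Suc k)" if "k < n" for k
    by (rule Suc.IH[of "\<lambda>k. d (Suc k)" "\<lambda>k. e (Suc k)", OF _ _ eq' that]) (rule Suc.prems)+
  then show ?case using \<open>d 0 = e 0\<close> Suc.prems(4) by (cases k) auto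
qed simp

text \<open>At generic points the denominators of the shuffle product do not vanish. The finite set \<open>F\<close> of forbidden values is
  needed for restricting functions to points away from given ones.\<close>

definition generic :: "rat set \<Rightarrow> ('i \<Rightarrow> nat \<Rightarrow> rat) \<Rightarrow> bool" where
  "generic F x \<longleftrightarrow> (\<forall>i. inj (x i)) \<and> (\<forall>i \<alpha>. x i \<alpha> \<notin> F)"

text \<open>A nonzero polynomial does not vanish at \<open>x\<^sub>v = t ^ (N ^ v)\<close> for all large integers \<open>t\<close>, once
  \<open>N\<close> exceeds all its exponents: the values of its monomials are then distinct powers of \<open>t\<close>
  (Kronecker's substitution). These points moreover have distinct coordinates, which lie outside any given finite set.\<close>

lemma nonzero_at_generic:
  fixes p :: "'i::countable mpoly"
  assumes "finite F" "p \<noteq> 0"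
  shows "\<exists>x. generic F x \<and> ev x p \<noteq> 0"
proof -
  define N where "N = Suc (Suc (\<Sum>m\<in>keys p. \<Sum>v\<in>keys m. lookup m v))"
  have N: "lookup m v < N" if "m \<in> keys p" for m v
  proof (cases "v \<in> keys m")
    case True
    have "lookup m v \<le> (\<Sum>v\<in>keys m. lookup m v)" using True by (intro member_le_sum) auto
    also have "\<dots> \<le> (\<Sum>m\<in>keys p. \<Sum>v\<in>keys m. lookup m v)"
      using that by (intro member_le_sum[of m "keys p" "\<lambda>m. \<Sum>v\<in>keys m. lookup m v"]) auto
    finally show ?thesis by (simp add: N_def)
  qed (simp add: in_keys_iff N_def)
  define e where "e m = (\<Sum>v\<in>keys m. lookup m v * N ^ to_nat v)" for m :: "'i var \<Rightarrow>\<^sub>0 nat"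
  have e: "e m = (\<Sum>k<n. (if k \<in> range (to_nat :: 'i var \<Rightarrow> nat) then lookup m (from_nat k) else 0) * N ^ k)"
    if "\<forall>v\<in>keys m. to_nat v < n" for m :: "'i var \<Rightarrow>\<^sub>0 nat" and n
  proof -
    have "e m = (\<Sum>k\<in>to_nat ` keys m. lookup m (from_nat k) * N ^ k)"
      unfolding e_def by (subst sum.reindex) (auto intro: inj_on_subset)
    also have "\<dots> = (\<Sum>k<n. (if k \<in> range (to_nat :: 'i var \<Rightarrow> nat) then lookup m (from_nat k) else 0) * N ^ k)"
      using that by (intro sum.mono_neutral_cong_left) (auto simp: in_keys_iff)
    finally show ?thesis .
  qed
  have inj: "inj_on e (keys p)"
  proof (rule inj_onI, rule poly_mapping_eqI)
    fix m m' v assume m: "m \<in> keys p" "m' \<in> keys p" "e m = e m'"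
    define n where "n = Suc (Max (to_nat ` (insert v (keys m \<union> keys m'))))"
    have n: "to_nat w < n" if "w \<in> insert v (keys m \<union> keys m')" for w
      unfolding n_def less_Suc_eq_le using that by (intro Max_ge) auto
    have "(if to_nat v \<in> range (to_nat :: 'i var \<Rightarrow> nat) then lookup m (from_nat (to_nat v)) else 0) =
          (if to_nat v \<in> range (to_nat :: 'i var \<Rightarrow> nat) then lookup m' (from_nat (to_nat v)) else 0)"
    proof (rule digits_unique[where k = "to_nat v" and N = N and n = n and
            d = "\<lambda>k. if k \<in> range (to_nat :: 'i var \<Rightarrow> nat) then lookup m (from_nat k) else 0" and
            e = "\<lambda>k. if k \<in> range (to_nat :: 'i var \<Rightarrow> nat) then lookup m' (from_nat k) else 0"])
      show "(\<Sum>k<n. (if k \<in> range (to_nat :: 'i var \<Rightarrow> nat) then lookup m (from_nat k) else 0) * N ^ k) =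
        (\<Sum>k<n. (if k \<in> range (to_nat :: 'i var \<Rightarrow> nat) then lookup m' (from_nat k) else 0) * N ^ k)"
        using m(3) n by (subst (1 2) e[symmetric]) auto
    qed (use m N n in \<open>auto simp: N_def\<close>)
    then show "lookup m v = lookup m' v" by simp
  qed
  define u where "u = (\<Sum>m\<in>keys p. monom (lookup p m) (e m))"
  obtain m0 where m0: "m0 \<in> keys p" using assms(2) by (metis all_not_in_conv keys_eq_empty)
  have "coeff u (e m0) = (\<Sum>m\<in>keys p. if m = m0 then lookup p m else 0)"
    unfolding u_def coeff_sum using inj m0 by (intro sum.cong) (auto simp: inj_on_def)
  then have "u \<noteq> 0" using m0 by (auto simp: in_keys_iff)
  then have fin: "finite {z. poly u z = 0}" by (rule poly_roots_finite)
  obtain b where b: "\<And>z. z \<in> F \<Longrightarrow> \<bar>z\<bar> \<le> b"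
    using assms(1) by (metis bdd_above.unfold bdd_above_finite finite_imageI imageI)
  obtain t0 :: nat where t0: "b < of_nat t0" using reals_Archimedean2 by blast
  have "infinite (of_nat ` {max 2 t0..} :: rat set)"
    by (subst finite_image_iff) (auto simp: inj_on_def infinite_Ici)
  then have "\<not> of_nat ` {max 2 t0..} \<subseteq> {z. poly u z = 0}" using fin finite_subset by blast
  then have "\<exists>z. z \<in> of_nat ` {max 2 t0..} \<and> z \<notin> {z. poly u z = 0}"
    unfolding subset_eq Ball_def by (simp only: not_all not_imp)
  then obtain z where z: "z \<in> of_nat ` {max 2 t0..}" "z \<notin> {z. poly u z = 0}" by (elim exE conjE)
  then obtain t :: nat where t': "z = of_nat t" "t \<in> {max 2 t0..}" by (elim imageE)
  then have t: "t \<ge> 2" "t \<ge> t0" "poly u (of_nat t) \<noteq> 0" using z(2) by auto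
  define x where "x i \<alpha> = (of_nat t :: rat) ^ (N ^ to_nat (X i \<alpha>))" for i :: 'i and \<alpha>
  have "ev x p = poly u (of_nat t)"
  proof -
    have "mono_eval (case_var x) m = of_nat t ^ e m" for m
    proof -
      have "case_var x v = of_nat t ^ (N ^ to_nat v)" for v by (cases v) (auto simp: x_def)
      then show ?thesis
        by (simp add: mono_eval_def e_def power_sum mult.commute flip: power_mult)
    qed
    then show ?thesis by (simp add: ev_def insertion_def u_def poly_sum poly_monom)
  qed
  moreover have "generic F x"
    unfolding generic_def
  proof safe
    fix i show "inj (x i)"
      using t(1) by (auto simp: inj_def x_def N_def)
  next
    fix i \<alpha> assume "x i \<alpha> \<in> F"
    then have "x i \<alpha> \<le> b" using b by fastforce
    moreover have "(of_nat t :: rat) ^ 1 \<le> x i \<alpha>"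
      unfolding x_def using t(1) by (intro power_increasing) (auto simp: N_def)
    moreover have "(of_nat t0 :: rat) \<le> of_nat t" using t(2) by (rule of_nat_mono)
    ultimately show False using t0 unfolding power_one_right by linarith
  qed
  ultimately show ?thesis using t(3) by auto
qed

lemma poly_ext:
  fixes p q :: "'i::countable mpoly"
  assumes "finite F" "\<And>x. generic F x \<Longrightarrow> ev x p = ev x q"
  shows "p = q"
proof (rule ccontr)
  assume "p \<noteq> q"
  then have "p - q \<noteq> 0" by simp
  from nonzero_at_generic[OF assms(1) this] assms(2) show False by auto
qed

subsection \<open>The variables of a polynomial\<close>

definition in_vars :: "'i dimvec \<Rightarrow> 'i mpoly set" where
  "in_vars \<gamma> = {p. \<forall>m\<in>keys p. keys m \<subseteq> {X i \<alpha> | i \<alpha>. \<alpha> < \<gamma> i}}"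

lemma in_vars_0 [simp]: "0 \<in> in_vars \<gamma>" and in_vars_const [simp]: "single 0 c \<in> in_vars \<gamma>"
  and in_vars_1 [simp]: "1 \<in> in_vars \<gamma>"
  by (auto simp: in_vars_def)

lemma in_vars_add [intro]: "p \<in> in_vars \<gamma> \<Longrightarrow> q \<in> in_vars \<gamma> \<Longrightarrow> p + q \<in> in_vars \<gamma>"
  unfolding in_vars_def using keys_add[of p q] by blast

lemma in_vars_uminus [intro]: "p \<in> in_vars \<gamma> \<Longrightarrow> - p \<in> in_vars \<gamma>"
  unfolding in_vars_def by (auto simp: in_keys_iff)

lemma in_vars_diff [intro]: "p \<in> in_vars \<gamma> \<Longrightarrow> q \<in> in_vars \<gamma> \<Longrightarrow> p - q \<in> in_vars \<gamma>"
  using in_vars_add[OF _ in_vars_uminus] by (metis add_uminus_conv_diff)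

lemma in_vars_mult [intro]:
  assumes "p \<in> in_vars \<gamma>" "q \<in> in_vars \<gamma>" shows "p * q \<in> in_vars \<gamma>"
  unfolding in_vars_def
proof safe
  fix m v assume "m \<in> keys (p * q)" and v: "v \<in> keys m"
  then obtain m1 m2 where m: "m = m1 + m2" "m1 \<in> keys p" "m2 \<in> keys q" using keys_mult[of p q] by blast
  then have "v \<in> keys m1 \<union> keys m2" using v keys_add[of m1 m2] by blast
  then show "\<exists>i \<alpha>. v = X i \<alpha> \<and> \<alpha> < \<gamma> i" using m assms unfolding in_vars_def by blast
qed

lemma in_vars_sum [intro]: "(\<And>x. x \<in> A \<Longrightarrow> f x \<in> in_vars \<gamma>) \<Longrightarrow> sum f A \<in> in_vars \<gamma>"
  by (induction A rule: infinite_finite_induct) auto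

lemma in_vars_prod [intro]: "(\<And>x. x \<in> A \<Longrightarrow> f x \<in> in_vars \<gamma>) \<Longrightarrow> prod f A \<in> in_vars \<gamma>"
  by (induction A rule: infinite_finite_induct) auto

lemma in_vars_power [intro]: "p \<in> in_vars \<gamma> \<Longrightarrow> p ^ n \<in> in_vars \<gamma>"
  by (induction n) auto

lemma in_vars_pvar [intro]: "\<alpha> < \<gamma> i \<Longrightarrow> pvar i \<alpha> \<in> in_vars \<gamma>"
  by (auto simp: in_vars_def pvar_def)

lemma ev_cong:
  assumes "p \<in> in_vars \<gamma>" "\<And>i \<alpha>. \<alpha> < \<gamma> i \<Longrightarrow> x i \<alpha> = y i \<alpha>"
  shows "ev x p = ev y p"
  unfolding ev_def using assms by (intro insertion_cong) (force simp: in_vars_def)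

lemma subst_in_vars:
  assumes "p \<in> in_vars \<gamma>" "\<And>i \<alpha>. \<alpha> < \<gamma> i \<Longrightarrow> s i \<alpha> \<in> in_vars \<delta>"
  shows "subst s p \<in> in_vars \<delta>"
  unfolding subst_def insertion_def mono_eval_def
proof (intro in_vars_sum in_vars_mult in_vars_const in_vars_prod in_vars_power)
  fix m v assume "m \<in> keys p" "v \<in> keys m"
  then obtain i \<alpha> where "v = X i \<alpha>" "\<alpha> < \<gamma> i" using assms(1) unfolding in_vars_def by blast
  then show "case_var s v \<in> in_vars \<delta>" using assms(2) by simp
qed

lemma subst_in_vars_all:
  assumes "\<And>i \<alpha>. s i \<alpha> \<in> in_vars \<delta>"
  shows "subst s p \<in> in_vars \<delta>"
  unfolding subst_def insertion_def mono_eval_def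
  by (intro in_vars_sum in_vars_mult in_vars_const in_vars_prod in_vars_power) (use assms in \<open>auto split: var.split\<close>)

lemma subst_id:
  fixes p :: "'i::countable mpoly"
  assumes "p \<in> in_vars \<gamma>" "\<And>i \<alpha>. \<alpha> < \<gamma> i \<Longrightarrow> s i \<alpha> = pvar i \<alpha>"
  shows "subst s p = p"
proof (rule poly_ext[of "{}"])
  fix x :: "'i \<Rightarrow> nat \<Rightarrow> rat"
  show "ev x (subst s p) = ev x p"
    unfolding ev_subst by (rule ev_cong[OF assms(1)]) (simp add: assms(2))
qed simp

section \<open>Symmetric polynomials as functions of finite sets\<close>

text \<open>A polynomial in \<open>hall_comp \<gamma>\<close> only depends on the set of values of its variables, so it is a
  function of families \<open>P\<close> of finite sets with \<open>card (P i) = \<gamma> i\<close>.\<close>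

definition fs :: "'i mpoly \<Rightarrow> ('i \<Rightarrow> rat set) \<Rightarrow> rat" where
  "fs p P = ev (\<lambda>i \<alpha>. sorted_list_of_set (P i) ! \<alpha>) p"

lemma sorted_list_bij:
  assumes "finite A"
  shows "bij_betw (\<lambda>\<alpha>. sorted_list_of_set A ! \<alpha>) {..<card A} A"
  using bij_betw_nth[of "sorted_list_of_set A" "{..<card A}" A] assms by auto

lemma same_image_permutes:
  assumes "inj_on x {..<n::nat}" "inj_on y {..<n}" "x ` {..<n} = y ` {..<n}"
  shows "\<exists>\<pi>. \<pi> permutes {..<n} \<and> (\<forall>\<alpha><n. y \<alpha> = x (\<pi> \<alpha>))"
proof -
  define \<pi> where "\<pi> \<alpha> = (if \<alpha> \<in> {..<n} then inv_into {..<n} x (y \<alpha>) else \<alpha>)" for \<alpha>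
  have y: "y \<alpha> \<in> x ` {..<n}" if "\<alpha> \<in> {..<n}" for \<alpha> using assms(3) that by blast
  have "inj_on \<pi> {..<n}"
    using assms(2) y by (auto simp: inj_on_def \<pi>_def inv_into_injective)
  moreover have "\<pi> ` {..<n} \<subseteq> {..<n}" using y inv_into_into[of _ x "{..<n}"] by (auto simp: \<pi>_def)
  ultimately have "bij_betw \<pi> {..<n} {..<n}"
    by (simp add: bij_betw_def endo_inj_surj)
  then have "\<pi> permutes {..<n}" by (rule bij_imp_permutes) (simp add: \<pi>_def)
  moreover have "\<forall>\<alpha><n. y \<alpha> = x (\<pi> \<alpha>)" using y by (simp add: \<pi>_def f_inv_into_f)
  ultimately show ?thesis by blast
qed

lemma hall_comp_iff:
  fixes p :: "'i::countable mpoly"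
  shows "p \<in> hall_comp \<gamma> \<longleftrightarrow> p \<in> in_vars \<gamma> \<and> (\<forall>\<pi> x. (\<forall>i. \<pi> i permutes {..<\<gamma> i}) \<longrightarrow> ev (\<lambda>i \<alpha>. x i (\<pi> i \<alpha>)) p = ev x p)"
proof -
  have "rename_vars \<pi> p = p \<longleftrightarrow> (\<forall>x. ev (\<lambda>i \<alpha>. x i (\<pi> i \<alpha>)) p = ev x p)" for \<pi>
  proof
    assume "rename_vars \<pi> p = p"
    then have "ev x (rename_vars \<pi> p) = ev x p" for x by simp
    then show "\<forall>x. ev (\<lambda>i \<alpha>. x i (\<pi> i \<alpha>)) p = ev x p" by (simp add: rename_vars_eq_subst)
  next
    assume "\<forall>x. ev (\<lambda>i \<alpha>. x i (\<pi> i \<alpha>)) p = ev x p"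
    then show "rename_vars \<pi> p = p" by (intro poly_ext[of "{}"]) (auto simp: rename_vars_eq_subst)
  qed
  then show ?thesis by (auto simp: hall_comp_def in_vars_def)
qed

lemma hall_ev:
  fixes p :: "'i::countable mpoly"
  assumes p: "p \<in> hall_comp \<gamma>"
    and inj: "\<And>i. inj_on (x i) {..<\<gamma> i}" "\<And>i. inj_on (y i) {..<\<gamma> i}"
    and im: "\<And>i. x i ` {..<\<gamma> i} = y i ` {..<\<gamma> i}"
  shows "ev x p = ev y p"
proof -
  from same_image_permutes[OF inj im] obtain \<pi>
    where \<pi>: "\<And>i. \<pi> i permutes {..<\<gamma> i}" "\<And>i \<alpha>. \<alpha> < \<gamma> i \<Longrightarrow> y i \<alpha> = x i (\<pi> i \<alpha>)" by metis
  have "ev y p = ev (\<lambda>i \<alpha>. x i (\<pi> i \<alpha>)) p"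
    using p \<pi>(2) by (intro ev_cong[of p \<gamma>]) (auto simp: hall_comp_iff)
  also have "\<dots> = ev x p" using p \<pi>(1) by (simp add: hall_comp_iff)
  finally show ?thesis by simp
qed

lemma hall_fs:
  fixes p :: "'i::countable mpoly"
  assumes "p \<in> hall_comp \<gamma>" "\<And>i. inj_on (x i) {..<\<gamma> i}"
  shows "ev x p = fs p (\<lambda>i. x i ` {..<\<gamma> i})"
  unfolding fs_def
proof (rule hall_ev[OF assms])
  fix i
  have "bij_betw (\<lambda>\<alpha>. sorted_list_of_set (x i ` {..<\<gamma> i}) ! \<alpha>) {..<\<gamma> i} (x i ` {..<\<gamma> i})"
    using sorted_list_bij[of "x i ` {..<\<gamma> i}"] by (simp add: card_image assms(2))
  then show "inj_on (\<lambda>\<alpha>. sorted_list_of_set (x i ` {..<\<gamma> i}) ! \<alpha>) {..<\<gamma> i}"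
    "x i ` {..<\<gamma> i} = (\<lambda>\<alpha>. sorted_list_of_set (x i ` {..<\<gamma> i}) ! \<alpha>) ` {..<\<gamma> i}"
    by (auto simp: bij_betw_def)
qed

text \<open>Permuting the coordinates of a generic point changes neither genericity nor the sets of coordinates.\<close>

lemma hallI:
  fixes p :: "'i::countable mpoly"
  assumes "finite F" "p \<in> in_vars \<gamma>" and "\<And>x. generic F x \<Longrightarrow> ev x p = f (\<lambda>i. x i ` {..<\<gamma> i})"
  shows "p \<in> hall_comp \<gamma>"
proof -
  have "rename_vars \<pi> p = p" if \<pi>: "\<And>i. \<pi> i permutes {..<\<gamma> i}" for \<pi>
  proof (rule poly_ext[OF assms(1)])
    fix x :: "'i \<Rightarrow> nat \<Rightarrow> rat" assume x: "generic F x"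
    then have "generic F (\<lambda>i \<alpha>. x i (\<pi> i \<alpha>))"
      using permutes_inj[OF \<pi>] unfolding generic_def inj_def by meson
    then have "ev (\<lambda>i \<alpha>. x i (\<pi> i \<alpha>)) p = f (\<lambda>i. (\<lambda>\<alpha>. x i (\<pi> i \<alpha>)) ` {..<\<gamma> i})" by (rule assms(3))
    also have "(\<lambda>i. (\<lambda>\<alpha>. x i (\<pi> i \<alpha>)) ` {..<\<gamma> i}) = (\<lambda>i. x i ` {..<\<gamma> i})"
      using permutes_image[OF \<pi>] by (simp add: image_image[symmetric, of "x _" "\<pi> _"])
    finally show "ev x (rename_vars \<pi> p) = ev x p"
      using assms(3)[OF x] by (simp add: rename_vars_eq_subst)
  qed
  then show ?thesis using assms(2) by (auto simp: hall_comp_def in_vars_def)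
qed

lemma hall_0 [simp]: "0 \<in> hall_comp \<gamma>"
  by (simp add: hall_comp_def rename_vars_def)

lemma hall_in_vars: "p \<in> hall_comp \<gamma> \<Longrightarrow> p \<in> in_vars \<gamma>"
  by (simp add: hall_comp_def in_vars_def)

context
  fixes \<gamma> :: "'i::countable dimvec"
begin

lemma hall_1 [simp]: "1 \<in> hall_comp \<gamma>"
  and hall_const [simp]: "single 0 c \<in> hall_comp \<gamma>"
  by (auto simp: hall_comp_iff)

lemma hall_add [intro]: "p \<in> hall_comp \<gamma> \<Longrightarrow> q \<in> hall_comp \<gamma> \<Longrightarrow> p + q \<in> hall_comp \<gamma>"
  and hall_diff [intro]: "p \<in> hall_comp \<gamma> \<Longrightarrow> q \<in> hall_comp \<gamma> \<Longrightarrow> p - q \<in> hall_comp \<gamma>"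
  and hall_mult [intro]: "p \<in> hall_comp \<gamma> \<Longrightarrow> q \<in> hall_comp \<gamma> \<Longrightarrow> p * q \<in> hall_comp \<gamma>"
  by (auto simp: hall_comp_iff)

lemma hall_power [intro]: "p \<in> hall_comp \<gamma> \<Longrightarrow> p ^ n \<in> hall_comp \<gamma>"
  by (induction n) auto

lemma hall_sum [intro]: "(\<And>x. x \<in> A \<Longrightarrow> f x \<in> hall_comp \<gamma>) \<Longrightarrow> sum f A \<in> hall_comp \<gamma>"
  by (induction A rule: infinite_finite_induct) auto

lemma hall_prod [intro]: "(\<And>x. x \<in> A \<Longrightarrow> f x \<in> hall_comp \<gamma>) \<Longrightarrow> prod f A \<in> hall_comp \<gamma>"
  by (induction A rule: infinite_finite_induct) auto

end

lemma extend_enumeration: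
  fixes P :: "'i \<Rightarrow> rat set"
  assumes "\<And>i. finite (P i)" "finite F" "\<And>i. P i \<inter> F = {}"
  shows "\<exists>x. generic F x \<and> (\<forall>i. x i ` {..<card (P i)} = P i)"
proof -
  have "\<exists>b. \<forall>z\<in>P i \<union> F. z < b" for i
  proof -
    have "\<forall>z\<in>P i \<union> F. z \<le> Max (insert 0 (P i \<union> F))" using assms by (intro ballI Max_ge) auto
    then show ?thesis by (intro exI[of _ "Max (insert 0 (P i \<union> F)) + 1"]) (auto intro: le_less_trans)
  qed
  then obtain b where b: "\<And>i z. z \<in> P i \<union> F \<Longrightarrow> z < b i" by metis
  define x where "x i \<alpha> = (if \<alpha> < card (P i) then sorted_list_of_set (P i) ! \<alpha> else b i + of_nat \<alpha>)" for i \<alpha>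
  have bij: "bij_betw (\<lambda>\<alpha>. sorted_list_of_set (P i) ! \<alpha>) {..<card (P i)} (P i)" for i
    by (rule sorted_list_bij[OF assms(1)])
  have im: "x i ` {..<card (P i)} = P i" for i
    using bij[of i] by (auto simp: x_def bij_betw_def)
  have low: "x i \<alpha> \<in> P i" if "\<alpha> < card (P i)" for i \<alpha> using im[of i] that by blast
  have "inj (x i)" for i
  proof (rule injI)
    fix \<alpha> \<beta> assume eq: "x i \<alpha> = x i \<beta>"
    have lt: "x i \<alpha> < x i \<beta>" if "\<alpha> < card (P i)" "\<not> \<beta> < card (P i)" for \<alpha> \<beta>
      using b[of "x i \<alpha>" i] low[OF that(1)] that(2) by (simp add: x_def[of i \<beta>] add_strict_increasing2 add_increasing2 less_le_trans)
    show "\<alpha> = \<beta>"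
    proof (cases "\<alpha> < card (P i)")
      case True
      then have "\<beta> < card (P i)" using lt eq by force
      then show ?thesis using True eq bij[of i] by (auto simp: x_def bij_betw_def inj_on_def)
    next
      case False
      then have "\<not> \<beta> < card (P i)" using lt[of \<beta> \<alpha>] eq by force
      then show ?thesis using False eq by (simp add: x_def)
    qed
  qed
  moreover have "x i \<alpha> \<notin> F" for i \<alpha>
  proof (cases "\<alpha> < card (P i)")
    case True
    then show ?thesis using low assms(3) by blast
  next
    case False
    have "b i \<le> x i \<alpha>" using False by (simp add: x_def)
    then show ?thesis using b[of "x i \<alpha>" i] by force
  qed
  ultimately show ?thesis using im by (auto simp: generic_def)
qed

lemma fs_ext:
  fixes p q :: "'i::countable mpoly"
  assumes "finite F" "p \<in> hall_comp \<gamma>" "q \<in> hall_comp \<gamma>"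
    and "\<And>P. (\<And>i. finite (P i)) \<Longrightarrow> (\<And>i. card (P i) = \<gamma> i) \<Longrightarrow> (\<And>i. P i \<inter> F = {}) \<Longrightarrow> fs p P = fs q P"
  shows "p = q"
proof (rule poly_ext[OF assms(1)])
  fix x :: "'i \<Rightarrow> nat \<Rightarrow> rat" assume x: "generic F x"
  have inj: "inj_on (x i) {..<\<gamma> i}" for i using x by (auto simp: generic_def intro: inj_on_subset)
  show "ev x p = ev x q"
    unfolding hall_fs[OF assms(2) inj] hall_fs[OF assms(3) inj]
    by (rule assms(4)) (use inj x in \<open>auto simp: card_image generic_def\<close>)
qed

lemma fs_if_ev:
  fixes p :: "'i::countable mpoly"
  assumes p: "p \<in> hall_comp \<gamma>" and "finite F"
    and f: "\<And>x. generic F x \<Longrightarrow> ev x p = f (\<lambda>i. x i ` {..<\<gamma> i})"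
    and P: "\<And>i. finite (P i)" "\<And>i. card (P i) = \<gamma> i" "\<And>i. P i \<inter> F = {}"
  shows "fs p P = f P"
proof -
  obtain x where x: "generic F x" "\<And>i. x i ` {..<\<gamma> i} = P i"
    using extend_enumeration[of P F] P assms(2) by auto
  have inj: "inj_on (x i) {..<\<gamma> i}" for i using x by (auto simp: generic_def intro: inj_on_subset)
  show ?thesis using f[OF x(1)] hall_fs[OF p inj] x(2) by simp
qed

section \<open>Polynomiality of the shuffle product\<close>

text \<open>The fraction in the shuffle product, with the two groups of variables given by their sets of values.\<close>

definition kern :: "'i::finite quiver \<Rightarrow> ('i \<Rightarrow> rat set) \<Rightarrow> ('i \<Rightarrow> rat set) \<Rightarrow> rat" where
  "kern a A B = (\<Prod>i\<in>UNIV. \<Prod>j\<in>UNIV. \<Prod>x\<in>A i. \<Prod>y\<in>B j. (y - x) ^ a i j) /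
    (\<Prod>i\<in>UNIV. \<Prod>x\<in>A i. \<Prod>y\<in>B i. y - x)"

definition pdiff :: "'i \<times> nat \<times> nat \<Rightarrow> 'i mpoly" where
  "pdiff = (\<lambda>(i, u, v). pvar i v - pvar i u)"

lemma ev_pdiff [simp]: "ev x (pdiff (i, u, v)) = x i v - x i u"
  by (simp add: pdiff_def)

subsection \<open>Divisibility by a difference of variables\<close>

lemma dvd_diff_mono_eval:
  fixes s s' :: "'v \<Rightarrow> 'b::comm_ring_1"
  assumes "\<And>v. l dvd s v - s' v"
  shows "l dvd mono_eval s m - mono_eval s' m"
proof -
  have mult: "l dvd a * b - a' * b'" if "l dvd a - a'" "l dvd b - b'" for a b a' b' :: 'b
  proof -
    have "a * b - a' * b' = a * (b - b') + (a - a') * b'" by (simp add: algebra_simps)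
    then show ?thesis using that by simp
  qed
  have pow: "l dvd s v ^ n - s' v ^ n" for v n
    by (induction n) (use assms in \<open>auto intro: mult\<close>)
  have "l dvd (\<Prod>v\<in>A. s v ^ lookup m v) - (\<Prod>v\<in>A. s' v ^ lookup m v)" for A
    by (induction A rule: infinite_finite_induct) (auto intro: mult pow)
  then show ?thesis by (simp add: mono_eval_def)
qed

text \<open>Identifying two variables: the kernel of this substitution is generated by their difference, which is therefore prime.\<close>

definition glue :: "'i \<Rightarrow> nat \<Rightarrow> nat \<Rightarrow> 'i::countable mpoly \<Rightarrow> 'i mpoly" where
  "glue i u v = subst (\<lambda>j \<alpha>. if j = i \<and> \<alpha> = v then pvar i u else pvar j \<alpha>)"

lemma ev_glue: "ev x (glue i u v p) = ev (\<lambda>j \<alpha>. if j = i \<and> \<alpha> = v then x i u else x j \<alpha>) p"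
proof -
  have "(\<lambda>j \<alpha>. ev x (if j = i \<and> \<alpha> = v then pvar i u else pvar j \<alpha>)) =
        (\<lambda>j \<alpha>. if j = i \<and> \<alpha> = v then x i u else x j \<alpha>)" by (intro ext) simp
  then show ?thesis by (simp add: glue_def)
qed

lemma glue_simps [simp]:
  "glue i u v (p * q) = glue i u v p * glue i u v q"
  "glue i u v (prod f A) = (\<Prod>x\<in>A. glue i u v (f x))"
  by (simp_all add: glue_def)

lemma pdiff_dvd_iff: "pdiff (i, u, v) dvd p \<longleftrightarrow> glue i u v p = (0 :: 'i::countable mpoly)"
proof
  assume "pdiff (i, u, v) dvd p"
  then obtain q where q: "p = pdiff (i, u, v) * q" by (elim dvdE)
  have "glue i u v (pdiff (i, u, v)) = (0 :: 'i mpoly)"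
    by (rule poly_ext[of "{}"]) (auto simp: ev_glue)
  then show "glue i u v p = 0" by (simp add: q)
next
  assume 0: "glue i u v p = 0"
  define s where "s = (\<lambda>j \<alpha>. if j = i \<and> \<alpha> = v then pvar i u else pvar j \<alpha> :: 'i mpoly)"
  have dvd: "pdiff (i, u, v) dvd case_var pvar w - case_var s w" for w
    by (cases w) (auto simp: s_def pdiff_def)
  have "pdiff (i, u, v) dvd subst pvar p - subst s p"
    unfolding subst_def insertion_def sum_subtractf[symmetric] right_diff_distrib[symmetric]
    by (intro dvd_sum dvd_mult dvd_diff_mono_eval dvd)
  moreover have "subst pvar p = p" by (rule poly_ext[of "{}"]) auto
  ultimately show "pdiff (i, u, v) dvd p" using 0 by (simp add: glue_def s_def)
qed

lemma pdiff_dvd_mult_cancel: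
  assumes "pdiff (i, u, v) dvd p * q" "glue i u v q \<noteq> (0 :: 'i::countable mpoly)"
  shows "pdiff (i, u, v) dvd p"
  using assms unfolding pdiff_dvd_iff by simp

lemma pdiff_dvd_if_vanishing:
  fixes p :: "'i::countable mpoly"
  assumes "\<And>x. x i u = x i v \<Longrightarrow> ev x p = 0"
  shows "pdiff (i, u, v) dvd p"
  unfolding pdiff_dvd_iff by (rule poly_ext[of "{}"]) (auto simp: ev_glue intro!: assms)

lemma pdiff_nonzero: "u \<noteq> v \<Longrightarrow> pdiff (i, u, v) \<noteq> (0 :: 'i::countable mpoly)"
proof
  assume "u \<noteq> v" "pdiff (i, u, v) = (0 :: 'i mpoly)"
  obtain x :: "'i \<Rightarrow> nat \<Rightarrow> rat" where "generic {} x" using nonzero_at_generic[of "{}" 1] by auto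
  moreover have "ev x (pdiff (i, u, v)) = 0" using \<open>pdiff (i, u, v) = 0\<close> by (simp del: ev_pdiff)
  ultimately show False using \<open>u \<noteq> v\<close> by (auto simp: generic_def dest: injD)
qed

lemma glue_pdiff_nonzero:
  fixes i j :: "'i::countable"
  assumes "u \<noteq> v" "p \<noteq> q" "\<not> (j = i \<and> {p, q} = {u, v})"
  shows "glue i u v (pdiff (j, p, q)) \<noteq> 0"
proof
  assume "glue i u v (pdiff (j, p, q)) = 0"
  then have 0: "ev x (glue i u v (pdiff (j, p, q))) = 0" for x by simp
  obtain x :: "'i \<Rightarrow> nat \<Rightarrow> rat" where "generic {} x" using nonzero_at_generic[of "{}" 1] by auto
  then have "x j \<alpha> = x j \<beta> \<longleftrightarrow> \<alpha> = \<beta>" for j \<alpha> \<beta> by (auto simp: generic_def dest: injD)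
  then show False using 0[of x] assms by (auto simp: ev_glue doubleton_eq_iff split: if_splits)
qed

subsection \<open>Removing the denominators\<close>

locale shuffle_setup =
  fixes a :: "'i::finite quiver" and \<gamma> \<delta> :: "'i dimvec" and f g :: "'i mpoly"
  assumes f: "f \<in> hall_comp \<gamma>" and g: "g \<in> hall_comp \<delta>"
begin

definition "n i = \<gamma> i + \<delta> i"

definition shuffle_value :: "('i \<Rightarrow> rat set) \<Rightarrow> rat" where
  "shuffle_value P = (\<Sum>A | \<forall>i. A i \<subseteq> P i \<and> card (A i) = \<gamma> i.
      fs f A * fs g (\<lambda>i. P i - A i) * kern a A (\<lambda>i. P i - A i))"

definition G where "G x = shuffle_value (\<lambda>i. x i ` {..<n i})"

text \<open>Triples \<open>(i, u, v)\<close> stand for the differences of variables at \<open>i\<close>: \<open>U S\<close> collects those in the denominator of the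
  summand of the shuffle \<open>S\<close>, \<open>T\<close> all of them, and \<open>E\<close> one for each pair of positions.\<close>

definition U where "U S = {(i, u, v). u \<in> S i \<and> v < n i \<and> v \<notin> S i}"

definition E where "E = {(i, u, v). u < v \<and> v < n i}"

definition flip :: "'i \<times> nat \<times> nat \<Rightarrow> 'i \<times> nat \<times> nat" where "flip = (\<lambda>(i, u, v). (i, v, u))"

definition T where "T = {(i, u, v). u < n i \<and> v < n i \<and> u \<noteq> v}"

definition numer :: "('i \<Rightarrow> nat set) \<Rightarrow> 'i mpoly" where
  "numer S = rename_vars (pos1 S) f * rename_vars (pos2 \<gamma> \<delta> S) g *
     (\<Prod>i\<in>UNIV. \<Prod>j\<in>UNIV. \<Prod>\<alpha><\<gamma> i. \<Prod>\<beta><\<delta> j. (pvar j (pos2 \<gamma> \<delta> S j \<beta>) - pvar i (pos1 S i \<alpha>)) ^ a i j)"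

abbreviation D where "D F \<equiv> (\<Prod>e\<in>F. pdiff e)"

lemma finite_T: "finite T"
proof (rule finite_subset)
  show "T \<subseteq> (SIGMA i:UNIV. {..<n i} \<times> {..<n i})" by (auto simp: T_def)
qed auto

lemma shufflesD:
  assumes "S \<in> shuffles_of \<gamma> \<delta>"
  shows "S i \<subseteq> {..<n i}" "card (S i) = \<gamma> i" "finite (S i)" "card ({..<n i} - S i) = \<delta> i" "U S \<subseteq> T"
proof -
  show S: "S i \<subseteq> {..<n i}" "card (S i) = \<gamma> i" for i using assms by (auto simp: shuffles_of_def n_def)
  show "finite (S i)" for i using S finite_subset by blast
  then show "card ({..<n i} - S i) = \<delta> i" using S[of i] by (simp add: card_Diff_subset n_def)
  show "U S \<subseteq> T" using S by (auto simp: U_def T_def)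
qed

lemma D_T_nonzero: "F \<subseteq> T \<Longrightarrow> D F \<noteq> 0"
  using finite_T finite_subset[of F T] by (auto simp: T_def pdiff_nonzero)

lemma D_split: "F \<subseteq> F' \<Longrightarrow> F' \<subseteq> T \<Longrightarrow> D F' = D F * D (F' - F)"
  using prod.subset_diff[of F F' pdiff] finite_T finite_subset by (metis mult.commute)

lemma pos_bij:
  assumes "S \<in> shuffles_of \<gamma> \<delta>"
  shows "bij_betw (pos1 S i) {..<\<gamma> i} (S i)" "bij_betw (pos2 \<gamma> \<delta> S i) {..<\<delta> i} ({..<n i} - S i)"
  using sorted_list_bij[OF shufflesD(3)[OF assms], of i] shufflesD(2)[OF assms, of i]
    sorted_list_bij[of "{..<n i} - S i"] shufflesD(4)[OF assms, of i]
  by (simp_all add: pos1_def[abs_def] pos2_def[abs_def] n_def)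

lemma prod_U:
  assumes "S \<in> shuffles_of \<gamma> \<delta>"
  shows "(\<Prod>i\<in>UNIV. \<Prod>\<alpha><\<gamma> i. \<Prod>\<beta><\<delta> i. pvar i (pos2 \<gamma> \<delta> S i \<beta>) - pvar i (pos1 S i \<alpha>)) = D (U S)"
proof -
  note S = shufflesD[OF assms]
  have "(\<Prod>\<alpha><\<gamma> i. \<Prod>\<beta><\<delta> i. pvar i (pos2 \<gamma> \<delta> S i \<beta>) - pvar i (pos1 S i \<alpha>)) =
      (\<Prod>(u, v)\<in>S i \<times> ({..<n i} - S i). pdiff (i, u, v))" for i
  proof -
    have "(\<Prod>\<alpha><\<gamma> i. \<Prod>\<beta><\<delta> i. pvar i (pos2 \<gamma> \<delta> S i \<beta>) - pvar i (pos1 S i \<alpha>)) =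
        (\<Prod>\<alpha><\<gamma> i. \<Prod>v\<in>{..<n i} - S i. pdiff (i, pos1 S i \<alpha>, v))"
      by (rule prod.cong[OF refl])
         (use prod.reindex_bij_betw[OF pos_bij(2)[OF assms, of i], of "\<lambda>v. pdiff (i, u, v)" for u]
           in \<open>simp only: pdiff_def prod.case\<close>)
    also have "\<dots> = (\<Prod>u\<in>S i. \<Prod>v\<in>{..<n i} - S i. pdiff (i, u, v))"
      by (rule prod.reindex_bij_betw[OF pos_bij(1)[OF assms, of i]])
    also have "\<dots> = (\<Prod>(u, v)\<in>S i \<times> ({..<n i} - S i). pdiff (i, u, v))"
      by (rule prod.cartesian_product)
    finally show ?thesis .
  qed
  then have "(\<Prod>i\<in>UNIV. \<Prod>\<alpha><\<gamma> i. \<Prod>\<beta><\<delta> i. pvar i (pos2 \<gamma> \<delta> S i \<beta>) - pvar i (pos1 S i \<alpha>)) =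
      (\<Prod>i\<in>UNIV. \<Prod>(u, v)\<in>S i \<times> ({..<n i} - S i). pdiff (i, u, v))"
    by (rule prod.cong[OF refl])
  also have "\<dots> = (\<Prod>(i, uv)\<in>(SIGMA i:UNIV. S i \<times> ({..<n i} - S i)). case uv of (u, v) \<Rightarrow> pdiff (i, u, v))"
    by (rule prod.Sigma) (use S(3) in auto)
  also have "\<dots> = D (U S)"
    by (rule prod.cong) (auto simp: U_def)
  finally show ?thesis .
qed

lemma to_fract_shuffle_summand:
  assumes "S \<in> shuffles_of \<gamma> \<delta>"
  shows "shuffle_summand a \<gamma> \<delta> f g S = to_fract (numer S) / to_fract (D (U S))"
  unfolding shuffle_summand_def Let_def prod_U[OF assms] numer_def by simp

lemma numer_in_vars:
  assumes "S \<in> shuffles_of \<gamma> \<delta>" shows "numer S \<in> in_vars n"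
proof -
  have 1: "pos1 S i \<alpha> < n i" if "\<alpha> < \<gamma> i" for i \<alpha>
  proof -
    have "pos1 S i \<alpha> \<in> S i" using bij_betwE[OF pos_bij(1)[OF assms, of i]] that by simp
    then show ?thesis using shufflesD(1)[OF assms, of i] by auto
  qed
  have 2: "pos2 \<gamma> \<delta> S i \<alpha> < n i" if "\<alpha> < \<delta> i" for i \<alpha>
    using bij_betwE[OF pos_bij(2)[OF assms, of i]] that by simp
  have "subst (\<lambda>i \<alpha>. pvar i (pos1 S i \<alpha>)) f \<in> in_vars n"
    by (rule subst_in_vars[OF hall_in_vars[OF f]]) (intro in_vars_pvar 1)
  moreover have "subst (\<lambda>i \<alpha>. pvar i (pos2 \<gamma> \<delta> S i \<alpha>)) g \<in> in_vars n"
    by (rule subst_in_vars[OF hall_in_vars[OF g]]) (intro in_vars_pvar 2)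
  moreover have "(\<Prod>i\<in>UNIV. \<Prod>j\<in>UNIV. \<Prod>\<alpha><\<gamma> i. \<Prod>\<beta><\<delta> j.
      (pvar j (pos2 \<gamma> \<delta> S j \<beta>) - pvar i (pos1 S i \<alpha>)) ^ a i j) \<in> in_vars n"
    by (intro in_vars_prod in_vars_power in_vars_diff in_vars_pvar) (auto intro: 1 2)
  ultimately show ?thesis
    unfolding numer_def rename_vars_eq_subst by (intro in_vars_mult)
qed

lemma ev_summand:
  assumes S: "S \<in> shuffles_of \<gamma> \<delta>" and inj: "\<And>i. inj_on (x i) {..<n i}"
  defines "A \<equiv> \<lambda>i. x i ` S i"
  shows "ev x (numer S) / ev x (D (U S)) =
     fs f A * fs g (\<lambda>i. x i ` {..<n i} - A i) * kern a A (\<lambda>i. x i ` {..<n i} - A i)"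
proof -
  note S' = shufflesD[OF S]
  define B where "B i = x i ` ({..<n i} - S i)" for i
  have B: "x i ` {..<n i} - A i = B i" for i
    using inj[of i] S'(1)[of i] unfolding A_def B_def by (simp add: inj_on_image_set_diff)
  have injS: "inj_on (x i) (S i)" "inj_on (x i) ({..<n i} - S i)" for i
    using inj[of i] S'(1)[of i] by (auto intro: inj_on_subset)
  note bij1 = pos_bij(1)[OF S] and bij2 = pos_bij(2)[OF S]
  have 1: "ev x (rename_vars (pos1 S) f) = fs f A"
  proof -
    have "ev x (rename_vars (pos1 S) f) = ev (\<lambda>i \<alpha>. x i (pos1 S i \<alpha>)) f" by (simp add: rename_vars_eq_subst)
    also have "\<dots> = fs f (\<lambda>i. (\<lambda>\<alpha>. x i (pos1 S i \<alpha>)) ` {..<\<gamma> i})"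
      using comp_inj_on[of "pos1 S _" "{..<\<gamma> _}" "x _"] bij1 injS
      by (intro hall_fs[OF f]) (simp add: bij_betw_def comp_def)
    also have "(\<lambda>i. (\<lambda>\<alpha>. x i (pos1 S i \<alpha>)) ` {..<\<gamma> i}) = A"
      using bij1 by (simp add: A_def bij_betw_def image_image[symmetric, of "x _" "pos1 S _"])
    finally show ?thesis .
  qed
  have 2: "ev x (rename_vars (pos2 \<gamma> \<delta> S) g) = fs g B"
  proof -
    have "ev x (rename_vars (pos2 \<gamma> \<delta> S) g) = ev (\<lambda>i \<alpha>. x i (pos2 \<gamma> \<delta> S i \<alpha>)) g" by (simp add: rename_vars_eq_subst)
    also have "\<dots> = fs g (\<lambda>i. (\<lambda>\<alpha>. x i (pos2 \<gamma> \<delta> S i \<alpha>)) ` {..<\<delta> i})"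
      using comp_inj_on[of "pos2 \<gamma> \<delta> S _" "{..<\<delta> _}" "x _"] bij2 injS
      by (intro hall_fs[OF g]) (simp add: bij_betw_def comp_def)
    also have "(\<lambda>i. (\<lambda>\<alpha>. x i (pos2 \<gamma> \<delta> S i \<alpha>)) ` {..<\<delta> i}) = B"
      using bij2 by (simp add: B_def[abs_def] bij_betw_def image_image[symmetric, of "x _" "pos2 \<gamma> \<delta> S _"])
    finally show ?thesis .
  qed
  have P1: "(\<Prod>\<alpha><\<gamma> i. h (x i (pos1 S i \<alpha>))) = (\<Prod>z\<in>A i. h z)" for h :: "rat \<Rightarrow> rat" and i
    unfolding A_def using prod.reindex_bij_betw[OF bij1[of i], of "\<lambda>u. h (x i u)"] prod.reindex[OF injS(1)[of i], of h] by simp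
  have P2: "(\<Prod>\<beta><\<delta> i. h (x i (pos2 \<gamma> \<delta> S i \<beta>))) = (\<Prod>z\<in>B i. h z)" for h :: "rat \<Rightarrow> rat" and i
    unfolding B_def using prod.reindex_bij_betw[OF bij2[of i], of "\<lambda>u. h (x i u)"] prod.reindex[OF injS(2)[of i], of h] by simp
  have 3: "ev x (\<Prod>i\<in>UNIV. \<Prod>j\<in>UNIV. \<Prod>\<alpha><\<gamma> i. \<Prod>\<beta><\<delta> j. (pvar j (pos2 \<gamma> \<delta> S j \<beta>) - pvar i (pos1 S i \<alpha>)) ^ a i j) =
     (\<Prod>i\<in>UNIV. \<Prod>j\<in>UNIV. \<Prod>x\<in>A i. \<Prod>y\<in>B j. (y - x) ^ a i j)"
    unfolding ev_simps ev_pvar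
    by (simp only: P2[of "\<lambda>z. (z - _) ^ _"] P1[of "\<lambda>z. \<Prod>y\<in>_. (y - z) ^ _"])
  have 4: "ev x (D (U S)) = (\<Prod>i\<in>UNIV. \<Prod>x\<in>A i. \<Prod>y\<in>B i. y - x)"
    unfolding prod_U[OF S, symmetric] unfolding ev_simps ev_pvar
    by (simp only: P2[of "\<lambda>z. z - _"] P1[of "\<lambda>z. \<Prod>y\<in>_. (y - z)"])
  show ?thesis unfolding B numer_def id_hom.insertion_mult[of "case_var x", folded ev_def] 1 2 3 4 kern_def by simp
qed

lemma G_eq_sum:
  assumes inj: "\<And>i. inj_on (x i) {..<n i}"
  shows "G x = (\<Sum>S\<in>shuffles_of \<gamma> \<delta>. ev x (numer S) / ev x (D (U S)))"
proof -
  let ?AA = "{A. \<forall>i. A i \<subseteq> x i ` {..<n i} \<and> card (A i) = \<gamma> i}"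
  have "bij_betw (\<lambda>S i. x i ` S i) (shuffles_of \<gamma> \<delta>) ?AA"
  proof (rule bij_betwI[where g = "\<lambda>A i. {u\<in>{..<n i}. x i u \<in> A i}"])
    show "(\<lambda>S i. x i ` S i) \<in> shuffles_of \<gamma> \<delta> \<rightarrow> ?AA"
    proof safe
      fix S i assume S: "S \<in> shuffles_of \<gamma> \<delta>"
      have "inj_on (x i) (S i)" using inj[of i] shufflesD(1)[OF S, of i] by (rule inj_on_subset)
      then show "card (x i ` S i) = \<gamma> i" using shufflesD(2)[OF S, of i] by (simp add: card_image)
    next
      fix S i u assume S: "S \<in> shuffles_of \<gamma> \<delta>" "u \<in> S i"
      then show "x i u \<in> x i ` {..<n i}" using shufflesD(1)[OF S(1), of i] by blast
    qed
    show "(\<lambda>A i. {u\<in>{..<n i}. x i u \<in> A i}) \<in> ?AA \<rightarrow> shuffles_of \<gamma> \<delta>"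
    proof safe
      fix A assume A: "\<forall>i. A i \<subseteq> x i ` {..<n i} \<and> card (A i) = \<gamma> i"
      have "card {u\<in>{..<n i}. x i u \<in> A i} = \<gamma> i" for i
      proof -
        have "A i \<subseteq> x i ` {..<n i}" using A by simp
        then have "x i ` {u\<in>{..<n i}. x i u \<in> A i} = A i" by blast
        moreover have "inj_on (x i) {u\<in>{..<n i}. x i u \<in> A i}" using inj[of i] by (rule inj_on_subset) auto
        ultimately show ?thesis using card_image A by fastforce
      qed
      then show "(\<lambda>i. {u\<in>{..<n i}. x i u \<in> A i}) \<in> shuffles_of \<gamma> \<delta>"
        by (auto simp: shuffles_of_def n_def)
    qed
    show "(\<lambda>i. {u\<in>{..<n i}. x i u \<in> x i ` S i}) = S" if "S \<in> shuffles_of \<gamma> \<delta>" for S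
    proof
      fix i
      show "{u\<in>{..<n i}. x i u \<in> x i ` S i} = S i"
        using shufflesD(1)[OF that, of i] inj[of i] by (auto simp: inj_on_def)
    qed
    show "(\<lambda>i. x i ` {u\<in>{..<n i}. x i u \<in> A i}) = A" if "A \<in> ?AA" for A
    proof
      fix i
      have "A i \<subseteq> x i ` {..<n i}" using that by simp
      then show "x i ` {u\<in>{..<n i}. x i u \<in> A i} = A i" by blast
    qed
  qed
  note reindex = sum.reindex_bij_betw[OF this, of "\<lambda>A. fs f A * fs g (\<lambda>i. x i ` {..<n i} - A i) * kern a A (\<lambda>i. x i ` {..<n i} - A i)"]
  show ?thesis
    unfolding G_def shuffle_value_def
    by (rule trans[OF reindex[symmetric] sum.cong[OF refl]]) (rule ev_summand[OF _ inj, symmetric])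
qed

lemma generic_inj_on: "generic F x \<Longrightarrow> inj_on (x i) M"
  by (auto simp: generic_def intro: inj_on_subset)

lemma ev_D_nonzero: "generic F x \<Longrightarrow> M \<subseteq> T \<Longrightarrow> ev x (D M) \<noteq> 0"
proof -
  assume x: "generic F x" and M: "M \<subseteq> T"
  have "ev x (pdiff e) \<noteq> 0" if "e \<in> M" for e
    using that M x by (cases e) (auto simp: T_def generic_def inj_eq)
  then show ?thesis using finite_subset[OF M finite_T] by simp
qed

definition Q where "Q = (\<Sum>S\<in>shuffles_of \<gamma> \<delta>. numer S * D (T - U S))"

lemma ev_Q:
  assumes "generic F x" shows "ev x Q = ev x (D T) * G x"
proof -
  have "ev x (numer S * D (T - U S)) = ev x (D T) * (ev x (numer S) / ev x (D (U S)))"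
    if S: "S \<in> shuffles_of \<gamma> \<delta>" for S
  proof -
    have eq: "ev x (D T) = ev x (D (U S)) * ev x (D (T - U S))"
      using arg_cong[OF D_split[OF shufflesD(5)[OF S] order_refl], of "ev x"] unfolding ev_simps(4) .
    have field: "u \<noteq> 0 \<Longrightarrow> m * w = (u * w) * (m / u)" for u m w :: rat by simp
    show ?thesis unfolding ev_simps(4) eq by (rule field[OF ev_D_nonzero[OF assms shufflesD(5)[OF S]]])
  qed
  then show ?thesis
    unfolding Q_def G_eq_sum[OF generic_inj_on[OF assms]] sum_distrib_left ev_simps(6)
    by (rule sum.cong[OF refl])
qed

lemma flip_flip [simp]: "flip (flip e) = e"
  by (cases e) (simp add: flip_def)

lemma flip_pdiff: "pdiff (flip e) = - pdiff e"
  by (cases e) (simp add: flip_def pdiff_def)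

lemma flip_U: "e \<in> U S \<Longrightarrow> flip e \<notin> U S"
  by (cases e) (auto simp: flip_def U_def)

lemma flip_T: "flip e \<in> T \<longleftrightarrow> e \<in> T"
  by (cases e) (auto simp: flip_def T_def)

lemma one_denominator_suffices:
  assumes e: "e \<in> T"
  shows "\<exists>R. \<forall>x. generic {} x \<longrightarrow> ev x R = ev x (D (T - {e})) * G x"
proof -
  have "\<exists>c. \<forall>x. generic {} x \<longrightarrow> ev x c * ev x (D (U S)) = ev x (D (T - {e}))" if S: "S \<in> shuffles_of \<gamma> \<delta>" for S
  proof (cases "e \<in> U S")
    case False
    then have "D (T - {e}) = D (U S) * D (T - {e} - U S)"
      using shufflesD(5)[OF S] by (intro D_split) auto
    then show ?thesis by (intro exI[of _ "D (T - {e} - U S)"]) (simp only: ev_simps(4) mult.commute simp_thms)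
  next
    case True
    have ne: "flip e \<noteq> e" using e by (cases e) (auto simp: flip_def T_def)
    have "D T = pdiff e * D (T - {e})" "D T = pdiff (flip e) * D (T - {flip e})"
      using finite_T e flip_T[of e] by (auto intro!: prod.remove)
    then have "pdiff e * D (T - {e}) = pdiff e * (- D (T - {flip e}))" by (simp add: flip_pdiff)
    moreover have "pdiff e \<noteq> 0" using e by (cases e) (auto simp: T_def pdiff_nonzero)
    ultimately have "D (T - {e}) = - D (T - {flip e})" by (simp only: mult_cancel_left simp_thms)
    moreover have "D (T - {flip e}) = D (U S) * D (T - {flip e} - U S)"
      using shufflesD(5)[OF S] flip_U[OF True] by (intro D_split) auto
    ultimately have "D (T - {e}) = D (U S) * (- D (T - {flip e} - U S))" by simp
    then show ?thesis by (intro exI[of _ "- D (T - {flip e} - U S)"]) (simp only: ev_simps(4) mult.commute simp_thms)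
  qed
  then obtain c where c: "\<And>S x. S \<in> shuffles_of \<gamma> \<delta> \<Longrightarrow> generic {} x \<Longrightarrow> ev x (c S) * ev x (D (U S)) = ev x (D (T - {e}))"
    by metis
  define R where "R = (\<Sum>S\<in>shuffles_of \<gamma> \<delta>. numer S * c S)"
  have "ev x R = ev x (D (T - {e})) * G x" if x: "generic {} x" for x
  proof -
    have "ev x (numer S * c S) = ev x (D (T - {e})) * (ev x (numer S) / ev x (D (U S)))"
      if S: "S \<in> shuffles_of \<gamma> \<delta>" for S
    proof -
      have field: "u \<noteq> 0 \<Longrightarrow> m * w = (w * u) * (m / u)" for u m w :: rat by simp
      show ?thesis
        unfolding ev_simps(4) c[OF S x, symmetric] by (rule field[OF ev_D_nonzero[OF x shufflesD(5)[OF S]]])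
    qed
    then show ?thesis
      unfolding R_def G_eq_sum[OF generic_inj_on[OF x]] sum_distrib_left ev_simps(6)
      by (rule sum.cong[OF refl])
  qed
  then show ?thesis by blast
qed

text \<open>Clearing every difference except the two orientations of one pair of positions produces a polynomial. With one
  orientation kept this is immediate; that polynomial changes sign when the two positions are exchanged, so it is
  divisible by their difference.\<close>

lemma no_denominator_at:
  assumes e: "e \<in> T"
  shows "\<exists>q. \<forall>x. generic {} x \<longrightarrow> ev x q = ev x (D (T - {e, flip e})) * G x"
proof -
  obtain i u v where e': "e = (i, u, v)" by (cases e)
  then have uv: "u < n i" "v < n i" "u \<noteq> v" using e by (auto simp: T_def)
  define W where "W = T - {e, flip e}"
  obtain R where R: "\<And>x. generic {} x \<Longrightarrow> ev x R = ev x (D (T - {flip e})) * G x"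
    using one_denominator_suffices[of "flip e"] e flip_T by blast
  have "D (T - {flip e}) = pdiff e * D (T - {flip e} - {e})"
    using e finite_T by (intro prod.remove) (auto simp: e' flip_def uv)
  also have "T - {flip e} - {e} = W" by (auto simp: W_def)
  finally have DR: "ev x (D (T - {flip e})) = (x i v - x i u) * ev x (D W)" for x
    by (simp only: ev_simps(4) e' ev_pdiff)
  define \<tau> where "\<tau> j = (if j = i then Transposition.transpose u v else id)" for j
  define sw where "sw x j \<alpha> = (x j (\<tau> j \<alpha>) :: rat)" for x j \<alpha>
  have \<tau>\<tau>: "\<tau> j (\<tau> j \<alpha>) = \<alpha>" for j \<alpha> by (simp add: \<tau>_def)
  have \<tau>n: "\<tau> j \<alpha> < n j \<longleftrightarrow> \<alpha> < n j" for j \<alpha> using uv by (auto simp: \<tau>_def Transposition.transpose_def)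
  have \<tau>_inj: "\<tau> j \<alpha> = \<tau> j \<beta> \<longleftrightarrow> \<alpha> = \<beta>" for j \<alpha> \<beta> using \<tau>\<tau> by metis
  have gen: "generic {} (sw x)" if "generic {} x" for x
    using that unfolding generic_def inj_def sw_def by (meson iffD1[OF \<tau>_inj])
  have Gsw: "G (sw x) = G x" for x
  proof -
    have "\<tau> j ` {..<n j} = {..<n j}" for j
      using \<tau>n \<tau>\<tau> by (auto simp: image_iff) (metis lessThan_iff)
    then have "sw x j ` {..<n j} = x j ` {..<n j}" for j
      using image_image[of "x j" "\<tau> j" "{..<n j}"] by (simp add: sw_def[abs_def])
    then show ?thesis by (simp add: G_def)
  qed
  have Dsw: "ev (sw x) (D W) = ev x (D W)" for x
  proof -
    define h where "h = (\<lambda>(j, p, q). (j, \<tau> j p, \<tau> j q))"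
    have hh: "h (h d) = d" for d by (cases d) (simp add: h_def \<tau>\<tau>)
    have hW: "h d \<in> W" if "d \<in> W" for d
    proof (cases d)
      case (fields j p q)
      have "h d \<in> T" using that \<tau>n \<tau>_inj by (auto simp: W_def T_def h_def fields)
      moreover have "h d \<noteq> e \<and> h d \<noteq> flip e"
      proof -
        have "h e = flip e" "h (flip e) = e" by (simp_all add: h_def e' flip_def \<tau>_def)
        then show ?thesis using that hh[of d] by (auto simp: W_def)
      qed
      ultimately show ?thesis by (simp add: W_def)
    qed
    have bij: "bij_betw h W W"
      by (rule bij_betwI[where g = h]) (use hh hW in auto)
    have "(\<Prod>d\<in>W. ev (sw x) (pdiff d)) = (\<Prod>d\<in>W. ev x (pdiff (h d)))"
      by (rule prod.cong[OF refl]) (auto simp: h_def sw_def split: prod.splits)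
    also have "\<dots> = (\<Prod>d\<in>W. ev x (pdiff d))" by (rule prod.reindex_bij_betw[OF bij])
    finally show ?thesis by (simp only: ev_simps(7))
  qed
  have anti: "subst (\<lambda>j \<alpha>. pvar j (\<tau> j \<alpha>)) R = - R"
  proof (rule poly_ext[of "{}"])
    fix x :: "'i \<Rightarrow> nat \<Rightarrow> rat" assume x: "generic {} x"
    have "ev x (subst (\<lambda>j \<alpha>. pvar j (\<tau> j \<alpha>)) R) = ev (sw x) R" by (simp add: sw_def[abs_def])
    also have "\<dots> = - ev x R"
      unfolding R[OF gen[OF x]] R[OF x] DR Gsw Dsw by (simp add: sw_def \<tau>_def algebra_simps)
    finally show "ev x (subst (\<lambda>j \<alpha>. pvar j (\<tau> j \<alpha>)) R) = ev x (- R)" by simp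
  qed simp
  have "pdiff (i, u, v) dvd R"
  proof (rule pdiff_dvd_if_vanishing)
    fix x :: "'i \<Rightarrow> nat \<Rightarrow> rat" assume eq: "x i u = x i v"
    have "(\<lambda>j \<alpha>. x j (\<tau> j \<alpha>)) = x"
      using eq by (intro ext) (auto simp: \<tau>_def Transposition.transpose_def)
    then have "ev x R = ev x (- R)" unfolding anti[symmetric] by simp
    then show "ev x R = 0" by simp
  qed
  then obtain q where q: "R = pdiff e * q" unfolding e' by (elim dvdE)
  have "ev x q = ev x (D W) * G x" if x: "generic {} x" for x
  proof -
    have "x i v - x i u \<noteq> 0" using x uv by (auto simp: generic_def inj_eq)
    moreover have "(x i v - x i u) * ev x q = (x i v - x i u) * (ev x (D W) * G x)"
    proof -
      have "ev x R = (x i v - x i u) * ev x (D W) * G x" using R[OF x] unfolding DR .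
      moreover have "ev x R = (x i v - x i u) * ev x q" by (simp only: q ev_simps(4) e' ev_pdiff)
      ultimately show ?thesis by (simp only: mult.assoc)
    qed
    ultimately show ?thesis by (simp only: mult_cancel_left simp_thms)
  qed
  then show ?thesis unfolding W_def by blast
qed

definition DD where "DD F = (\<Prod>e\<in>F. pdiff e * pdiff (flip e))"

lemma E_T: "T = E \<union> flip ` E"
proof -
  have "flip d \<in> E" if "d \<in> T" "d \<notin> E" for d using that by (cases d) (auto simp: T_def E_def flip_def)
  then have "d \<in> flip ` E" if "d \<in> T" "d \<notin> E" for d using that flip_flip by (metis imageI)
  then show ?thesis by (auto simp: T_def E_def flip_def)
qed

lemma flip_E: "d \<in> E \<Longrightarrow> flip d \<notin> E"
  by (cases d) (auto simp: E_def flip_def)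

lemma D_eq_DD:
  assumes "F \<subseteq> E" shows "D (F \<union> flip ` F) = DD F"
proof -
  have fin: "finite F" using assms finite_T E_T by (metis finite_Un finite_subset)
  have disj: "F \<inter> flip ` F = {}" using assms flip_E by blast
  have inj: "inj_on flip F" by (rule inj_onI) (metis flip_flip)
  show ?thesis
    using prod.union_disjoint[OF fin finite_imageI[OF fin] disj, of pdiff] prod.reindex[OF inj, of pdiff]
    by (simp only: DD_def prod.distrib comp_def)
qed

text \<open>The differences of distinct pairs of variables are pairwise coprime primes, so all of them can be
  removed from the denominator, one pair after the other.\<close>

lemma remove_denominators:
  assumes "finite M" "M \<subseteq> E"
  shows "\<exists>q. \<forall>x. generic {} x \<longrightarrow> ev x q = ev x (DD (E - M)) * G x"
  using assms
proof (induction M)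
  case empty
  have "D T = DD E" using D_eq_DD[OF order_refl] unfolding E_T[symmetric] .
  then show ?case using ev_Q unfolding Diff_empty by auto
next
  case (insert e M)
  define F where "F = E - insert e M"
  obtain Q' where Q': "\<And>x. generic {} x \<Longrightarrow> ev x Q' = ev x (DD (E - M)) * G x"
    using insert.IH insert.prems by blast
  have e: "e \<in> E" "e \<in> T" using insert.prems E_T by auto
  obtain qe where qe: "\<And>x. generic {} x \<Longrightarrow> ev x qe = ev x (D (T - {e, flip e})) * G x"
    using no_denominator_at[OF e(2)] by blast
  have fin: "finite E" using finite_T E_T by simp
  define H where "H = DD (E - {e} - F)"
  have "E - M = insert e F" using insert.prems insert.hyps(2) by (auto simp: F_def)
  then have DM: "DD (E - M) = pdiff e * pdiff (flip e) * DD F"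
    unfolding DD_def
  proof -
    assume "E - M = insert e F"
    have "finite F" "e \<notin> F" using fin by (auto simp: F_def)
    then show "(\<Prod>e\<in>E - M. pdiff e * pdiff (flip e)) = pdiff e * pdiff (flip e) * (\<Prod>e\<in>F. pdiff e * pdiff (flip e))"
      unfolding \<open>E - M = insert e F\<close> by (rule prod.insert)
  qed
  have "T - {e, flip e} = (E - {e}) \<union> flip ` (E - {e})"
  proof -
    have "inj flip" by (rule injI) (metis flip_flip)
    then have "flip ` (E - {e}) = flip ` E - {flip e}" by (simp add: image_set_diff)
    moreover have "e \<notin> flip ` E" using e(1) flip_E by auto
    moreover have "flip e \<notin> E" using e(1) flip_E by auto
    ultimately have "flip ` E - {e, flip e} = flip ` (E - {e})" "E - {e, flip e} = E - {e}" by blast+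
    then show ?thesis unfolding E_T Un_Diff by simp
  qed
  then have "D (T - {e, flip e}) = DD (E - {e})" using D_eq_DD[of "E - {e}"] by auto
  also have "\<dots> = DD F * H"
  proof -
    have "F \<subseteq> E - {e}" by (auto simp: F_def)
    from prod.subset_diff[OF this finite_Diff[OF fin], of "\<lambda>e. pdiff e * pdiff (flip e)"]
    show ?thesis unfolding H_def DD_def by (simp only: mult.commute)
  qed
  finally have De: "D (T - {e, flip e}) = DD F * H" .
  define l where "l = pdiff e"
  obtain i u v where e': "e = (i, u, v)" by (cases e)
  have uv: "u < v" using e(1) by (simp add: e' E_def)
  have l0: "l \<noteq> 0" using uv by (simp add: l_def e' pdiff_nonzero)
  have "glue i u v (pdiff d * pdiff (flip d)) \<noteq> 0" if "d \<in> E - {e} - F" for d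
  proof (cases d)
    case (fields j p q)
    have "p < q" "\<not> (j = i \<and> {p, q} = {u, v})"
      using that uv by (auto simp: E_def e' fields doubleton_eq_iff)
    then have "glue i u v (pdiff (j, p, q)) \<noteq> 0" using uv by (intro glue_pdiff_nonzero) auto
    moreover have "glue i u v (pdiff (flip d)) = - glue i u v (pdiff d)"
      by (simp add: flip_pdiff[of d] glue_def subst_simps(2)[of _ 0, simplified])
    ultimately show ?thesis by (simp add: fields)
  qed
  then have H0: "glue i u v H \<noteq> 0" using fin by (simp add: H_def DD_def del: glue_simps(1))
  have eq: "Q' * H = l * (- l * qe)"
  proof (rule poly_ext[of "{}"])
    fix x :: "'i \<Rightarrow> nat \<Rightarrow> rat" assume x: "generic {} x"
    show "ev x (Q' * H) = ev x (l * (- l * qe))"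
      unfolding ev_simps(3,4) Q'[OF x] qe[OF x] DM De flip_pdiff[of e] l_def by (simp only: mult_minus_left mult_minus_right mult_ac)
  qed simp
  have "l dvd Q'" unfolding l_def e'
    by (rule pdiff_dvd_mult_cancel[OF _ H0]) (simp only: eq[unfolded l_def e'] dvd_triv_left)
  then obtain Q1 where Q1: "Q' = l * Q1" by (elim dvdE)
  have "l * (Q1 * H) = l * (l * (- qe))" using eq unfolding Q1 by (simp only: mult.assoc mult_minus_left mult_minus_right)
  then have eq1: "Q1 * H = l * (- qe)" using l0 by (simp only: mult_cancel_left simp_thms)
  have "l dvd Q1" unfolding l_def e'
    by (rule pdiff_dvd_mult_cancel[OF _ H0]) (simp only: eq1[unfolded l_def e'] dvd_triv_left)
  then obtain Q2 where Q2: "Q1 = l * Q2" by (elim dvdE)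
  have "ev x (- Q2) = ev x (DD F) * G x" if x: "generic {} x" for x
  proof -
    have "ev x l \<noteq> 0" using uv x by (auto simp: l_def e' generic_def inj_eq)
    moreover have "- (ev x l * ev x l) * ev x (- Q2) = - (ev x l * ev x l) * (ev x (DD F) * G x)"
      using Q'[OF x] unfolding DM Q1 Q2 flip_pdiff[of e] l_def[symmetric] ev_simps(3,4)
      by (simp only: mult_minus_left mult_minus_right mult_ac minus_minus)
    ultimately show ?thesis by (simp only: mult_cancel_left neg_equal_0_iff_equal mult_eq_0_iff simp_thms)
  qed
  then show ?case unfolding F_def by blast
qed

theorem shuffle_polynomial:
  "\<exists>p. p \<in> hall_comp n \<and> (\<forall>x. generic {} x \<longrightarrow> ev x p = G x) \<and>
    to_fract p = (\<Sum>S\<in>shuffles_of \<gamma> \<delta>. shuffle_summand a \<gamma> \<delta> f g S)"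
proof -
  have "finite E" using finite_T E_T by simp
  from remove_denominators[OF this order_refl] obtain p
    where p: "\<And>x. generic {} x \<Longrightarrow> ev x p = G x" by (auto simp: DD_def)
  have DTp: "D T * p = Q"
    by (rule poly_ext[of "{}"]) (simp_all only: ev_Q p ev_simps(4) finite.emptyI)
  define \<kappa> where "\<kappa> = (\<lambda>i \<alpha>. if \<alpha> < n i then pvar i \<alpha> else 0 :: 'i mpoly)"
  have "D T \<in> in_vars n"
    by (intro in_vars_prod) (auto simp: T_def pdiff_def)
  moreover have "Q \<in> in_vars n"
    unfolding Q_def by (intro in_vars_sum in_vars_mult in_vars_prod numer_in_vars) (auto simp: T_def pdiff_def)
  ultimately have \<kappa>: "subst \<kappa> (D T) = D T" "subst \<kappa> Q = Q"
    using subst_id[of _ n \<kappa>] by (simp_all only: \<kappa>_def if_True)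
  have "D T * subst \<kappa> p = subst \<kappa> (D T * p)" unfolding subst_simps(3) \<kappa>(1) ..
  also have "\<dots> = D T * p" unfolding DTp \<kappa>(2) ..
  finally have "D T * subst \<kappa> p = D T * p" .
  then have "subst \<kappa> p = p" using D_T_nonzero[of T] by (simp only: mult_cancel_left order_refl simp_thms)
  moreover have "subst \<kappa> p \<in> in_vars n" by (rule subst_in_vars_all) (auto simp: \<kappa>_def)
  ultimately have pn: "p \<in> in_vars n" by simp
  have hall: "p \<in> hall_comp n"
    by (rule hallI[where F = "{}" and f = shuffle_value]) (simp_all add: p G_def pn)
  have "to_fract (D T) * (to_fract (numer S) / to_fract (D (U S))) = to_fract (numer S * D (T - U S))"
    if S: "S \<in> shuffles_of \<gamma> \<delta>" for S
  proof -
    have "to_fract (D T) = to_fract (D (U S)) * to_fract (D (T - U S))"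
      unfolding to_fract_mult[symmetric] D_split[OF shufflesD(5)[OF S] order_refl, symmetric] ..
    moreover have "to_fract (D (U S)) \<noteq> 0" using D_T_nonzero[OF shufflesD(5)[OF S]] by simp
    ultimately show ?thesis by simp
  qed
  then have "to_fract (D T) * (\<Sum>S\<in>shuffles_of \<gamma> \<delta>. shuffle_summand a \<gamma> \<delta> f g S) = to_fract Q"
    unfolding Q_def to_fract_sum sum_distrib_left
    by (intro sum.cong[OF refl]) (simp only: to_fract_shuffle_summand)
  also have "\<dots> = to_fract (D T) * to_fract p" unfolding DTp[symmetric] by (rule to_fract_mult)
  finally have "to_fract p = (\<Sum>S\<in>shuffles_of \<gamma> \<delta>. shuffle_summand a \<gamma> \<delta> f g S)"
    using D_T_nonzero[of T] by (simp only: mult_cancel_left to_fract_eq_0_iff order_refl simp_thms)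
  then show ?thesis using hall p by blast
qed

lemma shuffle_prod_hall: "shuffle_prod a \<gamma> \<delta> f g \<in> hall_comp n"
  and fs_shuffle_prod: "(\<And>i. finite (P i)) \<Longrightarrow> (\<And>i. card (P i) = n i) \<Longrightarrow>
      fs (shuffle_prod a \<gamma> \<delta> f g) P = shuffle_value P"
proof -
  obtain p where p: "p \<in> hall_comp n" "\<And>x. generic {} x \<Longrightarrow> ev x p = G x"
    "to_fract p = (\<Sum>S\<in>shuffles_of \<gamma> \<delta>. shuffle_summand a \<gamma> \<delta> f g S)"
    using shuffle_polynomial by blast
  have eq: "shuffle_prod a \<gamma> \<delta> f g = p"
    unfolding shuffle_prod_def p(3)[symmetric] by simp
  show "shuffle_prod a \<gamma> \<delta> f g \<in> hall_comp n" using p(1) eq by simp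
  assume "\<And>i. finite (P i)" "\<And>i. card (P i) = n i"
  then show "fs (shuffle_prod a \<gamma> \<delta> f g) P = shuffle_value P"
    unfolding eq by (intro fs_if_ev[OF p(1), of "{}" shuffle_value]) (auto simp: p(2) G_def)
qed

end

section \<open>The algebra as a convolution algebra\<close>

type_synonym 'i fam = "'i \<Rightarrow> rat set"

definition fam_card :: "'i fam \<Rightarrow> 'i dimvec" where
  "fam_card P = (\<lambda>i. card (P i))"

definition ffam :: "'i fam \<Rightarrow> bool" where
  "ffam P \<longleftrightarrow> (\<forall>i. finite (P i))"

definition avoids :: "rat set \<Rightarrow> 'i fam \<Rightarrow> bool" where
  "avoids F P \<longleftrightarrow> (\<forall>i. P i \<inter> F = {})"

lemma ffam_mono: "ffam P \<Longrightarrow> A \<le> P \<Longrightarrow> ffam A"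
  by (auto simp: ffam_def le_fun_def intro: finite_subset)

lemma ffam_diff [simp]: "ffam P \<Longrightarrow> ffam (P - A)"
  by (auto simp: ffam_def)

lemma ffam_sup [simp]: "ffam (sup A B) \<longleftrightarrow> ffam A \<and> ffam B"
  by (auto simp: ffam_def)

lemma ffam_bot [simp]: "ffam bot"
  by (simp add: ffam_def)

lemma finite_subfams: "ffam P \<Longrightarrow> finite {..P :: 'i::finite fam}"
  by (rule finite_subset[of _ "Pi\<^sub>E UNIV (\<lambda>i. Pow (P i))"]) (auto simp: ffam_def le_fun_def subset_iff intro!: finite_PiE)

lemma fam_card_sup:
  "ffam A \<Longrightarrow> ffam B \<Longrightarrow> inf A B = bot \<Longrightarrow> fam_card (sup A B) = (\<lambda>i. fam_card A i + fam_card B i)"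
  by (auto simp: fam_card_def ffam_def fun_eq_iff card_Un_disjoint)

lemma fam_card_diff:
  assumes "ffam P" "A \<le> P" shows "fam_card P i = fam_card A i + fam_card (P - A) i"
proof -
  have "finite (P i)" "A i \<subseteq> P i" using assms by (auto simp: ffam_def le_fun_def)
  then show ?thesis using card_mono[of "P i" "A i"] by (simp add: fam_card_def card_Diff_subset finite_subset)
qed

lemma fam_card_bot [simp]: "fam_card bot = (\<lambda>_. 0)"
  by (simp add: fam_card_def)

lemma fam_card_eq_0: "ffam P \<Longrightarrow> fam_card P = (\<lambda>_. 0) \<Longrightarrow> P = bot"
  by (auto simp: fam_card_def ffam_def fun_eq_iff)

lemma fs_simps [simp]:
  "fs 0 P = 0" "fs 1 P = 1" "fs (single 0 c) P = c" "fs (p + q) P = fs p P + fs q P" "fs (p - q) P = fs p P - fs q P"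
  "fs (p * q) P = fs p P * fs q P" "fs (p ^ n) P = fs p P ^ n"
  "fs (sum h A) P = (\<Sum>x\<in>A. fs (h x) P)" "fs (prod h A) P = (\<Prod>x\<in>A. fs (h x) P)"
  by (simp_all add: fs_def)

text \<open>The value of an element on a finite family \<open>P\<close> only involves its component in \<open>fam_card P\<close>.\<close>

definition cv :: "'i coha \<Rightarrow> 'i fam \<Rightarrow> rat" where
  "cv f P = fs (lookup f (fam_card P)) P"

lemma lookup_scale: "lookup (coha_scale c f) \<gamma> = single 0 c * lookup f (\<gamma> :: 'i::countable dimvec)"
proof -
  have "lookup (single 0 c * lookup f \<gamma>) m = c * lookup (lookup f \<gamma>) m" for m
    by (simp flip: mult_map_scale_conv_mult add: Poly_Mapping.map.rep_eq when_def)
  then show ?thesis by (intro poly_mapping_eqI) (simp add: lookup_coha_scale)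
qed

lemma cv_simps [simp]:
  "cv 0 P = 0" "cv (f + g) P = cv f P + cv g P" "cv (f - g) P = cv f P - cv g P" "cv (sum h A) P = (\<Sum>x\<in>A. cv (h x) P)"
  by (simp_all add: cv_def lookup_add lookup_minus lookup_sum)

lemma cv_scale [simp]: "cv (coha_scale c f) P = c * cv (f :: 'i::countable coha) P"
  by (simp add: cv_def lookup_scale)

lemma cv_single: "cv (single \<gamma> p) P = (if fam_card P = \<gamma> then fs p P else 0)"
  by (auto simp: cv_def lookup_single when_def)

lemma cv_ext:
  fixes f g :: "'i::countable coha"
  assumes "finite F" "f \<in> coha_carrier" "g \<in> coha_carrier"
    "\<And>P. ffam P \<Longrightarrow> avoids F P \<Longrightarrow> cv f P = cv g P"
  shows "f = g"
proof (rule poly_mapping_eqI, rule fs_ext[OF assms(1)])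
  fix \<gamma> show "lookup f \<gamma> \<in> hall_comp \<gamma>" "lookup g \<gamma> \<in> hall_comp \<gamma>"
    using assms(2,3) by (auto simp: coha_carrier_def)
  fix P assume "\<And>i. finite (P i)" "\<And>i. card (P i) = \<gamma> i" "\<And>i. P i \<inter> F = {}"
  then show "fs (lookup f \<gamma>) P = fs (lookup g \<gamma>) P"
    using assms(4)[of P] by (simp add: cv_def fam_card_def ffam_def avoids_def)
qed

lemma carrier_simps [simp]:
  fixes f g :: "'i::countable coha"
  shows "0 \<in> coha_carrier"
    and "f \<in> coha_carrier \<Longrightarrow> g \<in> coha_carrier \<Longrightarrow> f + g \<in> coha_carrier"
    and "f \<in> coha_carrier \<Longrightarrow> g \<in> coha_carrier \<Longrightarrow> f - g \<in> coha_carrier"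
    and "f \<in> coha_carrier \<Longrightarrow> coha_scale c f \<in> coha_carrier"
  by (auto simp: coha_carrier_def lookup_add lookup_minus lookup_scale)

lemma carrier_sum [intro]:
  "(\<And>x. x \<in> A \<Longrightarrow> f x \<in> coha_carrier) \<Longrightarrow> (\<Sum>x\<in>A. f x :: 'i::countable coha) \<in> coha_carrier"
  by (induction A rule: infinite_finite_induct) auto

lemma carrier_single [simp]: "single \<gamma> p \<in> coha_carrier \<longleftrightarrow> p \<in> hall_comp \<gamma>"
  by (auto simp: coha_carrier_def lookup_single when_def)

lemma carrier_one [simp]: "(coha_one :: 'i::countable coha) \<in> coha_carrier"
  by (simp add: coha_one_def)

lemma cv_one: "ffam P \<Longrightarrow> cv coha_one P = (if P = bot then 1 else 0)"
  using fam_card_eq_0[of P] by (auto simp: coha_one_def cv_single)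

subsection \<open>The kernel\<close>

lemma kern_sup_left:
  assumes "ffam A" "ffam B" "inf A B = bot"
  shows "kern a (sup A B) C = kern a A C * kern a B C"
proof -
  have "finite (A i)" "finite (B i)" "A i \<inter> B i = {}" for i using assms by (auto simp: ffam_def fun_eq_iff)
  then show ?thesis by (simp add: kern_def prod.union_disjoint prod.distrib)
qed

lemma kern_sup_right:
  assumes "ffam A" "ffam B" "inf A B = bot"
  shows "kern a C (sup A B) = kern a C A * kern a C B"
proof -
  have "finite (A i)" "finite (B i)" "A i \<inter> B i = {}" for i using assms by (auto simp: ffam_def fun_eq_iff)
  then show ?thesis by (simp add: kern_def prod.union_disjoint prod.distrib)
qed

lemma kern_bot [simp]: "kern a bot B = 1" "kern a A bot = 1"
  by (simp_all add: kern_def)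

definition bit_sign :: "bit \<Rightarrow> rat" where
  "bit_sign b = (if b = 1 then - 1 else 1)"

lemma bit_sign_add: "bit_sign (b + c) = bit_sign b * bit_sign c"
  by (cases b; cases c) (auto simp: bit_sign_def)

lemma bit_sign_square [simp]: "bit_sign b * bit_sign b = 1"
  by (simp add: bit_sign_def)

lemma bit_sign_0 [simp]: "bit_sign 0 = 1"
  by (simp add: bit_sign_def)

lemma bit_sign_1 [simp]: "bit_sign 1 = - 1"
  by (simp add: bit_sign_def)

lemma of_int_bit_eq: "(of_int k :: bit) = of_bool (odd k)"
  by (cases "even k") (auto elim!: evenE oddE)

text \<open>Exchanging the arguments changes the sign of every difference; the numbers of arrows in the two directions agree,
  so only the sign given by the Euler form remains.\<close>

lemma kern_swap:
  assumes "symmetric_quiver a"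
  shows "kern a B A = bit_sign (of_int (euler_form a (int \<circ> fam_card A) (int \<circ> fam_card B))) * kern a A B"
proof -
  define N where "N = (\<Sum>i\<in>UNIV. \<Sum>j\<in>UNIV. a i j * card (A i) * card (B j))"
  define M where "M = (\<Sum>i\<in>UNIV. card (A i) * card (B i))"
  have pw: "(x - y) ^ n = (- 1) ^ n * (y - x) ^ n" for x y :: rat and n
    by (metis minus_diff_eq power_minus)
  have "(\<Prod>i\<in>UNIV. \<Prod>j\<in>UNIV. \<Prod>x\<in>B i. \<Prod>y\<in>A j. (y - x) ^ a i j) =
        (\<Prod>j\<in>UNIV. \<Prod>i\<in>UNIV. \<Prod>y\<in>A j. \<Prod>x\<in>B i. (y - x) ^ a j i)"
    by (rule trans[OF prod.swap], rule prod.cong[OF refl], rule prod.cong[OF refl], rule trans[OF prod.swap])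
       (use assms in \<open>simp add: symmetric_quiver_def\<close>)
  also have "\<dots> = (\<Prod>j\<in>UNIV. \<Prod>i\<in>UNIV. \<Prod>y\<in>A j. \<Prod>x\<in>B i. (- 1) ^ a j i * (x - y) ^ a j i)"
    by (intro prod.cong refl) (rule pw)
  also have "\<dots> = (- 1) ^ N * (\<Prod>i\<in>UNIV. \<Prod>j\<in>UNIV. \<Prod>x\<in>A i. \<Prod>y\<in>B j. (y - x) ^ a i j)"
    by (simp add: prod.distrib N_def power_sum mult_ac flip: power_mult)
  finally have num: "(\<Prod>i\<in>UNIV. \<Prod>j\<in>UNIV. \<Prod>x\<in>B i. \<Prod>y\<in>A j. (y - x) ^ a i j) =
      (- 1) ^ N * (\<Prod>i\<in>UNIV. \<Prod>j\<in>UNIV. \<Prod>x\<in>A i. \<Prod>y\<in>B j. (y - x) ^ a i j)" .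
  have "(\<Prod>i\<in>UNIV. \<Prod>x\<in>B i. \<Prod>y\<in>A i. y - x) = (\<Prod>i\<in>UNIV. \<Prod>y\<in>A i. \<Prod>x\<in>B i. (- 1) * (x - y))"
    by (rule prod.cong[OF refl], rule trans[OF prod.swap]) simp
  also have "\<dots> = (- 1) ^ M * (\<Prod>i\<in>UNIV. \<Prod>x\<in>A i. \<Prod>y\<in>B i. y - x)"
    unfolding prod.distrib by (simp add: M_def power_sum mult_ac flip: power_mult)
  finally have den: "(\<Prod>i\<in>UNIV. \<Prod>x\<in>B i. \<Prod>y\<in>A i. y - x) = (- 1) ^ M * (\<Prod>i\<in>UNIV. \<Prod>x\<in>A i. \<Prod>y\<in>B i. y - x)" .
  have eul: "euler_form a (int \<circ> fam_card A) (int \<circ> fam_card B) = int M - int N"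
    by (simp add: euler_form_def fam_card_def M_def N_def)
  have "bit_sign (of_int (int M - int N)) = (- 1) ^ N / (- 1) ^ M"
    by (auto simp: bit_sign_def of_int_bit_eq uminus_power_if)
  then show ?thesis unfolding eul kern_def[of a B A] num den by (simp add: kern_def)
qed

lemma hall_shuffle_prod:
  fixes f g :: "'i::finite mpoly"
  assumes "f \<in> hall_comp \<gamma>" "g \<in> hall_comp \<delta>"
  shows "shuffle_prod a \<gamma> \<delta> f g \<in> hall_comp (\<lambda>i. \<gamma> i + \<delta> i)"
proof -
  interpret shuffle_setup a \<gamma> \<delta> f g by standard fact+
  show ?thesis using shuffle_prod_hall by (simp add: n_def[abs_def])
qed

lemma fs_shuffle:
  fixes f g :: "'i::finite mpoly"
  assumes "f \<in> hall_comp \<gamma>" "g \<in> hall_comp \<delta>" "ffam P" "fam_card P = (\<lambda>i. \<gamma> i + \<delta> i)"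
  shows "fs (shuffle_prod a \<gamma> \<delta> f g) P =
    (\<Sum>A\<in>{A\<in>{..P}. fam_card A = \<gamma>}. fs f A * fs g (P - A) * kern a A (P - A))"
proof -
  interpret shuffle_setup a \<gamma> \<delta> f g by standard fact+
  have "{A. \<forall>i. A i \<subseteq> P i \<and> card (A i) = \<gamma> i} = {A\<in>{..P}. fam_card A = \<gamma>}"
    by (auto simp: le_fun_def fam_card_def fun_eq_iff)
  moreover have "(\<lambda>i. P i - A i) = P - A" for A by (simp add: fun_diff_def)
  moreover have "fs (shuffle_prod a \<gamma> \<delta> f g) P = shuffle_value P"
    using assms(3,4) by (intro fs_shuffle_prod) (auto simp: ffam_def fam_card_def n_def fun_eq_iff)
  ultimately show ?thesis by (simp add: shuffle_value_def)
qed

definition dim_par :: "'i::finite quiver \<Rightarrow> 'i dimvec \<Rightarrow> bit" where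
  "dim_par a \<gamma> = of_int (euler_form a (int \<circ> \<gamma>) (int \<circ> \<gamma>))"

locale twisted =
  fixes a :: "'i::finite quiver" and \<psi> :: "bit ^ 'i \<Rightarrow> bit ^ 'i \<Rightarrow> bit"
  assumes symm: "symmetric_quiver a" and tw: "sign_twist a \<psi>"
begin

abbreviation mul (infixl "\<star>" 70) where "mul \<equiv> twisted_mult a \<psi>"

definition cls :: "'i dimvec \<Rightarrow> bit ^ 'i" where
  "cls \<gamma> = mod2 (int \<circ> \<gamma>)"

definition twisted_kern :: "'i fam \<Rightarrow> 'i fam \<Rightarrow> rat" where
  "twisted_kern A B = bit_sign (\<psi> (cls (fam_card A)) (cls (fam_card B))) * kern a A B"

abbreviation par :: "'i fam \<Rightarrow> bit" where
  "par P \<equiv> dim_par a (fam_card P)"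

lemma lookup_mul:
  "lookup (f \<star> g) \<rho> = (\<Sum>\<gamma>\<in>keys f. \<Sum>\<delta>\<in>keys g. if (\<lambda>i. \<gamma> i + \<delta> i) = \<rho>
      then single 0 (bit_sign (\<psi> (cls \<gamma>) (cls \<delta>))) * shuffle_prod a \<gamma> \<delta> (lookup f \<gamma>) (lookup g \<delta>) else 0)"
proof -
  have "coha_mult a (single \<gamma> (lookup f \<gamma>)) (single \<delta> (lookup g \<delta>)) =
      single (\<lambda>i. \<gamma> i + \<delta> i) (shuffle_prod a \<gamma> \<delta> (lookup f \<gamma>) (lookup g \<delta>))"
    if "\<gamma> \<in> keys f" "\<delta> \<in> keys g" for \<gamma> \<delta>
    using that by (simp add: coha_mult_def in_keys_iff)
  then show ?thesis
    unfolding twisted_mult_def lookup_sum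
    by (intro sum.cong refl) (simp add: lookup_scale lookup_single when_def bit_sign_def cls_def)
qed

lemma mul_carrier [simp]:
  assumes "f \<in> coha_carrier" "g \<in> coha_carrier"
  shows "f \<star> g \<in> coha_carrier"
  unfolding coha_carrier_def
proof (intro CollectI allI)
  fix \<rho>
  have "shuffle_prod a \<gamma> \<delta> (lookup f \<gamma>) (lookup g \<delta>) \<in> hall_comp \<rho>" if "(\<lambda>i. \<gamma> i + \<delta> i) = \<rho>" for \<gamma> \<delta>
    using hall_shuffle_prod[of "lookup f \<gamma>" \<gamma> "lookup g \<delta>" \<delta> a] assms that by (auto simp: coha_carrier_def)
  then show "lookup (f \<star> g) \<rho> \<in> hall_comp \<rho>"
    unfolding lookup_mul by (intro hall_sum) (simp add: hall_mult)
qed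

text \<open>The shuffles in the product of two components correspond to the subfamilies \<open>A\<close> of the first dimension vector; for
  the other subfamilies the value of \<open>f\<close> or of \<open>g\<close> belongs to another component.\<close>

lemma cv_mul:
  assumes fg: "f \<in> coha_carrier" "g \<in> coha_carrier" and P: "ffam P"
  shows "cv (f \<star> g) P = (\<Sum>A\<in>{..P}. twisted_kern A (P - A) * cv f A * cv g (P - A))"
proof -
  define t where "t A = twisted_kern A (P - A) * cv f A * cv g (P - A)" for A
  have fin: "finite {..P}" by (rule finite_subfams[OF P])
  have summand: "fs (if (\<lambda>i. \<gamma> i + \<delta> i) = fam_card P
        then single 0 (bit_sign (\<psi> (cls \<gamma>) (cls \<delta>))) * shuffle_prod a \<gamma> \<delta> (lookup f \<gamma>) (lookup g \<delta>) else 0) P =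
      (\<Sum>A\<in>{..P}. if fam_card A = \<gamma> then if fam_card (P - A) = \<delta> then t A else 0 else 0)" (is "?l = ?r") for \<gamma> \<delta>
  proof (cases "(\<lambda>i. \<gamma> i + \<delta> i) = fam_card P")
    case True
    have \<delta>: "fam_card (P - A) = \<delta>" if "A \<in> {..P}" "fam_card A = \<gamma>" for A
    proof
      fix i
      have "\<gamma> i + \<delta> i = fam_card A i + fam_card (P - A) i"
        using fun_cong[OF True, of i] fam_card_diff[OF P, of A i] that(1) by simp
      then show "fam_card (P - A) i = \<delta> i" using that(2) by simp
    qed
    have "?l = (\<Sum>A\<in>{A\<in>{..P}. fam_card A = \<gamma>}.
        bit_sign (\<psi> (cls \<gamma>) (cls \<delta>)) * (fs (lookup f \<gamma>) A * fs (lookup g \<delta>) (P - A) * kern a A (P - A)))"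
      using fg True P by (simp add: fs_shuffle coha_carrier_def sum_distrib_left)
    also have "\<dots> = (\<Sum>A\<in>{A\<in>{..P}. fam_card A = \<gamma>}. t A)"
      by (intro sum.cong refl) (auto simp: t_def twisted_kern_def cv_def \<delta>)
    also have "\<dots> = ?r"
      unfolding sum.inter_filter[OF fin] by (intro sum.cong refl) (simp add: \<delta>)
    finally show ?thesis .
  next
    case False
    have "\<not> (fam_card A = \<gamma> \<and> fam_card (P - A) = \<delta>)" if "A \<in> {..P}" for A
    proof
      assume "fam_card A = \<gamma> \<and> fam_card (P - A) = \<delta>"
      then have "(\<lambda>i. \<gamma> i + \<delta> i) = fam_card P"
        using fam_card_diff[OF P, of A] that by (auto simp: fun_eq_iff)
      then show False using False by simp
    qed
    then have "?r = 0" by (intro sum.neutral) auto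
    then show ?thesis using False by simp
  qed
  have "cv (f \<star> g) P = (\<Sum>\<gamma>\<in>keys f. \<Sum>\<delta>\<in>keys g. \<Sum>A\<in>{..P}.
      if fam_card A = \<gamma> then if fam_card (P - A) = \<delta> then t A else 0 else 0)"
    unfolding cv_def lookup_mul fs_simps(8) summand ..
  also have "\<dots> = (\<Sum>A\<in>{..P}. \<Sum>\<gamma>\<in>keys f. \<Sum>\<delta>\<in>keys g.
      if fam_card A = \<gamma> then if fam_card (P - A) = \<delta> then t A else 0 else 0)"
    by (subst (2) sum.swap) (simp add: sum.swap[of _ "{..P}"])
  also have "\<dots> = (\<Sum>A\<in>{..P}. t A)"
  proof (rule sum.cong[OF refl])
    fix A
    have inner: "(\<Sum>\<delta>\<in>keys g. if fam_card A = \<gamma> then if fam_card (P - A) = \<delta> then t A else 0 else 0) =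
        (if fam_card A = \<gamma> then if fam_card (P - A) \<in> keys g then t A else 0 else 0)" for \<gamma>
      by simp
    have "t A = 0" if "fam_card A \<notin> keys f \<or> fam_card (P - A) \<notin> keys g"
      using that by (auto simp: t_def cv_def in_keys_iff)
    then show "(\<Sum>\<gamma>\<in>keys f. \<Sum>\<delta>\<in>keys g.
      if fam_card A = \<gamma> then if fam_card (P - A) = \<delta> then t A else 0 else 0) = t A"
      unfolding inner by auto
  qed
  finally show ?thesis by (simp add: t_def)
qed

subsection \<open>Signs\<close>

lemma psi_add: "\<psi> (u + v) w = \<psi> u w + \<psi> v w" "\<psi> w (u + v) = \<psi> w u + \<psi> w v"
  using tw by (auto simp: sign_twist_def bilinear_form_def Vector_Spaces.linear_iff)

lemma cls_add: "cls (\<lambda>i. \<gamma> i + \<delta> i) = cls \<gamma> + cls \<delta>"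
  by (simp add: cls_def mod2_def vec_eq_iff)

lemma twisted_kern_sup_left:
  assumes "ffam A" "ffam B" "inf A B = bot"
  shows "twisted_kern (sup A B) C = twisted_kern A C * twisted_kern B C"
  unfolding twisted_kern_def fam_card_sup[OF assms] cls_add psi_add bit_sign_add kern_sup_left[OF assms] by simp

lemma twisted_kern_sup_right:
  assumes "ffam A" "ffam B" "inf A B = bot"
  shows "twisted_kern C (sup A B) = twisted_kern C A * twisted_kern C B"
  unfolding twisted_kern_def fam_card_sup[OF assms] cls_add psi_add bit_sign_add kern_sup_right[OF assms] by simp

lemma twisted_kern_bot [simp]: "twisted_kern bot A = 1" "twisted_kern A bot = 1"
proof -
  have "cls (\<lambda>_. 0) = 0" using cls_add[of "\<lambda>_. 0" "\<lambda>_. 0"] by simp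
  moreover have "\<psi> 0 u = 0" "\<psi> u 0 = 0" for u
    using psi_add(1)[of 0 0 u] psi_add(2)[of u 0 0] by auto
  ultimately show "twisted_kern bot A = 1" "twisted_kern A bot = 1" by (simp_all add: twisted_kern_def)
qed

lemma euler_form_add:
  "euler_form a (\<lambda>i. \<gamma> i + \<delta> i) \<rho> = euler_form a \<gamma> \<rho> + euler_form a \<delta> \<rho>"
  "euler_form a \<rho> (\<lambda>i. \<gamma> i + \<delta> i) = euler_form a \<rho> \<gamma> + euler_form a \<rho> \<delta>"
  by (simp_all add: euler_form_def algebra_simps sum.distrib)

lemma euler_form_sym: "euler_form a \<gamma> \<delta> = euler_form a \<delta> \<gamma>"
proof -
  have "(\<Sum>i\<in>UNIV. \<Sum>j\<in>UNIV. int (a i j) * \<gamma> i * \<delta> j) = (\<Sum>j\<in>UNIV. \<Sum>i\<in>UNIV. int (a j i) * \<gamma> i * \<delta> j)"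
    using symm by (subst sum.swap) (simp add: symmetric_quiver_def)
  then show ?thesis by (simp add: euler_form_def mult_ac)
qed

lemma bit_move: "(x :: bit) + y = z \<Longrightarrow> y = z + x"
  by (cases x; cases y; cases z) auto

lemma twisted_kern_swap: "twisted_kern B A = bit_sign (par A * par B) * twisted_kern A B"
proof -
  have "\<psi> (cls (fam_card A)) (cls (fam_card B)) + \<psi> (cls (fam_card B)) (cls (fam_card A)) =
      of_int (euler_form a (int \<circ> fam_card A) (int \<circ> fam_card B)) + par A * par B"
    using tw unfolding sign_twist_def cls_def dim_par_def of_int_add of_int_mult by blast
  then have *: "\<psi> (cls (fam_card B)) (cls (fam_card A)) =
      of_int (euler_form a (int \<circ> fam_card A) (int \<circ> fam_card B)) + par A * par B
        + \<psi> (cls (fam_card A)) (cls (fam_card B))"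
    by (rule bit_move)
  have s: "bit_sign b * (bit_sign b * z) = z" for b z by (simp add: mult.assoc[symmetric])
  show ?thesis unfolding twisted_kern_def * kern_swap[OF symm, of B A] bit_sign_add by (simp add: mult_ac s)
qed

subsection \<open>The twisted product is an associative, unital, super-commutative algebra structure\<close>

lemma mul_add_left:
  assumes "f \<in> coha_carrier" "g \<in> coha_carrier" "h \<in> coha_carrier"
  shows "(f + g) \<star> h = f \<star> h + g \<star> h"
  by (rule cv_ext[of "{}"]) (use assms in \<open>auto simp: cv_mul algebra_simps sum.distrib\<close>)

lemma mul_add_right:
  assumes "f \<in> coha_carrier" "g \<in> coha_carrier" "h \<in> coha_carrier"
  shows "h \<star> (f + g) = h \<star> f + h \<star> g"
  by (rule cv_ext[of "{}"]) (use assms in \<open>auto simp: cv_mul algebra_simps sum.distrib\<close>)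

lemma mul_scale:
  assumes "f \<in> coha_carrier" "g \<in> coha_carrier"
  shows "coha_scale c f \<star> g = coha_scale c (f \<star> g)" "f \<star> coha_scale c g = coha_scale c (f \<star> g)"
  by (rule cv_ext[of "{}"]; use assms in \<open>auto simp: cv_mul algebra_simps sum_distrib_left\<close>)+

lemma mul_zero [simp]: "f \<in> coha_carrier \<Longrightarrow> 0 \<star> f = 0" "f \<in> coha_carrier \<Longrightarrow> f \<star> 0 = 0"
  by (rule cv_ext[of "{}"]; auto simp: cv_mul)+

lemma mul_sum_left:
  assumes "\<And>x. x \<in> A \<Longrightarrow> f x \<in> coha_carrier" "h \<in> coha_carrier"
  shows "(\<Sum>x\<in>A. f x) \<star> h = (\<Sum>x\<in>A. f x \<star> h)"
  using assms(1)
  by (induction A rule: infinite_finite_induct) (auto simp: mul_add_left assms(2) carrier_sum)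

lemma mul_sum_right:
  assumes "\<And>x. x \<in> A \<Longrightarrow> f x \<in> coha_carrier" "h \<in> coha_carrier"
  shows "h \<star> (\<Sum>x\<in>A. f x) = (\<Sum>x\<in>A. h \<star> f x)"
  using assms(1)
  by (induction A rule: infinite_finite_induct) (auto simp: mul_add_right assms(2) carrier_sum)

lemma mul_one [simp]:
  assumes "f \<in> coha_carrier" shows "coha_one \<star> f = f" "f \<star> coha_one = f"
proof -
  have 1: "cv (coha_one \<star> f) P = cv f P" if P: "ffam P" for P
  proof -
    have [simp]: "P - bot = P" by (simp add: fun_eq_iff)
    have "cv (coha_one \<star> f) P = (\<Sum>A\<in>{..P}. if A = bot then cv f P else 0)"
      unfolding cv_mul[OF carrier_one assms P]
      by (rule sum.cong[OF refl]) (use P in \<open>auto simp: cv_one ffam_mono\<close>)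
    then show ?thesis using finite_subfams[OF P] by simp
  qed
  have 2: "cv (f \<star> coha_one) P = cv f P" if P: "ffam P" for P
  proof -
    have "cv coha_one (P - A) = (if A = P then 1 else 0)" if "A \<le> P" for A
    proof -
      have "P - A = bot \<longleftrightarrow> A = P" using that by (auto simp: fun_eq_iff le_fun_def)
      then show ?thesis using P by (simp add: cv_one)
    qed
    moreover have "P - bot = P" by (simp add: fun_eq_iff)
    ultimately have "cv (f \<star> coha_one) P = (\<Sum>A\<in>{..P}. if A = P then cv f P else 0)"
      unfolding cv_mul[OF assms carrier_one P]
      by (intro sum.cong refl) (auto simp: fun_diff_def bot_fun_def[symmetric])
    then show ?thesis using finite_subfams[OF P] by simp
  qed
  show "coha_one \<star> f = f" "f \<star> coha_one = f"
    by (rule cv_ext[of "{}"]; use assms 1 2 in simp)+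
qed

lemma diff_sup: "A \<le> P \<Longrightarrow> sup A (P - A) = (P :: 'i fam)"
  by (auto simp: fun_eq_iff le_fun_def)

lemma inf_diff [simp]: "inf A (P - A) = (bot :: 'i fam)"
  by (auto simp: fun_eq_iff)

text \<open>Both sides are sums over the decompositions of a family into three parts.\<close>

lemma mul_assoc:
  assumes f: "f \<in> coha_carrier" and g: "g \<in> coha_carrier" and h: "h \<in> coha_carrier"
  shows "(f \<star> g) \<star> h = f \<star> (g \<star> h)"
proof (rule cv_ext[of "{}"])
  fix P :: "'i fam" assume P: "ffam P"
  define t where "t A B = twisted_kern A B * twisted_kern A (P - A - B) * twisted_kern B (P - A - B) * cv f A * cv g B * cv h (P - A - B)" for A B
  have fin: "finite {..A}" if "A \<le> P" for A using finite_subfams ffam_mono[OF P that] by blast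
  have "cv ((f \<star> g) \<star> h) P = (\<Sum>D\<in>{..P}. \<Sum>A\<in>{..D}. t A (D - A))"
    unfolding cv_mul[OF mul_carrier[OF f g] h P]
  proof (rule sum.cong[OF refl])
    fix D assume "D \<in> {..P}"
    then have D: "D \<le> P" "ffam D" using ffam_mono[OF P] by auto
    have "twisted_kern D (P - D) * (twisted_kern A (D - A) * cv f A * cv g (D - A)) * cv h (P - D) = t A (D - A)" if A: "A \<in> {..D}" for A
    proof -
      have A': "A \<le> D" "ffam A" using A ffam_mono[OF D(2)] by auto
      have "P - A - (D - A) = P - D" using A'(1) by (auto simp: fun_eq_iff le_fun_def)
      moreover have "twisted_kern D (P - D) = twisted_kern A (P - D) * twisted_kern (D - A) (P - D)"
        using twisted_kern_sup_left[of A "D - A" "P - D"] diff_sup[OF A'(1)] A'(2) D(2) by simp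
      ultimately show ?thesis by (simp add: t_def)
    qed
    then show "twisted_kern D (P - D) * cv (f \<star> g) D * cv h (P - D) = (\<Sum>A\<in>{..D}. t A (D - A))"
      unfolding cv_mul[OF f g D(2)] by (simp add: sum_distrib_left sum_distrib_right)
  qed
  also have "\<dots> = (\<Sum>(D, A)\<in>(SIGMA D:{..P}. {..D}). t A (D - A))"
    by (rule sum.Sigma) (use fin in auto)
  also have "\<dots> = (\<Sum>(A, B)\<in>(SIGMA A:{..P}. {..P - A}). t A B)"
  proof (rule sum.reindex_bij_witness[where j = "\<lambda>(D, A). (A, D - A)" and i = "\<lambda>(A, B). (sup A B, A)"])
    fix x assume "x \<in> (SIGMA A:{..P}. {..P - A})"
    then obtain A B where x: "x = (A, B)" "A \<le> P" "B \<le> P - A" by auto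
    have "sup A B \<le> P" "sup A B - A = B" using x(2,3) by (auto simp: fun_eq_iff le_fun_def)
    then show "(case case x of (A, B) \<Rightarrow> (sup A B, A) of (D, A) \<Rightarrow> (A, D - A)) = x"
      "(case x of (A, B) \<Rightarrow> (sup A B, A)) \<in> (SIGMA D:{..P}. {..D})" by (auto simp: x(1))
  next
    fix x assume "x \<in> (SIGMA D:{..P}. {..D})"
    then obtain D A where x: "x = (D, A)" "D \<le> P" "A \<le> D" by auto
    have "A \<le> P" using x(2,3) by simp
    moreover have "D - A \<le> P - A" using x(2) by (auto simp: le_fun_def)
    ultimately show "(case x of (D, A) \<Rightarrow> (A, D - A)) \<in> (SIGMA A:{..P}. {..P - A})"
      "(case case x of (D, A) \<Rightarrow> (A, D - A) of (A, B) \<Rightarrow> (sup A B, A)) = x"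
      "(case case x of (D, A) \<Rightarrow> (A, D - A) of (A, B) \<Rightarrow> t A B) = (case x of (D, A) \<Rightarrow> t A (D - A))"
      using x(3) by (auto simp: x(1) diff_sup)
  qed
  also have "\<dots> = (\<Sum>A\<in>{..P}. \<Sum>B\<in>{..P - A}. t A B)"
  proof (rule sum.Sigma[symmetric])
    show "\<forall>A\<in>{..P}. finite {..P - A}" using finite_subfams[OF ffam_diff[OF P]] by blast
  qed (use fin in auto)
  also have "\<dots> = cv (f \<star> (g \<star> h)) P"
    unfolding cv_mul[OF f mul_carrier[OF g h] P]
  proof (rule sum.cong[OF refl])
    fix A assume "A \<in> {..P}"
    then have A: "A \<le> P" "ffam A" "ffam (P - A)" using ffam_mono[OF P] P by auto
    have "twisted_kern A (P - A) * cv f A * (twisted_kern B (P - A - B) * cv g B * cv h (P - A - B)) = t A B" if B: "B \<in> {..P - A}" for B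
    proof -
      have B': "B \<le> P - A" "ffam B" using B ffam_mono[OF A(3)] by auto
      have "twisted_kern A (P - A) = twisted_kern A B * twisted_kern A (P - A - B)"
        using twisted_kern_sup_right[of B "P - A - B" A] diff_sup[OF B'(1)] B'(2) A(3) by simp
      then show ?thesis by (simp add: t_def)
    qed
    then show "(\<Sum>B\<in>{..P - A}. t A B) = twisted_kern A (P - A) * cv f A * cv (g \<star> h) (P - A)"
      unfolding cv_mul[OF g h A(3)] by (simp add: sum_distrib_left)
  qed
  finally show "cv ((f \<star> g) \<star> h) P = cv (f \<star> (g \<star> h)) P" .
qed (use assms in auto)

text \<open>Exchanging a subfamily with its complement in the convolution produces the same sign in every term, because the
  parity is constant on the components of either factor.\<close>

lemma mul_commute:
  assumes f: "f \<in> coha_carrier" and g: "g \<in> coha_carrier"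
    and p: "\<And>\<gamma>. \<gamma> \<in> keys f \<Longrightarrow> dim_par a \<gamma> = p" and q: "\<And>\<gamma>. \<gamma> \<in> keys g \<Longrightarrow> dim_par a \<gamma> = q"
  shows "f \<star> g = coha_scale (bit_sign (p * q)) (g \<star> f)"
proof (rule cv_ext[of "{}"])
  fix P :: "'i fam" assume P: "ffam P"
  have dd: "P - (P - A) = A" if "A \<le> P" for A using that by (auto simp: fun_eq_iff le_fun_def)
  have le: "P - A \<le> P" for A by (auto simp: le_fun_def)
  have "cv (f \<star> g) P = (\<Sum>A\<in>{..P}. twisted_kern (P - A) A * cv f (P - A) * cv g A)"
    unfolding cv_mul[OF f g P]
    by (rule sum.reindex_bij_witness[where i = "\<lambda>A. P - A" and j = "\<lambda>A. P - A"]) (auto simp: dd le)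
  also have "\<dots> = (\<Sum>A\<in>{..P}. bit_sign (p * q) * (twisted_kern A (P - A) * cv g A * cv f (P - A)))"
  proof (rule sum.cong[OF refl])
    fix A
    show "twisted_kern (P - A) A * cv f (P - A) * cv g A = bit_sign (p * q) * (twisted_kern A (P - A) * cv g A * cv f (P - A))"
    proof (cases "cv f (P - A) = 0 \<or> cv g A = 0")
      case False
      then have "fam_card (P - A) \<in> keys f" "fam_card A \<in> keys g" by (auto simp: cv_def in_keys_iff)
      then show ?thesis using twisted_kern_swap[of "P - A" A] p q by (simp add: mult.commute)
    qed auto
  qed
  finally show "cv (f \<star> g) P = cv (coha_scale (bit_sign (p * q)) (g \<star> f)) P"
    using P f g by (simp add: cv_mul sum_distrib_left)
qed (use assms in auto)

end

section \<open>Operators acting componentwise\<close>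

definition cmap :: "('i dimvec \<Rightarrow> 'i mpoly \<Rightarrow> 'i mpoly) \<Rightarrow> 'i coha \<Rightarrow> 'i coha" where
  "cmap H f = (\<Sum>\<gamma>\<in>keys f. single \<gamma> (H \<gamma> (lookup f \<gamma>)))"

lemma lookup_cmap: "H \<gamma> 0 = 0 \<Longrightarrow> lookup (cmap H f) \<gamma> = H \<gamma> (lookup f \<gamma>)"
  by (auto simp: cmap_def lookup_sum lookup_single when_def in_keys_iff)

lemma carrier_lookup: "f \<in> coha_carrier \<Longrightarrow> lookup f \<gamma> \<in> hall_comp \<gamma>"
  by (simp add: coha_carrier_def)

lemma cmap_carrier:
  fixes f :: "'i::countable coha"
  assumes "\<And>\<gamma> p. p \<in> hall_comp \<gamma> \<Longrightarrow> H \<gamma> p \<in> hall_comp \<gamma>" "f \<in> coha_carrier"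
  shows "cmap H f \<in> coha_carrier"
  unfolding cmap_def by (rule carrier_sum) (simp add: assms(1) carrier_lookup[OF assms(2)])

lemma hall_fsI:
  fixes p :: "'i::countable mpoly"
  assumes "finite F" "p \<in> in_vars \<gamma>" "\<And>x. generic F x \<Longrightarrow> ev x p = f (\<lambda>i. x i ` {..<\<gamma> i})"
  shows "p \<in> hall_comp \<gamma>" and "ffam P \<Longrightarrow> fam_card P = \<gamma> \<Longrightarrow> avoids F P \<Longrightarrow> fs p P = f P"
proof -
  show p: "p \<in> hall_comp \<gamma>" by (rule hallI[OF assms(1,2), of f]) (rule assms(3))
  show "ffam P \<Longrightarrow> fam_card P = \<gamma> \<Longrightarrow> avoids F P \<Longrightarrow> fs p P = f P"
    by (rule fs_if_ev[OF p assms(1), of f]) (auto simp: assms(3) ffam_def fam_card_def avoids_def)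
qed

lemma avoids_empty [simp]: "avoids {} P"
  by (simp add: avoids_def)

lemma generic_inj: "generic F x \<Longrightarrow> inj_on (x i) M"
  by (auto simp: generic_def intro: inj_on_subset)

subsection \<open>Multiplicative operators\<close>

definition usub :: "rat poly \<Rightarrow> 'i::countable mpoly \<Rightarrow> 'i mpoly" where
  "usub r p = (\<Sum>k\<le>Polynomial.degree r. single 0 (coeff r k) * p ^ k)"

lemma ev_usub [simp]: "ev x (usub r p) = poly r (ev x p)"
  by (simp add: usub_def poly_altdef)

definition mpw :: "('i::finite \<Rightarrow> rat poly) \<Rightarrow> 'i fam \<Rightarrow> rat" where
  "mpw q P = (\<Prod>i\<in>UNIV. \<Prod>x\<in>P i. poly (q i) x)"

definition mpw_poly :: "('i::finite \<Rightarrow> rat poly) \<Rightarrow> 'i dimvec \<Rightarrow> 'i mpoly" where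
  "mpw_poly q \<gamma> = (\<Prod>i\<in>UNIV. \<Prod>\<alpha><\<gamma> i. usub (q i) (pvar i \<alpha>))"

lemma mpw_poly: "mpw_poly q \<gamma> \<in> hall_comp \<gamma>"
  "ffam P \<Longrightarrow> fam_card P = \<gamma> \<Longrightarrow> fs (mpw_poly q \<gamma>) P = mpw q P"
proof -
  have v: "mpw_poly q \<gamma> \<in> in_vars \<gamma>"
    unfolding mpw_poly_def usub_def by (intro in_vars_prod in_vars_sum in_vars_mult in_vars_power) auto
  have e: "ev x (mpw_poly q \<gamma>) = mpw q (\<lambda>i. x i ` {..<\<gamma> i})" if "generic {} x" for x
    using generic_inj[OF that] by (simp add: mpw_poly_def mpw_def prod.reindex)
  note * = hall_fsI[where F = "{}" and f = "mpw q", OF finite.emptyI v e]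
  show "mpw_poly q \<gamma> \<in> hall_comp \<gamma>" "ffam P \<Longrightarrow> fam_card P = \<gamma> \<Longrightarrow> fs (mpw_poly q \<gamma>) P = mpw q P"
    using * by auto
qed

text \<open>Multiplication by a product of one-variable polynomials over all variables; as such products are multiplicative on
  disjoint unions, it is an endomorphism of the algebra.\<close>

definition mop :: "('i::finite \<Rightarrow> rat poly) \<Rightarrow> 'i coha \<Rightarrow> 'i coha" where
  "mop q = cmap (\<lambda>\<gamma> p. mpw_poly q \<gamma> * p)"

lemma mop_carrier [simp]: "f \<in> coha_carrier \<Longrightarrow> mop q f \<in> coha_carrier"
  unfolding mop_def by (rule cmap_carrier) (auto intro: hall_mult mpw_poly)

lemma cv_mop [simp]: "ffam P \<Longrightarrow> cv (mop q f) P = mpw q P * cv f P"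
  by (simp add: cv_def mop_def lookup_cmap mpw_poly)

lemma mpw_sup:
  assumes "ffam A" "ffam B" "inf A B = bot" shows "mpw q (sup A B) = mpw q A * mpw q B"
proof -
  have "finite (A i)" "finite (B i)" "A i \<inter> B i = {}" for i using assms by (auto simp: ffam_def fun_eq_iff)
  then show ?thesis by (simp add: mpw_def prod.union_disjoint prod.distrib)
qed

subsection \<open>Multiplication by the sum of all variables\<close>

definition psum :: "'i::finite fam \<Rightarrow> rat" where
  "psum P = (\<Sum>i\<in>UNIV. \<Sum>x\<in>P i. x)"

definition psum_poly :: "'i::finite dimvec \<Rightarrow> 'i mpoly" where
  "psum_poly \<gamma> = (\<Sum>i\<in>UNIV. \<Sum>\<alpha><\<gamma> i. pvar i \<alpha>)"

lemma psum_poly: "psum_poly \<gamma> \<in> hall_comp \<gamma>"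
  "ffam P \<Longrightarrow> fam_card P = \<gamma> \<Longrightarrow> fs (psum_poly \<gamma>) P = psum P"
proof -
  have v: "psum_poly \<gamma> \<in> in_vars \<gamma>"
    unfolding psum_poly_def by (intro in_vars_sum) auto
  have e: "ev x (psum_poly \<gamma>) = psum (\<lambda>i. x i ` {..<\<gamma> i})" if "generic {} x" for x
    using generic_inj[OF that] by (simp add: psum_poly_def psum_def sum.reindex)
  note * = hall_fsI[where F = "{}" and f = psum, OF finite.emptyI v e]
  show "psum_poly \<gamma> \<in> hall_comp \<gamma>" "ffam P \<Longrightarrow> fam_card P = \<gamma> \<Longrightarrow> fs (psum_poly \<gamma>) P = psum P"
    using * by auto
qed

text \<open>Its values are additive on disjoint unions, so multiplication by the sum of the variables is a derivation.\<close>

definition sig :: "'i::finite coha \<Rightarrow> 'i coha" where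
  "sig = cmap (\<lambda>\<gamma> p. psum_poly \<gamma> * p)"

lemma lookup_sig: "lookup (sig f) \<gamma> = psum_poly \<gamma> * lookup f \<gamma>"
  by (simp add: sig_def lookup_cmap)

lemma sig_carrier [simp]: "f \<in> coha_carrier \<Longrightarrow> sig f \<in> coha_carrier"
  unfolding sig_def by (rule cmap_carrier) (auto intro: hall_mult psum_poly)

lemma cv_sig [simp]: "ffam P \<Longrightarrow> cv (sig f) P = psum P * cv f P"
  by (simp add: cv_def lookup_sig psum_poly)

lemma sig_simps [simp]: "sig 0 = 0" "sig (f + g) = sig f + sig g" "sig (f - g) = sig f - sig g"
  "sig (coha_scale c f) = coha_scale c (sig f)"
  by (rule poly_mapping_eqI; simp add: lookup_sig lookup_add lookup_minus lookup_scale algebra_simps)+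

lemma sig_sum [simp]: "sig (sum h A) = (\<Sum>x\<in>A. sig (h x))"
  by (induction A rule: infinite_finite_induct) auto

lemma psum_sup:
  assumes "ffam A" "ffam B" "inf A B = bot" shows "psum (sup A B) = psum A + psum B"
proof -
  have "finite (A i)" "finite (B i)" "A i \<inter> B i = {}" for i using assms by (auto simp: ffam_def fun_eq_iff)
  then show ?thesis by (simp add: psum_def sum.union_disjoint sum.distrib)
qed

subsection \<open>Affine substitutions\<close>

definition fimg :: "(rat \<Rightarrow> rat) \<Rightarrow> 'i fam \<Rightarrow> 'i fam" where
  "fimg s P = (\<lambda>i. s ` P i)"

lemma ffam_fimg [simp]: "ffam P \<Longrightarrow> ffam (fimg s P)"
  by (simp add: ffam_def fimg_def)

lemma fam_card_fimg [simp]: "inj s \<Longrightarrow> fam_card (fimg s P) = fam_card P"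
  by (simp add: fam_card_def fimg_def card_image inj_on_subset[of s UNIV])

lemma fimg_diff: "inj s \<Longrightarrow> fimg s P - fimg s A = fimg s (P - A)"
  by (simp add: fimg_def fun_eq_iff image_set_diff)

lemma fimg_subfams:
  fixes P :: "'i fam"
  assumes s: "inj s" shows "bij_betw (fimg s) {..P} {..fimg s P}"
proof (rule bij_betwI[where g = "\<lambda>A i. s -` A i"])
  show "fimg s \<in> {..P} \<rightarrow> {..fimg s P}" 
    by (rule funcsetI) (simp add: fimg_def le_fun_def image_mono)
  have sub: "s -` A i \<subseteq> P i" if "A i \<subseteq> s ` P i" for A :: "'i fam" and i
    using vimage_mono[OF that, of s] inj_vimage_image_eq[OF s, of "P i"] by simp
  show "(\<lambda>A i. s -` A i) \<in> {..fimg s P} \<rightarrow> {..P}"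
    by (rule funcsetI) (simp add: fimg_def le_fun_def sub)
  show "(\<lambda>i. s -` fimg s A i) = A" for A :: "'i fam" by (simp add: fimg_def inj_vimage_image_eq[OF s])
  show "fimg s (\<lambda>i. s -` A i) = A" if A: "A \<in> {..fimg s P}" for A :: "'i fam"
  proof
    fix i
    have "A i \<subseteq> s ` P i" using A by (simp add: fimg_def le_fun_def)
    then have "A i \<subseteq> range s" by blast
    then show "fimg s (\<lambda>i. s -` A i) i = A i" by (simp add: fimg_def image_vimage_eq Int_absorb2)
  qed
qed

text \<open>The kernel is a product of differences, so it is translation invariant and homogeneous; its degree is minus the Euler form.\<close>

lemma kern_affine:
  fixes c d :: rat
  assumes c: "c \<noteq> 0"
  defines "s \<equiv> \<lambda>x. c * x + d"
  shows "kern a (fimg s A) (fimg s B) = c powi (- euler_form a (int \<circ> fam_card A) (int \<circ> fam_card B)) * kern a A B"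
proof -
  have inj: "inj_on s M" for M using c by (auto simp: s_def inj_on_def)
  have diff: "s y - s x = c * (y - x)" for x y by (simp add: s_def algebra_simps)
  define N where "N = (\<Sum>i\<in>UNIV. \<Sum>j\<in>UNIV. a i j * card (A i) * card (B j))"
  define M where "M = (\<Sum>i\<in>UNIV. card (A i) * card (B i))"
  have num: "(\<Prod>i\<in>UNIV. \<Prod>j\<in>UNIV. \<Prod>x\<in>A i. \<Prod>y\<in>B j. (c * (y - x)) ^ a i j) =
      c ^ N * (\<Prod>i\<in>UNIV. \<Prod>j\<in>UNIV. \<Prod>x\<in>A i. \<Prod>y\<in>B j. (y - x) ^ a i j)"
    unfolding power_mult_distrib prod.distrib by (simp add: N_def power_sum mult_ac flip: power_mult)
  have den: "(\<Prod>i\<in>UNIV. \<Prod>x\<in>A i. \<Prod>y\<in>B i. c * (y - x)) = c ^ M * (\<Prod>i\<in>UNIV. \<Prod>x\<in>A i. \<Prod>y\<in>B i. y - x)"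
    unfolding prod.distrib by (simp add: M_def power_sum mult_ac flip: power_mult)
  have eul: "- euler_form a (int \<circ> fam_card A) (int \<circ> fam_card B) = int N - int M"
    by (simp add: euler_form_def fam_card_def M_def N_def)
  have "c powi (int N - int M) = c ^ N / c ^ M" using c by (simp add: power_int_diff)
  then show ?thesis
    unfolding eul kern_def fimg_def by (simp add: prod.reindex[OF inj] diff num den)
qed

definition tra_poly :: "'i::countable mpoly \<Rightarrow> 'i mpoly" where
  "tra_poly = subst (\<lambda>i \<alpha>. pvar i \<alpha> + 1)"

definition tra :: "'i::finite coha \<Rightarrow> 'i coha" where
  "tra = cmap (\<lambda>_. tra_poly)"

lemma lookup_tra: "lookup (tra f) \<gamma> = tra_poly (lookup f \<gamma>)"
  by (simp add: tra_def lookup_cmap tra_poly_def)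

lemma tra_poly_hall:
  fixes p :: "'i::countable mpoly"
  assumes p: "p \<in> hall_comp \<gamma>"
  shows "tra_poly p \<in> hall_comp \<gamma>" "ffam P \<Longrightarrow> fam_card P = \<gamma> \<Longrightarrow> fs (tra_poly p) P = fs p (fimg (\<lambda>x. 1 * x + 1) P)"
proof -
  have v: "tra_poly p \<in> in_vars \<gamma>"
    unfolding tra_poly_def by (rule subst_in_vars[OF hall_in_vars[OF p]]) (auto intro: in_vars_add)
  have e: "ev x (tra_poly p) = fs p (fimg (\<lambda>x. 1 * x + 1) (\<lambda>i. x i ` {..<\<gamma> i}))" if "generic {} x" for x
  proof -
    have "ev x (tra_poly p) = ev (\<lambda>i \<alpha>. 1 * x i \<alpha> + 1) p" by (simp add: tra_poly_def)
    also have "\<dots> = fs p (\<lambda>i. (\<lambda>\<alpha>. 1 * x i \<alpha> + 1) ` {..<\<gamma> i})"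
      using that by (intro hall_fs[OF p]) (auto simp: inj_on_def generic_def dest: injD)
    finally show ?thesis by (simp add: fimg_def image_image)
  qed
  note * = hall_fsI[where F = "{}" and f = "\<lambda>P. fs p (fimg (\<lambda>x. 1 * x + 1) P)", OF finite.emptyI v e]
  show "tra_poly p \<in> hall_comp \<gamma>" "ffam P \<Longrightarrow> fam_card P = \<gamma> \<Longrightarrow> fs (tra_poly p) P = fs p (fimg (\<lambda>x. 1 * x + 1) P)"
    using * by auto
qed

lemma tra_carrier [simp]: "f \<in> coha_carrier \<Longrightarrow> tra f \<in> coha_carrier"
  unfolding tra_def by (rule cmap_carrier) (auto intro: tra_poly_hall)

lemma inj_affine: "c \<noteq> 0 \<Longrightarrow> inj (\<lambda>x::rat. c * x + d)"
  by (auto simp: inj_def)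

lemma cv_tra: "f \<in> coha_carrier \<Longrightarrow> ffam P \<Longrightarrow> cv (tra f) P = cv f (fimg (\<lambda>x. 1 * x + 1) P)"
  unfolding cv_def lookup_tra fam_card_fimg[OF inj_affine[OF one_neq_zero]]
  by (rule tra_poly_hall(2)[OF carrier_lookup _ refl])

lemma tra_simps [simp]:
  fixes f g :: "'i::finite coha"
  shows "tra 0 = (0 :: 'i coha)" "tra (f + g) = tra f + tra g" "tra (f - g) = tra f - tra g"
  "tra (coha_scale c f) = coha_scale c (tra f)"
proof -
  have c: "tra_poly (single 0 c) = (single 0 c :: 'i mpoly)"
    unfolding tra_poly_def by (rule poly_ext[of "{}"]) auto
  have c': "tra_poly (single 0 c * p) = single 0 c * tra_poly p" for p :: "'i mpoly"
    using c by (simp only: tra_poly_def subst_simps)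
  show "tra 0 = (0 :: 'i coha)" "tra (f + g) = tra f + tra g" "tra (f - g) = tra f - tra g"
    "tra (coha_scale c f) = coha_scale c (tra f)"
    by (rule poly_mapping_eqI; simp add: lookup_tra lookup_add lookup_minus lookup_scale c';
        simp add: tra_poly_def)+
qed

subsection \<open>Translation minus the identity lowers degrees\<close>

definition degless :: "nat \<Rightarrow> 'i mpoly \<Rightarrow> bool" where
  "degless d p \<longleftrightarrow> (\<forall>m\<in>keys p. mono_degree m < d)"

lemma mono_degree_superset: "finite A \<Longrightarrow> keys m \<subseteq> A \<Longrightarrow> mono_degree m = (\<Sum>v\<in>A. lookup m v)"
  unfolding mono_degree_def by (rule sum.mono_neutral_left) (auto simp: in_keys_iff)

lemma mono_degree_add: "mono_degree (m + n) = mono_degree m + mono_degree n"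
proof -
  have "keys (m + n) \<subseteq> keys m \<union> keys n" by (rule keys_add)
  then show ?thesis
    by (subst (1 2 3) mono_degree_superset[of "keys m \<union> keys n"]) (auto simp: lookup_add sum.distrib)
qed

lemma mono_degree_0 [simp]: "mono_degree 0 = 0" and mono_degree_single [simp]: "mono_degree (single v n) = n"
  by (auto simp: mono_degree_def)

lemma degless_add: "degless d p \<Longrightarrow> degless d q \<Longrightarrow> degless d (p + q)"
  unfolding degless_def using keys_add[of p q] by blast

lemma degless_sum: "(\<And>x. x \<in> A \<Longrightarrow> degless d (h x)) \<Longrightarrow> degless d (sum h A)"
  by (induction A rule: infinite_finite_induct) (auto intro: degless_add, simp_all add: degless_def)

lemma degless_mono: "degless d p \<Longrightarrow> d \<le> e \<Longrightarrow> degless e p"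
  by (auto simp: degless_def)

lemma degless_mult: "degless (Suc d) p \<Longrightarrow> degless e q \<Longrightarrow> degless (d + e) (p * q)"
  unfolding degless_def using keys_mult[of p q] by (force simp: mono_degree_add)

definition degpair :: "nat \<Rightarrow> 'i mpoly \<Rightarrow> 'i mpoly \<Rightarrow> bool" where
  "degpair d p q \<longleftrightarrow> degless d (p - q) \<and> degless (Suc d) p \<and> degless (Suc d) q"

lemma degpair_mult:
  fixes p q p' q' :: "'i::countable mpoly"
  assumes "degpair d p q" "degpair e p' q'" shows "degpair (d + e) (p * p') (q * q')"
proof -
  have "p * p' - q * q' = p * (p' - q') + q' * (p - q)" by (simp add: algebra_simps)
  moreover have "degless (d + e) (p * (p' - q'))" "degless (e + d) (q' * (p - q))"
    "degless (d + Suc e) (p * p')" "degless (d + Suc e) (q * q')"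
    using assms unfolding degpair_def by (blast intro: degless_mult)+
  ultimately show ?thesis by (simp add: degpair_def degless_add add.commute)
qed

lemma degpair_1: "degpair 0 1 1"
  by (simp add: degpair_def degless_def)

lemma degpair_power:
  fixes p q :: "'i::countable mpoly"
  assumes "degpair 1 p q" shows "degpair n (p ^ n) (q ^ n)"
proof (induction n)
  case (Suc n)
  then show ?case using degpair_mult[OF assms Suc] by simp
qed (simp add: degpair_1)

lemma degpair_tra: "degpair (mono_degree m) (mono_eval (case_var (\<lambda>i \<alpha>. pvar i \<alpha> + 1)) m) (mono_eval (case_var pvar) m)"
  for m :: "'i::countable var \<Rightarrow>\<^sub>0 nat"
proof -
  have "degpair 1 (pvar i \<alpha> + 1) (pvar i \<alpha>)" for i :: 'i and \<alpha>
    unfolding degpair_def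
  proof (intro conjI degless_add)
    show "degless 1 (pvar i \<alpha> + 1 - pvar i \<alpha>)" by (simp add: degless_def)
    show "degless (Suc 1) (pvar i \<alpha>)" "degless (Suc 1) (pvar i \<alpha>)"
      unfolding pvar_def degless_def by simp_all
    show "degless (Suc 1) (1 :: 'i mpoly)" by (simp add: degless_def)
  qed
  then have v: "degpair 1 (case_var (\<lambda>i \<alpha>. pvar i \<alpha> + 1) v) (case_var pvar v)" for v :: "'i var" by (cases v) simp
  have "degpair (\<Sum>v\<in>A. lookup m v) (\<Prod>v\<in>A. case_var (\<lambda>i \<alpha>. pvar i \<alpha> + 1) v ^ lookup m v) (\<Prod>v\<in>A. case_var pvar v ^ lookup m v)"
    if "finite A" for A
    using that
  proof (induction A)
    case (insert w A)
    then show ?case using degpair_mult[OF degpair_power[OF v] insert.IH, of "lookup m w" w] by simp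
  qed (simp add: degpair_1)
  then show ?thesis by (simp add: mono_eval_def mono_degree_def)
qed

lemma degless_single_mult: "degless d p \<Longrightarrow> degless d (single 0 c * p)" for p :: "'i::countable mpoly"
  using degless_mult[of 0 "single 0 c" d p] by (simp add: degless_def)

lemma degless_tra:
  fixes p :: "'i::countable mpoly"
  assumes "degless (Suc d) p" shows "degless d (tra_poly p - p)"
proof -
  have "subst pvar p = p" by (rule poly_ext[of "{}"]) auto
  then have "tra_poly p - p = subst (\<lambda>i \<alpha>. pvar i \<alpha> + 1) p - subst pvar p" by (simp add: tra_poly_def)
  also have "\<dots> = (\<Sum>m\<in>keys p. single 0 (lookup p m) *
      (mono_eval (case_var (\<lambda>i \<alpha>. pvar i \<alpha> + 1)) m - mono_eval (case_var pvar) m))"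
    by (simp only: subst_def insertion_def sum_subtractf right_diff_distrib)
  also have "degless d \<dots>"
  proof (intro degless_sum degless_single_mult)
    fix m assume m: "m \<in> keys p"
    show "degless d (mono_eval (case_var (\<lambda>i \<alpha>. pvar i \<alpha> + 1)) m - mono_eval (case_var pvar) m)"
    proof (rule degless_mono)
      show "degless (mono_degree m) (mono_eval (case_var (\<lambda>i \<alpha>. pvar i \<alpha> + 1)) m - mono_eval (case_var pvar) m)"
        using degpair_tra[of m] unfolding degpair_def by blast
    qed (use assms m in \<open>auto simp: degless_def\<close>)
  qed
  finally show ?thesis .
qed

definition tdiff :: "'i::finite coha \<Rightarrow> 'i coha" where
  "tdiff f = tra f - f"

lemma tdiff_nilpotent:
  fixes f :: "'i::finite coha"
  shows "\<exists>n. (tdiff ^^ n) f = 0"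
proof -
  have "\<exists>d. \<forall>\<gamma>\<in>keys f. degless d (lookup f \<gamma>)"
  proof -
    define d where "d = Suc (Max (insert 0 (\<Union>\<gamma>\<in>keys f. mono_degree ` keys (lookup f \<gamma>))))"
    have "mono_degree m < d" if "\<gamma> \<in> keys f" "m \<in> keys (lookup f \<gamma>)" for \<gamma> m
      unfolding d_def less_Suc_eq_le by (rule Max_ge) (use that in auto)
    then show ?thesis by (auto simp: degless_def)
  qed
  then obtain d where "\<And>\<gamma>. degless d (lookup f \<gamma>)" by (metis degless_def in_keys_iff keys_zero empty_iff)
  then have "(tdiff ^^ d) f = 0"
  proof (induction d arbitrary: f)
    case 0
    then have "lookup f \<gamma> = 0" for \<gamma> by (simp add: degless_def)
    then show ?case by (simp add: poly_mapping_eqI)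
  next
    case (Suc d)
    have "degless d (lookup (tdiff f) \<gamma>)" for \<gamma>
      unfolding tdiff_def lookup_minus lookup_tra by (rule degless_tra[OF Suc.prems])
    then have "(tdiff ^^ d) (tdiff f) = 0" by (rule Suc.IH)
    then show ?case by (simp add: funpow_swap1)
  qed
  then show ?thesis by blast
qed

section \<open>The bigrading\<close>

lemma mono_eval_scale:
  "mono_eval (\<lambda>v. t * s v) m = t ^ mono_degree m * (mono_eval s m :: 'b::comm_ring_1)"
  by (simp add: mono_eval_def mono_degree_def power_mult_distrib prod.distrib power_sum)

lemma ev_scale: "ev (\<lambda>i \<alpha>. t * x i \<alpha>) p = (\<Sum>m\<in>keys p. t ^ mono_degree m * (lookup p m * mono_eval (case_var x) m))"
proof -
  have "case_var (\<lambda>i \<alpha>. t * x i \<alpha>) = (\<lambda>v. t * case_var x v)" by (auto split: var.split)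
  then show ?thesis by (simp add: ev_def insertion_def mono_eval_scale mult_ac)
qed

lemma ev_scale_eigen:
  fixes p :: "'i::countable mpoly"
  assumes "finite F"
  shows "(\<forall>x. generic F x \<longrightarrow> ev (\<lambda>i \<alpha>. t * x i \<alpha>) p = c * ev x p) \<longleftrightarrow> (\<forall>m\<in>keys p. t ^ mono_degree m = c)"
proof
  assume R: "\<forall>x. generic F x \<longrightarrow> ev (\<lambda>i \<alpha>. t * x i \<alpha>) p = c * ev x p"
  define q where "q = (\<Sum>m\<in>keys p. single m (t ^ mono_degree m * lookup p m))"
  have q_ev: "ev x q = ev (\<lambda>i \<alpha>. t * x i \<alpha>) p" for x
    by (simp add: q_def ev_scale ev_single mult.assoc)
  have "q = single 0 c * p"
  proof (rule poly_ext[OF assms])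
    fix x :: "'i \<Rightarrow> nat \<Rightarrow> rat" assume "generic F x"
    then show "ev x q = ev x (single 0 c * p)" unfolding q_ev using R by simp
  qed
  moreover have "lookup (single 0 c * p) n = c * lookup p n" for n
    by (simp flip: mult_map_scale_conv_mult add: Poly_Mapping.map.rep_eq when_def)
  moreover have "lookup q n = t ^ mono_degree n * lookup p n" for n
    by (simp add: q_def lookup_sum lookup_single when_def in_keys_iff)
  ultimately have "t ^ mono_degree n * lookup p n = c * lookup p n" for n by metis
  then show "\<forall>m\<in>keys p. t ^ mono_degree m = c" by (auto simp: in_keys_iff)
next
  assume "\<forall>m\<in>keys p. t ^ mono_degree m = c"
  moreover have "ev x p = (\<Sum>m\<in>keys p. lookup p m * mono_eval (case_var x) m)" for x
    by (simp add: ev_def insertion_def)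
  ultimately have "ev (\<lambda>i \<alpha>. t * x i \<alpha>) p = c * ev x p" for x
    unfolding ev_scale by (simp add: sum_distrib_left)
  then show "\<forall>x. generic F x \<longrightarrow> ev (\<lambda>i \<alpha>. t * x i \<alpha>) p = c * ev x p" by blast
qed

definition hpart :: "nat \<Rightarrow> 'i mpoly \<Rightarrow> 'i mpoly" where
  "hpart d p = (\<Sum>m\<in>{m\<in>keys p. mono_degree m = d}. single m (lookup p m))"

lemma lookup_hpart: "lookup (hpart d p) m = (if mono_degree m = d then lookup p m else 0)"
  by (simp add: hpart_def lookup_sum lookup_single when_def in_keys_iff)

lemma ev_hpart: "ev x (hpart d p) = (\<Sum>m\<in>{m\<in>keys p. mono_degree m = d}. lookup p m * mono_eval (case_var x) m)"
  by (simp add: hpart_def ev_single)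

text \<open>Homogeneous parts are the coefficients in \<open>t\<close> of the values at the points scaled by \<open>t\<close>, hence inherit symmetry.\<close>

lemma hpart_hall:
  fixes p :: "'i::countable mpoly"
  assumes p: "p \<in> hall_comp \<gamma>" shows "hpart d p \<in> hall_comp \<gamma>"
  unfolding hall_comp_iff
proof (intro conjI allI impI)
  have "keys (hpart d p) \<subseteq> keys p" by (auto simp: in_keys_iff lookup_hpart split: if_splits)
  then show "hpart d p \<in> in_vars \<gamma>" using hall_in_vars[OF p] by (auto simp: in_vars_def)
next
  fix \<pi> and x :: "'i \<Rightarrow> nat \<Rightarrow> rat" assume \<pi>: "\<forall>i. \<pi> i permutes {..<\<gamma> i}"
  define u where "u x = (\<Sum>m\<in>keys p. monom (lookup p m * mono_eval (case_var x) m) (mono_degree m))"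
    for x :: "'i \<Rightarrow> nat \<Rightarrow> rat"
  have u: "poly (u x) t = ev (\<lambda>i \<alpha>. t * x i \<alpha>) p" for x t
    by (simp add: u_def ev_scale poly_sum poly_monom mult_ac)
  have c: "coeff (u x) d = ev x (hpart d p)" for x
    by (simp add: u_def coeff_sum ev_hpart sum.inter_filter)
  have "poly (u (\<lambda>i \<alpha>. x i (\<pi> i \<alpha>))) = poly (u x)"
  proof
    fix t
    show "poly (u (\<lambda>i \<alpha>. x i (\<pi> i \<alpha>))) t = poly (u x) t"
      using p \<pi> unfolding u hall_comp_iff by (blast dest: spec[of _ "\<lambda>i \<alpha>. t * x i \<alpha>"])
  qed
  then show "ev (\<lambda>i \<alpha>. x i (\<pi> i \<alpha>)) (hpart d p) = ev x (hpart d p)"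
    unfolding c[symmetric] by (simp add: poly_eq_poly_eq_iff)
qed

definition euler_dim :: "'i::finite quiver \<Rightarrow> 'i dimvec \<Rightarrow> int" where
  "euler_dim a \<gamma> = euler_form a (int \<circ> \<gamma>) (int \<circ> \<gamma>)"

text \<open>The projection to a bigraded component. It is zero when \<open>k\<close> does not come from a polynomial degree.\<close>

definition cmp :: "'i::finite quiver \<Rightarrow> 'i dimvec \<Rightarrow> int \<Rightarrow> 'i coha \<Rightarrow> 'i coha" where
  "cmp a \<gamma> k f = (if even (k - euler_dim a \<gamma>) \<and> k \<ge> euler_dim a \<gamma>
     then single \<gamma> (hpart (nat ((k - euler_dim a \<gamma>) div 2)) (lookup f \<gamma>)) else 0)"

lemma lookup_cmp: "lookup (lookup (cmp a \<gamma> k f) \<delta>) m =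
    (if \<delta> = \<gamma> \<and> 2 * int (mono_degree m) + euler_dim a \<gamma> = k then lookup (lookup f \<delta>) m else 0)"
proof -
  have "2 * int (mono_degree m) + euler_dim a \<gamma> = k \<longleftrightarrow>
      even (k - euler_dim a \<gamma>) \<and> k \<ge> euler_dim a \<gamma> \<and> mono_degree m = nat ((k - euler_dim a \<gamma>) div 2)"
  proof
    assume "2 * int (mono_degree m) + euler_dim a \<gamma> = k"
    then have "k - euler_dim a \<gamma> = 2 * int (mono_degree m)" by simp
    then show "even (k - euler_dim a \<gamma>) \<and> k \<ge> euler_dim a \<gamma> \<and> mono_degree m = nat ((k - euler_dim a \<gamma>) div 2)" by simp
  next
    assume R: "even (k - euler_dim a \<gamma>) \<and> k \<ge> euler_dim a \<gamma> \<and> mono_degree m = nat ((k - euler_dim a \<gamma>) div 2)"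
    then obtain b where "k - euler_dim a \<gamma> = 2 * b" by (elim conjE evenE)
    then show "2 * int (mono_degree m) + euler_dim a \<gamma> = k" using R by simp
  qed
  then show ?thesis by (auto simp: cmp_def lookup_single when_def lookup_hpart)
qed

lemma cmp_simps [simp]:
  fixes f g :: "'i::finite coha"
  shows "cmp a \<gamma> k 0 = 0" "cmp a \<gamma> k (f + g) = cmp a \<gamma> k f + cmp a \<gamma> k g" "cmp a \<gamma> k (f - g) = cmp a \<gamma> k f - cmp a \<gamma> k g"
    "cmp a \<gamma> k (coha_scale c f) = coha_scale c (cmp a \<gamma> k f)"
  by (rule poly_mapping_eqI, rule poly_mapping_eqI; simp add: lookup_cmp lookup_add lookup_minus lookup_coha_scale)+

lemma cmp_sum: "cmp a \<gamma> k (sum h A) = (\<Sum>x\<in>A. cmp a \<gamma> k (h x))"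
  by (induction A rule: infinite_finite_induct) auto

lemma bideg_iff_keys: "f \<in> coha_bideg a \<gamma> k \<longleftrightarrow> f \<in> coha_carrier \<and> keys f \<subseteq> {\<gamma>} \<and>
    (\<forall>m\<in>keys (lookup f \<gamma>). 2 * int (mono_degree m) + euler_dim a \<gamma> = k)"
  for f :: "'i::finite coha"
proof
  assume "f \<in> coha_bideg a \<gamma> k"
  then show "f \<in> coha_carrier \<and> keys f \<subseteq> {\<gamma>} \<and> (\<forall>m\<in>keys (lookup f \<gamma>). 2 * int (mono_degree m) + euler_dim a \<gamma> = k)"
    by (auto simp: coha_bideg_def euler_dim_def split: if_splits)
next
  assume f: "f \<in> coha_carrier \<and> keys f \<subseteq> {\<gamma>} \<and> (\<forall>m\<in>keys (lookup f \<gamma>). 2 * int (mono_degree m) + euler_dim a \<gamma> = k)"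
  have "lookup f \<delta> = 0" if "\<delta> \<noteq> \<gamma>" for \<delta> using f that by (auto simp: in_keys_iff)
  then have "f = single \<gamma> (lookup f \<gamma>)"
    by (intro poly_mapping_eqI[where 'a = "'i dimvec"]) (simp add: lookup_single when_def)
  then show "f \<in> coha_bideg a \<gamma> k"
    using f carrier_lookup[of f \<gamma>] unfolding coha_bideg_def euler_dim_def[symmetric] by blast
qed

lemma bideg_carrier: "f \<in> coha_bideg a \<gamma> k \<Longrightarrow> f \<in> coha_carrier" for f :: "'i::finite coha"
  by (simp add: bideg_iff_keys)

lemma bideg_lookup: "f \<in> coha_bideg a \<gamma> k \<Longrightarrow> \<delta> \<noteq> \<gamma> \<Longrightarrow> lookup f \<delta> = 0" for f :: "'i::finite coha"
  by (auto simp: bideg_iff_keys in_keys_iff)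

lemma bideg_subspace: "coha.subspace (coha_bideg a \<gamma> k)" for a :: "'i::finite quiver"
  unfolding coha.subspace_def
proof (intro conjI ballI allI)
  show "0 \<in> coha_bideg a \<gamma> k" by (simp add: bideg_iff_keys)
  fix f g assume "f \<in> coha_bideg a \<gamma> k" "g \<in> coha_bideg a \<gamma> k"
  then show "f + g \<in> coha_bideg a \<gamma> k"
    using keys_add[of f g] keys_add[of "lookup f \<gamma>" "lookup g \<gamma>"] unfolding bideg_iff_keys
    by (auto simp: lookup_add)
next
  fix c f assume "f \<in> coha_bideg a \<gamma> k"
  moreover have "keys (coha_scale c f) \<subseteq> keys f"
    by (auto simp: in_keys_iff lookup_scale)
  ultimately show "coha_scale c f \<in> coha_bideg a \<gamma> k"
    unfolding bideg_iff_keys by (auto simp: in_keys_iff lookup_coha_scale)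
qed

lemma cmp_bideg: "f \<in> coha_carrier \<Longrightarrow> cmp a \<gamma> k f \<in> coha_bideg a \<gamma> k" for f :: "'i::finite coha"
  unfolding bideg_iff_keys
proof (intro conjI)
  assume f: "f \<in> coha_carrier"
  show "cmp a \<gamma> k f \<in> coha_carrier"
    by (simp add: cmp_def hpart_hall carrier_lookup[OF f])
  show "keys (cmp a \<gamma> k f) \<subseteq> {\<gamma>}" by (simp add: cmp_def)
  show "\<forall>m\<in>keys (lookup (cmp a \<gamma> k f) \<gamma>). 2 * int (mono_degree m) + euler_dim a \<gamma> = k"
    by (auto simp: in_keys_iff lookup_cmp split: if_splits)
qed

lemma cmp_of_bideg:
  assumes "f \<in> coha_bideg a \<gamma> k"
  shows "cmp a \<delta> l f = (if \<delta> = \<gamma> \<and> l = k then f else 0)"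
proof (rule poly_mapping_eqI, rule poly_mapping_eqI)
  fix \<rho> m
  have "lookup (lookup f \<rho>) m \<noteq> 0 \<Longrightarrow> \<rho> = \<gamma> \<and> 2 * int (mono_degree m) + euler_dim a \<gamma> = k"
    using assms unfolding bideg_iff_keys by (cases "\<rho> = \<gamma>") (auto simp: in_keys_iff bideg_lookup[OF assms])
  then show "lookup (lookup (cmp a \<delta> l f) \<rho>) m = lookup (lookup (if \<delta> = \<gamma> \<and> l = k then f else 0) \<rho>) m"
    by (auto simp: lookup_cmp)
qed

definition bisupp :: "'i::finite quiver \<Rightarrow> 'i coha \<Rightarrow> ('i dimvec \<times> int) set" where
  "bisupp a f = (SIGMA \<gamma>:keys f. (\<lambda>m. 2 * int (mono_degree m) + euler_dim a \<gamma>) ` keys (lookup f \<gamma>))"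

lemma finite_bisupp [simp]: "finite (bisupp a f)"
  by (simp add: bisupp_def)

lemma cmp_decomposition: "f = (\<Sum>(\<gamma>, k)\<in>bisupp a f. cmp a \<gamma> k f)"
proof (rule poly_mapping_eqI, rule poly_mapping_eqI)
  fix \<delta> m
  have "lookup (lookup (\<Sum>(\<gamma>, k)\<in>bisupp a f. cmp a \<gamma> k f) \<delta>) m =
      (\<Sum>j\<in>bisupp a f. if j = (\<delta>, 2 * int (mono_degree m) + euler_dim a \<delta>) then lookup (lookup f \<delta>) m else 0)"
    unfolding lookup_sum by (intro sum.cong refl) (auto simp: lookup_cmp split: if_splits)
  also have "\<dots> = lookup (lookup f \<delta>) m"
    by (auto simp: bisupp_def in_keys_iff)
  finally show "lookup (lookup f \<delta>) m = lookup (lookup (\<Sum>(\<gamma>, k)\<in>bisupp a f. cmp a \<gamma> k f) \<delta>) m" ..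
qed

lemma subspace_cmpI:
  assumes "coha.subspace S" "\<And>\<gamma> k. cmp a \<gamma> k f \<in> S" shows "f \<in> S"
  by (subst cmp_decomposition[of f a]) (auto intro!: coha.subspace_sum[OF assms(1)] assms(2))

lemma cmp_span:
  assumes "\<And>b. b \<in> B \<Longrightarrow> \<exists>\<gamma> k. b \<in> coha_bideg a \<gamma> k" "f \<in> coha.span B"
  shows "cmp a \<gamma> k f \<in> coha.span (B \<inter> coha_bideg a \<gamma> k)"
  using assms(2)
proof (induction rule: coha.span_induct_alt)
  case base
  then show ?case by (simp add: coha.span_zero)
next
  case (step c b g)
  obtain \<delta> l where b: "b \<in> coha_bideg a \<delta> l" using assms(1) step(1) by blast
  have "cmp a \<gamma> k b \<in> coha.span (B \<inter> coha_bideg a \<gamma> k)"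
    unfolding cmp_of_bideg[OF b] using b step(1) by (auto intro: coha.span_zero coha.span_base)
  then show ?case using step by (simp add: coha.span_add coha.span_scale)
qed

lemma powi_2_inj: "(2::rat) powi m = 2 powi n \<longleftrightarrow> m = n"
  using power_int_strict_increasing[of m n "2::rat"] power_int_strict_increasing[of n m "2::rat"]
  by (cases m n rule: linorder_cases) auto

abbreviation "quad \<equiv> (\<lambda>x::rat. 4 * x + 0)"

text \<open>Homogeneity is tested by scaling the arguments. Scaling by \<open>4 = 2 ^ 2\<close> makes the eigenvalue a power of two whose exponent is
  the cohomological degree, in which each variable counts twice.\<close>

lemma bideg_iff:
  fixes f :: "'i::finite coha"
  assumes f: "f \<in> coha_carrier" and F: "finite F"
  shows "f \<in> coha_bideg a \<gamma> k \<longleftrightarrow> keys f \<subseteq> {\<gamma>} \<and>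
    (\<forall>P. ffam P \<longrightarrow> avoids F P \<longrightarrow> fam_card P = \<gamma> \<longrightarrow> cv f (fimg quad P) = 2 powi (k - euler_dim a \<gamma>) * cv f P)"
proof -
  let ?c = "2 powi (k - euler_dim a \<gamma>) :: rat" and ?p = "lookup f \<gamma>"
  have p: "?p \<in> hall_comp \<gamma>" by (rule carrier_lookup[OF f])
  have "(4::rat) ^ d = ?c \<longleftrightarrow> 2 * int d + euler_dim a \<gamma> = k" for d
  proof -
    have "(4::rat) ^ d = 2 powi (2 * int d)" by (simp add: power_int_mult)
    then show ?thesis by (simp only: powi_2_inj) auto
  qed
  then have 1: "(\<forall>m\<in>keys ?p. 2 * int (mono_degree m) + euler_dim a \<gamma> = k) \<longleftrightarrow>
      (\<forall>x. generic F x \<longrightarrow> ev (\<lambda>i \<alpha>. 4 * x i \<alpha>) ?p = ?c * ev x ?p)"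
    using ev_scale_eigen[OF F, of 4 ?p ?c] by simp
  have ev1: "ev x ?p = fs ?p (\<lambda>i. x i ` {..<\<gamma> i})" "ev (\<lambda>i \<alpha>. 4 * x i \<alpha>) ?p = fs ?p (fimg quad (\<lambda>i. x i ` {..<\<gamma> i}))"
    if "generic F x" for x
  proof -
    have inj: "inj (x i)" for i using that by (simp add: generic_def)
    show "ev x ?p = fs ?p (\<lambda>i. x i ` {..<\<gamma> i})" using inj by (intro hall_fs[OF p]) (auto intro: inj_on_subset)
    have "ev (\<lambda>i \<alpha>. 4 * x i \<alpha>) ?p = fs ?p (\<lambda>i. (\<lambda>\<alpha>. 4 * x i \<alpha>) ` {..<\<gamma> i})"
      using inj by (intro hall_fs[OF p]) (auto simp: inj_on_def dest: injD)
    then show "ev (\<lambda>i \<alpha>. 4 * x i \<alpha>) ?p = fs ?p (fimg quad (\<lambda>i. x i ` {..<\<gamma> i}))"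
      by (simp add: fimg_def image_image)
  qed
  have "(\<forall>x. generic F x \<longrightarrow> ev (\<lambda>i \<alpha>. 4 * x i \<alpha>) ?p = ?c * ev x ?p) \<longleftrightarrow>
      (\<forall>P. ffam P \<longrightarrow> avoids F P \<longrightarrow> fam_card P = \<gamma> \<longrightarrow> cv f (fimg quad P) = ?c * cv f P)" (is "?l = ?r")
  proof
    assume ?l
    show ?r
    proof (intro allI impI)
      fix P :: "'i fam" assume P: "ffam P" "avoids F P" "fam_card P = \<gamma>"
      then obtain x where x: "generic F x" "\<And>i. x i ` {..<\<gamma> i} = P i"
        using extend_enumeration[of P F] F by (auto simp: ffam_def avoids_def fam_card_def)
      then show "cv f (fimg quad P) = ?c * cv f P"
        using \<open>?l\<close> ev1[OF x(1)] P fam_card_fimg[OF inj_affine[of 4 0], of P] by (simp add: cv_def)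
    qed
  next
    assume r: ?r
    show ?l
    proof (intro allI impI)
      fix x :: "'i \<Rightarrow> nat \<Rightarrow> rat" assume x: "generic F x"
      have P: "ffam (\<lambda>i. x i ` {..<\<gamma> i})" "avoids F (\<lambda>i. x i ` {..<\<gamma> i})" "fam_card (\<lambda>i. x i ` {..<\<gamma> i}) = \<gamma>"
        using x generic_inj[OF x] by (auto simp: ffam_def avoids_def generic_def fam_card_def card_image)
      show "ev (\<lambda>i \<alpha>. 4 * x i \<alpha>) ?p = ?c * ev x ?p"
        using r[rule_format, OF P] P fam_card_fimg[OF inj_affine[of 4 0], of "\<lambda>i. x i ` {..<\<gamma> i}"] unfolding ev1[OF x]
        by (simp add: cv_def)
    qed
  qed
  then show ?thesis unfolding bideg_iff_keys using f 1 by auto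
qed

lemma bideg_cv:
  fixes f :: "'i::finite coha"
  assumes "f \<in> coha_bideg a \<gamma> k" "ffam P" "fam_card P = \<gamma>"
  shows "cv f (fimg quad P) = 2 powi (k - euler_dim a \<gamma>) * cv f P"
proof -
  have "\<forall>P. ffam P \<longrightarrow> avoids {} P \<longrightarrow> fam_card P = \<gamma> \<longrightarrow> cv f (fimg quad P) = 2 powi (k - euler_dim a \<gamma>) * cv f P"
    using assms(1) unfolding bideg_iff[OF bideg_carrier[OF assms(1)] finite.emptyI] by (rule conjunct2)
  from this[rule_format, OF assms(2) avoids_empty assms(3)] show ?thesis .
qed

lemma sig_bideg:
  assumes "f \<in> coha_bideg a \<gamma> k" shows "sig f \<in> coha_bideg a \<gamma> (k + 2)"
proof -
  have f: "f \<in> coha_carrier" by (rule bideg_carrier[OF assms])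
  have ps: "psum (fimg quad P) = 4 * psum P" for P :: "'a fam"
    using inj_affine[of 4 0] by (simp add: psum_def fimg_def sum.reindex inj_on_subset[of _ UNIV] sum_distrib_left)
  have "keys (sig f) \<subseteq> {\<gamma>}" using bideg_lookup[OF assms] by (fastforce simp: in_keys_iff lookup_sig)
  moreover have "cv (sig f) (fimg quad P) = 2 powi (k + 2 - euler_dim a \<gamma>) * cv (sig f) P"
    if P: "ffam P" "fam_card P = \<gamma>" for P
  proof -
    have "cv f (fimg quad P) = 2 powi (k - euler_dim a \<gamma>) * cv f P"
      using assms P unfolding bideg_iff[OF f finite.emptyI] by simp
    moreover have "(2::rat) powi (k + 2 - euler_dim a \<gamma>) = 4 * 2 powi (k - euler_dim a \<gamma>)"
      using power_int_add[of "2::rat" "k - euler_dim a \<gamma>" 2] by (simp add: algebra_simps)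
    ultimately show ?thesis unfolding cv_sig[OF ffam_fimg[OF P(1)]] cv_sig[OF P(1)] ps by simp
  qed
  ultimately show ?thesis unfolding bideg_iff[OF sig_carrier[OF f] finite.emptyI] by blast
qed

section \<open>Decomposable elements\<close>

context twisted
begin

lemma keys_mul: "\<rho> \<in> keys (f \<star> g) \<Longrightarrow> \<exists>\<gamma>\<in>keys f. \<exists>\<delta>\<in>keys g. \<rho> = (\<lambda>i. \<gamma> i + \<delta> i)"
proof (rule ccontr)
  assume \<rho>: "\<rho> \<in> keys (f \<star> g)" and not: "\<not> (\<exists>\<gamma>\<in>keys f. \<exists>\<delta>\<in>keys g. \<rho> = (\<lambda>i. \<gamma> i + \<delta> i))"
  have "lookup (f \<star> g) \<rho> = 0"
    unfolding lookup_mul by (intro sum.neutral ballI) (use not in auto)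
  then show False using \<rho> by (simp add: in_keys_iff)
qed

lemma cv_mul_fimg:
  assumes f: "f \<in> coha_carrier" and g: "g \<in> coha_carrier" and P: "ffam P" and s: "inj s"
  shows "cv (f \<star> g) (fimg s P) =
    (\<Sum>A\<in>{..P}. twisted_kern (fimg s A) (fimg s (P - A)) * cv f (fimg s A) * cv g (fimg s (P - A)))"
  unfolding cv_mul[OF f g ffam_fimg[OF P]]
  by (rule trans[OF sum.reindex_bij_betw[OF fimg_subfams[OF s], symmetric]]) (simp add: fimg_diff[OF s])

lemma twisted_kern_affine:
  assumes "c \<noteq> 0"
  shows "twisted_kern (fimg (\<lambda>x. c * x + d) A) (fimg (\<lambda>x. c * x + d) B) =
    c powi (- euler_form a (int \<circ> fam_card A) (int \<circ> fam_card B)) * twisted_kern A B"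
  unfolding twisted_kern_def fam_card_fimg[OF inj_affine[OF assms]] kern_affine[OF assms] by simp

lemma euler_dim_add: "euler_dim a (\<lambda>i. \<gamma> i + \<delta> i) = euler_dim a \<gamma> + euler_dim a \<delta> + 2 * euler_form a (int \<circ> \<gamma>) (int \<circ> \<delta>)"
proof -
  have "int \<circ> (\<lambda>i. \<gamma> i + \<delta> i) = (\<lambda>i. (int \<circ> \<gamma>) i + (int \<circ> \<delta>) i)" by (simp add: fun_eq_iff)
  then show ?thesis
    unfolding euler_dim_def using euler_form_sym[of "int \<circ> \<delta>" "int \<circ> \<gamma>"] by (simp only: euler_form_add)
qed

lemma mul_bideg:
  assumes f: "f \<in> coha_bideg a \<gamma> k" and g: "g \<in> coha_bideg a \<delta> l"
  shows "f \<star> g \<in> coha_bideg a (\<lambda>i. \<gamma> i + \<delta> i) (k + l)"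
proof -
  have fc: "f \<in> coha_carrier" and gc: "g \<in> coha_carrier" using f g bideg_carrier by auto
  have kf: "keys f \<subseteq> {\<gamma>}" and kg: "keys g \<subseteq> {\<delta>}" using f g by (auto simp: bideg_iff_keys)
  have "keys (f \<star> g) \<subseteq> {\<lambda>i. \<gamma> i + \<delta> i}" using keys_mul kf kg by blast
  moreover have "cv (f \<star> g) (fimg quad P) = 2 powi (k + l - euler_dim a (\<lambda>i. \<gamma> i + \<delta> i)) * cv (f \<star> g) P"
    if P: "ffam P" for P
    unfolding cv_mul_fimg[OF fc gc P inj_affine[of 4 0, OF numeral_neq_zero]] cv_mul[OF fc gc P] sum_distrib_left
  proof (rule sum.cong[OF refl])
    fix A assume "A \<in> {..P}"
    then have A: "ffam A" "ffam (P - A)" using ffam_mono[OF P] P by auto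
    show "twisted_kern (fimg quad A) (fimg quad (P - A)) * cv f (fimg quad A) * cv g (fimg quad (P - A)) =
        2 powi (k + l - euler_dim a (\<lambda>i. \<gamma> i + \<delta> i)) * (twisted_kern A (P - A) * cv f A * cv g (P - A))"
    proof (cases "fam_card A = \<gamma> \<and> fam_card (P - A) = \<delta>")
      case True
      let ?e = "euler_form a (int \<circ> \<gamma>) (int \<circ> \<delta>)"
      have "cv f (fimg quad A) = 2 powi (k - euler_dim a \<gamma>) * cv f A"
        using True A by (intro bideg_cv[OF f]) auto
      moreover have "cv g (fimg quad (P - A)) = 2 powi (l - euler_dim a \<delta>) * cv g (P - A)"
        using True A by (intro bideg_cv[OF g]) auto
      moreover have "twisted_kern (fimg quad A) (fimg quad (P - A)) = 2 powi (- (2 * ?e)) * twisted_kern A (P - A)"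
      proof -
        have "(4::rat) powi (- ?e) = 2 powi (2 * - ?e)" unfolding power_int_mult by simp
        then show ?thesis using twisted_kern_affine[of 4 0 A "P - A", OF numeral_neq_zero] True by simp
      qed
      moreover have "(2::rat) powi (k + l - euler_dim a (\<lambda>i. \<gamma> i + \<delta> i)) =
          2 powi (- (2 * ?e)) * 2 powi (k - euler_dim a \<gamma>) * 2 powi (l - euler_dim a \<delta>)"
        unfolding euler_dim_add by (simp add: power_int_add[symmetric] algebra_simps)
      ultimately show ?thesis by (simp only: mult_ac)
    next
      case False
      have "cv f A = 0 \<and> cv f (fimg quad A) = 0 \<or> cv g (P - A) = 0 \<and> cv g (fimg quad (P - A)) = 0"
        using False bideg_lookup[OF f] bideg_lookup[OF g] fam_card_fimg[OF inj_affine[of 4 0, OF numeral_neq_zero]]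
        by (auto simp: cv_def)
      then show ?thesis by auto
    qed
  qed
  ultimately show ?thesis unfolding bideg_iff[OF mul_carrier[OF fc gc] finite.emptyI] by blast
qed

text \<open>The augmentation ideal; \<open>Dec\<close> is its square.\<close>

definition Hplus :: "'i coha set" where
  "Hplus = {f \<in> coha_carrier. lookup f (\<lambda>_. 0) = 0}"

definition Dec :: "'i coha set" where
  "Dec = coha.span {f \<star> g | f g. f \<in> Hplus \<and> g \<in> Hplus}"

lemma Hplus_subspace: "coha.subspace Hplus"
  by (auto simp: coha.subspace_def Hplus_def lookup_add lookup_scale)

lemma Hplus_carrier: "f \<in> Hplus \<Longrightarrow> f \<in> coha_carrier"
  by (simp add: Hplus_def)

lemma fs_bot: "p \<in> hall_comp (\<lambda>_. 0) \<Longrightarrow> p = single 0 (fs p bot)" for p :: "'i mpoly"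
  by (rule fs_ext[of "{}"]) (auto simp: fun_eq_iff[of _ bot], metis bot_fun_def card_0_eq)

lemma Hplus_iff_cv: "f \<in> coha_carrier \<Longrightarrow> f \<in> Hplus \<longleftrightarrow> cv f bot = 0"
  using fs_bot[OF carrier_lookup, of f] by (auto simp: Hplus_def cv_def)

lemma Dec_subspace: "coha.subspace Dec"
  by (simp add: Dec_def coha.subspace_span)

lemma mul_Hplus: "f \<in> Hplus \<Longrightarrow> g \<in> coha_carrier \<Longrightarrow> f \<star> g \<in> Hplus"
proof -
  assume f: "f \<in> Hplus" and g: "g \<in> coha_carrier"
  have "{..bot :: 'i fam} = {bot}" by (auto simp: bot_unique)
  moreover have "cv f bot = 0" using f Hplus_iff_cv[OF Hplus_carrier[OF f]] by simp
  ultimately have "cv (f \<star> g) bot = 0" using cv_mul[OF Hplus_carrier[OF f] g, of bot] by simp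
  then show ?thesis using Hplus_iff_cv[OF mul_carrier[OF Hplus_carrier[OF f] g]] by simp
qed

lemma Dec_Hplus: "Dec \<subseteq> Hplus"
  unfolding Dec_def by (rule coha.span_minimal[OF _ Hplus_subspace]) (auto intro: mul_Hplus Hplus_carrier)

lemma mul_Dec: "f \<in> Hplus \<Longrightarrow> g \<in> Hplus \<Longrightarrow> f \<star> g \<in> Dec"
  unfolding Dec_def by (rule coha.span_base) blast

lemma cmp_Hplus: "f \<in> Hplus \<Longrightarrow> cmp a \<gamma> k f \<in> Hplus"
proof -
  assume f: "f \<in> Hplus"
  have "lookup (cmp a \<gamma> k f) (\<lambda>_. 0) = 0"
    by (rule poly_mapping_eqI) (use f in \<open>auto simp: lookup_cmp Hplus_def\<close>)
  then show ?thesis using bideg_carrier[OF cmp_bideg[OF Hplus_carrier[OF f]]] by (simp add: Hplus_def)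
qed

lemma cmp_Dec:
  assumes "f \<in> Dec" shows "cmp a \<gamma> k f \<in> Dec"
proof -
  let ?B = "{f \<star> g | f g \<gamma> \<delta> k l. f \<in> Hplus \<and> g \<in> Hplus \<and> f \<in> coha_bideg a \<gamma> k \<and> g \<in> coha_bideg a \<delta> l}"
  have "f \<star> g \<in> coha.span ?B" if f: "f \<in> Hplus" and g: "g \<in> Hplus" for f g
  proof -
    have c: "cmp a \<gamma> k f \<in> coha_carrier" "cmp a \<gamma> k g \<in> coha_carrier" for \<gamma> k
      using f g cmp_Hplus Hplus_carrier by blast+
    have "f \<star> g = (\<Sum>i\<in>bisupp a f. case i of (\<gamma>, k) \<Rightarrow> cmp a \<gamma> k f) \<star> (\<Sum>j\<in>bisupp a g. case j of (\<gamma>, k) \<Rightarrow> cmp a \<gamma> k g)"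
      using cmp_decomposition[of f a] cmp_decomposition[of g a] by simp
    also have "\<dots> = (\<Sum>i\<in>bisupp a f. \<Sum>j\<in>bisupp a g. (case i of (\<gamma>, k) \<Rightarrow> cmp a \<gamma> k f) \<star> (case j of (\<gamma>, k) \<Rightarrow> cmp a \<gamma> k g))"
      by (subst mul_sum_left, (auto split: prod.split intro!: carrier_sum c)[2], rule sum.cong[OF refl],
          rule mul_sum_right) (auto split: prod.split intro!: c)
    also have "\<dots> \<in> coha.span ?B"
    proof (intro coha.span_sum)
      fix i j :: "'i dimvec \<times> int"
      obtain \<gamma> k \<delta> l where ij: "i = (\<gamma>, k)" "j = (\<delta>, l)" by (cases i, cases j)
      have "cmp a \<gamma> k f \<star> cmp a \<delta> l g \<in> ?B"
        using f g cmp_Hplus cmp_bideg Hplus_carrier by blast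
      then show "(case i of (\<gamma>, k) \<Rightarrow> cmp a \<gamma> k f) \<star> (case j of (\<gamma>, k) \<Rightarrow> cmp a \<gamma> k g) \<in> coha.span ?B"
        unfolding ij prod.case by (rule coha.span_base)
    qed
    finally show ?thesis .
  qed
  then have "Dec \<subseteq> coha.span ?B"
    unfolding Dec_def by (intro coha.span_minimal) (auto simp: coha.subspace_span)
  then have "cmp a \<gamma> k f \<in> coha.span (?B \<inter> coha_bideg a \<gamma> k)"
    using assms by (intro cmp_span) (auto, blast intro: mul_bideg)
  also have "\<dots> \<subseteq> Dec" unfolding Dec_def by (rule coha.span_mono) blast
  finally show ?thesis .
qed

lemma Dec_stable:
  assumes "\<And>f g. \<phi> (f + g) = \<phi> f + \<phi> g" "\<And>c f. \<phi> (coha_scale c f) = coha_scale c (\<phi> f)"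
    "\<And>f g. f \<in> Hplus \<Longrightarrow> g \<in> Hplus \<Longrightarrow> \<phi> (f \<star> g) \<in> Dec" "f \<in> Dec"
  shows "\<phi> f \<in> Dec"
  using assms(4) unfolding Dec_def
proof (induction rule: coha.span_induct_alt)
  case base
  have "\<phi> 0 = 0" using assms(1)[of 0 0] by simp
  then show ?case by (simp add: coha.span_zero)
next
  case (step c x y)
  have "\<phi> x \<in> Dec" using step(1) assms(3) by blast
  then show ?case using step(2) unfolding assms(1,2) Dec_def by (intro coha.span_add coha.span_scale)
qed

lemma mop_simps [simp]: "mop q (f + g) = mop q f + mop q g" "mop q (f - g) = mop q f - mop q g"
  "mop q (coha_scale c f) = coha_scale c (mop q f)"
  by (rule poly_mapping_eqI; simp add: mop_def lookup_cmap lookup_add lookup_minus lookup_scale algebra_simps)+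

lemma mop_mul:
  assumes f: "f \<in> coha_carrier" and g: "g \<in> coha_carrier" shows "mop q (f \<star> g) = mop q f \<star> mop q g"
proof (rule cv_ext[of "{}"])
  fix P :: "'i fam" assume P: "ffam P"
  have "mpw q P * (twisted_kern A (P - A) * cv f A * cv g (P - A)) = twisted_kern A (P - A) * cv (mop q f) A * cv (mop q g) (P - A)"
    if "A \<in> {..P}" for A
  proof -
    have A: "A \<le> P" "ffam A" "ffam (P - A)" using that ffam_mono[OF P] P by auto
    have "mpw q P = mpw q A * mpw q (P - A)"
      using mpw_sup[OF A(2,3) inf_diff, of q] diff_sup[OF A(1)] by simp
    then show ?thesis using A by simp
  qed
  then show "cv (mop q (f \<star> g)) P = cv (mop q f \<star> mop q g) P"
    unfolding cv_mop[OF P] cv_mul[OF f g P] cv_mul[OF mop_carrier[OF f] mop_carrier[OF g] P] sum_distrib_left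
    by (rule sum.cong[OF refl])
qed (use f g in auto)

lemma mop_Hplus: "f \<in> Hplus \<Longrightarrow> mop q f \<in> Hplus"
  using Hplus_iff_cv[of f] Hplus_iff_cv[of "mop q f"] Hplus_carrier[of f] by simp

lemma mop_Dec: "f \<in> Dec \<Longrightarrow> mop q f \<in> Dec"
  by (rule Dec_stable[of "mop q"]) (auto simp: mop_mul Hplus_carrier intro: mul_Dec mop_Hplus)

lemma tra_mul:
  assumes f: "f \<in> coha_carrier" and g: "g \<in> coha_carrier" shows "tra (f \<star> g) = tra f \<star> tra g"
proof (rule cv_ext[of "{}"])
  fix P :: "'i fam" assume P: "ffam P"
  have t: "twisted_kern (fimg (\<lambda>x. 1 * x + 1) A) (fimg (\<lambda>x. 1 * x + 1) B) = twisted_kern A B" for A B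
    by (subst twisted_kern_affine) simp_all
  have "cv (tra f \<star> tra g) P = (\<Sum>A\<in>{..P}. twisted_kern A (P - A) * cv f (fimg (\<lambda>x. 1 * x + 1) A) * cv g (fimg (\<lambda>x. 1 * x + 1) (P - A)))"
    unfolding cv_mul[OF tra_carrier[OF f] tra_carrier[OF g] P]
    by (rule sum.cong[OF refl]) (use P ffam_mono[OF P] in \<open>simp add: cv_tra f g\<close>)
  then show "cv (tra (f \<star> g)) P = cv (tra f \<star> tra g) P"
    unfolding cv_tra[OF mul_carrier[OF f g] P] cv_mul_fimg[OF f g P inj_affine[OF one_neq_zero]] t by simp
qed (use f g in auto)

lemma tra_Hplus: "f \<in> Hplus \<Longrightarrow> tra f \<in> Hplus"
  by (simp add: Hplus_def lookup_tra tra_poly_def)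

lemma tra_Dec: "f \<in> Dec \<Longrightarrow> tra f \<in> Dec"
  by (rule Dec_stable[of tra]) (auto simp: tra_mul Hplus_carrier intro: mul_Dec tra_Hplus)

lemma sig_mul:
  assumes f: "f \<in> coha_carrier" and g: "g \<in> coha_carrier" shows "sig (f \<star> g) = sig f \<star> g + f \<star> sig g"
proof (rule cv_ext[of "{}"])
  fix P :: "'i fam" assume P: "ffam P"
  have "psum P * (twisted_kern A (P - A) * cv f A * cv g (P - A)) =
      twisted_kern A (P - A) * cv (sig f) A * cv g (P - A) + twisted_kern A (P - A) * cv f A * cv (sig g) (P - A)"
    if "A \<in> {..P}" for A
  proof -
    have A: "A \<le> P" "ffam A" "ffam (P - A)" using that ffam_mono[OF P] P by auto
    have "psum P = psum A + psum (P - A)"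
      using psum_sup[OF A(2,3) inf_diff] diff_sup[OF A(1)] by simp
    then show ?thesis using A by (simp add: algebra_simps)
  qed
  then show "cv (sig (f \<star> g)) P = cv (sig f \<star> g + f \<star> sig g) P"
    unfolding cv_sig[OF P] cv_simps(2) cv_mul[OF f g P] cv_mul[OF sig_carrier[OF f] g P] cv_mul[OF f sig_carrier[OF g] P]
      sum_distrib_left sum.distrib[symmetric]
    by (rule sum.cong[OF refl])
qed (use f g in auto)

lemma sig_Hplus: "f \<in> Hplus \<Longrightarrow> sig f \<in> Hplus"
  using Hplus_iff_cv[of f] Hplus_iff_cv[of "sig f"] Hplus_carrier[of f] by simp

lemma sig_Dec: "f \<in> Dec \<Longrightarrow> sig f \<in> Dec"
  by (rule Dec_stable[of sig])
     (auto simp: sig_mul Hplus_carrier intro!: mul_Dec sig_Hplus coha.subspace_add[OF Dec_subspace])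

subsection \<open>Multiplication by the sum of the variables is injective modulo decomposables\<close>

lemma tdiff_Dec: "f \<in> Dec \<Longrightarrow> tdiff f \<in> Dec"
  unfolding tdiff_def by (rule coha.subspace_diff[OF Dec_subspace tra_Dec])

lemma ev_of_nat [simp]: "ev x (of_nat n) = of_nat n"
  by (induction n) auto

lemma tra_sig:
  fixes f :: "'i coha"
  assumes "keys f \<subseteq> {\<gamma>}"
  shows "tra (sig f) = sig (tra f) + coha_scale (of_nat (\<Sum>i\<in>UNIV. \<gamma> i)) (tra f)"
proof (rule poly_mapping_eqI)
  fix \<delta> :: "'i dimvec"
  have "tra_poly (psum_poly \<delta>) = psum_poly \<delta> + single 0 (of_nat (\<Sum>i\<in>UNIV. \<delta> i))"
    by (rule poly_ext[of "{}"]) (simp_all add: tra_poly_def psum_poly_def sum.distrib)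
  then have "tra_poly (psum_poly \<delta> * p) = psum_poly \<delta> * tra_poly p + single 0 (of_nat (\<Sum>i\<in>UNIV. \<delta> i)) * tra_poly p" for p
    by (simp add: tra_poly_def algebra_simps)
  moreover have "lookup f \<delta> = 0" if "\<delta> \<noteq> \<gamma>" using assms that by (auto simp: in_keys_iff)
  ultimately show "lookup (tra (sig f)) \<delta> = lookup (sig (tra f) + coha_scale (of_nat (\<Sum>i\<in>UNIV. \<gamma> i)) (tra f)) \<delta>"
    by (cases "\<delta> = \<gamma>") (auto simp: lookup_tra lookup_sig lookup_add lookup_scale tra_poly_def)
qed

lemma keys_tdiff: "keys (tdiff f) \<subseteq> keys f"
proof
  fix \<gamma> assume "\<gamma> \<in> keys (tdiff f)"
  then show "\<gamma> \<in> keys f"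
    by (cases "lookup f \<gamma> = 0") (auto simp: in_keys_iff tdiff_def lookup_minus lookup_tra tra_poly_def)
qed

lemma keys_tdiff_pow: "keys ((tdiff ^^ k) f) \<subseteq> keys f"
  by (induction k) (use keys_tdiff in \<open>auto\<close>)

lemma tdiff_simps: "tdiff (f + g) = tdiff f + tdiff g" "tdiff (coha_scale c f) = coha_scale c (tdiff f)"
  "tdiff (tra f) = tra (tdiff f)" for f g :: "'i coha"
  by (simp_all add: tdiff_def coha.scale_right_diff_distrib)

text \<open>On the component of dimension vector \<open>\<gamma>\<close>, the commutator of \<open>tdiff\<close> and \<open>sig\<close> is the invertible
  operator \<open>tra\<close>, multiplied by the total dimension of \<open>\<gamma>\<close>.\<close>

lemma tdiff_pow_sig:
  fixes f :: "'i coha"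
  assumes "keys f \<subseteq> {\<gamma>}"
  shows "(tdiff ^^ Suc k) (sig f) = sig ((tdiff ^^ Suc k) f) +
    coha_scale (of_nat (Suc k) * of_nat (\<Sum>i\<in>UNIV. \<gamma> i)) (tra ((tdiff ^^ k) f))"
proof (induction k)
  case 0
  show ?case using tra_sig[OF assms] by (simp add: tdiff_def)
next
  case (Suc k)
  let ?n = "of_nat (\<Sum>i\<in>UNIV. \<gamma> i) :: rat" and ?g = "(tdiff ^^ Suc k) f"
  have g: "keys ?g \<subseteq> {\<gamma>}" using keys_tdiff_pow assms by blast
  have "(tdiff ^^ Suc (Suc k)) (sig f) = tdiff ((tdiff ^^ Suc k) (sig f))" by simp
  also have "\<dots> = tdiff (sig ?g) + coha_scale (of_nat (Suc k) * ?n) (tra ?g)"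
    unfolding Suc.IH tdiff_simps by simp
  also have "tdiff (sig ?g) = sig (tdiff ?g) + coha_scale ?n (tra ?g)"
    unfolding tdiff_def[of "sig ?g"] tra_sig[OF g] by (simp add: tdiff_def)
  also have "sig (tdiff ?g) + coha_scale ?n (tra ?g) + coha_scale (of_nat (Suc k) * ?n) (tra ?g) =
      sig ((tdiff ^^ Suc (Suc k)) f) + coha_scale (of_nat (Suc (Suc k)) * ?n) (tra ?g)"
  proof -
    have "of_nat (Suc (Suc k)) * ?n = ?n + of_nat (Suc k) * ?n" by (simp add: algebra_simps)
    then have "coha_scale (of_nat (Suc (Suc k)) * ?n) (tra ?g) = coha_scale ?n (tra ?g) + coha_scale (of_nat (Suc k) * ?n) (tra ?g)"
      by (simp only: coha.scale_left_distrib)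
    then show ?thesis by (simp only: funpow.simps comp_apply add.assoc)
  qed
  finally show ?case .
qed

text \<open>If some power \<open>tdiff ^^ k\<close> maps \<open>h\<close> into \<open>Dec\<close>, with \<open>k > 0\<close>, then the commutator formula shows that \<open>k - 1\<close> has the same
  property; and a sufficiently high power annihilates \<open>h\<close>.\<close>

lemma sig_Dec_cancel_single:
  assumes h: "keys h \<subseteq> {\<gamma>}" "\<gamma> \<noteq> (\<lambda>_. 0)" and sh: "sig h \<in> Dec"
  shows "h \<in> Dec"
proof (rule ccontr)
  assume "h \<notin> Dec"
  obtain n where "(tdiff ^^ n) h = 0" using tdiff_nilpotent by blast
  then have n: "(tdiff ^^ n) h \<in> Dec" by (simp add: coha.subspace_0[OF Dec_subspace])
  define k where "k = (LEAST n. (tdiff ^^ n) h \<in> Dec)"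
  have k: "(tdiff ^^ k) h \<in> Dec" unfolding k_def by (rule LeastI[of "\<lambda>n. (tdiff ^^ n) h \<in> Dec", OF n])
  then obtain j where j: "k = Suc j" using \<open>h \<notin> Dec\<close> by (cases k) auto
  have notj: "(tdiff ^^ j) h \<notin> Dec" using not_less_Least[of j "\<lambda>n. (tdiff ^^ n) h \<in> Dec"] j k_def by simp
  let ?c = "of_nat (Suc j) * of_nat (\<Sum>i\<in>UNIV. \<gamma> i) :: rat"
  have "(\<Sum>i\<in>UNIV. \<gamma> i) \<noteq> 0" using h(2) by (auto simp: fun_eq_iff)
  then have c: "?c \<noteq> 0" by (simp only: mult_eq_0_iff of_nat_eq_0_iff) simp
  have pow: "(tdiff ^^ m) (sig h) \<in> Dec" for m by (induction m) (auto simp: sh tdiff_Dec)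
  have "coha_scale ?c (tra ((tdiff ^^ j) h)) = (tdiff ^^ Suc j) (sig h) - sig ((tdiff ^^ Suc j) h)"
    unfolding tdiff_pow_sig[OF h(1)] by simp
  also have "\<dots> \<in> Dec"
    using pow[of "Suc j"] sig_Dec[OF k] unfolding j by (rule coha.subspace_diff[OF Dec_subspace])
  finally have "coha_scale (1 / ?c) (coha_scale ?c (tra ((tdiff ^^ j) h))) \<in> Dec"
    by (rule coha.subspace_scale[OF Dec_subspace])
  then have "tra ((tdiff ^^ j) h) \<in> Dec" using c by simp
  moreover have "tdiff ((tdiff ^^ j) h) \<in> Dec" using k unfolding j by simp
  ultimately have "tra ((tdiff ^^ j) h) - tdiff ((tdiff ^^ j) h) \<in> Dec"
    by (rule coha.subspace_diff[OF Dec_subspace])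
  then show False using notj by (simp add: tdiff_def)
qed

lemma cmp_sig: "cmp a \<gamma> (k + 2) (sig f) = sig (cmp a \<gamma> k f)" if "f \<in> coha_carrier" for f
proof -
  let ?I = "bisupp a f" and ?f = "\<lambda>j. cmp a (fst j) (snd j) f"
  have f: "f = (\<Sum>j\<in>?I. ?f j)" using cmp_decomposition[of f a] unfolding split_def .
  have "cmp a \<gamma> (k + 2) (sig (?f j)) = sig (cmp a \<gamma> k (?f j))" for j
    unfolding cmp_of_bideg[OF sig_bideg[OF cmp_bideg[OF that]]] cmp_of_bideg[OF cmp_bideg[OF that]] by simp
  then have "cmp a \<gamma> (k + 2) (sig (\<Sum>j\<in>?I. ?f j)) = sig (cmp a \<gamma> k (\<Sum>j\<in>?I. ?f j))"
    by (simp only: sig_sum cmp_sum)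
  then show ?thesis unfolding f[symmetric] .
qed

lemma sig_Dec_cancel:
  assumes h: "h \<in> Hplus" and sh: "sig h \<in> Dec"
  shows "h \<in> Dec"
proof (rule subspace_cmpI[OF Dec_subspace])
  fix \<gamma> k
  show "cmp a \<gamma> k h \<in> Dec"
  proof (cases "\<gamma> = (\<lambda>_. 0)")
    case True
    have "lookup h \<gamma> = 0" using h unfolding True Hplus_def by simp
    then have "cmp a \<gamma> k h = 0" by (simp add: cmp_def hpart_def)
    then show ?thesis by (simp add: coha.subspace_0[OF Dec_subspace])
  next
    case False
    have "keys (cmp a \<gamma> k h) \<subseteq> {\<gamma>}" by (simp add: cmp_def)
    moreover have "sig (cmp a \<gamma> k h) \<in> Dec"
      unfolding cmp_sig[OF Hplus_carrier[OF h], symmetric] by (rule cmp_Dec[OF sh])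
    ultimately show ?thesis by (rule sig_Dec_cancel_single[OF _ False])
  qed
qed

end

definition lowdeg :: "nat \<Rightarrow> 'i mpoly \<Rightarrow> bool" where
  "lowdeg d p \<longleftrightarrow> (\<forall>m\<in>keys p. d \<le> mono_degree m)"

lemma lowdeg_mult: "lowdeg d p \<Longrightarrow> lowdeg e q \<Longrightarrow> lowdeg (d + e) (p * q)"
  unfolding lowdeg_def using keys_mult[of p q] by (force simp: mono_degree_add)

lemma lowdeg_0 [simp]: "lowdeg 0 p"
  by (simp add: lowdeg_def)

lemma mono_degree_eq_0: "mono_degree m = 0 \<longleftrightarrow> m = 0"
proof
  assume "mono_degree m = 0"
  then have "\<forall>v\<in>keys m. lookup m v = 0" by (simp add: mono_degree_def)
  then show "m = 0" by (intro poly_mapping_eqI) (auto simp: in_keys_iff)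
qed simp

lemma ev_0: "ev (\<lambda>_ _. 0) p = lookup p 0"
proof -
  have "ev (\<lambda>_ _. 0) p = (\<Sum>m\<in>keys p. 0 ^ mono_degree m * (lookup p m * mono_eval (case_var (\<lambda>_ _. 0)) m))"
    using ev_scale[of 0 "\<lambda>_ _. 0" p] by simp
  also have "\<dots> = (\<Sum>m\<in>keys p. if m = 0 then lookup p m else 0)"
    by (intro sum.cong refl) (auto simp: mono_degree_eq_0 power_0_left)
  finally show ?thesis by (simp add: in_keys_iff)
qed

lemma lowdeg_1_minus_const: "lowdeg 1 (single 0 (ev (\<lambda>_ _. 0) p) - p)"
  unfolding lowdeg_def
proof
  fix m assume "m \<in> keys (single 0 (ev (\<lambda>_ _. 0) p) - p)"
  then have "m \<noteq> 0" by (auto simp: in_keys_iff lookup_minus ev_0)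
  then have "mono_degree m \<noteq> 0" by (simp add: mono_degree_eq_0)
  then show "1 \<le> mono_degree m" by simp
qed

context twisted
begin

text \<open>Modulo elements of higher degree, \<open>mop q\<close> is a nonzero multiple of the identity on each component,
  so it can be inverted degree by degree.\<close>

lemma mop_Dec_cancel:
  fixes u :: "'i coha"
  assumes u: "u \<in> coha_carrier" "keys u \<subseteq> {\<gamma>}" and q: "\<And>i. poly (q i) 0 \<noteq> 0" and mu: "mop q u \<in> Dec"
  shows "u \<in> Dec"
proof -
  define h where "h = mpw_poly q \<gamma>"
  define c where "c = ev (\<lambda>_ _. 0) h"
  have c: "c \<noteq> 0" using q by (simp add: c_def h_def mpw_poly_def)
  have approx: "\<exists>d r. d \<in> Dec \<and> r \<in> coha_carrier \<and> keys r \<subseteq> {\<gamma>} \<and> lowdeg D (lookup r \<gamma>) \<and> u = d + r" for D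
  proof (induction D)
    case 0
    then show ?case using u coha.subspace_0[OF Dec_subspace] by (intro exI[of _ 0] exI[of _ u]) simp
  next
    case (Suc D)
    then obtain d r where r: "d \<in> Dec" "r \<in> coha_carrier" "keys r \<subseteq> {\<gamma>}" "lowdeg D (lookup r \<gamma>)" "u = d + r" by blast
    define x where "x = coha_scale (1 / c) (mop q r)"
    have "mop q r = mop q u - mop q d" unfolding r(5) by simp
    also have "\<dots> \<in> Dec" by (rule coha.subspace_diff[OF Dec_subspace mu mop_Dec[OF r(1)]])
    finally have x: "x \<in> Dec" unfolding x_def by (rule coha.subspace_scale[OF Dec_subspace])
    have "r - x \<in> coha_carrier" using r(2) by (simp add: x_def)
    moreover have "lookup (r - x) \<delta> = 0" if "\<delta> \<noteq> \<gamma>" for \<delta>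
      using r(3) that by (auto simp: x_def lookup_minus lookup_scale mop_def lookup_cmap in_keys_iff)
    then have "keys (r - x) \<subseteq> {\<gamma>}" by (auto simp: in_keys_iff)
    moreover have "lookup (r - x) \<gamma> = single 0 (1 / c) * ((single 0 c - h) * lookup r \<gamma>)"
    proof -
      have "single 0 (1 / c) * (single 0 c * z) = z" for z :: "'i mpoly"
        using c by (simp add: mult.assoc[symmetric] mult_single)
      then show ?thesis
        by (simp add: x_def lookup_minus lookup_scale mop_def lookup_cmap h_def left_diff_distrib right_diff_distrib)
    qed
    moreover have "lowdeg (0 + (1 + D)) (single 0 (1 / c) * ((single 0 c - h) * lookup r \<gamma>))"
      using r(4) lowdeg_1_minus_const[of h] unfolding c_def[symmetric] by (intro lowdeg_mult) auto
    moreover have "u = (d + x) + (r - x)" using r(5) by simp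
    moreover have "d + x \<in> Dec" by (rule coha.subspace_add[OF Dec_subspace r(1) x])
    ultimately show ?case by (intro exI[of _ "d + x"] exI[of _ "r - x"]) simp
  qed
  show ?thesis
  proof (rule subspace_cmpI[OF Dec_subspace])
    fix \<delta> k
    define D where "D = Suc (nat (k - euler_dim a \<gamma>))"
    obtain d r where r: "d \<in> Dec" "keys r \<subseteq> {\<gamma>}" "lowdeg D (lookup r \<gamma>)" "u = d + r" using approx by blast
    have "lookup (lookup (cmp a \<delta> k r) \<rho>) m = 0" for \<rho> m
    proof (cases "\<rho> = \<gamma> \<and> \<delta> = \<gamma> \<and> 2 * int (mono_degree m) + euler_dim a \<gamma> = k")
      case True
      then have "mono_degree m < D" by (simp add: D_def) linarith
      then have "lookup (lookup r \<gamma>) m = 0" using r(3) by (auto simp: lowdeg_def in_keys_iff not_le[symmetric])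
      then show ?thesis using True by (simp add: lookup_cmp)
    next
      case False
      moreover have "lookup r \<rho> = 0" if "\<rho> \<noteq> \<gamma>" using r(2) that by (auto simp: in_keys_iff)
      ultimately show ?thesis by (cases "\<rho> = \<gamma>") (auto simp: lookup_cmp)
    qed
    then have "cmp a \<delta> k r = 0" by (intro poly_mapping_eqI) simp
    then show "cmp a \<delta> k u \<in> Dec" unfolding r(4) using cmp_Dec[OF r(1)] by simp
  qed
qed

end

section \<open>Finite-dimensionality of the bigraded components\<close>

lemma bideg_finite_span: "\<exists>M. finite M \<and> coha_bideg a \<gamma> k \<subseteq> coha.span M" for a :: "'i::finite quiver"
proof -
  define vs where "vs = {X i \<alpha> | i \<alpha>. \<alpha> < \<gamma> i}"
  have "vs \<subseteq> (\<lambda>(i, \<alpha>). X i \<alpha>) ` (SIGMA i:UNIV. {..<\<gamma> i})" by (auto simp: vs_def)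
  then have vs: "finite vs" by (rule finite_subset) simp
  define d where "d = nat (k - euler_dim a \<gamma>)"
  define ms where "ms = {m :: 'i var \<Rightarrow>\<^sub>0 nat. keys m \<subseteq> vs \<and> mono_degree m \<le> d}"
  have low: "lookup m v \<le> d" if m: "m \<in> ms" for m v
  proof (cases "v \<in> keys m")
    case True
    then have "lookup m v \<le> mono_degree m" unfolding mono_degree_def by (intro member_le_sum) auto
    then show ?thesis using m by (simp add: ms_def)
  qed (simp add: in_keys_iff)
  have zero: "lookup m v = 0" if "m \<in> ms" "v \<notin> vs" for m v
    using that by (auto simp: ms_def in_keys_iff)
  have "lookup ` ms \<subseteq> {f. \<forall>v. (v \<in> vs \<longrightarrow> f v \<in> {..d}) \<and> (v \<notin> vs \<longrightarrow> f v = 0)}"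
    using low zero by auto
  moreover have "finite {f. \<forall>v. (v \<in> vs \<longrightarrow> f v \<in> {..d}) \<and> (v \<notin> vs \<longrightarrow> f v = 0)}"
    using vs by (rule finite_set_of_finite_funs) simp
  ultimately have "finite (lookup ` ms)" by (rule finite_subset)
  then have ms: "finite ms" by (rule finite_imageD) (rule inj_onI, rule poly_mapping_eq_iff[THEN iffD2])
  have "coha_bideg a \<gamma> k \<subseteq> coha.span ((\<lambda>m. single \<gamma> (single m 1)) ` ms)"
  proof
    fix f assume f: "f \<in> coha_bideg a \<gamma> k"
    have f_eq: "f = (\<Sum>m\<in>keys (lookup f \<gamma>). coha_scale (lookup (lookup f \<gamma>) m) (single \<gamma> (single m 1)))"
    proof (rule poly_mapping_eqI)
      fix \<delta>
      have "(\<Sum>m\<in>keys (lookup f \<gamma>). single 0 (lookup (lookup f \<gamma>) m) * single m 1) = lookup f \<gamma>"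
        by (simp add: mult_single flip: poly_mapping_sum_single)
      then show "lookup f \<delta> = lookup (\<Sum>m\<in>keys (lookup f \<gamma>). coha_scale (lookup (lookup f \<gamma>) m) (single \<gamma> (single m 1))) \<delta>"
        using bideg_lookup[OF f, of \<delta>]
        by (cases "\<delta> = \<gamma>") (simp_all add: lookup_sum lookup_scale lookup_single)
    qed
    have ms': "m \<in> ms" if m: "m \<in> keys (lookup f \<gamma>)" for m
    proof -
      have e: "2 * int (mono_degree m) + euler_dim a \<gamma> = k" using f m by (simp add: bideg_iff_keys)
      have "keys m \<subseteq> vs"
        using hall_in_vars[OF carrier_lookup[OF bideg_carrier[OF f]], of \<gamma>] m by (auto simp: in_vars_def vs_def)
      moreover have "mono_degree m \<le> d" using e unfolding d_def by linarith
      ultimately show ?thesis by (simp add: ms_def)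
    qed
    have "(\<Sum>m\<in>keys (lookup f \<gamma>). coha_scale (lookup (lookup f \<gamma>) m) (single \<gamma> (single m 1)))
        \<in> coha.span ((\<lambda>m. single \<gamma> (single m 1)) ` ms)"
      by (intro coha.span_sum coha.span_scale coha.span_base imageI ms')
    then show "f \<in> coha.span ((\<lambda>m. single \<gamma> (single m 1)) ` ms)" unfolding f_eq[symmetric] .
  qed
  then show ?thesis using ms by blast
qed

lemma (in vector_space) exists_complement:
  assumes T: "subspace T" "T \<subseteq> U"
  shows "\<exists>B. B \<subseteq> U \<and> independent B \<and> span B \<inter> T = {0} \<and> (\<forall>u\<in>U. \<exists>b\<in>span B. \<exists>t\<in>T. u = b + t)"
proof -
  obtain C where C: "C \<subseteq> T" "independent C" "T \<subseteq> span C" using maximal_independent_subset[of T] by blast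
  have "C \<subseteq> U" using C T by blast
  then obtain D where D: "C \<subseteq> D" "D \<subseteq> U" "independent D" "U \<subseteq> span D"
    using maximal_independent_subset_extend[of C U] C(2) by blast
  define B where "B = D - C"
  have B: "B \<subseteq> D" by (auto simp: B_def)
  have indB: "independent B" using D(3) B by (rule independent_mono)
  have "x = 0" if x: "x \<in> span B" "x \<in> T" for x
  proof -
    have xC: "x \<in> span C" using x C by blast
    have 1: "representation D x = representation B x" by (rule representation_extend[OF D(3) x(1) B])
    have 2: "representation D x = representation C x" by (rule representation_extend[OF D(3) xC D(1)])
    have "representation D x v = 0" for v
    proof (cases "v \<in> C")
      case True
      then have "v \<notin> B" by (simp add: B_def)
      then show ?thesis unfolding 1 using representation_ne_zero[of B x v] by blast
    next
      case False
      then show ?thesis unfolding 2 using representation_ne_zero[of C x v] by blast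
    qed
    moreover have "x \<in> span D" using x(1) span_mono[OF B] by blast
    ultimately show ?thesis using sum_nonzero_representation_eq[OF D(3), of x] by simp
  qed
  moreover have "0 \<in> span B" "0 \<in> T" using span_zero subspace_0[OF T(1)] by auto
  moreover have "\<exists>b\<in>span B. \<exists>t\<in>T. u = b + t" if "u \<in> U" for u
  proof -
    have "D = B \<union> C" using D(1) by (auto simp: B_def)
    then have "u \<in> span (B \<union> C)" using that D(4) by blast
    then obtain b t where "u = b + t" "b \<in> span B" "t \<in> span C" unfolding span_Un by blast
    moreover have "span C \<subseteq> T" using C(1) T(1) by (rule span_minimal)
    ultimately show ?thesis by blast
  qed
  ultimately show ?thesis using indB B D(2) by (intro exI[of _ B]) blast
qed

section \<open>The space of generators\<close>

context twisted
begin

text \<open>The elements to be complemented by the primitive ones.\<close>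

definition sig_Dec_sum :: "'i coha set" where
  "sig_Dec_sum = {d + m | d m. d \<in> Dec \<and> m \<in> sig ` Hplus}"

lemma sig_Hplus_subspace: "coha.subspace (sig ` Hplus)"
  unfolding coha.subspace_def
proof (intro conjI ballI allI)
  show "0 \<in> sig ` Hplus"
    using imageI[OF coha.subspace_0[OF Hplus_subspace], of sig] by simp
next
  fix x y assume "x \<in> sig ` Hplus" "y \<in> sig ` Hplus"
  then obtain f g where fg: "x = sig f" "y = sig g" "f \<in> Hplus" "g \<in> Hplus" by (elim imageE)
  show "x + y \<in> sig ` Hplus"
    using imageI[OF coha.subspace_add[OF Hplus_subspace fg(3,4)], of sig] by (simp add: fg(1,2))
next
  fix c x assume "x \<in> sig ` Hplus"
  then obtain f where f: "x = sig f" "f \<in> Hplus" by (elim imageE)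
  show "coha_scale c x \<in> sig ` Hplus"
    using imageI[OF coha.subspace_scale[OF Hplus_subspace f(2), of c], of sig] by (simp add: f(1))
qed

lemma sig_Dec_sum_subspace: "coha.subspace sig_Dec_sum"
  unfolding sig_Dec_sum_def by (rule coha.subspace_sums[OF Dec_subspace sig_Hplus_subspace])

lemma Dec_sig_Dec_sum: "d \<in> Dec \<Longrightarrow> d \<in> sig_Dec_sum"
  unfolding sig_Dec_sum_def using coha.subspace_0[OF sig_Hplus_subspace] by force

lemma sig_sig_Dec_sum: "h \<in> Hplus \<Longrightarrow> sig h \<in> sig_Dec_sum"
  unfolding sig_Dec_sum_def using coha.subspace_0[OF Dec_subspace] by force

lemma MsubE:
  assumes "x \<in> sig_Dec_sum" obtains d h where "x = d + sig h" "d \<in> Dec" "h \<in> Hplus"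
  using assms unfolding sig_Dec_sum_def by blast

lemma cmp_sig': "f \<in> coha_carrier \<Longrightarrow> cmp a \<gamma> k (sig f) = sig (cmp a \<gamma> (k - 2) f)"
  using cmp_sig[of f \<gamma> "k - 2"] by simp

lemma cmp_sig_Dec_sum: "x \<in> sig_Dec_sum \<Longrightarrow> cmp a \<gamma> k x \<in> sig_Dec_sum"
proof (elim MsubE)
  fix d h assume x: "x = d + sig h" "d \<in> Dec" "h \<in> Hplus"
  have "cmp a \<gamma> k x = cmp a \<gamma> k d + sig (cmp a \<gamma> (k - 2) h)"
    unfolding x(1) cmp_simps(2) cmp_sig'[OF Hplus_carrier[OF x(3)]] ..
  then show "cmp a \<gamma> k x \<in> sig_Dec_sum" using cmp_Dec[OF x(2)] cmp_Hplus[OF x(3)] unfolding sig_Dec_sum_def by blast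
qed

lemma bideg_Hplus: "f \<in> coha_bideg a \<gamma> k \<Longrightarrow> \<gamma> \<noteq> (\<lambda>_. 0) \<Longrightarrow> f \<in> Hplus"
  using bideg_carrier[of f a \<gamma> k] bideg_lookup[of f a \<gamma> k "\<lambda>_. 0"] by (simp add: Hplus_def)

lemma cmp_Hplus_0:
  assumes "f \<in> Hplus" shows "cmp a (\<lambda>_. 0) k f = 0"
proof -
  have "lookup f (\<lambda>_. 0) = 0" using assms by (simp add: Hplus_def)
  then show ?thesis by (simp add: cmp_def hpart_def)
qed

definition prim_basis :: "('i dimvec \<Rightarrow> int \<Rightarrow> 'i coha set) \<Rightarrow> bool" where
  "prim_basis Bp \<longleftrightarrow> (\<forall>\<gamma> k. Bp \<gamma> k \<subseteq> coha_bideg a \<gamma> k \<and> coha.independent (Bp \<gamma> k) \<and>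
     (\<gamma> = (\<lambda>_. 0) \<longrightarrow> Bp \<gamma> k = {}) \<and> coha.span (Bp \<gamma> k) \<inter> sig_Dec_sum \<subseteq> {0} \<and>
     (\<gamma> \<noteq> (\<lambda>_. 0) \<longrightarrow> (\<forall>u\<in>coha_bideg a \<gamma> k. \<exists>b\<in>coha.span (Bp \<gamma> k). \<exists>t\<in>sig_Dec_sum. u = b + t)))"

lemma prim_basis_exists: "\<exists>Bp. prim_basis Bp"
proof -
  have "\<exists>B. B \<subseteq> coha_bideg a \<gamma> k \<and> coha.independent B \<and> (\<gamma> = (\<lambda>_. 0) \<longrightarrow> B = {}) \<and> coha.span B \<inter> sig_Dec_sum \<subseteq> {0} \<and>
     (\<gamma> \<noteq> (\<lambda>_. 0) \<longrightarrow> (\<forall>u\<in>coha_bideg a \<gamma> k. \<exists>b\<in>coha.span B. \<exists>t\<in>sig_Dec_sum. u = b + t))" for \<gamma> k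
  proof (cases "\<gamma> = (\<lambda>_. 0)")
    case True
    then show ?thesis by (intro exI[of _ "{}"]) (simp add: coha.independent_empty)
  next
    case False
    have "coha.subspace (sig_Dec_sum \<inter> coha_bideg a \<gamma> k)"
      by (rule coha.subspace_inter[OF sig_Dec_sum_subspace bideg_subspace])
    from coha.exists_complement[OF this Int_lower2]
    obtain B where B: "B \<subseteq> coha_bideg a \<gamma> k" "coha.independent B" "coha.span B \<inter> (sig_Dec_sum \<inter> coha_bideg a \<gamma> k) = {0}"
      "\<forall>u\<in>coha_bideg a \<gamma> k. \<exists>b\<in>coha.span B. \<exists>t\<in>sig_Dec_sum \<inter> coha_bideg a \<gamma> k. u = b + t" by blast
    have "coha.span B \<subseteq> coha_bideg a \<gamma> k" by (rule coha.span_minimal[OF B(1) bideg_subspace])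
    then have "coha.span B \<inter> sig_Dec_sum \<subseteq> {0}" using B(3) by blast
    then show ?thesis using B(1,2,4) False by (intro exI[of _ B]) blast
  qed
  then have "\<forall>\<gamma> k. \<exists>B. B \<subseteq> coha_bideg a \<gamma> k \<and> coha.independent B \<and> (\<gamma> = (\<lambda>_. 0) \<longrightarrow> B = {}) \<and> coha.span B \<inter> sig_Dec_sum \<subseteq> {0} \<and>
     (\<gamma> \<noteq> (\<lambda>_. 0) \<longrightarrow> (\<forall>u\<in>coha_bideg a \<gamma> k. \<exists>b\<in>coha.span B. \<exists>t\<in>sig_Dec_sum. u = b + t))" by blast
  then show ?thesis unfolding prim_basis_def by (simp only: choice_iff)
qed

end

locale twisted_prim = twisted a \<psi> for a :: "'i::finite quiver" and \<psi> +
  fixes Bp :: "'i dimvec \<Rightarrow> int \<Rightarrow> 'i coha set"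
  assumes prim: "prim_basis Bp"
begin

lemma Bp: "Bp \<gamma> k \<subseteq> coha_bideg a \<gamma> k" "coha.independent (Bp \<gamma> k)" "Bp (\<lambda>_. 0) k = {}"
  "coha.span (Bp \<gamma> k) \<inter> sig_Dec_sum \<subseteq> {0}"
  "\<gamma> \<noteq> (\<lambda>_. 0) \<Longrightarrow> u \<in> coha_bideg a \<gamma> k \<Longrightarrow> \<exists>b\<in>coha.span (Bp \<gamma> k). \<exists>t\<in>sig_Dec_sum. u = b + t"
  using prim unfolding prim_basis_def by blast+

definition "PB = (\<Union>\<gamma> k. Bp \<gamma> k)"

definition "Vprim = coha.span PB"

lemma PB_homogeneous: "b \<in> PB \<Longrightarrow> \<exists>\<gamma> k. b \<in> coha_bideg a \<gamma> k"
  using Bp(1) unfolding PB_def by blast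

lemma PB_bideg: "PB \<inter> coha_bideg a \<gamma> k \<subseteq> Bp \<gamma> k"
proof
  fix b assume b: "b \<in> PB \<inter> coha_bideg a \<gamma> k"
  then obtain \<delta> l where bl: "b \<in> Bp \<delta> l" by (auto simp: PB_def)
  then have "b \<noteq> 0" using Bp(2)[of \<delta> l] coha.dependent_zero[of "Bp \<delta> l"] by auto
  have "b \<in> coha_bideg a \<delta> l" using bl Bp(1) by blast
  then have "cmp a \<gamma> k b = (if \<gamma> = \<delta> \<and> k = l then b else 0)" by (rule cmp_of_bideg)
  moreover have "cmp a \<gamma> k b = b" using cmp_of_bideg[of b a \<gamma> k \<gamma> k] b by simp
  ultimately have "\<gamma> = \<delta> \<and> k = l" using \<open>b \<noteq> 0\<close> by (auto split: if_splits)
  then show "b \<in> Bp \<gamma> k" using bl by simp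
qed

lemma cmp_Vprim': "x \<in> Vprim \<Longrightarrow> cmp a \<gamma> k x \<in> coha.span (Bp \<gamma> k)"
proof -
  assume "x \<in> Vprim"
  then have "cmp a \<gamma> k x \<in> coha.span (PB \<inter> coha_bideg a \<gamma> k)"
    unfolding Vprim_def by (rule cmp_span[rotated]) (rule PB_homogeneous)
  then show ?thesis using coha.span_mono[OF PB_bideg] by (rule rev_subsetD)
qed

lemma span_Bp_Vprim: "coha.span (Bp \<gamma> k) \<subseteq> Vprim"
  unfolding Vprim_def by (rule coha.span_mono) (auto simp: PB_def)

lemma cmp_Vprim: "x \<in> Vprim \<Longrightarrow> cmp a \<gamma> k x \<in> Vprim"
  using cmp_Vprim' span_Bp_Vprim by blast

lemma Vprim_subspace: "coha.subspace Vprim"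
  by (simp add: Vprim_def)

lemma Vprim_bideg: "Vprim \<inter> coha_bideg a \<gamma> k = coha.span (Bp \<gamma> k)"
proof
  show "coha.span (Bp \<gamma> k) \<subseteq> Vprim \<inter> coha_bideg a \<gamma> k"
    using span_Bp_Vprim coha.span_minimal[OF Bp(1) bideg_subspace] by blast
  show "Vprim \<inter> coha_bideg a \<gamma> k \<subseteq> coha.span (Bp \<gamma> k)"
  proof
    fix x assume x: "x \<in> Vprim \<inter> coha_bideg a \<gamma> k"
    then have "cmp a \<gamma> k x = x" using cmp_of_bideg[of x a \<gamma> k \<gamma> k] by simp
    then show "x \<in> coha.span (Bp \<gamma> k)" using cmp_Vprim'[of x \<gamma> k] x by simp
  qed
qed

lemma Vprim_Hplus: "Vprim \<subseteq> Hplus"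
  unfolding Vprim_def
proof (rule coha.span_minimal[OF _ Hplus_subspace], rule subsetI)
  fix b assume "b \<in> PB"
  then obtain \<gamma> k where b: "b \<in> Bp \<gamma> k" by (auto simp: PB_def)
  then have "\<gamma> \<noteq> (\<lambda>_. 0)" using Bp(3) by auto
  then show "b \<in> Hplus" using b Bp(1) bideg_Hplus by blast
qed

lemma Vprim_sig_Dec_sum: "x \<in> Vprim \<Longrightarrow> x \<in> sig_Dec_sum \<Longrightarrow> x = 0"
proof -
  assume x: "x \<in> Vprim" "x \<in> sig_Dec_sum"
  have "cmp a \<gamma> k x = 0" for \<gamma> k using cmp_Vprim'[OF x(1)] cmp_sig_Dec_sum[OF x(2)] Bp(4) by blast
  then show "x = 0" using cmp_decomposition[of x a] by simp
qed

text \<open>Here \<open>sig\<close> plays the role of the variable \<open>x\<close> of \<open>Vprim[x]\<close>.\<close>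

definition phi :: "'i coha poly \<Rightarrow> 'i coha" where
  "phi p = (\<Sum>n\<le>Polynomial.degree p. (sig ^^ n) (coeff p n))"

lemma sig_pow_0 [simp]: "(sig ^^ n) 0 = (0 :: 'i coha)"
  by (induction n) auto

lemma sig_pow_add: "(sig ^^ n) (f + g) = (sig ^^ n) f + (sig ^^ n) (g :: 'i coha)"
  by (induction n) auto

lemma sig_pow_scale: "(sig ^^ n) (coha_scale c f) = coha_scale c ((sig ^^ n) (f :: 'i coha))"
  by (induction n) auto

lemma sig_pow_Hplus: "f \<in> Hplus \<Longrightarrow> (sig ^^ n) f \<in> Hplus"
  by (induction n) (auto intro: sig_Hplus)

lemma sig_pow_bideg: "f \<in> coha_bideg a \<gamma> k \<Longrightarrow> (sig ^^ n) f \<in> coha_bideg a \<gamma> (k + 2 * int n)"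
proof (induction n)
  case (Suc n)
  then show ?case using sig_bideg[of "(sig ^^ n) f" a \<gamma> "k + 2 * int n"] by (simp add: algebra_simps)
qed simp

lemma phi_superset: "Polynomial.degree p \<le> N \<Longrightarrow> phi p = (\<Sum>n\<le>N. (sig ^^ n) (coeff p n))"
  unfolding phi_def by (rule sum.mono_neutral_left) (auto simp: coeff_eq_0)

lemma phi_add: "phi (p + q) = phi p + phi q"
proof -
  define N where "N = max (Polynomial.degree p) (Polynomial.degree q)"
  have "phi p = (\<Sum>n\<le>N. (sig ^^ n) (coeff p n))" "phi q = (\<Sum>n\<le>N. (sig ^^ n) (coeff q n))"
    "phi (p + q) = (\<Sum>n\<le>N. (sig ^^ n) (coeff (p + q) n))"
    by (rule phi_superset, simp add: N_def degree_add_le)+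
  then show ?thesis by (simp only: coeff_add sig_pow_add sum.distrib)
qed

lemma phi_Hplus: "p \<in> tensor_Qx Vprim \<Longrightarrow> phi p \<in> Hplus"
  unfolding phi_def using Vprim_Hplus
  by (intro coha.subspace_sum[OF Hplus_subspace] sig_pow_Hplus) (auto simp: tensor_Qx_def)

text \<open>Reading off the coefficients one after the other: the constant one lies in \<open>Vprim \<inter> sig_Dec_sum\<close>, and then one
  factor \<open>sig\<close> can be cancelled.\<close>

lemma sum_sig_pow_Dec:
  assumes "\<And>n. w n \<in> Vprim" "(\<Sum>n\<le>N. (sig ^^ n) (w n)) \<in> Dec" "n \<le> N"
  shows "w n = 0"
  using assms
proof (induction N arbitrary: w n)
  case 0
  then show ?case using Vprim_sig_Dec_sum[OF 0(1)] Dec_sig_Dec_sum by simp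
next
  case (Suc N)
  let ?r = "\<Sum>n\<le>N. (sig ^^ n) (w (Suc n))"
  have r: "?r \<in> Hplus"
    using Vprim_Hplus Suc.prems(1) by (intro coha.subspace_sum[OF Hplus_subspace] sig_pow_Hplus) auto
  have eq: "(\<Sum>n\<le>Suc N. (sig ^^ n) (w n)) = w 0 + sig ?r"
    by (simp only: sum.atMost_Suc_shift sig_sum funpow.simps comp_apply id_apply)
  have "w 0 = (\<Sum>n\<le>Suc N. (sig ^^ n) (w n)) - sig ?r" unfolding eq by simp
  also have "\<dots> \<in> sig_Dec_sum" by (rule coha.subspace_diff[OF sig_Dec_sum_subspace Dec_sig_Dec_sum[OF Suc.prems(2)] sig_sig_Dec_sum[OF r]])
  finally have w0: "w 0 = 0" by (rule Vprim_sig_Dec_sum[OF Suc.prems(1)])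
  then have "sig ?r \<in> Dec" using Suc.prems(2) unfolding eq by simp
  then have "?r \<in> Dec" by (rule sig_Dec_cancel[OF r])
  then have "w (Suc n) = 0" if "n \<le> N" for n using Suc.IH[of "\<lambda>n. w (Suc n)" n] Suc.prems(1) that by simp
  then show ?case using w0 Suc.prems(3) by (cases n) auto
qed

lemma phi_Dec:
  assumes "p \<in> tensor_Qx Vprim" "phi p \<in> Dec" shows "p = 0"
proof (rule poly_eqI)
  fix n
  have "coeff p n = 0" if "n \<le> Polynomial.degree p"
    using sum_sig_pow_Dec[of "coeff p" "Polynomial.degree p" n] assms that by (simp add: tensor_Qx_def phi_def)
  then show "coeff p n = coeff 0 n" by (cases "n \<le> Polynomial.degree p") (auto simp: coeff_eq_0)
qed

definition "V = phi ` tensor_Qx Vprim"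

lemma tensor_simps:
  "0 \<in> tensor_Qx Vprim" "p \<in> tensor_Qx Vprim \<Longrightarrow> q \<in> tensor_Qx Vprim \<Longrightarrow> p + q \<in> tensor_Qx Vprim"
  "p \<in> tensor_Qx Vprim \<Longrightarrow> q \<in> tensor_Qx Vprim \<Longrightarrow> p - q \<in> tensor_Qx Vprim"
  "p \<in> tensor_Qx Vprim \<Longrightarrow> map_poly (coha_scale c) p \<in> tensor_Qx Vprim"
  using Vprim_subspace
  by (auto simp: tensor_Qx_def coeff_map_poly coha.subspace_0 coha.subspace_add coha.subspace_diff coha.subspace_scale)

lemma phi_scale: "phi (map_poly (coha_scale c) p) = coha_scale c (phi p)"
proof -
  have "Polynomial.degree (map_poly (coha_scale c) p) \<le> Polynomial.degree p"
    by (rule degree_le) (simp add: coeff_map_poly coeff_eq_0)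
  then show ?thesis
    by (simp add: phi_superset[of _ "Polynomial.degree p"] coeff_map_poly sig_pow_scale coha.scale_sum_right)
qed

lemma phi_0 [simp]: "phi 0 = 0"
  by (simp add: phi_def)

lemma phi_diff: "phi (p - q) = phi p - phi q"
  using phi_add[of "p - q" q] by (simp add: algebra_simps)

lemma V_subspace: "coha.subspace V"
  unfolding coha.subspace_def
proof (intro conjI ballI allI)
  show "0 \<in> V" using imageI[OF tensor_simps(1), of phi] by (simp add: V_def)
next
  fix x y assume "x \<in> V" "y \<in> V"
  then obtain p q where pq: "x = phi p" "y = phi q" "p \<in> tensor_Qx Vprim" "q \<in> tensor_Qx Vprim"
    unfolding V_def by (elim imageE)
  show "x + y \<in> V" unfolding V_def pq(1,2) phi_add[symmetric] by (rule imageI[OF tensor_simps(2)[OF pq(3,4)]])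
next
  fix c x assume "x \<in> V"
  then obtain p where p: "x = phi p" "p \<in> tensor_Qx Vprim" unfolding V_def by (elim imageE)
  show "coha_scale c x \<in> V" unfolding V_def p(1) phi_scale[symmetric] by (rule imageI[OF tensor_simps(4)[OF p(2)]])
qed

lemma V_Hplus: "V \<subseteq> Hplus"
  using phi_Hplus unfolding V_def by blast

lemma V_Dec: "x \<in> V \<Longrightarrow> x \<in> Dec \<Longrightarrow> x = 0"
proof -
  assume "x \<in> V" "x \<in> Dec"
  then obtain p where p: "x = phi p" "p \<in> tensor_Qx Vprim" unfolding V_def by (elim imageE)
  then have "p = 0" using phi_Dec[OF p(2)] \<open>x \<in> Dec\<close> by simp
  then show "x = 0" using p(1) by simp
qed

lemma inj_phi: "inj_on phi (tensor_Qx Vprim)"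
proof (rule inj_onI)
  fix p q assume p: "p \<in> tensor_Qx Vprim" and q: "q \<in> tensor_Qx Vprim" and eq: "phi p = phi q"
  have "phi (p - q) \<in> Dec" unfolding phi_diff eq by (simp add: coha.subspace_0[OF Dec_subspace])
  then have "p - q = 0" by (rule phi_Dec[OF tensor_simps(3)[OF p q]])
  then show "p = q" by simp
qed

lemma sig_pow_V:
  assumes "w \<in> Vprim" shows "(sig ^^ n) w \<in> V"
proof -
  have m: "monom w n \<in> tensor_Qx Vprim" using assms coha.subspace_0[OF Vprim_subspace] by (simp add: tensor_Qx_def)
  have "phi (monom w n) = (\<Sum>j\<le>n. (sig ^^ j) (coeff (monom w n) j))" by (rule phi_superset[OF degree_monom_le])
  also have "\<dots> = (\<Sum>j\<le>n. if j = n then (sig ^^ n) w else 0)" by (intro sum.cong refl) simp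
  finally have e: "phi (monom w n) = (sig ^^ n) w" by simp
  show ?thesis using imageI[OF m, of phi] unfolding V_def e .
qed

lemma cmp_sig_pow: "f \<in> coha_carrier \<Longrightarrow> cmp a \<gamma> k ((sig ^^ n) f) = (sig ^^ n) (cmp a \<gamma> (k - 2 * int n) f)"
proof (induction n arbitrary: k)
  case (Suc n)
  have "(sig ^^ n) f \<in> coha_carrier" using Suc.prems by (induction n) auto
  then show ?case using Suc.IH[OF Suc.prems, of "k - 2"] by (simp add: cmp_sig' algebra_simps)
qed simp

lemma cmp_phi:
  assumes p: "p \<in> tensor_Qx Vprim"
  obtains q where "q \<in> tensor_Qx_bideg a Vprim \<gamma> k" "cmp a \<gamma> k (phi p) = phi q"
proof
  define q where "q = Abs_poly (\<lambda>n. cmp a \<gamma> (k - 2 * int n) (coeff p n))"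
  have q: "coeff q n = cmp a \<gamma> (k - 2 * int n) (coeff p n)" for n
    unfolding q_def by (rule coeff_Abs_poly[of "Polynomial.degree p", THEN fun_cong]) (simp add: coeff_eq_0)
  have pc: "coeff p n \<in> Vprim" "coeff p n \<in> coha_carrier" for n
    using p Vprim_Hplus Hplus_carrier by (auto simp: tensor_Qx_def)
  show "q \<in> tensor_Qx_bideg a Vprim \<gamma> k"
    unfolding tensor_Qx_bideg_def using cmp_Vprim[OF pc(1)] cmp_bideg[OF pc(2)] by (simp add: q)
  have "Polynomial.degree q \<le> Polynomial.degree p" by (rule degree_le) (simp add: q coeff_eq_0)
  then show "cmp a \<gamma> k (phi p) = phi q"
    by (simp add: phi_superset[of q "Polynomial.degree p"] phi_def[of p] cmp_sum cmp_sig_pow[OF pc(2)] q)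
qed

lemma tensor_bideg_subset: "tensor_Qx_bideg a Vprim \<gamma> k \<subseteq> tensor_Qx Vprim"
  by (auto simp: tensor_Qx_bideg_def tensor_Qx_def)

lemma phi_bideg:
  assumes "q \<in> tensor_Qx_bideg a Vprim \<gamma> k" shows "phi q \<in> coha_bideg a \<gamma> k"
  unfolding phi_def
proof (rule coha.subspace_sum[OF bideg_subspace])
  fix n
  have "coeff q n \<in> coha_bideg a \<gamma> (k - 2 * int n)" using assms by (simp add: tensor_Qx_bideg_def)
  from sig_pow_bideg[OF this, of n] show "(sig ^^ n) (coeff q n) \<in> coha_bideg a \<gamma> k" by simp
qed

lemma phi_image_bideg: "phi ` tensor_Qx_bideg a Vprim \<gamma> k = V \<inter> coha_bideg a \<gamma> k"
proof
  show "phi ` tensor_Qx_bideg a Vprim \<gamma> k \<subseteq> V \<inter> coha_bideg a \<gamma> k"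
    using phi_bideg tensor_bideg_subset unfolding V_def by blast
  show "V \<inter> coha_bideg a \<gamma> k \<subseteq> phi ` tensor_Qx_bideg a Vprim \<gamma> k"
  proof
    fix x assume x: "x \<in> V \<inter> coha_bideg a \<gamma> k"
    then obtain p where p: "p \<in> tensor_Qx Vprim" "x = phi p" unfolding V_def by blast
    obtain q where "q \<in> tensor_Qx_bideg a Vprim \<gamma> k" "cmp a \<gamma> k (phi p) = phi q" by (rule cmp_phi[OF p(1)])
    moreover have "cmp a \<gamma> k x = x" using cmp_of_bideg[of x a \<gamma> k \<gamma> k] x by simp
    ultimately show "x \<in> phi ` tensor_Qx_bideg a Vprim \<gamma> k" unfolding p(2) by simp
  qed
qed

lemma cmp_V: "x \<in> V \<Longrightarrow> cmp a \<gamma> k x \<in> V"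
proof -
  assume "x \<in> V"
  then obtain p where p: "x = phi p" "p \<in> tensor_Qx Vprim" unfolding V_def by (elim imageE)
  obtain q where "q \<in> tensor_Qx_bideg a Vprim \<gamma> k" "cmp a \<gamma> k (phi p) = phi q" by (rule cmp_phi[OF p(2)])
  then show ?thesis unfolding V_def p(1) using tensor_bideg_subset by auto
qed

lemma iso_phi: "bigraded_iso_tensor_Qx a Vprim V phi"
  unfolding bigraded_iso_tensor_Qx_def using inj_phi phi_add phi_scale phi_image_bideg
  by (auto simp: bij_betw_def V_def)

lemma bigraded_subspaceI:
  assumes W: "coha.subspace W" and c: "\<And>x \<gamma> k. x \<in> W \<Longrightarrow> cmp a \<gamma> k x \<in> W" and sub: "W \<subseteq> coha_carrier"
  shows "bigraded_subspace a W"
  unfolding bigraded_subspace_def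
proof (intro conjI W equalityI)
  show "coha.span (\<Union>\<gamma> k. W \<inter> coha_bideg a \<gamma> k) \<subseteq> W" by (rule coha.span_minimal[OF _ W]) blast
  show "W \<subseteq> coha.span (\<Union>\<gamma> k. W \<inter> coha_bideg a \<gamma> k)"
  proof
    fix x assume x: "x \<in> W"
    show "x \<in> coha.span (\<Union>\<gamma> k. W \<inter> coha_bideg a \<gamma> k)"
    proof (rule subspace_cmpI[OF coha.subspace_span])
      fix \<gamma> k
      have "cmp a \<gamma> k x \<in> W \<inter> coha_bideg a \<gamma> k" using c[OF x] cmp_bideg[of x a \<gamma> k] sub x by blast
      then show "cmp a \<gamma> k x \<in> coha.span (\<Union>\<gamma> k. W \<inter> coha_bideg a \<gamma> k)" by (intro coha.span_base) blast
    qed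
  qed
qed

lemma bigraded_V: "bigraded_subspace a V"
  using V_Hplus Hplus_carrier by (intro bigraded_subspaceI V_subspace cmp_V) auto

lemma bigraded_Vprim: "bigraded_subspace a Vprim"
  using Vprim_Hplus Hplus_carrier by (intro bigraded_subspaceI Vprim_subspace cmp_Vprim) auto

text \<open>Decompose into a primitive element and an element \<open>d + sig g\<close>, and continue with \<open>g\<close>, whose degree is smaller by two.\<close>

lemma bideg_V_Dec:
  assumes "h \<in> coha_bideg a \<gamma> k" "\<gamma> \<noteq> (\<lambda>_. 0)"
  shows "\<exists>v\<in>V. \<exists>d\<in>Dec. h = v + d"
  using assms(1)
proof (induction "nat (k - euler_dim a \<gamma>)" arbitrary: k h rule: less_induct)
  case less
  obtain b t where bt: "b \<in> coha.span (Bp \<gamma> k)" "t \<in> sig_Dec_sum" "h = b + t" using Bp(5)[OF assms(2) less.prems] by blast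
  obtain d g where g: "t = d + sig g" "d \<in> Dec" "g \<in> Hplus" using bt(2) by (rule MsubE)
  have "b \<in> Vprim" "b \<in> coha_bideg a \<gamma> k" using bt(1) Vprim_bideg[of \<gamma> k] by auto
  define g' where "g' = cmp a \<gamma> (k - 2) g"
  have g': "g' \<in> coha_bideg a \<gamma> (k - 2)" unfolding g'_def by (rule cmp_bideg[OF Hplus_carrier[OF g(3)]])
  have "h = cmp a \<gamma> k h" using cmp_of_bideg[OF less.prems, of \<gamma> k] by simp
  also have "\<dots> = b + (cmp a \<gamma> k d + sig g')"
    unfolding bt(3) g(1) cmp_simps(2) cmp_sig'[OF Hplus_carrier[OF g(3)]] g'_def
    using cmp_of_bideg[OF \<open>b \<in> coha_bideg a \<gamma> k\<close>, of \<gamma> k] by simp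
  finally have h: "h = b + (cmp a \<gamma> k d + sig g')" .
  have bV: "b \<in> V" using sig_pow_V[OF \<open>b \<in> Vprim\<close>, of 0] by simp
  have dD: "cmp a \<gamma> k d \<in> Dec" by (rule cmp_Dec[OF g(2)])
  have "\<exists>v\<in>V. \<exists>d\<in>Dec. g' = v + d"
  proof (cases "k > euler_dim a \<gamma>")
    case True
    then show ?thesis by (intro less.hyps[OF _ g']) linarith
  next
    case False
    have "keys (lookup g' \<gamma>) = {}" using g' False unfolding bideg_iff_keys by force
    then have "lookup g' \<gamma> = 0" by simp
    then have "lookup g' \<delta> = 0" for \<delta> using bideg_lookup[OF g', of \<delta>] by (cases "\<delta> = \<gamma>") auto
    then have "g' = 0" by (intro poly_mapping_eqI) simp
    then show ?thesis using coha.subspace_0[OF V_subspace] coha.subspace_0[OF Dec_subspace] by force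
  qed
  then obtain v e where ve: "v \<in> V" "e \<in> Dec" "g' = v + e" by blast
  have "sig v \<in> V"
  proof -
    obtain p where p: "p \<in> tensor_Qx Vprim" "v = phi p" using ve(1) unfolding V_def by blast
    have "sig v = (\<Sum>n\<le>Polynomial.degree p. (sig ^^ Suc n) (coeff p n))" unfolding p(2) phi_def by simp
    also have "\<dots> \<in> V"
      using p(1) by (intro coha.subspace_sum[OF V_subspace] sig_pow_V) (simp add: tensor_Qx_def)
    finally show ?thesis .
  qed
  then have "b + sig v \<in> V" "cmp a \<gamma> k d + sig e \<in> Dec"
    using bV dD ve(2) sig_Dec by (auto intro: coha.subspace_add[OF V_subspace] coha.subspace_add[OF Dec_subspace])
  moreover have "h = (b + sig v) + (cmp a \<gamma> k d + sig e)" unfolding h ve(3) by (simp add: algebra_simps)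
  ultimately show ?case by blast
qed

lemma Hplus_V_Dec:
  assumes "h \<in> Hplus" shows "\<exists>v\<in>V. \<exists>d\<in>Dec. h = v + d"
proof -
  have "h \<in> {v + d | v d. v \<in> V \<and> d \<in> Dec}"
  proof (rule subspace_cmpI[OF coha.subspace_sums[OF V_subspace Dec_subspace]])
    fix \<gamma> k
    have z: "0 + 0 \<in> {v + d | v d. v \<in> V \<and> d \<in> Dec}"
      using coha.subspace_0[OF V_subspace] coha.subspace_0[OF Dec_subspace] by blast
    show "cmp a \<gamma> k h \<in> {v + d | v d. v \<in> V \<and> d \<in> Dec}"
    proof (cases "\<gamma> = (\<lambda>_. 0)")
      case True
      then show ?thesis using z cmp_Hplus_0[OF assms, of k] by simp
    next
      case False
      then show ?thesis using bideg_V_Dec[OF cmp_bideg[OF Hplus_carrier[OF assms]] False] by blast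
    qed
  qed
  then show ?thesis by blast
qed

lemma Vprim_bideg_finite_span: "\<exists>B. finite B \<and> coha.span B = Vprim \<inter> coha_bideg a \<gamma> k"
proof -
  obtain M where M: "finite M" "coha_bideg a \<gamma> k \<subseteq> coha.span M" using bideg_finite_span by blast
  have "finite (Bp \<gamma> k)"
    using coha.independent_span_bound[OF M(1) Bp(2), of \<gamma> k] Bp(1)[of \<gamma> k] M(2) by blast
  then show ?thesis using Vprim_bideg by blast
qed

end

section \<open>Restriction to a pair of disjoint families\<close>

text \<open>Its product over the elements \<open>x\<close> of \<open>W\<close> is the \<open>n\<close>-th power of the product of all \<open>y - x\<close>.\<close>

definition clearing :: "'i fam \<Rightarrow> nat \<Rightarrow> 'i \<Rightarrow> rat poly" where
  "clearing Y n = (\<lambda>i. \<Prod>y\<in>Y i. [:y, - 1:] ^ n)"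

definition famun :: "'i fam \<Rightarrow> rat set" where
  "famun Y = (\<Union>i. Y i)"

lemma finite_famun [simp]: "ffam Y \<Longrightarrow> finite (famun (Y :: 'i::finite fam))"
  by (simp add: famun_def ffam_def)

lemma avoids_inf: "avoids (famun Y) W \<Longrightarrow> inf W Y = bot"
  by (auto simp: avoids_def famun_def fun_eq_iff)

lemma avoids_mono: "avoids (famun Y) W \<Longrightarrow> Z \<le> Y \<Longrightarrow> U \<le> W \<Longrightarrow> avoids (famun Z) U"
  unfolding avoids_def famun_def le_fun_def by blast

lemma mpw_times: "mpw (\<lambda>i. q i * r i) W = mpw q W * mpw r W"
  by (simp add: mpw_def prod.distrib)

lemma mpw_bot [simp]: "mpw q bot = 1"
  by (simp add: mpw_def)

lemma mpw_vy_add: "mpw (clearing Y (n + m)) W = mpw (clearing Y m) W * mpw (clearing Y n) W"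
proof -
  have "clearing Y (n + m) = (\<lambda>i. clearing Y m i * clearing Y n i)" by (simp add: clearing_def power_add prod.distrib fun_eq_iff)
  then show ?thesis by (simp add: mpw_times)
qed

lemma mpw_vy_sup:
  assumes "ffam Y" "Z \<le> Y" shows "mpw (clearing Y n) W = mpw (clearing Z n) W * mpw (clearing (Y - Z) n) W"
proof -
  have "clearing Y n i = clearing Z n i * clearing (Y - Z) n i" for i
    unfolding clearing_def using assms prod.subset_diff[of "Z i" "Y i" "\<lambda>y. [:y, - 1:] ^ n"]
    by (simp add: ffam_def le_fun_def mult.commute)
  then have "clearing Y n = (\<lambda>i. clearing Z n i * clearing (Y - Z) n i)" by (rule ext)
  then show ?thesis by (simp add: mpw_times)
qed

text \<open>For \<open>n > 0\<close>, multiplication by \<open>mpw (clearing Z n)\<close> clears the denominators of the kernel between \<open>W\<close> and \<open>Z\<close>.\<close>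

lemma kern_mpw:
  fixes Z :: "'i::finite fam"
  assumes Z: "ffam Z" and n: "n > 0"
  shows "\<exists>q. (\<forall>W. ffam W \<longrightarrow> inf W Z = bot \<longrightarrow> mpw (clearing Z n) W * kern a W Z = mpw q W) \<and>
    ((\<forall>i. 0 \<notin> Z i) \<longrightarrow> (\<forall>i. poly (q i) 0 \<noteq> 0))"
proof -
  define q where "q i = clearing Z (n - 1) i * (\<Prod>j\<in>UNIV. \<Prod>z\<in>Z j. [:z, - 1:] ^ a i j)" for i
  have fin: "finite (Z i)" for i using Z by (simp add: ffam_def)
  have "mpw (clearing Z n) W * kern a W Z = mpw q W" if W: "ffam W" "inf W Z = bot" for W
  proof -
    have ne: "(\<Prod>i\<in>UNIV. \<Prod>x\<in>W i. \<Prod>y\<in>Z i. y - x) \<noteq> 0"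
      using W Z by (auto simp: ffam_def fun_eq_iff)
    have "mpw (clearing Z n) W = mpw (clearing Z (n - 1)) W * mpw (clearing Z 1) W"
      using mpw_vy_add[of Z 1 "n - 1" W] n by simp
    moreover have "mpw (clearing Z 1) W = (\<Prod>i\<in>UNIV. \<Prod>x\<in>W i. \<Prod>y\<in>Z i. y - x)"
      by (simp add: mpw_def clearing_def poly_prod)
    moreover have "mpw q W = mpw (clearing Z (n - 1)) W * (\<Prod>i\<in>UNIV. \<Prod>j\<in>UNIV. \<Prod>x\<in>W i. \<Prod>y\<in>Z j. (y - x) ^ a i j)"
    proof -
      have "(\<Prod>x\<in>W i. \<Prod>j\<in>UNIV. \<Prod>y\<in>Z j. (y - x) ^ a i j) = (\<Prod>j\<in>UNIV. \<Prod>x\<in>W i. \<Prod>y\<in>Z j. (y - x) ^ a i j)" for i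
        by (rule prod.swap)
      then show ?thesis by (simp add: q_def[abs_def] mpw_times) (simp add: mpw_def poly_prod)
    qed
    ultimately show ?thesis using ne by (simp add: kern_def)
  qed
  moreover have "poly (q i) 0 \<noteq> 0" if "\<forall>i. 0 \<notin> Z i" for i
    using that fin by (auto simp: q_def clearing_def poly_prod)
  ultimately show ?thesis by blast
qed

definition smul :: "('i dimvec \<Rightarrow> rat) \<Rightarrow> 'i::finite coha \<Rightarrow> 'i coha" where
  "smul s = cmap (\<lambda>\<gamma> p. single 0 (s \<gamma>) * p)"

lemma smul_carrier [simp]: "f \<in> coha_carrier \<Longrightarrow> smul s f \<in> coha_carrier"
  unfolding smul_def by (rule cmap_carrier) (auto intro: hall_mult)

lemma cv_smul [simp]: "cv (smul s f) P = s (fam_card P) * cv f P"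
  by (simp add: cv_def smul_def lookup_cmap)

text \<open>Substituting the elements of \<open>Z\<close> for some of the variables leaves a symmetric polynomial in the others.\<close>

lemma partial_evaluation_poly:
  fixes p :: "'i::finite mpoly"
  assumes p: "p \<in> hall_comp (\<lambda>i. \<alpha> i + fam_card Z i)" and Z: "ffam Z"
  obtains p' where "p' \<in> hall_comp \<alpha>"
    "\<And>W. ffam W \<Longrightarrow> fam_card W = \<alpha> \<Longrightarrow> avoids (famun Z) W \<Longrightarrow> fs p' W = fs p (sup W Z)"
proof
  define F where "F = famun Z"
  have F: "finite F" using Z by (simp add: F_def)
  define z where "z i \<beta> = sorted_list_of_set (Z i) ! \<beta>" for i \<beta>
  define p' where "p' = subst (\<lambda>i \<beta>. if \<beta> < \<alpha> i then pvar i \<beta> else single 0 (z i (\<beta> - \<alpha> i))) p"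
  have v: "p' \<in> in_vars \<alpha>" unfolding p'_def by (rule subst_in_vars_all) auto
  have e: "ev x p' = fs p (sup (\<lambda>i. x i ` {..<\<alpha> i}) Z)" if x: "generic F x" for x
  proof -
    define y where "y i \<beta> = (if \<beta> < \<alpha> i then x i \<beta> else z i (\<beta> - \<alpha> i))" for i \<beta>
    have zb: "bij_betw (z i) {..<fam_card Z i} (Z i)" for i
      unfolding z_def fam_card_def using Z by (intro sorted_list_bij) (simp add: ffam_def)
    have xF: "x i \<beta> \<notin> Z j" for i j \<beta> using x by (auto simp: generic_def F_def famun_def)
    have "ev x p' = ev y p"
    proof -
      have "(\<lambda>i \<beta>. ev x (if \<beta> < \<alpha> i then pvar i \<beta> else single 0 (z i (\<beta> - \<alpha> i)))) = y"
        by (intro ext) (simp add: y_def)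
      then show ?thesis by (simp add: p'_def)
    qed
    also have "\<dots> = fs p (\<lambda>i. y i ` {..<\<alpha> i + fam_card Z i})"
    proof (rule hall_fs[OF p])
      fix i
      show "inj_on (y i) {..<\<alpha> i + fam_card Z i}"
      proof (rule inj_onI)
        fix \<beta> \<beta>' assume b: "\<beta> \<in> {..<\<alpha> i + fam_card Z i}" "\<beta>' \<in> {..<\<alpha> i + fam_card Z i}" "y i \<beta> = y i \<beta>'"
        have zi: "z i (\<beta> - \<alpha> i) \<in> Z i" if "\<beta> \<in> {..<\<alpha> i + fam_card Z i}" "\<not> \<beta> < \<alpha> i" for \<beta>
          using that bij_betwE[OF zb[of i]] by simp
        have inj: "inj (x i)" using x by (simp add: generic_def)
        show "\<beta> = \<beta>'"
        proof (cases "\<beta> < \<alpha> i"; cases "\<beta>' < \<alpha> i")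
          assume "\<beta> < \<alpha> i" "\<beta>' < \<alpha> i"
          then show ?thesis using b(3) inj by (simp add: y_def inj_eq)
        next
          assume "\<beta> < \<alpha> i" "\<not> \<beta>' < \<alpha> i"
          then show ?thesis using b(3) zi[OF b(2)] xF[of i \<beta> i] by (simp add: y_def)
        next
          assume "\<not> \<beta> < \<alpha> i" "\<beta>' < \<alpha> i"
          then show ?thesis using b(3) zi[OF b(1)] xF[of i \<beta>' i] by (simp add: y_def)
        next
          assume n: "\<not> \<beta> < \<alpha> i" "\<not> \<beta>' < \<alpha> i"
          then have "z i (\<beta> - \<alpha> i) = z i (\<beta>' - \<alpha> i)" using b(3) by (simp add: y_def)
          then have "\<beta> - \<alpha> i = \<beta>' - \<alpha> i"
            using inj_onD[OF bij_betw_imp_inj_on[OF zb[of i]], of "\<beta> - \<alpha> i" "\<beta>' - \<alpha> i"] b n by simp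
          then show ?thesis using n by simp
        qed
      qed
    qed
    also have "(\<lambda>i. y i ` {..<\<alpha> i + fam_card Z i}) = sup (\<lambda>i. x i ` {..<\<alpha> i}) Z"
    proof
      fix i
      have "{..<\<alpha> i + fam_card Z i} = {..<\<alpha> i} \<union> (\<lambda>\<beta>. \<alpha> i + \<beta>) ` {..<fam_card Z i}"
      proof (intro equalityI subsetI)
        fix \<beta> assume b: "\<beta> \<in> {..<\<alpha> i + fam_card Z i}"
        show "\<beta> \<in> {..<\<alpha> i} \<union> (\<lambda>\<beta>. \<alpha> i + \<beta>) ` {..<fam_card Z i}"
        proof (cases "\<beta> < \<alpha> i")
          case False
          then have "\<beta> = \<alpha> i + (\<beta> - \<alpha> i)" "\<beta> - \<alpha> i < fam_card Z i" using b by auto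
          then show ?thesis by blast
        qed simp
      qed auto
      then have "y i ` {..<\<alpha> i + fam_card Z i} = y i ` {..<\<alpha> i} \<union> (\<lambda>\<beta>. y i (\<alpha> i + \<beta>)) ` {..<fam_card Z i}"
        by (simp add: image_Un image_image)
      also have "\<dots> = x i ` {..<\<alpha> i} \<union> z i ` {..<fam_card Z i}" by (simp add: y_def)
      finally show "y i ` {..<\<alpha> i + fam_card Z i} = sup (\<lambda>i. x i ` {..<\<alpha> i}) Z i"
        using bij_betw_imp_surj_on[OF zb[of i]] by simp
    qed
    finally show ?thesis .
  qed
  note * = hall_fsI[where F = F and f = "\<lambda>W. fs p (sup W Z)", OF F v]
  show "p' \<in> hall_comp \<alpha>" by (rule *(1)) (rule e)
  show "fs p' W = fs p (sup W Z)" if W: "ffam W" "fam_card W = \<alpha>" "avoids (famun Z) W" for W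
    by (rule *(2)[OF _ W(1,2) W(3)[folded F_def]]) (rule e)
qed

lemma partial_evaluation:
  fixes f :: "'i::finite coha"
  assumes f: "f \<in> coha_carrier" and Z: "ffam Z"
  obtains f' where "f' \<in> coha_carrier" "\<And>W. ffam W \<Longrightarrow> avoids (famun Z) W \<Longrightarrow> cv f' W = cv f (sup W Z)"
proof -
  let ?sh = "\<lambda>\<alpha> i. \<alpha> i + fam_card Z i"
  have "\<forall>\<alpha>. \<exists>p'. p' \<in> hall_comp \<alpha> \<and> (\<forall>W. ffam W \<longrightarrow> fam_card W = \<alpha> \<longrightarrow> avoids (famun Z) W \<longrightarrow>
      fs p' W = fs (lookup f (?sh \<alpha>)) (sup W Z))"
  proof
    fix \<alpha>
    obtain p' where "p' \<in> hall_comp \<alpha>"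
      "\<And>W. ffam W \<Longrightarrow> fam_card W = \<alpha> \<Longrightarrow> avoids (famun Z) W \<Longrightarrow> fs p' W = fs (lookup f (?sh \<alpha>)) (sup W Z)"
      using partial_evaluation_poly[OF carrier_lookup[OF f] Z] by blast
    then show "\<exists>p'. p' \<in> hall_comp \<alpha> \<and> (\<forall>W. ffam W \<longrightarrow> fam_card W = \<alpha> \<longrightarrow> avoids (famun Z) W \<longrightarrow>
      fs p' W = fs (lookup f (?sh \<alpha>)) (sup W Z))" by blast
  qed
  from choice[OF this] obtain p' where p': "\<And>\<alpha>. p' \<alpha> \<in> hall_comp \<alpha>"
    "\<And>W. ffam W \<Longrightarrow> avoids (famun Z) W \<Longrightarrow> fs (p' (fam_card W)) W = fs (lookup f (?sh (fam_card W))) (sup W Z)"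
    by blast
  define S where "S = (\<lambda>\<kappa> i. \<kappa> i - fam_card Z i) ` keys f"
  have S: "finite S" by (simp add: S_def)
  define f' where "f' = (\<Sum>\<alpha>\<in>S. single \<alpha> (p' \<alpha>))"
  show ?thesis
  proof
    show "f' \<in> coha_carrier" unfolding f'_def by (rule carrier_sum) (simp add: p'(1))
    fix W :: "'i fam" assume W: "ffam W" "avoids (famun Z) W"
    have "cv f (sup W Z) = fs (lookup f (?sh (fam_card W))) (sup W Z)"
      by (simp add: cv_def fam_card_sup[OF W(1) Z avoids_inf[OF W(2)]])
    moreover have "cv f' W = (if fam_card W \<in> S then fs (p' (fam_card W)) W else 0)"
      using S by (simp add: f'_def cv_single)
    moreover have "lookup f (?sh (fam_card W)) = 0" if "fam_card W \<notin> S"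
    proof (rule ccontr)
      assume "lookup f (?sh (fam_card W)) \<noteq> 0"
      then have "(\<lambda>i. ?sh (fam_card W) i - fam_card Z i) \<in> S" unfolding S_def by (intro imageI) (simp add: in_keys_iff)
      then show False using that by simp
    qed
    ultimately show "cv f' W = cv f (sup W Z)" using p'(2)[OF W] by simp
  qed
qed

context twisted
begin

text \<open>For fixed \<open>Z\<close>, the first factor of a product is a function of \<open>W\<close> once its interaction with \<open>Y\<close> has been multiplied by
  the clearing factor; \<open>factor_right\<close> is the analogue for the second factor.\<close>

lemma factor_left:
  fixes f :: "'i coha"
  assumes f: "f \<in> coha_carrier" and Y: "ffam Y" and Z: "Z \<le> Y" and n: "n > 0"
  shows "\<exists>f'\<in>coha_carrier. \<forall>W. ffam W \<longrightarrow> avoids (famun Y) W \<longrightarrow>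
    cv f' W = mpw (clearing Y n) W * twisted_kern W (Y - Z) * cv f (sup W Z)"
proof -
  have fZ: "ffam Z" "ffam (Y - Z)" using ffam_mono[OF Y Z] Y by auto
  obtain f1 where f1: "f1 \<in> coha_carrier" "\<And>W. ffam W \<Longrightarrow> avoids (famun Z) W \<Longrightarrow> cv f1 W = cv f (sup W Z)"
    using partial_evaluation[OF f fZ(1)] by blast
  obtain q where q: "\<And>W. ffam W \<Longrightarrow> inf W (Y - Z) = bot \<Longrightarrow> mpw (clearing (Y - Z) n) W * kern a W (Y - Z) = mpw q W"
    using kern_mpw[OF fZ(2) n, of a] by blast
  define f' where "f' = smul (\<lambda>\<gamma>. bit_sign (\<psi> (cls \<gamma>) (cls (fam_card (Y - Z))))) (mop q (mop (clearing Z n) f1))"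
  have "f' \<in> coha_carrier" using f1(1) by (simp add: f'_def)
  moreover have "cv f' W = mpw (clearing Y n) W * twisted_kern W (Y - Z) * cv f (sup W Z)" if W: "ffam W" "avoids (famun Y) W" for W
  proof -
    have av: "avoids (famun Z) W" by (rule avoids_mono[OF W(2) Z order_refl])
    have "Y - Z \<le> Y" by (auto simp: le_fun_def)
    then have "inf W (Y - Z) = bot" by (intro avoids_inf avoids_mono[OF W(2) _ order_refl])
    then have e: "mpw q W = mpw (clearing (Y - Z) n) W * kern a W (Y - Z)" using q[OF W(1)] by simp
    show ?thesis
      unfolding f'_def cv_smul cv_mop[OF W(1)] e f1(2)[OF W(1) av] twisted_kern_def mpw_vy_sup[OF Y Z] by (simp only: mult_ac)
  qed
  ultimately show ?thesis by blast
qed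

lemma diff_diff_fam: "Z \<le> Y \<Longrightarrow> Y - (Y - Z) = (Z :: 'i fam)"
  by (auto simp: fun_eq_iff le_fun_def)

lemma diff_le_fam: "Y - Z \<le> (Y :: 'i fam)"
  by (auto simp: le_fun_def)

lemma factor_right:
  fixes f :: "'i coha"
  assumes f: "f \<in> coha_carrier" and Y: "ffam Y" and Z: "Z \<le> Y" and n: "n > 0"
  shows "\<exists>f'\<in>coha_carrier. \<forall>W. ffam W \<longrightarrow> avoids (famun Y) W \<longrightarrow>
    cv f' W = mpw (clearing Y n) W * twisted_kern Z W * cv f (sup W (Y - Z))"
proof -
  obtain f1 where f1: "f1 \<in> coha_carrier" "\<forall>W. ffam W \<longrightarrow> avoids (famun Y) W \<longrightarrow>
    cv f1 W = mpw (clearing Y n) W * twisted_kern W Z * cv f (sup W (Y - Z))"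
    using factor_left[OF f Y diff_le_fam[of Y Z] n] unfolding diff_diff_fam[OF Z] by blast
  have "cv (smul (\<lambda>\<gamma>. bit_sign (dim_par a \<gamma> * par Z)) f1) W = mpw (clearing Y n) W * twisted_kern Z W * cv f (sup W (Y - Z))"
    if W: "ffam W" "avoids (famun Y) W" for W
    using f1(2)[rule_format, OF W] twisted_kern_swap[of Z W] by (simp add: mult_ac)
  then show ?thesis using f1(1) by (intro bexI[of _ "smul (\<lambda>\<gamma>. bit_sign (dim_par a \<gamma> * par Z)) f1"]) auto
qed

definition plus_part :: "'i coha \<Rightarrow> 'i coha" where
  "plus_part f = f - coha_scale (cv f bot) coha_one"

lemma plus_part_Hplus: "f \<in> coha_carrier \<Longrightarrow> plus_part f \<in> Hplus"
  by (simp add: Hplus_iff_cv plus_part_def cv_one)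

lemma cv_plus_part: "ffam W \<Longrightarrow> cv (plus_part f) W = (if W = bot then 0 else cv f W)"
  by (simp add: plus_part_def cv_one)

text \<open>Among the terms of a product, evaluated at \<open>sup W Y\<close>, those which split \<open>W\<close> nontrivially between the
  two factors add up, as a function of \<open>W\<close>, to a decomposable element.\<close>

lemma product_restriction:
  fixes b g :: "'i coha"
  assumes b: "b \<in> coha_carrier" and g: "g \<in> coha_carrier" and Y: "ffam Y" and n: "n > 0"
  shows "\<exists>D\<in>Dec. \<forall>W. ffam W \<longrightarrow> W \<noteq> bot \<longrightarrow> avoids (famun Y) W \<longrightarrow>
    mpw (clearing Y n) W * cv (b \<star> g) (sup W Y) = cv D W +
      mpw (clearing Y n) W * (\<Sum>Z\<in>{..Y}. twisted_kern (sup W Z) (Y - Z) * cv b (sup W Z) * cv g (Y - Z)) +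
      mpw (clearing Y n) W * (\<Sum>Z\<in>{..Y}. twisted_kern Z (sup W (Y - Z)) * cv b Z * cv g (sup W (Y - Z)))"
proof -
  have "\<forall>Z. \<exists>f'. Z \<le> Y \<longrightarrow> f' \<in> coha_carrier \<and> (\<forall>W. ffam W \<longrightarrow> avoids (famun Y) W \<longrightarrow>
      cv f' W = mpw (clearing Y n) W * twisted_kern W (Y - Z) * cv b (sup W Z))"
    using factor_left[OF b Y _ n] by blast
  from choice[OF this] obtain f' where f': "\<And>Z. Z \<le> Y \<Longrightarrow> f' Z \<in> coha_carrier"
    "\<And>Z W. Z \<le> Y \<Longrightarrow> ffam W \<Longrightarrow> avoids (famun Y) W \<Longrightarrow> cv (f' Z) W = mpw (clearing Y n) W * twisted_kern W (Y - Z) * cv b (sup W Z)"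
    by blast
  have "\<forall>Z. \<exists>f'. Z \<le> Y \<longrightarrow> f' \<in> coha_carrier \<and> (\<forall>W. ffam W \<longrightarrow> avoids (famun Y) W \<longrightarrow>
      cv f' W = mpw (clearing Y n) W * twisted_kern Z W * cv g (sup W (Y - Z)))"
    using factor_right[OF g Y _ n] by blast
  from choice[OF this] obtain g' where g': "\<And>Z. Z \<le> Y \<Longrightarrow> g' Z \<in> coha_carrier"
    "\<And>Z W. Z \<le> Y \<Longrightarrow> ffam W \<Longrightarrow> avoids (famun Y) W \<Longrightarrow> cv (g' Z) W = mpw (clearing Y n) W * twisted_kern Z W * cv g (sup W (Y - Z))"
    by blast
  define D where "D = (\<Sum>Z\<in>{..Y}. coha_scale (twisted_kern Z (Y - Z)) (plus_part (f' Z) \<star> plus_part (g' Z)))"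
  have D: "D \<in> Dec"
    unfolding D_def using f'(1) g'(1)
    by (intro coha.subspace_sum[OF Dec_subspace] coha.subspace_scale[OF Dec_subspace] mul_Dec plus_part_Hplus) auto
  have "mpw (clearing Y n) W * cv (b \<star> g) (sup W Y) = cv D W +
      mpw (clearing Y n) W * (\<Sum>Z\<in>{..Y}. twisted_kern (sup W Z) (Y - Z) * cv b (sup W Z) * cv g (Y - Z)) +
      mpw (clearing Y n) W * (\<Sum>Z\<in>{..Y}. twisted_kern Z (sup W (Y - Z)) * cv b Z * cv g (sup W (Y - Z)))"
    if W: "ffam W" "W \<noteq> bot" "avoids (famun Y) W" for W
  proof -
    let ?m = "mpw (clearing Y n)"
    define t where "t A Z = twisted_kern (sup A Z) (sup (W - A) (Y - Z)) * cv b (sup A Z) * cv g (sup (W - A) (Y - Z))" for A Z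
    have WY: "inf W Y = bot" by (rule avoids_inf[OF W(3)])
    then have dis: "W i \<inter> Y i = {}" for i by (simp add: fun_eq_iff)
    have fin: "finite {..W}" "finite {..Y}" using finite_subfams W(1) Y by auto
    have "cv (b \<star> g) (sup W Y) = (\<Sum>A\<in>{..sup W Y}. twisted_kern A (sup W Y - A) * cv b A * cv g (sup W Y - A))"
      using W(1) Y by (intro cv_mul[OF b g]) simp
    also have "\<dots> = (\<Sum>(Z, A)\<in>{..Y} \<times> {..W}. t A Z)"
    proof (rule sum.reindex_bij_witness[where i = "\<lambda>(Z, A). sup A Z" and j = "\<lambda>B. (inf B Y, inf B W)"])
      fix B assume "B \<in> {..sup W Y}"
      then have B: "B i \<subseteq> W i \<union> Y i" for i by (simp add: le_fun_def)
      have 1: "sup (inf B W) (inf B Y) = B"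
      proof
        fix i show "sup (inf B W) (inf B Y) i = B i" using B[of i] by auto
      qed
      then show "(case (inf B Y, inf B W) of (Z, A) \<Rightarrow> sup A Z) = B" by simp
      show "(inf B Y, inf B W) \<in> {..Y} \<times> {..W}" by simp
      have "sup (W - inf B W) (Y - inf B Y) = sup W Y - B"
      proof
        fix i show "sup (W - inf B W) (Y - inf B Y) i = (sup W Y - B) i" using B[of i] dis[of i] by auto
      qed
      then show "(case (inf B Y, inf B W) of (Z, A) \<Rightarrow> t A Z) = twisted_kern B (sup W Y - B) * cv b B * cv g (sup W Y - B)"
        by (simp add: t_def 1)
    next
      fix x assume "x \<in> {..Y} \<times> {..W}"
      then obtain Z A where x: "x = (Z, A)" "Z \<le> Y" "A \<le> W" by auto
      have s: "Z i \<subseteq> Y i" "A i \<subseteq> W i" for i using x(2,3) by (auto simp: le_fun_def)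
      have "inf (sup A Z) Y = Z"
      proof
        fix i show "inf (sup A Z) Y i = Z i" using s[of i] dis[of i] by auto
      qed
      moreover have "inf (sup A Z) W = A"
      proof
        fix i show "inf (sup A Z) W i = A i" using s[of i] dis[of i] by auto
      qed
      ultimately show "(inf (case x of (Z, A) \<Rightarrow> sup A Z) Y, inf (case x of (Z, A) \<Rightarrow> sup A Z) W) = x"
        by (simp add: x(1))
      show "(case x of (Z, A) \<Rightarrow> sup A Z) \<in> {..sup W Y}" using x by (simp add: le_supI1 le_supI2)
    qed
    also have "\<dots> = (\<Sum>Z\<in>{..Y}. \<Sum>A\<in>{..W}. t A Z)" by (rule sum.cartesian_product[symmetric])
    finally have total: "cv (b \<star> g) (sup W Y) = (\<Sum>Z\<in>{..Y}. \<Sum>A\<in>{..W}. t A Z)" .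
    have one: "?m W * (\<Sum>A\<in>{..W}. t A Z) = twisted_kern Z (Y - Z) * cv (plus_part (f' Z) \<star> plus_part (g' Z)) W + ?m W * t W Z + ?m W * t bot Z"
      if "Z \<in> {..Y}" for Z
    proof -
      have Z: "Z \<le> Y" "ffam Z" "ffam (Y - Z)" using that ffam_mono[OF Y] Y by auto
      define u where "u A = twisted_kern A (W - A) * cv (plus_part (f' Z)) A * cv (plus_part (g' Z)) (W - A)" for A
      have u: "cv (plus_part (f' Z) \<star> plus_part (g' Z)) W = (\<Sum>A\<in>{..W}. u A)"
        unfolding u_def using plus_part_Hplus f'(1)[OF Z(1)] g'(1)[OF Z(1)] Hplus_carrier
        by (intro cv_mul W(1)) blast+
      have WW: "W - W = bot" "W - bot = W" by (auto simp: fun_eq_iff)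
      have edge: "u bot = 0" "u W = 0" using W(1) by (simp_all add: u_def cv_plus_part WW)
      have mid: "?m W * t A Z = twisted_kern Z (Y - Z) * u A" if A: "A \<in> {..W}" "A \<noteq> bot" "A \<noteq> W" for A
      proof -
        have A': "A \<le> W" "ffam A" "ffam (W - A)" "W - A \<noteq> bot" "W - A \<le> W"
          using A ffam_mono[OF W(1)] W(1) by (auto simp: le_fun_def fun_eq_iff)
        have av: "avoids (famun Y) A" "avoids (famun Y) (W - A)" "avoids (famun Z) A" "avoids (famun (Y - Z)) (W - A)"
          by (rule avoids_mono[OF W(3)]; use A'(1,5) Z(1) diff_le_fam in simp)+
        have s1: "twisted_kern (sup A Z) (sup (W - A) (Y - Z)) = (twisted_kern A (W - A) * twisted_kern A (Y - Z)) * (twisted_kern Z (W - A) * twisted_kern Z (Y - Z))"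
          using twisted_kern_sup_left[OF A'(2) Z(2) avoids_inf[OF av(3)]] twisted_kern_sup_right[OF A'(3) Z(3) avoids_inf[OF av(4)]] by simp
        have m: "?m W = ?m A * ?m (W - A)"
          using mpw_sup[OF A'(2,3) inf_diff, of "clearing Y n"] diff_sup[OF A'(1)] by simp
        show ?thesis
          using A(2) A' f'(2)[OF Z(1) A'(2) av(1)] g'(2)[OF Z(1) A'(3) av(2)]
          by (simp add: t_def u_def cv_plus_part s1 m mult_ac)
      qed
      have "(\<Sum>A\<in>{..W}. ?m W * t A Z - twisted_kern Z (Y - Z) * u A) = (\<Sum>A\<in>{bot, W}. ?m W * t A Z - twisted_kern Z (Y - Z) * u A)"
        by (rule sum.mono_neutral_right) (use fin mid in auto)
      also have "\<dots> = ?m W * t bot Z + ?m W * t W Z" using W(2) edge by simp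
      finally have "?m W * (\<Sum>A\<in>{..W}. t A Z) - twisted_kern Z (Y - Z) * (\<Sum>A\<in>{..W}. u A) = ?m W * t bot Z + ?m W * t W Z"
        by (simp only: sum_subtractf sum_distrib_left)
      then show ?thesis unfolding u by linarith
    qed
    have "?m W * cv (b \<star> g) (sup W Y) = (\<Sum>Z\<in>{..Y}. twisted_kern Z (Y - Z) * cv (plus_part (f' Z) \<star> plus_part (g' Z)) W + ?m W * t W Z + ?m W * t bot Z)"
      unfolding total sum_distrib_left[of "?m W" _ "{..Y}"] by (rule sum.cong[OF refl one])
    also have "\<dots> = cv D W + ?m W * (\<Sum>Z\<in>{..Y}. t W Z) + ?m W * (\<Sum>Z\<in>{..Y}. t bot Z)"
      by (simp add: sum.distrib sum_distrib_left D_def)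
    finally have result: "?m W * cv (b \<star> g) (sup W Y) = cv D W + ?m W * (\<Sum>Z\<in>{..Y}. t W Z) + ?m W * (\<Sum>Z\<in>{..Y}. t bot Z)" .
    have WW: "W - W = bot" "W - bot = W" by (auto simp: fun_eq_iff)
    show ?thesis using result unfolding t_def WW sup_bot_left .
  qed
  then show ?thesis using D by blast
qed

end

section \<open>Derivatives of relations\<close>

definition dim_size :: "'i::finite dimvec \<Rightarrow> nat" where
  "dim_size \<gamma> = (\<Sum>i\<in>UNIV. \<gamma> i)"

text \<open>The rational identities behind the induction step of \<open>word_restriction\<close>.\<close>

lemma split_term:
  fixes m m1 m2 tz tzw tzy cb g d t1 t2 S s qv e twy :: rat
  assumes "m = m1 * m2" "tz = tzw * tzy" "m2 * g = d + m2 * t2 * S" "m1 * tzw = s * qv" "tzw = e * t1" "twy = t1 * t2"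
  shows "m * (tz * cb * g) = s * cb * tzy * (qv * d) + m * twy * (e * (tzy * cb * S))"
proof -
  have 1: "m * (tz * cb * g) = (m1 * tzw) * (cb * tzy) * (m2 * g)"
    unfolding assms(1,2) by (simp only: mult_ac)
  have 2: "(m1 * tzw) * (cb * tzy) * (m2 * t2 * S) = m * twy * (e * (tzy * cb * S))"
    unfolding assms(1,5,6) by (simp only: mult_ac)
  have 3: "(m1 * tzw) * (cb * tzy) * d = s * cb * tzy * (qv * d)"
    unfolding assms(4) by (simp only: mult_ac)
  show ?thesis unfolding 1 assms(3) distrib_left 2 3 ..
qed

lemma split_sum:
  fixes m t :: rat and f E :: "'z \<Rightarrow> rat" and x e :: "'c \<Rightarrow> rat" and g :: "'z \<Rightarrow> 'c \<Rightarrow> rat"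
  assumes "\<And>Z. Z \<in> A \<Longrightarrow> m * f Z = E Z + m * t * (\<Sum>c\<in>C. x c * (e c * g Z c))"
  shows "m * (\<Sum>Z\<in>A. f Z) = (\<Sum>Z\<in>A. E Z) + m * t * (\<Sum>c\<in>C. x c * (e c * (\<Sum>Z\<in>A. g Z c)))"
proof -
  have 1: "m * (\<Sum>Z\<in>A. f Z) = (\<Sum>Z\<in>A. E Z + m * t * (\<Sum>c\<in>C. x c * (e c * g Z c)))"
    unfolding sum_distrib_left[of m f A] by (rule sum.cong[OF refl assms])
  have 2: "(\<Sum>Z\<in>A. \<Sum>c\<in>C. x c * (e c * g Z c)) = (\<Sum>c\<in>C. x c * (e c * (\<Sum>Z\<in>A. g Z c)))"
    unfolding sum_distrib_left by (rule sum.swap)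
  have 3: "(\<Sum>Z\<in>A. m * t * (\<Sum>c\<in>C. x c * (e c * g Z c))) = m * t * (\<Sum>Z\<in>A. \<Sum>c\<in>C. x c * (e c * g Z c))"
    by (rule sum_distrib_left[symmetric])
  show ?thesis unfolding 1 sum.distrib 3 2 ..
qed

lemma split_total:
  fixes m t L d P Q D :: rat and x i j :: "'c \<Rightarrow> rat"
  assumes "L = d + m * P + m * Q" "P = t * (\<Sum>c\<in>C. x c * i c)" "m * Q = D + m * t * (\<Sum>c\<in>C. x c * j c)"
  shows "L = (d + D) + m * t * (\<Sum>c\<in>C. x c * (i c + j c))"
proof -
  have "(\<Sum>c\<in>C. x c * (i c + j c)) = (\<Sum>c\<in>C. x c * i c) + (\<Sum>c\<in>C. x c * j c)"
    by (simp only: distrib_left sum.distrib)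
  then have "m * t * (\<Sum>c\<in>C. x c * (i c + j c)) = m * P + m * t * (\<Sum>c\<in>C. x c * j c)"
    unfolding assms(2) by (simp only: distrib_left mult.assoc)
  then show ?thesis using assms(1,3) by linarith
qed

text \<open>Letters are the elements of a homogeneous basis of the space of generators.\<close>

locale twisted_basis = twisted_prim a \<psi> Bp for a :: "'i::finite quiver" and \<psi> Bp +
  fixes B :: "'i coha set"
  assumes B_homogeneous: "b \<in> B \<Longrightarrow> \<exists>\<gamma> k. b \<in> coha_bideg a \<gamma> k"
    and B_independent: "coha.independent B" and B_span: "coha.span B = V"
begin

lemma B_V: "b \<in> B \<Longrightarrow> b \<in> V"
  using coha.span_base B_span by blast

lemma B_Hplus: "b \<in> B \<Longrightarrow> b \<in> Hplus"
  using B_V V_Hplus by blast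

lemma B_carrier [simp]: "b \<in> B \<Longrightarrow> b \<in> coha_carrier"
  using B_Hplus Hplus_carrier by blast

definition letter_dim :: "'i coha \<Rightarrow> 'i dimvec" where
  "letter_dim b = the_elem (keys b)"

lemma keys_B: "b \<in> B \<Longrightarrow> keys b = {letter_dim b}"
proof -
  assume b: "b \<in> B"
  then have "b \<noteq> 0" using B_independent coha.dependent_zero[of B] by auto
  moreover obtain \<gamma> k where "b \<in> coha_bideg a \<gamma> k" using B_homogeneous[OF b] by blast
  ultimately have "keys b = {\<gamma>}" unfolding bideg_iff_keys by (simp add: subset_singleton_iff)
  then show ?thesis by (simp add: letter_dim_def)
qed

lemma letter_dim_nonzero: "b \<in> B \<Longrightarrow> letter_dim b \<noteq> (\<lambda>_. 0)"
proof
  assume b: "b \<in> B" "letter_dim b = (\<lambda>_. 0)"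
  have "lookup b (\<lambda>_. 0) = 0" using B_Hplus[OF b(1)] unfolding Hplus_def mem_Collect_eq by (elim conjE)
  moreover have "(\<lambda>_. 0) \<in> keys b" unfolding keys_B[OF b(1)] b(2) by (rule singletonI)
  ultimately show False by (simp only: in_keys_iff)
qed

lemma cv_B: "b \<in> B \<Longrightarrow> cv b P \<noteq> 0 \<Longrightarrow> fam_card P = letter_dim b"
proof (rule ccontr)
  assume b: "b \<in> B" "cv b P \<noteq> 0" and "fam_card P \<noteq> letter_dim b"
  then have "fam_card P \<notin> keys b" by (simp only: keys_B singleton_iff not_False_eq_True)
  then have "lookup b (fam_card P) = 0" by (simp only: in_keys_iff not_not)
  then have "cv b P = 0" by (simp only: cv_def fs_simps)
  then show False using b(2) by (rule notE[rotated])
qed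

definition eval_word :: "'i coha list \<Rightarrow> 'i coha" where
  "eval_word w = foldr (\<star>) w coha_one"

lemma eval_word_simps [simp]: "eval_word [] = coha_one" "eval_word (b # w) = b \<star> eval_word w"
  by (simp_all add: eval_word_def)

lemma eval_word_carrier [simp]: "set w \<subseteq> coha_carrier \<Longrightarrow> eval_word w \<in> coha_carrier"
  by (induction w) auto

text \<open>The sum over the occurrences of \<open>c\<close> of the word without this occurrence, with the sign from moving \<open>c\<close> to the front.\<close>

primrec word_deriv :: "'i coha \<Rightarrow> 'i coha list \<Rightarrow> 'i coha" where
  "word_deriv c [] = 0"
| "word_deriv c (b # w) = (if b = c then eval_word w else 0) +
     coha_scale (bit_sign (dim_par a (letter_dim b) * dim_par a (letter_dim c))) (b \<star> word_deriv c w)"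

lemma word_deriv_carrier [simp]: "set w \<subseteq> coha_carrier \<Longrightarrow> word_deriv c w \<in> coha_carrier"
  by (induction w) auto

text \<open>The value of a word at \<open>sup W Y\<close>, as a function of \<open>W\<close>, up to a decomposable error \<open>D\<close>. The exponent \<open>n\<close> of the
  clearing factor may be increased, which allows a common choice for several words.\<close>

definition restricts :: "'i dimvec \<Rightarrow> 'i coha set \<Rightarrow> nat \<Rightarrow> 'i coha list \<Rightarrow> 'i fam \<Rightarrow> 'i coha \<Rightarrow> bool" where
  "restricts \<gamma> C n w Y D \<longleftrightarrow> D \<in> Dec \<and> (\<forall>W. ffam W \<longrightarrow> fam_card W = \<gamma> \<longrightarrow> avoids (famun Y) W \<longrightarrow>
     mpw (clearing Y n) W * cv (eval_word w) (sup W Y) =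
       cv D W + mpw (clearing Y n) W * twisted_kern W Y * (\<Sum>c\<in>C. cv c W * cv (word_deriv c w) Y))"

lemma restrictsD:
  assumes "restricts \<gamma> C n w Y D"
  shows "D \<in> Dec" "ffam W \<Longrightarrow> fam_card W = \<gamma> \<Longrightarrow> avoids (famun Y) W \<Longrightarrow>
     mpw (clearing Y n) W * cv (eval_word w) (sup W Y) =
       cv D W + mpw (clearing Y n) W * twisted_kern W Y * (\<Sum>c\<in>C. cv c W * cv (word_deriv c w) Y)"
proof -
  note r = assms[unfolded restricts_def]
  show "D \<in> Dec" by (rule conjunct1[OF r])
  show "ffam W \<Longrightarrow> fam_card W = \<gamma> \<Longrightarrow> avoids (famun Y) W \<Longrightarrow>
     mpw (clearing Y n) W * cv (eval_word w) (sup W Y) =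
       cv D W + mpw (clearing Y n) W * twisted_kern W Y * (\<Sum>c\<in>C. cv c W * cv (word_deriv c w) Y)"
    by (rule conjunct2[OF r, rule_format])
qed

lemma restricts_mono:
  assumes "restricts \<gamma> C n w Y D" "n \<le> n'"
  shows "\<exists>D'. restricts \<gamma> C n' w Y D'"
proof -
  obtain m where m: "n' = n + m" using assms(2) le_Suc_ex by blast
  have "restricts \<gamma> C n' w Y (mop (clearing Y m) D)"
    unfolding restricts_def
  proof (intro conjI allI impI)
    show "mop (clearing Y m) D \<in> Dec" by (rule mop_Dec[OF restrictsD(1)[OF assms(1)]])
    fix W assume W: "ffam W" "fam_card W = \<gamma>" "avoids (famun Y) W"
    have "mpw (clearing Y n) W * cv (eval_word w) (sup W Y) =
       cv D W + mpw (clearing Y n) W * twisted_kern W Y * (\<Sum>c\<in>C. cv c W * cv (word_deriv c w) Y)"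
      by (rule restrictsD(2)[OF assms(1) W])
    then have "mpw (clearing Y m) W * (mpw (clearing Y n) W * cv (eval_word w) (sup W Y)) =
       mpw (clearing Y m) W * (cv D W + mpw (clearing Y n) W * twisted_kern W Y * (\<Sum>c\<in>C. cv c W * cv (word_deriv c w) Y))" by (rule arg_cong)
    then show "mpw (clearing Y n') W * cv (eval_word w) (sup W Y) =
       cv (mop (clearing Y m) D) W + mpw (clearing Y n') W * twisted_kern W Y * (\<Sum>c\<in>C. cv c W * cv (word_deriv c w) Y)"
      unfolding m mpw_vy_add cv_mop[OF W(1)] by (simp only: distrib_left mult.assoc)
  qed
  then show ?thesis by (rule exI)
qed

end

context twisted_basis begin

text \<open>Modulo decomposable elements in \<open>W\<close>, a word without letters larger than \<open>\<gamma>\<close> restricts to the sum of its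
  derivatives with respect to the letters of dimension vector \<open>\<gamma>\<close>.\<close>

lemma word_restriction:
  assumes C: "finite C" "C \<subseteq> B" "\<And>c. c \<in> C \<Longrightarrow> letter_dim c = \<gamma>" and \<gamma>: "\<gamma> \<noteq> (\<lambda>_. 0)"
    and w: "set w \<subseteq> B" "\<And>b. b \<in> set w \<Longrightarrow> letter_dim b = \<gamma> \<Longrightarrow> b \<in> C" "\<And>b. b \<in> set w \<Longrightarrow> dim_size (letter_dim b) \<le> dim_size \<gamma>"
    and Y: "ffam Y"
  shows "\<exists>n>0. \<exists>D. restricts \<gamma> C n w Y D"
  using w Y
proof (induction w arbitrary: Y)
  case Nil
  have "restricts \<gamma> C 1 [] Y 0"
    unfolding restricts_def
  proof (intro conjI allI impI)
    show "0 \<in> Dec" by (rule coha.subspace_0[OF Dec_subspace])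
    fix W :: "'i fam" assume W: "ffam W" "fam_card W = \<gamma>"
    have "W \<noteq> bot" using W(2) \<gamma> by auto
    have "sup W Y \<noteq> bot"
    proof
      assume "sup W Y = bot"
      then have "W \<le> bot" using sup_ge1[of W Y] by (simp only:)
      then have "W = bot" by (rule le_bot)
      with \<open>W \<noteq> bot\<close> show False ..
    qed
    then have "cv (eval_word []) (sup W Y) = 0" using \<open>sup W Y \<noteq> bot\<close>
      by (simp only: eval_word_simps cv_one ffam_sup W(1) Nil(4) if_False simp_thms)
    then show "mpw (clearing Y 1) W * cv (eval_word []) (sup W Y) =
       cv 0 W + mpw (clearing Y 1) W * twisted_kern W Y * (\<Sum>c\<in>C. cv c W * cv (word_deriv c []) Y)"
      by simp
  qed
  then show ?case by (intro exI[of _ 1]) auto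
next
  case (Cons b w)
  have b: "b \<in> B" "b \<in> coha_carrier" and wB: "set w \<subseteq> B" using Cons.prems(1) by auto
  then have wc: "set w \<subseteq> coha_carrier" by auto
  have "\<forall>Z. \<exists>n D. restricts \<gamma> C n w (Y - Z) D"
  proof
    fix Z
    have "\<exists>n>0. \<exists>D. restricts \<gamma> C n w (Y - Z) D"
    proof (rule Cons.IH[OF wB])
      show "letter_dim x = \<gamma> \<Longrightarrow> x \<in> C" "dim_size (letter_dim x) \<le> dim_size \<gamma>" if "x \<in> set w" for x
        using Cons.prems(2,3)[of x] that by auto
    qed (rule ffam_diff[OF Cons.prems(4)])
    then show "\<exists>n D. restricts \<gamma> C n w (Y - Z) D" by blast
  qed
  from choice[OF this] obtain nn where nn: "\<forall>Z. \<exists>D. restricts \<gamma> C (nn Z) w (Y - Z) D" by (elim exE)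
  define n where "n = Suc (\<Sum>Z\<in>{..Y}. nn Z)"
  have fin: "finite {..Y}" by (rule finite_subfams[OF Cons.prems(4)])
  have "\<forall>Z. \<exists>D. Z \<le> Y \<longrightarrow> restricts \<gamma> C n w (Y - Z) D"
  proof (intro allI)
    fix Z
    show "\<exists>D. Z \<le> Y \<longrightarrow> restricts \<gamma> C n w (Y - Z) D"
    proof (cases "Z \<le> Y")
      case True
      then have "nn Z \<le> (\<Sum>Z\<in>{..Y}. nn Z)" using fin by (intro member_le_sum) auto
      then have le: "nn Z \<le> n" by (simp add: n_def)
      obtain D0 where "restricts \<gamma> C (nn Z) w (Y - Z) D0" using nn[rule_format, of Z] by (elim exE)
      from restricts_mono[OF this le] show ?thesis by (elim exE) (intro exI impI)
    qed auto
  qed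
  from choice[OF this] obtain DD where DD: "\<And>Z. Z \<le> Y \<Longrightarrow> restricts \<gamma> C n w (Y - Z) (DD Z)" by blast
  have n0: "n > 0" by (simp add: n_def)
  have "\<forall>Z. \<exists>q. Z \<le> Y \<longrightarrow> (\<forall>W. ffam W \<longrightarrow> inf W Z = bot \<longrightarrow> mpw (clearing Z n) W * kern a W Z = mpw q W)"
  proof (intro allI)
    fix Z
    show "\<exists>q. Z \<le> Y \<longrightarrow> (\<forall>W. ffam W \<longrightarrow> inf W Z = bot \<longrightarrow> mpw (clearing Z n) W * kern a W Z = mpw q W)"
    proof (cases "Z \<le> Y")
      case True
      from kern_mpw[OF ffam_mono[OF Cons.prems(4) True] n0, of a] show ?thesis
        by (elim exE conjE) (intro exI impI)
    qed simp
  qed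
  from choice[OF this] obtain q where q: "\<And>Z W. Z \<le> Y \<Longrightarrow> ffam W \<Longrightarrow> inf W Z = bot \<Longrightarrow> mpw (clearing Z n) W * kern a W Z = mpw (q Z) W"
    by blast
  from product_restriction[OF b(2) eval_word_carrier[OF wc] Cons.prems(4) n0]
  obtain D1 where D1: "D1 \<in> Dec" and D1': "\<forall>W. ffam W \<longrightarrow> W \<noteq> bot \<longrightarrow> avoids (famun Y) W \<longrightarrow>
    mpw (clearing Y n) W * cv (b \<star> eval_word w) (sup W Y) = cv D1 W +
      mpw (clearing Y n) W * (\<Sum>Z\<in>{..Y}. twisted_kern (sup W Z) (Y - Z) * cv b (sup W Z) * cv (eval_word w) (Y - Z)) +
      mpw (clearing Y n) W * (\<Sum>Z\<in>{..Y}. twisted_kern Z (sup W (Y - Z)) * cv b Z * cv (eval_word w) (sup W (Y - Z)))"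
    by (rule bexE)
  define s where "s Z = bit_sign (dim_par a \<gamma> * par Z) * bit_sign (\<psi> (cls \<gamma>) (cls (fam_card Z)))" for Z
  define EE where "EE Z = coha_scale (s Z * cv b Z * twisted_kern Z (Y - Z)) (mop (q Z) (DD Z))" for Z
  define D where "D = D1 + (\<Sum>Z\<in>{..Y}. EE Z)"
  have "EE Z \<in> Dec" if "Z \<in> {..Y}" for Z
    using restrictsD(1)[OF DD[of Z]] that unfolding EE_def by (intro coha.subspace_scale[OF Dec_subspace] mop_Dec) simp
  then have "D \<in> Dec"
    unfolding D_def by (intro coha.subspace_add[OF Dec_subspace] coha.subspace_sum[OF Dec_subspace] D1)
  moreover have "mpw (clearing Y n) W * cv (eval_word (b # w)) (sup W Y) =
      cv D W + mpw (clearing Y n) W * twisted_kern W Y * (\<Sum>c\<in>C. cv c W * cv (word_deriv c (b # w)) Y)"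
    if W: "ffam W" "fam_card W = \<gamma>" "avoids (famun Y) W" for W
  proof -
    let ?m = "mpw (clearing Y n) W"
    have Wbot: "W \<noteq> bot" using W(2) \<gamma> by auto
    \<comment> \<open>\<open>W\<close> goes into the first letter: by maximality of \<open>\<gamma>\<close>, that letter then takes nothing of \<open>Y\<close>.\<close>
    have first: "(\<Sum>Z\<in>{..Y}. twisted_kern (sup W Z) (Y - Z) * cv b (sup W Z) * cv (eval_word w) (Y - Z)) =
        twisted_kern W Y * (\<Sum>c\<in>C. cv c W * (if b = c then cv (eval_word w) Y else 0))"
    proof -
      have "cv b (sup W Z) = 0" if Z: "Z \<in> {..Y}" "Z \<noteq> bot" for Z
      proof (rule ccontr)
        assume "cv b (sup W Z) \<noteq> 0"
        then have "fam_card (sup W Z) = letter_dim b" by (rule cv_B[OF b(1)])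
        moreover have fZ: "ffam Z" using Z ffam_mono[OF Cons.prems(4)] by auto
        moreover have "inf W Z = bot" by (rule avoids_inf[OF avoids_mono[OF W(3) _ order_refl]]) (use Z(1) in simp)
        ultimately have "letter_dim b = (\<lambda>i. \<gamma> i + fam_card Z i)" using fam_card_sup[OF W(1) fZ] W(2) by simp
        then have "dim_size (letter_dim b) = dim_size \<gamma> + dim_size (fam_card Z)" by (simp add: dim_size_def sum.distrib)
        then have "dim_size (fam_card Z) = 0" using Cons.prems(3)[of b] by simp
        then have "fam_card Z = (\<lambda>_. 0)" by (simp add: dim_size_def fun_eq_iff)
        then show False using fam_card_eq_0[OF fZ] Z(2) by simp
      qed
      then have "(\<Sum>Z\<in>{..Y}. twisted_kern (sup W Z) (Y - Z) * cv b (sup W Z) * cv (eval_word w) (Y - Z)) =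
          (\<Sum>Z\<in>{bot}. twisted_kern (sup W Z) (Y - Z) * cv b (sup W Z) * cv (eval_word w) (Y - Z))"
        using fin by (intro sum.mono_neutral_right) auto
      also have "\<dots> = twisted_kern W Y * (cv b W * cv (eval_word w) Y)"
      proof -
        have "Y - bot = Y" by (simp add: fun_eq_iff)
        then show ?thesis by (simp add: mult.assoc)
      qed
      also have "cv b W * cv (eval_word w) Y = (\<Sum>c\<in>C. cv c W * (if b = c then cv (eval_word w) Y else 0))"
      proof (cases "b \<in> C")
        case True
        have "(\<Sum>c\<in>C. cv c W * (if b = c then cv (eval_word w) Y else 0)) = (\<Sum>c\<in>C. if c = b then cv b W * cv (eval_word w) Y else 0)"
          by (intro sum.cong refl) auto
        then show ?thesis using True C(1) by simp
      next
        case False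
        then have "letter_dim b \<noteq> \<gamma>" using Cons.prems(2)[of b] by auto
        then have "cv b W = 0" using cv_B[OF b(1), of W] W(2) by auto
        moreover have "(\<Sum>c\<in>C. cv c W * (if b = c then cv (eval_word w) Y else 0)) = 0"
          using False by (intro sum.neutral) auto
        ultimately show ?thesis by simp
      qed
      finally show ?thesis .
    qed
    \<comment> \<open>\<open>W\<close> goes into the rest of the word, to which the induction hypothesis applies.\<close>
    have second: "?m * (twisted_kern Z (sup W (Y - Z)) * cv b Z * cv (eval_word w) (sup W (Y - Z))) =
        cv (EE Z) W + ?m * twisted_kern W Y * (\<Sum>c\<in>C. cv c W * (bit_sign (dim_par a (letter_dim b) * dim_par a (letter_dim c)) *
          (twisted_kern Z (Y - Z) * cv b Z * cv (word_deriv c w) (Y - Z))))" if Z: "Z \<in> {..Y}" for Z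
    proof (cases "cv b Z = 0")
      case True
      then show ?thesis by (simp add: EE_def)
    next
      case False
      have fZ: "Z \<le> Y" "ffam Z" "ffam (Y - Z)" using Z ffam_mono[OF Cons.prems(4)] Cons.prems(4) by auto
      have av: "avoids (famun Z) W" "avoids (famun (Y - Z)) W"
        using avoids_mono[OF W(3) fZ(1) order_refl] avoids_mono[OF W(3) diff_le_fam order_refl] by auto
      have m: "?m = mpw (clearing Z n) W * mpw (clearing (Y - Z) n) W" by (rule mpw_vy_sup[OF Cons.prems(4) fZ(1)])
      have "inf (Y - Z) Z = bot" "inf Z (Y - Z) = bot" by (auto simp: fun_eq_iff)
      then have tkWY: "twisted_kern W Y = twisted_kern W Z * twisted_kern W (Y - Z)"
        using twisted_kern_sup_right[OF fZ(2,3), of W] diff_sup[OF fZ(1)] by simp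
      have tkZ: "twisted_kern Z (sup W (Y - Z)) = twisted_kern Z W * twisted_kern Z (Y - Z)"
        by (rule twisted_kern_sup_right[OF W(1) fZ(3) avoids_inf[OF av(2)]])
      have sw: "twisted_kern Z W = bit_sign (dim_par a \<gamma> * par Z) * twisted_kern W Z" using twisted_kern_swap[of Z W] W(2) by simp
      have swk: "twisted_kern Z W = s Z * kern a W Z" unfolding sw by (simp add: s_def twisted_kern_def W(2))
      have parZ: "par Z = dim_par a (letter_dim b)" using cv_B[OF b(1) False] by simp
      let ?S = "\<Sum>c\<in>C. cv c W * cv (word_deriv c w) (Y - Z)"
      have R: "mpw (clearing (Y - Z) n) W * cv (eval_word w) (sup W (Y - Z)) =
          cv (DD Z) W + mpw (clearing (Y - Z) n) W * twisted_kern W (Y - Z) * ?S"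
        by (rule restrictsD(2)[OF DD[OF fZ(1)] W(1,2) av(2)])
      have sq: "mpw (clearing Z n) W * twisted_kern Z W = s Z * mpw (q Z) W"
        unfolding swk q[OF fZ(1) W(1) avoids_inf[OF av(1)], symmetric] by (rule mult.left_commute)
      have E: "cv (EE Z) W = s Z * cv b Z * twisted_kern Z (Y - Z) * (mpw (q Z) W * cv (DD Z) W)"
        by (simp only: EE_def cv_scale cv_mop[OF W(1)])
      have e4: "bit_sign (dim_par a \<gamma> * par Z) * (twisted_kern Z (Y - Z) * cv b Z * ?S) =
          (\<Sum>c\<in>C. cv c W * (bit_sign (dim_par a (letter_dim b) * dim_par a (letter_dim c)) * (twisted_kern Z (Y - Z) * cv b Z * cv (word_deriv c w) (Y - Z))))"
        unfolding sum_distrib_left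
      proof (rule sum.cong[OF refl])
        fix c assume "c \<in> C"
        then have gc: "letter_dim c = \<gamma>" by (rule C(3))
        show "bit_sign (dim_par a \<gamma> * par Z) * (twisted_kern Z (Y - Z) * cv b Z * (cv c W * cv (word_deriv c w) (Y - Z))) =
          cv c W * (bit_sign (dim_par a (letter_dim b) * dim_par a (letter_dim c)) * (twisted_kern Z (Y - Z) * cv b Z * cv (word_deriv c w) (Y - Z)))"
          unfolding parZ gc mult.commute[of "dim_par a \<gamma>"] by (simp only: mult_ac)
      qed
      show ?thesis
        unfolding E e4[symmetric] by (rule split_term[OF m tkZ R sq sw tkWY])
    qed
    have word_deriv_sum: "cv (word_deriv c (b # w)) Y = (if b = c then cv (eval_word w) Y else 0) +
        bit_sign (dim_par a (letter_dim b) * dim_par a (letter_dim c)) * (\<Sum>Z\<in>{..Y}. twisted_kern Z (Y - Z) * cv b Z * cv (word_deriv c w) (Y - Z))" for c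
      using cv_mul[OF b(2) word_deriv_carrier[OF wc] Cons.prems(4), of c] by simp
    have sec: "?m * (\<Sum>Z\<in>{..Y}. twisted_kern Z (sup W (Y - Z)) * cv b Z * cv (eval_word w) (sup W (Y - Z))) =
        (\<Sum>Z\<in>{..Y}. cv (EE Z) W) + ?m * twisted_kern W Y * (\<Sum>c\<in>C. cv c W * (bit_sign (dim_par a (letter_dim b) * dim_par a (letter_dim c)) *
          (\<Sum>Z\<in>{..Y}. twisted_kern Z (Y - Z) * cv b Z * cv (word_deriv c w) (Y - Z))))"
      by (rule split_sum[OF second])
    have D_eq: "cv D W = cv D1 W + (\<Sum>Z\<in>{..Y}. cv (EE Z) W)" by (simp add: D_def)
    show ?thesis
      unfolding eval_word_simps D_eq word_deriv_sum
      by (rule split_total[OF D1'[rule_format, OF W(1) Wbot W(3)] first sec])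
  qed
  ultimately have "restricts \<gamma> C n (b # w) Y D" unfolding restricts_def by simp
  then show ?case using n0 by (intro exI[of _ n] exI[of _ D] conjI)
qed

end

context twisted_basis
begin

lemma single_lookup_Dec: "f \<in> Dec \<Longrightarrow> single \<gamma> (lookup f \<gamma>) \<in> Dec"
proof (rule subspace_cmpI[OF Dec_subspace])
  fix \<delta> k assume f: "f \<in> Dec"
  have "cmp a \<delta> k (single \<gamma> (lookup f \<gamma>)) = (if \<delta> = \<gamma> then cmp a \<gamma> k f else 0)"
    by (intro poly_mapping_eqI) (simp add: lookup_cmp lookup_single)
  then show "cmp a \<delta> k (single \<gamma> (lookup f \<gamma>)) \<in> Dec"
    using cmp_Dec[OF f, of \<gamma> k] coha.subspace_0[OF Dec_subspace] by (simp split: if_splits)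
qed

text \<open>By restriction, for every \<open>Y\<close> the linear combination of the letters \<open>c\<close> of dimension vector \<open>\<gamma>\<close> with the values
  at \<open>Y\<close> of the derivatives as coefficients becomes decomposable when it is multiplied by a kernel factor. That factor is
  nonzero at the origin if \<open>Y\<close> avoids \<open>0\<close>, so it can be cancelled; the combination lies in \<open>V\<close> and in \<open>Dec\<close>, and its coefficients vanish.\<close>

lemma derivative_relation:
  fixes Ws :: "'i coha list set" and k :: "'i coha list \<Rightarrow> rat"
  assumes Ws: "finite Ws" "\<And>w. w \<in> Ws \<Longrightarrow> set w \<subseteq> B" "\<And>w b. w \<in> Ws \<Longrightarrow> b \<in> set w \<Longrightarrow> dim_size (letter_dim b) \<le> dim_size \<gamma>"
    and rel: "(\<Sum>w\<in>Ws. coha_scale (k w) (eval_word w)) = 0" and c: "c \<in> B" "letter_dim c = \<gamma>"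
  shows "(\<Sum>w\<in>Ws. coha_scale (k w) (word_deriv c w)) = 0"
proof -
  have \<gamma>: "\<gamma> \<noteq> (\<lambda>_. 0)" using letter_dim_nonzero[OF c(1)] unfolding c(2) .
  define C where "C = insert c {b \<in> \<Union>(set ` Ws). letter_dim b = \<gamma>}"
  have C: "finite C" "C \<subseteq> B" "\<And>b. b \<in> C \<Longrightarrow> letter_dim b = \<gamma>" and Cw: "\<And>w b. w \<in> Ws \<Longrightarrow> b \<in> set w \<Longrightarrow> letter_dim b = \<gamma> \<Longrightarrow> b \<in> C"
    and cC: "c \<in> C"
    using Ws(1,2) c unfolding C_def by (auto intro!: finite_subset[OF Collect_subset])
  have wc: "w \<in> Ws \<Longrightarrow> set w \<subseteq> coha_carrier" for w using Ws(2) B_carrier by blast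
  define dv where "dv e = (\<Sum>w\<in>Ws. coha_scale (k w) (word_deriv e w))" for e
  have dvc: "dv e \<in> coha_carrier" for e
    unfolding dv_def by (intro carrier_sum carrier_simps word_deriv_carrier wc)
  have "dv c = 0"
  proof (rule cv_ext[of "{0}"])
    fix Y :: "'i fam" assume Y: "ffam Y" "avoids {0} Y"
    have "\<forall>w. \<exists>n. w \<in> Ws \<longrightarrow> n > 0 \<and> (\<exists>D. restricts \<gamma> C n w Y D)"
    proof (intro allI)
      fix w
      show "\<exists>n. w \<in> Ws \<longrightarrow> n > 0 \<and> (\<exists>D. restricts \<gamma> C n w Y D)"
      proof (cases "w \<in> Ws")
        case True
        have "\<exists>n>0. \<exists>D. restricts \<gamma> C n w Y D"
        proof (rule word_restriction[OF C(1,2) _ \<gamma> Ws(2)[OF True] _ _ Y(1)])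
          show "letter_dim b = \<gamma>" if "b \<in> C" for b by (rule C(3)[OF that])
          show "b \<in> C" if "b \<in> set w" "letter_dim b = \<gamma>" for b by (rule Cw[OF True that])
          show "dim_size (letter_dim b) \<le> dim_size \<gamma>" if "b \<in> set w" for b by (rule Ws(3)[OF True that])
        qed
        then show ?thesis by (elim exE conjE) (intro exI conjI impI)
      qed simp
    qed
    from choice[OF this] obtain nn where nn: "\<forall>w. w \<in> Ws \<longrightarrow> nn w > 0 \<and> (\<exists>D. restricts \<gamma> C (nn w) w Y D)" by (elim exE)
    define n where "n = Suc (\<Sum>w\<in>Ws. nn w)"
    have n0: "n > 0" by (simp add: n_def)
    have "\<forall>w. \<exists>D. w \<in> Ws \<longrightarrow> restricts \<gamma> C n w Y D"
    proof (intro allI)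
      fix w
      show "\<exists>D. w \<in> Ws \<longrightarrow> restricts \<gamma> C n w Y D"
      proof (cases "w \<in> Ws")
        case True
        then have "nn w \<le> (\<Sum>w\<in>Ws. nn w)" using Ws(1) by (intro member_le_sum) auto
        then have le: "nn w \<le> n" by (simp add: n_def)
        have "\<exists>D. restricts \<gamma> C (nn w) w Y D" by (rule conjunct2[OF nn[rule_format, OF True]])
        then obtain D0 where "restricts \<gamma> C (nn w) w Y D0" by (elim exE)
        from restricts_mono[OF this le] show ?thesis by (elim exE) (intro exI impI)
      qed auto
    qed
    from choice[OF this] obtain DD where DD': "\<forall>w. w \<in> Ws \<longrightarrow> restricts \<gamma> C n w Y (DD w)" by (elim exE)
    have DD: "restricts \<gamma> C n w Y (DD w)" if "w \<in> Ws" for w by (rule DD'[rule_format, OF that])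
    define D where "D = (\<Sum>w\<in>Ws. coha_scale (k w) (DD w))"
    have D: "D \<in> Dec"
      unfolding D_def by (intro coha.subspace_sum[OF Dec_subspace] coha.subspace_scale[OF Dec_subspace] restrictsD(1)[OF DD])
    \<comment> \<open>The vanishing of this combination of letters is what has to be shown.\<close>
    define U where "U = (\<Sum>b\<in>C. coha_scale (cv (dv b) Y) b)"
    have "\<forall>i. 0 \<notin> Y i" using Y(2) by (auto simp: avoids_def)
    with kern_mpw[OF Y(1) n0, of a] obtain q where
      q: "\<And>W. ffam W \<Longrightarrow> inf W Y = bot \<Longrightarrow> mpw (clearing Y n) W * kern a W Y = mpw q W" and q0: "\<And>i. poly (q i) 0 \<noteq> 0"
      by blast
    define s where "s = bit_sign (\<psi> (cls \<gamma>) (cls (fam_card Y)))"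
    have key: "0 = cv D W + s * (mpw q W * cv U W)" if W: "ffam W" "fam_card W = \<gamma>" "avoids (famun Y) W" for W
    proof -
      let ?m = "mpw (clearing Y n) W"
      have cvU: "cv U W = (\<Sum>b\<in>C. cv b W * cv (dv b) Y)" unfolding U_def cv_simps cv_scale by (simp only: mult.commute)
      have dvb: "cv (dv b) Y = (\<Sum>w\<in>Ws. k w * cv (word_deriv b w) Y)" for b unfolding dv_def by (simp only: cv_simps cv_scale)
      have "0 = ?m * cv (\<Sum>w\<in>Ws. coha_scale (k w) (eval_word w)) (sup W Y)" unfolding rel by (simp only: cv_simps mult_zero_right)
      also have "\<dots> = (\<Sum>w\<in>Ws. k w * (?m * cv (eval_word w) (sup W Y)))"
        unfolding cv_simps cv_scale sum_distrib_left by (intro sum.cong refl mult.left_commute)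
      also have "\<dots> = (\<Sum>w\<in>Ws. k w * (cv (DD w) W + ?m * twisted_kern W Y * (\<Sum>b\<in>C. cv b W * cv (word_deriv b w) Y)))"
        by (intro sum.cong refl arg_cong2[of _ _ _ _ "(*)"] restrictsD(2)[OF DD W])
      also have "\<dots> = (\<Sum>w\<in>Ws. k w * cv (DD w) W) + ?m * twisted_kern W Y * (\<Sum>w\<in>Ws. \<Sum>b\<in>C. cv b W * (k w * cv (word_deriv b w) Y))"
        by (simp add: distrib_left sum.distrib sum_distrib_left mult_ac)
      also have "(\<Sum>w\<in>Ws. \<Sum>b\<in>C. cv b W * (k w * cv (word_deriv b w) Y)) = cv U W"
        unfolding cvU dvb sum_distrib_left by (rule sum.swap)
      also have "(\<Sum>w\<in>Ws. k w * cv (DD w) W) = cv D W" unfolding D_def by (simp only: cv_simps cv_scale)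
      also have "?m * twisted_kern W Y = s * mpw q W"
        unfolding q[OF W(1) avoids_inf[OF W(3)], symmetric] twisted_kern_def W(2) s_def by (rule mult.left_commute)
      finally show ?thesis by (simp only: mult.assoc)
    qed
    have Uc: "U \<in> coha_carrier"
      unfolding U_def using C(2) by (intro carrier_sum carrier_simps B_carrier) auto
    have kU: "keys U \<subseteq> {\<gamma>}"
    proof
      fix \<delta> assume \<delta>: "\<delta> \<in> keys U"
      show "\<delta> \<in> {\<gamma>}"
      proof (rule ccontr)
        assume "\<delta> \<notin> {\<gamma>}"
        then have "lookup b \<delta> = 0" if "b \<in> C" for b
          using keys_B[of b] C(2,3) that in_keys_iff[of \<delta> b] by auto
        then have "lookup U \<delta> = 0" unfolding U_def lookup_sum lookup_scale by (intro sum.neutral ballI) simp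
        then show False using \<delta> by (simp add: in_keys_iff)
      qed
    qed
    have "mop q U = coha_scale (- s) (single \<gamma> (lookup D \<gamma>))"
    proof (rule cv_ext[OF finite_famun[OF Y(1)]])
      show "mop q U \<in> coha_carrier" by (rule mop_carrier[OF Uc])
      show "coha_scale (- s) (single \<gamma> (lookup D \<gamma>)) \<in> coha_carrier"
        by (intro carrier_simps Hplus_carrier subsetD[OF Dec_Hplus] single_lookup_Dec D)
      fix P :: "'i fam" assume P: "ffam P" "avoids (famun Y) P"
      show "cv (mop q U) P = cv (coha_scale (- s) (single \<gamma> (lookup D \<gamma>))) P"
      proof (cases "fam_card P = \<gamma>")
        case True
        have e: "cv (single \<gamma> (lookup D \<gamma>)) P = cv D P" unfolding cv_single by (simp add: True cv_def)
        have "s * s = 1" by (simp add: s_def)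
        have "- s * cv D P = s * s * (mpw q P * cv U P)" 
        proof -
          have "cv D P = - (s * (mpw q P * cv U P))" using key[OF P(1) True P(2)] by linarith
          then show ?thesis by simp
        qed
        then show ?thesis unfolding cv_mop[OF P(1)] cv_scale e \<open>s * s = 1\<close> by simp
      next
        case False
        then have "lookup U (fam_card P) = 0" using kU in_keys_iff[of "fam_card P" U] by auto
        then have "cv U P = 0" unfolding cv_def by (simp only: fs_simps)
        then show ?thesis unfolding cv_mop[OF P(1)] cv_scale cv_single using False by simp
      qed
    qed
    then have "mop q U \<in> Dec"
      using coha.subspace_scale[OF Dec_subspace single_lookup_Dec[OF D, of \<gamma>], of "- s"] by (simp only:)
    then have "U \<in> Dec" by (rule mop_Dec_cancel[OF Uc kU q0])
    moreover have "U \<in> V"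
      unfolding U_def using C(2) B_V by (intro coha.subspace_sum[OF V_subspace] coha.subspace_scale[OF V_subspace]) auto
    ultimately have "U = 0" by (rule V_Dec[rotated])
    then have "cv (dv c) Y = 0"
      unfolding U_def by (rule coha.independentD[OF B_independent C(1,2) _ cC])
    then show "cv (dv c) Y = cv 0 Y" by simp
  qed (rule dvc | simp)+
  then show ?thesis unfolding dv_def .
qed

end

section \<open>Freeness\<close>

text \<open>With this monoid structure, the free algebra is a subring of the convolution ring of finitely supported functions.\<close>

instantiation list :: (type) monoid_add
begin

definition "0 = ([] :: 'a list)"

definition "u + w = u @ (w :: 'a list)"

instance by standard (simp_all add: zero_list_def plus_list_def)

end

definition words_over :: "'h set \<Rightarrow> ('h list \<Rightarrow>\<^sub>0 rat) set" where
  "words_over V = {t. \<forall>w\<in>keys t. set w \<subseteq> V}"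

abbreviation wd :: "'h list \<Rightarrow> 'h list \<Rightarrow>\<^sub>0 rat" where "wd w \<equiv> single w 1"

abbreviation con :: "rat \<Rightarrow> 'h list \<Rightarrow>\<^sub>0 rat" where "con c \<equiv> single [] c"

lemma single_times: "single u c * single w d = (single (u @ w) (c * d) :: 'h list \<Rightarrow>\<^sub>0 rat)"
  by (simp add: mult_single plus_list_def)

lemma con_1: "con 1 = 1"
  by (metis single_one zero_list_def)

lemma con_commute: "con c * t = t * (con c :: 'h list \<Rightarrow>\<^sub>0 rat)"
proof -
  have "con c * (\<Sum>w\<in>keys t. single w (lookup t w)) = (\<Sum>w\<in>keys t. single w (lookup t w)) * con c"
    unfolding sum_distrib_left sum_distrib_right single_times by (simp add: mult.commute)
  then show ?thesis unfolding poly_mapping_sum_single[symmetric] .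
qed

lemma free_mult_eq: "(\<Sum>u\<in>keys s. \<Sum>w\<in>keys t. single (u @ w) (lookup s u * lookup t w)) = s * (t :: 'h list \<Rightarrow>\<^sub>0 rat)"
proof -
  have "(\<Sum>u\<in>keys s. single u (lookup s u)) * (\<Sum>w\<in>keys t. single w (lookup t w)) =
      (\<Sum>u\<in>keys s. \<Sum>w\<in>keys t. single (u @ w) (lookup s u * lookup t w))"
    unfolding sum_product single_times ..
  then show ?thesis unfolding poly_mapping_sum_single[symmetric] by (rule sym)
qed

lemma free_algebra_simps [simp]:
  "carrier (free_algebra V) = words_over V" "mult (free_algebra V) = (*)" "one (free_algebra V) = 1"
  "zero (free_algebra V) = 0" "add (free_algebra V) = (+)"
  unfolding free_algebra_def words_over_def by (simp_all add: free_mult_eq con_1)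

lemma words_over_simps [simp]:
  "0 \<in> words_over V" "con c \<in> words_over V" "1 \<in> words_over V"
  "s \<in> words_over V \<Longrightarrow> t \<in> words_over V \<Longrightarrow> s + t \<in> words_over V" "s \<in> words_over V \<Longrightarrow> t \<in> words_over V \<Longrightarrow> s - t \<in> words_over V"
  "s \<in> words_over V \<Longrightarrow> t \<in> words_over V \<Longrightarrow> s * t \<in> words_over V" "s \<in> words_over V \<Longrightarrow> - s \<in> words_over V"
  "set w \<subseteq> V \<Longrightarrow> single w c \<in> words_over V"
proof -
  show 0: "0 \<in> words_over V" "set w \<subseteq> V \<Longrightarrow> single w c \<in> words_over V" for w c by (auto simp: words_over_def)
  show "con c \<in> words_over V" by (auto simp: words_over_def)
  then show "1 \<in> words_over V" using 0(2)[of "[]" 1] by (simp add: con_1)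
  show "s \<in> words_over V \<Longrightarrow> t \<in> words_over V \<Longrightarrow> s + t \<in> words_over V" for s t using Poly_Mapping.keys_add[of s t] by (auto simp: words_over_def)
  show "s \<in> words_over V \<Longrightarrow> t \<in> words_over V \<Longrightarrow> s - t \<in> words_over V" for s t using keys_diff[of s t] by (auto simp: words_over_def)
  show "s \<in> words_over V \<Longrightarrow> - s \<in> words_over V" by (auto simp: words_over_def)
  assume "s \<in> words_over V" "t \<in> words_over V"
  then show "s * t \<in> words_over V" using keys_mult[of s t] unfolding words_over_def plus_list_def by fastforce
qed

lemma words_over_sum: "(\<And>x. x \<in> A \<Longrightarrow> f x \<in> words_over V) \<Longrightarrow> sum f A \<in> words_over V"
  by (induction A rule: infinite_finite_induct) auto

lemma words_over_mono: "A \<subseteq> V \<Longrightarrow> t \<in> words_over A \<Longrightarrow> t \<in> words_over V"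
  by (auto simp: words_over_def)

lemma ring_free_algebra: "ring (free_algebra V)"
proof (rule ringI)
  show "abelian_group (free_algebra V)"
  proof (rule abelian_groupI)
    fix x assume "x \<in> carrier (free_algebra V)"
    then show "\<exists>y\<in>carrier (free_algebra V). y \<oplus>\<^bsub>free_algebra V\<^esub> x = \<zero>\<^bsub>free_algebra V\<^esub>"
      by (intro bexI[of _ "- x"]) auto
  qed (auto simp: add.assoc add.commute)
  show "monoid (free_algebra V)" by (rule monoidI) (auto simp: mult.assoc)
qed (auto simp: algebra_simps)

context twisted
begin

lemma ring_twisted_coha: "ring (twisted_coha a \<psi>)"
proof (rule ringI)
  show "abelian_group (twisted_coha a \<psi>)"
  proof (rule abelian_groupI)
    fix x assume x: "x \<in> carrier (twisted_coha a \<psi>)"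
    then have "0 - x \<in> coha_carrier" unfolding twisted_coha_def by (intro carrier_simps) simp
    then show "\<exists>y\<in>carrier (twisted_coha a \<psi>). y \<oplus>\<^bsub>twisted_coha a \<psi>\<^esub> x = \<zero>\<^bsub>twisted_coha a \<psi>\<^esub>"
      by (intro bexI[of _ "0 - x"]) (simp_all add: twisted_coha_def)
  qed (simp_all add: twisted_coha_def add.assoc add.commute)
  show "monoid (twisted_coha a \<psi>)" by (rule monoidI) (simp_all add: twisted_coha_def mul_assoc)
qed (simp_all add: twisted_coha_def mul_add_left mul_add_right)

end

context twisted_basis
begin

abbreviation "ew \<equiv> eval_words a \<psi>"

lemma ew_superset: "finite A \<Longrightarrow> keys t \<subseteq> A \<Longrightarrow> ew t = (\<Sum>w\<in>A. coha_scale (lookup t w) (eval_word w))"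
  unfolding eval_words_def eval_word_def[symmetric]
  by (rule sum.mono_neutral_left) (auto simp: in_keys_iff)

lemma ew_add: "ew (s + t) = ew s + ew t"
proof -
  have f: "finite (keys s \<union> keys t)" by simp
  show ?thesis
    unfolding ew_superset[OF f Poly_Mapping.keys_add] ew_superset[OF f Un_upper1] ew_superset[OF f Un_upper2]
    by (simp only: lookup_add coha.scale_left_distrib sum.distrib)
qed

lemma ew_single: "ew (single w c) = coha_scale c (eval_word w)"
  using ew_superset[of "{w}" "single w c"] by simp

lemma ew_0: "ew 0 = 0"
  using ew_superset[of "{}" 0] by simp

lemma ew_sum: "ew (sum f A) = (\<Sum>x\<in>A. ew (f x))"
  by (induction A rule: infinite_finite_induct) (simp_all add: ew_0 ew_add)

lemma ew_diff: "ew (s - t) = ew s - ew t"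
  using ew_add[of "s - t" t] by simp

lemma V_carrier: "V \<subseteq> coha_carrier"
  using V_Hplus Hplus_carrier by blast

lemma B_sub_V: "B \<subseteq> V"
  using B_V by blast

lemma eval_word_V: "set w \<subseteq> V \<Longrightarrow> eval_word w \<in> coha_carrier"
  using V_carrier by (intro eval_word_carrier) blast

lemma ew_carrier: "t \<in> words_over V \<Longrightarrow> ew t \<in> coha_carrier"
  unfolding ew_superset[OF finite_keys order_refl] words_over_def by (intro carrier_sum carrier_simps eval_word_V) auto

lemma eval_word_append: "set u \<subseteq> coha_carrier \<Longrightarrow> set w \<subseteq> coha_carrier \<Longrightarrow> eval_word (u @ w) = eval_word u \<star> eval_word w"
  by (induction u) (simp_all add: mul_assoc)

lemma ew_mult:
  assumes s: "s \<in> words_over V" and t: "t \<in> words_over V"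
  shows "ew (s * t) = ew s \<star> ew t"
proof -
  have su: "set u \<subseteq> V" if "u \<in> keys s" for u using s that by (auto simp: words_over_def)
  have tw: "set w \<subseteq> V" if "w \<in> keys t" for w using t that by (auto simp: words_over_def)
  have "ew s \<star> ew t = (\<Sum>u\<in>keys s. coha_scale (lookup s u) (eval_word u)) \<star> (\<Sum>w\<in>keys t. coha_scale (lookup t w) (eval_word w))"
    unfolding ew_superset[OF finite_keys order_refl] ..
  also have "\<dots> = (\<Sum>u\<in>keys s. coha_scale (lookup s u) (eval_word u) \<star> (\<Sum>w\<in>keys t. coha_scale (lookup t w) (eval_word w)))"
    by (rule mul_sum_left) (intro carrier_simps carrier_sum eval_word_V su tw, assumption)+
  also have "\<dots> = (\<Sum>u\<in>keys s. \<Sum>w\<in>keys t. coha_scale (lookup s u) (eval_word u) \<star> coha_scale (lookup t w) (eval_word w))"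
    by (intro sum.cong refl mul_sum_right carrier_simps eval_word_V su tw)
  also have "\<dots> = (\<Sum>u\<in>keys s. \<Sum>w\<in>keys t. ew (single (u @ w) (lookup s u * lookup t w)))"
  proof (intro sum.cong refl)
    fix u w assume "u \<in> keys s" "w \<in> keys t"
    then have c: "eval_word u \<in> coha_carrier" "eval_word w \<in> coha_carrier" "set u \<subseteq> coha_carrier" "set w \<subseteq> coha_carrier"
      using eval_word_V su tw V_carrier by blast+
    show "coha_scale (lookup s u) (eval_word u) \<star> coha_scale (lookup t w) (eval_word w) = ew (single (u @ w) (lookup s u * lookup t w))"
      unfolding ew_single eval_word_append[OF c(3,4)] by (simp add: mul_scale c)
  qed
  also have "\<dots> = ew (s * t)" unfolding ew_sum[symmetric] free_mult_eq ..
  finally show ?thesis by (rule sym)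
qed

definition relation_ideal :: "('i coha list \<Rightarrow>\<^sub>0 rat) set" where
  "relation_ideal = Idl\<^bsub>free_algebra V\<^esub> (supercomm_relations a V)"

lemma relations_FA: "supercomm_relations a V \<subseteq> words_over V"
  unfolding supercomm_relations_def
  by (auto intro!: words_over_simps coha.subspace_add[OF V_subspace] coha.subspace_scale[OF V_subspace])

lemma relation_ideal_ideal: "ideal relation_ideal (free_algebra V)"
  unfolding relation_ideal_def using relations_FA by (intro ring.genideal_ideal[OF ring_free_algebra]) simp

lemma relations_RI: "supercomm_relations a V \<subseteq> relation_ideal"
  unfolding relation_ideal_def using relations_FA by (intro ring.genideal_self[OF ring_free_algebra]) simp

lemma relation_ideal_FA: "t \<in> relation_ideal \<Longrightarrow> t \<in> words_over V"
  using ideal.Icarr[OF relation_ideal_ideal] by simp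

lemma relation_ideal_0: "0 \<in> relation_ideal"
  using additive_subgroup.zero_closed[OF ideal.axioms(1)[OF relation_ideal_ideal]] by simp

lemma relation_ideal_add: "s \<in> relation_ideal \<Longrightarrow> t \<in> relation_ideal \<Longrightarrow> s + t \<in> relation_ideal"
  using additive_subgroup.a_closed[OF ideal.axioms(1)[OF relation_ideal_ideal]] by simp

lemma relation_ideal_lmult: "s \<in> relation_ideal \<Longrightarrow> t \<in> words_over V \<Longrightarrow> t * s \<in> relation_ideal"
  using ideal.I_l_closed[OF relation_ideal_ideal] by simp

lemma relation_ideal_rmult: "s \<in> relation_ideal \<Longrightarrow> t \<in> words_over V \<Longrightarrow> s * t \<in> relation_ideal"
  using ideal.I_r_closed[OF relation_ideal_ideal] by simp

lemma con_minus: "con (- 1) * t = - (t :: 'h list \<Rightarrow>\<^sub>0 rat)"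
proof -
  have "con (- 1) = - (1 :: 'h list \<Rightarrow>\<^sub>0 rat)" unfolding con_1[symmetric] by (rule single_uminus)
  then show ?thesis by simp
qed

lemma relation_ideal_diff: "s \<in> relation_ideal \<Longrightarrow> t \<in> relation_ideal \<Longrightarrow> s - t \<in> relation_ideal"
  using relation_ideal_add[of s "- t"] relation_ideal_lmult[of t "con (- 1)"] unfolding con_minus by simp

lemma relation_ideal_sum: "(\<And>x. x \<in> A \<Longrightarrow> f x \<in> relation_ideal) \<Longrightarrow> sum f A \<in> relation_ideal"
  by (induction A rule: infinite_finite_induct) (auto simp: relation_ideal_0 intro: relation_ideal_add)

lemma bit_sign_parity:
  assumes "u \<in> coha_bideg a \<gamma> k" "v \<in> coha_bideg a \<delta> l" "u \<noteq> 0" "v \<noteq> 0"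
  shows "(- 1) powi (k * l) = bit_sign (dim_par a \<gamma> * dim_par a \<delta>)" "odd k \<longleftrightarrow> dim_par a \<gamma> = 1"
proof -
  have e: "(of_int k :: bit) = dim_par a \<gamma>" if "u \<in> coha_bideg a \<gamma> k" "u \<noteq> 0" for u :: "'i coha" and \<gamma> k
  proof -
    have "keys u \<noteq> {}" using that(2) by simp
    then have "\<gamma> \<in> keys u" using that(1) unfolding bideg_iff_keys by blast
    then have "lookup u \<gamma> \<noteq> 0" by (simp add: in_keys_iff)
    then obtain m where "m \<in> keys (lookup u \<gamma>)" by (metis keys_eq_empty ex_in_conv)
    then have "k = 2 * int (mono_degree m) + euler_dim a \<gamma>" using that(1) unfolding bideg_iff_keys by auto
    then show ?thesis by (simp add: dim_par_def euler_dim_def of_int_bit_eq)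
  qed
  note ek = e[OF assms(1,3)] and el = e[OF assms(2,4)]
  show "(- 1) powi (k * l) = bit_sign (dim_par a \<gamma> * dim_par a \<delta>)"
    unfolding ek[symmetric] el[symmetric] of_int_bit_eq bit_sign_def by (auto simp: power_int_minus_left)
  show "odd k \<longleftrightarrow> dim_par a \<gamma> = 1" unfolding ek[symmetric] of_int_bit_eq by simp
qed

lemma super_commute:
  assumes "u \<in> coha_bideg a \<gamma> k" "v \<in> coha_bideg a \<delta> l"
  shows "u \<star> v = coha_scale ((- 1) powi (k * l)) (v \<star> u)"
proof (cases "u = 0 \<or> v = 0")
  case True
  have "u \<in> coha_carrier" "v \<in> coha_carrier" using assms bideg_carrier by blast+
  with True show ?thesis by auto
next
  case False
  have "dim_par a \<rho> = dim_par a \<gamma>" if "\<rho> \<in> keys u" for \<rho> using assms(1) that unfolding bideg_iff_keys by auto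
  moreover have "dim_par a \<rho> = dim_par a \<delta>" if "\<rho> \<in> keys v" for \<rho> using assms(2) that unfolding bideg_iff_keys by auto
  ultimately show ?thesis
    using mul_commute[OF bideg_carrier[OF assms(1)] bideg_carrier[OF assms(2)]] bit_sign_parity(1)[OF assms] False by metis
qed

lemma odd_square:
  assumes "u \<in> coha_bideg a \<gamma> k" "odd k"
  shows "u \<star> u = 0"
proof -
  have "(- 1 :: rat) powi (k * k) = - 1" using assms(2) by (simp add: power_int_minus_left)
  then have "u \<star> u = coha_scale (- 1) (u \<star> u)" using super_commute[OF assms(1,1)] by simp
  then have "coha_scale 1 (u \<star> u) - coha_scale (- 1) (u \<star> u) = 0" by simp
  then have "coha_scale 2 (u \<star> u) = 0" unfolding coha.scale_left_diff_distrib[symmetric] by simp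
  then show ?thesis by (simp add: coha.scale_eq_0_iff)
qed

lemma ew_relation: "r \<in> supercomm_relations a V \<Longrightarrow> ew r = 0"
proof -
  have w1: "eval_word [u] = u" if "u \<in> coha_carrier" for u using that by simp
  have w2: "eval_word [u, v] = u \<star> v" if "u \<in> coha_carrier" "v \<in> coha_carrier" for u v using that by simp
  assume r: "r \<in> supercomm_relations a V"
  then consider
    (add) u v where "r = wd [u + v] - wd [u] - wd [v]" "u \<in> V" "v \<in> V"
  | (scale) c u where "r = wd [coha_scale c u] - single [u] c" "u \<in> V"
  | (comm) u v \<gamma> \<delta> k l where "r = wd [u, v] - single [v, u] ((- 1) powi (k * l))" "u \<in> coha_bideg a \<gamma> k" "v \<in> coha_bideg a \<delta> l"
  | (odd) u \<gamma> k where "r = wd [u, u]" "u \<in> coha_bideg a \<gamma> k" "odd k"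
    unfolding supercomm_relations_def by blast
  then show ?thesis
  proof cases
    case add
    then have "u \<in> coha_carrier" "v \<in> coha_carrier" using V_carrier by auto
    then show ?thesis unfolding add(1) ew_diff ew_single by (simp only: w1 carrier_simps) simp
  next
    case scale
    then have "u \<in> coha_carrier" using V_carrier by auto
    then show ?thesis unfolding scale(1) ew_diff ew_single by (simp only: w1 carrier_simps) simp
  next
    case comm
    note c = bideg_carrier[OF comm(2)] bideg_carrier[OF comm(3)]
    show ?thesis unfolding comm(1) ew_diff ew_single w2[OF c] w2[OF c(2,1)] super_commute[OF comm(2,3)] by simp
  next
    case odd
    note c = bideg_carrier[OF odd(2)]
    show ?thesis unfolding odd(1) ew_single w2[OF c c] odd_square[OF odd(2,3)] by simp
  qed
qed

lemma ew_ring_hom: "ring_hom_ring (free_algebra V) (twisted_coha a \<psi>) ew"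
proof (rule ring_hom_ringI[OF ring_free_algebra ring_twisted_coha])
  show "ew \<one>\<^bsub>free_algebra V\<^esub> = \<one>\<^bsub>twisted_coha a \<psi>\<^esub>"
    unfolding free_algebra_simps con_1[symmetric] ew_single by (simp add: twisted_coha_def)
qed (simp_all add: twisted_coha_def ew_carrier ew_mult ew_add)

lemma relation_ideal_kernel: "t \<in> relation_ideal \<Longrightarrow> ew t = 0"
proof -
  let ?K = "a_kernel (free_algebra V) (twisted_coha a \<psi>) ew"
  have K: "?K = {t \<in> words_over V. ew t = 0}" unfolding a_kernel_def' by (simp add: twisted_coha_def)
  have "relation_ideal \<subseteq> ?K"
    unfolding relation_ideal_def
  proof (rule ring.genideal_minimal[OF ring_free_algebra])
    show "ideal ?K (free_algebra V)" by (rule ring_hom_ring.kernel_is_ideal[OF ew_ring_hom])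
    show "supercomm_relations a V \<subseteq> ?K" unfolding K using relations_FA ew_relation by blast
  qed
  then show "t \<in> relation_ideal \<Longrightarrow> ew t = 0" unfolding K by blast
qed

end

context twisted_basis
begin

text \<open>The lift of \<open>word_deriv\<close> to the free algebra.\<close>

primrec formal_deriv :: "'i coha \<Rightarrow> 'i coha list \<Rightarrow> ('i coha list \<Rightarrow>\<^sub>0 rat)" where
  "formal_deriv c [] = 0"
| "formal_deriv c (b # w) = (if b = c then wd w else 0) +
     single [b] (bit_sign (dim_par a (letter_dim b) * dim_par a (letter_dim c))) * formal_deriv c w"

lemma formal_deriv_keys: "u \<in> keys (formal_deriv c w) \<Longrightarrow> set u \<subseteq> set w \<and> length u < length w"
proof (induction w arbitrary: u)
  case Nil then show ?case by simp
next
  case (Cons b w)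
  let ?s = "bit_sign (dim_par a (letter_dim b) * dim_par a (letter_dim c))"
  have "u \<in> keys (if b = c then wd w else 0) \<union> keys (single [b] ?s * formal_deriv c w)"
    using Cons.prems unfolding formal_deriv.simps by (rule subsetD[OF Poly_Mapping.keys_add])
  then consider "u = w" | "u \<in> keys (single [b] ?s * formal_deriv c w)" by (auto split: if_splits)
  then show ?case
  proof cases
    case 2
    then obtain p r where "u = p + r" "p \<in> keys (single [b] ?s)" "r \<in> keys (formal_deriv c w)"
      using keys_mult[of "single [b] ?s" "formal_deriv c w"] by blast
    then have "u = b # r" "set r \<subseteq> set w" "length r < length w"
      using Cons.IH[of r] by (auto simp: plus_list_def split: if_splits)
    then show ?thesis by auto
  qed auto
qed

lemma formal_deriv_FA: "set w \<subseteq> B \<Longrightarrow> formal_deriv c w \<in> words_over B"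
  using formal_deriv_keys unfolding words_over_def by blast

lemma words_over_B_V: "t \<in> words_over B \<Longrightarrow> t \<in> words_over V"
  by (rule words_over_mono[OF B_sub_V])

lemma ew_con: "t \<in> words_over V \<Longrightarrow> ew (con x * t) = coha_scale x (ew t)"
  by (subst ew_mult) (simp_all add: ew_single mul_scale ew_carrier)

lemma ew_fder: "set w \<subseteq> B \<Longrightarrow> ew (formal_deriv c w) = word_deriv c w"
proof (induction w)
  case Nil then show ?case by (simp add: ew_0)
next
  case (Cons b w)
  have b: "b \<in> B" "b \<in> coha_carrier" and w: "set w \<subseteq> B" "set w \<subseteq> coha_carrier" using Cons.prems by auto
  let ?s = "bit_sign (dim_par a (letter_dim b) * dim_par a (letter_dim c))"
  have "single [b] ?s \<in> words_over V" using B_V[OF b(1)] by (intro words_over_simps) simp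
  then have "ew (single [b] ?s * formal_deriv c w) = ew (single [b] ?s) \<star> ew (formal_deriv c w)"
    by (rule ew_mult[OF _ words_over_B_V[OF formal_deriv_FA[OF w(1)]]])
  also have "\<dots> = coha_scale ?s (b \<star> word_deriv c w)"
    unfolding ew_single Cons.IH[OF w(1)] using b(2) w(2) by (simp add: mul_scale)
  finally show ?case by (simp add: ew_add ew_single ew_0)
qed

definition mu :: "'i dimvec \<Rightarrow> 'i coha list \<Rightarrow> nat" where
  "mu \<gamma> w = length (filter (\<lambda>b. letter_dim b = \<gamma>) w)"

lemma B_bideg: assumes "b \<in> B" shows "\<exists>k. b \<in> coha_bideg a (letter_dim b) k"
proof -
  obtain \<gamma> k where b: "b \<in> coha_bideg a \<gamma> k" using B_homogeneous[OF assms] by blast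
  then have "keys b \<subseteq> {\<gamma>}" unfolding bideg_iff_keys by blast
  then have "letter_dim b = \<gamma>" using keys_B[OF assms] by simp
  with b show ?thesis by blast
qed

lemma letters_commute:
  assumes b: "b \<in> B" and c: "c \<in> B"
  defines "s \<equiv> bit_sign (dim_par a (letter_dim b) * dim_par a (letter_dim c))"
  shows "single [c, b] s - wd [b, c] \<in> relation_ideal"
proof -
  obtain k l where kl: "c \<in> coha_bideg a (letter_dim c) k" "b \<in> coha_bideg a (letter_dim b) l" using B_bideg b c by blast
  have "c \<noteq> 0" "b \<noteq> 0" using keys_B[OF b] keys_B[OF c] by auto
  from bit_sign_parity(1)[OF kl this] have s: "(- 1) powi (k * l) = s" by (simp add: s_def mult.commute)
  have "wd [c, b] - single [b, c] ((- 1) powi (k * l)) \<in> supercomm_relations a V"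
    unfolding supercomm_relations_def using kl B_V[OF b] B_V[OF c] by blast
  then have "wd [c, b] - single [b, c] s \<in> relation_ideal" unfolding s using relations_RI by blast
  then have "con s * (wd [c, b] - single [b, c] s) \<in> relation_ideal" by (rule relation_ideal_lmult) simp
  then show ?thesis by (simp add: right_diff_distrib single_times s_def)
qed

text \<open>The Euler identity: moving each letter \<open>c\<close> back to its place in the word undoes the signs in the derivative.\<close>

lemma euler_words:
  assumes C: "finite C" "C \<subseteq> B" "\<And>c. c \<in> C \<Longrightarrow> letter_dim c = \<gamma>"
  shows "set w \<subseteq> B \<Longrightarrow> (\<And>b. b \<in> set w \<Longrightarrow> letter_dim b = \<gamma> \<Longrightarrow> b \<in> C) \<Longrightarrow>
    (\<Sum>c\<in>C. wd [c] * formal_deriv c w) - single w (of_nat (mu \<gamma> w)) \<in> relation_ideal"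
proof (induction w)
  case Nil then show ?case by (simp add: mu_def relation_ideal_0)
next
  case (Cons b w)
  have b: "b \<in> B" and w: "set w \<subseteq> B" using Cons.prems(1) by auto
  have bC: "b \<in> C \<longleftrightarrow> letter_dim b = \<gamma>" using Cons.prems(2)[of b] C(3) by auto
  define s where "s c = bit_sign (dim_par a (letter_dim b) * dim_par a (letter_dim c))" for c
  have IH: "(\<Sum>c\<in>C. wd [c] * formal_deriv c w) - single w (of_nat (mu \<gamma> w)) \<in> relation_ideal"
    by (rule Cons.IH[OF w]) (use Cons.prems(2) in auto)
  have bV: "wd [b] \<in> words_over V" using B_V[OF b] by (intro words_over_simps) simp
  have X: "(\<Sum>c\<in>C. (single [c, b] (s c) - wd [b, c]) * formal_deriv c w) \<in> relation_ideal"
    unfolding s_def using C(2) by (intro relation_ideal_sum relation_ideal_rmult letters_commute b words_over_B_V formal_deriv_FA w) auto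
  have Y: "wd [b] * ((\<Sum>c\<in>C. wd [c] * formal_deriv c w) - single w (of_nat (mu \<gamma> w))) \<in> relation_ideal"
    by (rule relation_ideal_lmult[OF IH bV])
  have e1: "(\<Sum>c\<in>C. wd [c] * formal_deriv c (b # w)) =
      (if b \<in> C then wd (b # w) else 0) + (\<Sum>c\<in>C. single [c, b] (s c) * formal_deriv c w)"
  proof -
    have "(\<Sum>c\<in>C. wd [c] * formal_deriv c (b # w)) =
        (\<Sum>c\<in>C. (if b = c then wd (b # w) else 0) + single [c, b] (s c) * formal_deriv c w)"
    proof (rule sum.cong[OF refl])
      fix c
      have "wd [c] * (single [b] (s c) * formal_deriv c w) = single [c, b] (s c) * formal_deriv c w"
        by (simp add: mult.assoc[symmetric] single_times)
      then show "wd [c] * formal_deriv c (b # w) = (if b = c then wd (b # w) else 0) + single [c, b] (s c) * formal_deriv c w"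
        by (simp add: distrib_left single_times s_def)
    qed
    then show ?thesis using C(1) by (simp add: sum.distrib)
  qed
  have e2: "(\<Sum>c\<in>C. (single [c, b] (s c) - wd [b, c]) * formal_deriv c w) =
      (\<Sum>c\<in>C. single [c, b] (s c) * formal_deriv c w) - (\<Sum>c\<in>C. wd [b, c] * formal_deriv c w)"
    by (simp add: left_diff_distrib sum_subtractf)
  have e3: "wd [b] * ((\<Sum>c\<in>C. wd [c] * formal_deriv c w) - single w (of_nat (mu \<gamma> w))) =
      (\<Sum>c\<in>C. wd [b, c] * formal_deriv c w) - single (b # w) (of_nat (mu \<gamma> w))"
    by (simp add: right_diff_distrib sum_distrib_left mult.assoc[symmetric] single_times)
  have e4: "single (b # w) (of_nat (mu \<gamma> (b # w))) =
      single (b # w) (of_nat (mu \<gamma> w)) + (if b \<in> C then wd (b # w) else (0 :: 'i coha list \<Rightarrow>\<^sub>0 rat))"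
    by (simp add: mu_def bC single_add[symmetric] add.commute)
  have "(\<Sum>c\<in>C. wd [c] * formal_deriv c (b # w)) - single (b # w) (of_nat (mu \<gamma> (b # w))) =
     (\<Sum>c\<in>C. (single [c, b] (s c) - wd [b, c]) * formal_deriv c w) +
     wd [b] * ((\<Sum>c\<in>C. wd [c] * formal_deriv c w) - single w (of_nat (mu \<gamma> w)))"
    unfolding e1 e2 e3 e4 by simp
  then show ?case using relation_ideal_add[OF X Y] by (simp only:)
qed

definition der :: "'i coha \<Rightarrow> ('i coha list \<Rightarrow>\<^sub>0 rat) \<Rightarrow> ('i coha list \<Rightarrow>\<^sub>0 rat)" where
  "der c t = (\<Sum>w\<in>keys t. con (lookup t w) * formal_deriv c w)"

lemma der_keys: assumes "u \<in> keys (der c t)" shows "\<exists>w\<in>keys t. set u \<subseteq> set w \<and> length u < length w"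
proof -
  have "u \<in> (\<Union>w\<in>keys t. keys (con (lookup t w) * formal_deriv c w))"
    using assms keys_sum[of "\<lambda>w. con (lookup t w) * formal_deriv c w" "keys t"] unfolding der_def by blast
  then obtain w where w: "w \<in> keys t" "u \<in> keys (con (lookup t w) * formal_deriv c w)" by blast
  then obtain p r where "u = p + r" "p \<in> keys (con (lookup t w) :: 'i coha list \<Rightarrow>\<^sub>0 rat)" "r \<in> keys (formal_deriv c w)"
    using keys_mult[of "con (lookup t w)" "formal_deriv c w"] by blast
  then have "u \<in> keys (formal_deriv c w)" by (auto simp: plus_list_def split: if_splits)
  then show ?thesis using w(1) formal_deriv_keys by blast
qed

lemma coha_one_nonzero: "coha_one \<noteq> (0 :: 'i coha)"
proof
  assume "coha_one = (0 :: 'i coha)"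
  then have "cv (coha_one :: 'i coha) bot = cv (0 :: 'i coha) bot" by (simp only:)
  then show False by (simp add: cv_one)
qed

text \<open>Induction on the length of the words and then on their number. If \<open>t\<close> is a relation, its derivatives with respect to the
  letters of largest dimension vector \<open>\<gamma>\<close> are shorter relations, so they lie in the ideal. By the Euler identity so does the
  sum of the terms of \<open>t\<close>, each multiplied by its number of letters of dimension vector \<open>\<gamma>\<close>. If \<open>M\<close> is the
  largest of these numbers, then \<open>M * t\<close> minus this sum has fewer words.\<close>

lemma kernel_basis: "t \<in> words_over B \<Longrightarrow> (\<And>w. w \<in> keys t \<Longrightarrow> length w < L) \<Longrightarrow> ew t = 0 \<Longrightarrow> t \<in> relation_ideal"
proof (induction L arbitrary: t)
  case 0
  have "keys t = {}"
  proof (rule equals0I)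
    fix w assume "w \<in> keys t"
    then show False using 0(2)[of w] by simp
  qed
  then show ?case by (simp add: relation_ideal_0)
next
  case (Suc L)
  note outer = Suc.IH
  show ?case using Suc.prems
  proof (induction "card (keys t)" arbitrary: t rule: less_induct)
    case (less t)
    note t = less.prems
    have tB: "set w \<subseteq> B" if "w \<in> keys t" for w using t(1) that by (auto simp: words_over_def)
    define Lt where "Lt = \<Union>(set ` keys t)"
    have Lt: "finite Lt" "Lt \<subseteq> B" using tB by (auto simp: Lt_def)
    show ?case
    proof (cases "Lt = {}")
      case True
      then have kt: "keys t \<subseteq> {[]}" by (auto simp: Lt_def)
      then have "ew t = coha_scale (lookup t []) coha_one" using ew_superset[of "{[]}" t] by simp
      then have "lookup t [] = 0" using t(3) coha_one_nonzero by (simp add: coha.scale_eq_0_iff)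
      then have "[] \<notin> keys t" by (simp add: in_keys_iff)
      then have "keys t = {}" using kt by blast
      then show ?thesis by (simp add: relation_ideal_0)
    next
      case False
      have "Max ((\<lambda>b. dim_size (letter_dim b)) ` Lt) \<in> (\<lambda>b. dim_size (letter_dim b)) ` Lt" using Lt(1) False by (intro Max_in) auto
      then obtain b where b: "b \<in> Lt" "dim_size (letter_dim b) = Max ((\<lambda>b. dim_size (letter_dim b)) ` Lt)" by auto
      have max: "dim_size (letter_dim b') \<le> dim_size (letter_dim b)" if "b' \<in> Lt" for b' unfolding b(2) using Lt(1) that by auto
      define \<gamma> where "\<gamma> = letter_dim b"
      define C where "C = {c \<in> Lt. letter_dim c = \<gamma>}"
      have C: "finite C" "C \<subseteq> B" "\<And>c. c \<in> C \<Longrightarrow> letter_dim c = \<gamma>" using Lt by (auto simp: C_def)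
      have derI: "der c t \<in> relation_ideal" if c: "c \<in> C" for c
      proof (rule outer)
        show "der c t \<in> words_over B" unfolding words_over_def using der_keys tB by blast
        show "length u < L" if "u \<in> keys (der c t)" for u using der_keys[OF that] t(2) by fastforce
        have "ew (der c t) = (\<Sum>w\<in>keys t. coha_scale (lookup t w) (word_deriv c w))"
          unfolding der_def ew_sum by (intro sum.cong refl) (simp add: ew_con words_over_B_V formal_deriv_FA tB ew_fder)
        also have "\<dots> = 0"
        proof (rule derivative_relation[OF finite_keys tB _ _ _ C(3)[OF c]])
          show "dim_size (letter_dim b') \<le> dim_size \<gamma>" if "w \<in> keys t" "b' \<in> set w" for w b'
            unfolding \<gamma>_def using that by (intro max) (auto simp: Lt_def)
          show "(\<Sum>w\<in>keys t. coha_scale (lookup t w) (eval_word w)) = 0"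
            using t(3) ew_superset[OF finite_keys order_refl, of t] by simp
          show "c \<in> B" using c C(2) by blast
        qed
        finally show "ew (der c t) = 0" .
      qed
      \<comment> \<open>Modulo the ideal, \<open>E\<close> is the sum of the terms of \<open>t\<close>, weighted by their numbers of letters in \<open>C\<close>.\<close>
      define E where "E = (\<Sum>c\<in>C. wd [c] * der c t)"
      have E: "E \<in> relation_ideal"
        unfolding E_def using C(2) B_V by (intro relation_ideal_sum relation_ideal_lmult derI words_over_simps) auto
      define t' where "t' = (\<Sum>w\<in>keys t. single w (lookup t w * of_nat (mu \<gamma> w)))"
      have "E - t' = (\<Sum>w\<in>keys t. con (lookup t w) * ((\<Sum>c\<in>C. wd [c] * formal_deriv c w) - single w (of_nat (mu \<gamma> w))))"
      proof -
        have "E = (\<Sum>c\<in>C. \<Sum>w\<in>keys t. con (lookup t w) * (wd [c] * formal_deriv c w))"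
          unfolding E_def der_def sum_distrib_left
          unfolding mult.assoc[symmetric] con_commute[of _ "wd _", symmetric] ..
        also have "\<dots> = (\<Sum>w\<in>keys t. con (lookup t w) * (\<Sum>c\<in>C. wd [c] * formal_deriv c w))"
          unfolding sum_distrib_left by (rule sum.swap)
        finally show ?thesis
          unfolding t'_def by (simp add: right_diff_distrib sum_subtractf single_times)
      qed
      moreover have "\<dots> \<in> relation_ideal"
      proof (intro relation_ideal_sum relation_ideal_lmult euler_words C)
        fix w assume w: "w \<in> keys t"
        show "set w \<subseteq> B" by (rule tB[OF w])
        show "b' \<in> C" if "b' \<in> set w" "letter_dim b' = \<gamma>" for b' using that w by (auto simp: C_def Lt_def)
      qed simp_all
      ultimately have "E - t' \<in> relation_ideal" by (simp only:)
      then have "E - (E - t') \<in> relation_ideal" by (rule relation_ideal_diff[OF E])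
      then have t'I: "t' \<in> relation_ideal" by simp
      define M where "M = Max (mu \<gamma> ` keys t)"
      obtain w1 where w1: "w1 \<in> keys t" "b \<in> set w1" using b(1) by (auto simp: Lt_def)
      then have "b \<in> set (filter (\<lambda>b. letter_dim b = \<gamma>) w1)" by (simp add: \<gamma>_def)
      then have "mu \<gamma> w1 > 0" unfolding mu_def by (rule length_pos_if_in_set)
      moreover have "mu \<gamma> w1 \<le> M" unfolding M_def using w1 by simp
      ultimately have M0: "M > 0" by simp
      have "M \<in> mu \<gamma> ` keys t" unfolding M_def using w1 by (intro Max_in) auto
      then obtain w0 where w0: "w0 \<in> keys t" "mu \<gamma> w0 = M" by auto
      \<comment> \<open>The words with the maximal number \<open>M\<close> of such letters cancel.\<close>
      define t2 where "t2 = con (of_nat M) * t - t'"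
      have "con (of_nat M) * t = (\<Sum>w\<in>keys t. single w (of_nat M * lookup t w))"
      proof -
        have "con (of_nat M) * (\<Sum>w\<in>keys t. single w (lookup t w)) = (\<Sum>w\<in>keys t. single w (of_nat M * lookup t w))"
          unfolding sum_distrib_left single_times by simp
        then show ?thesis unfolding poly_mapping_sum_single[symmetric] .
      qed
      then have t2: "t2 = (\<Sum>w\<in>keys t. single w (of_nat M * lookup t w - lookup t w * of_nat (mu \<gamma> w)))"
        unfolding t2_def t'_def by (simp add: sum_subtractf single_diff)
      have k2: "keys t2 \<subseteq> keys t - {w0}"
      proof
        fix u assume "u \<in> keys t2"
        then have "u \<in> (\<Union>w\<in>keys t. keys (single w (of_nat M * lookup t w - lookup t w * of_nat (mu \<gamma> w))))"
          using keys_sum[of "\<lambda>w. single w (of_nat M * lookup t w - lookup t w * of_nat (mu \<gamma> w))" "keys t"]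
          unfolding t2 by blast
        then show "u \<in> keys t - {w0}" using w0(2) by (auto split: if_splits)
      qed
      have tV: "t \<in> words_over V" by (rule words_over_B_V[OF t(1)])
      have "t2 \<in> relation_ideal"
      proof (rule less.hyps)
        show "card (keys t2) < card (keys t)" using k2 w0(1) by (intro psubset_card_mono) auto
        show "t2 \<in> words_over B" unfolding words_over_def using k2 tB by blast
        show "length w < Suc L" if "w \<in> keys t2" for w using t(2) that k2 by blast
        show "ew t2 = 0" unfolding t2_def ew_diff ew_con[OF tV] t(3) relation_ideal_kernel[OF t'I] by simp
      qed
      then have "t2 + t' \<in> relation_ideal" by (rule relation_ideal_add[OF _ t'I])
      then have "con (of_nat M) * t \<in> relation_ideal" by (simp add: t2_def)
      then have "con (1 / of_nat M) * (con (of_nat M) * t) \<in> relation_ideal" by (rule relation_ideal_lmult) simp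
      then show ?thesis using M0 by (simp add: mult.assoc[symmetric] single_times con_1)
    qed
  qed
qed

text \<open>The linear relations between the letters rewrite every element of \<open>V\<close> in terms of the basis.\<close>

lemma reduce_letter: assumes "v \<in> V" shows "\<exists>r\<in>words_over B. wd [v] - r \<in> relation_ideal"
proof -
  have "v \<in> coha.span B" using assms B_span by simp
  then have "v \<in> V \<and> (\<exists>r\<in>words_over B. wd [v] - r \<in> relation_ideal)"
  proof (induction rule: coha.span_induct_alt)
    case base
    have 0: "(0 :: 'i coha) \<in> V" by (rule coha.subspace_0[OF V_subspace])
    then have "wd [coha_scale 0 0] - single [0] 0 \<in> supercomm_relations a V" unfolding supercomm_relations_def by blast
    then have "wd [0] - 0 \<in> relation_ideal" using relations_RI by auto
    then show ?case using 0 by (intro conjI bexI[of _ 0]) simp_all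
  next
    case (step c b y)
    then obtain r where r: "r \<in> words_over B" "wd [y] - r \<in> relation_ideal" and y: "y \<in> V" by blast
    have b: "b \<in> V" "coha_scale c b \<in> V" using B_V[OF step(1)] coha.subspace_scale[OF V_subspace] by auto
    have "wd [coha_scale c b + y] - wd [coha_scale c b] - wd [y] \<in> supercomm_relations a V"
      unfolding supercomm_relations_def using b(2) y by blast
    then have 1: "wd [coha_scale c b + y] - wd [coha_scale c b] - wd [y] \<in> relation_ideal" using relations_RI by blast
    have "wd [coha_scale c b] - single [b] c \<in> supercomm_relations a V"
      unfolding supercomm_relations_def using b(1) by blast
    then have 2: "wd [coha_scale c b] - single [b] c \<in> relation_ideal" using relations_RI by blast
    have "wd [coha_scale c b + y] - (single [b] c + r) =
        (wd [coha_scale c b + y] - wd [coha_scale c b] - wd [y]) + ((wd [coha_scale c b] - single [b] c) + (wd [y] - r))"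
      by simp
    also have "\<dots> \<in> relation_ideal" by (intro relation_ideal_add 1 2 r(2))
    finally have "wd [coha_scale c b + y] - (single [b] c + r) \<in> relation_ideal" .
    moreover have "single [b] c + r \<in> words_over B" using r(1) step(1) by simp
    moreover have "coha_scale c b + y \<in> V" by (rule coha.subspace_add[OF V_subspace b(2) y])
    ultimately show ?case by blast
  qed
  then show ?thesis by blast
qed

lemma reduce_word: "set w \<subseteq> V \<Longrightarrow> \<exists>r\<in>words_over B. wd w - r \<in> relation_ideal"
proof (induction w)
  case Nil
  have "wd [] - con 1 \<in> relation_ideal" by (simp add: relation_ideal_0)
  then show ?case by (intro bexI[of _ "con 1"]) simp_all
next
  case (Cons v w)
  then have v: "v \<in> V" and w: "set w \<subseteq> V" by auto
  obtain r where r: "r \<in> words_over B" "wd [v] - r \<in> relation_ideal" using reduce_letter[OF v] by blast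
  obtain s where s: "s \<in> words_over B" "wd w - s \<in> relation_ideal" using Cons.IH[OF w] by blast
  have "wd (v # w) - r * s = (wd [v] - r) * wd w + r * (wd w - s)"
    by (simp add: left_diff_distrib right_diff_distrib single_times)
  also have "\<dots> \<in> relation_ideal"
    by (rule relation_ideal_add[OF relation_ideal_rmult[OF r(2) words_over_simps(8)[OF w]] relation_ideal_lmult[OF s(2) words_over_B_V[OF r(1)]]])
  finally show ?case using r(1) s(1) by (intro bexI[of _ "r * s"]) simp_all
qed

lemma kernel_RI: assumes t: "t \<in> words_over V" "ew t = 0" shows "t \<in> relation_ideal"
proof -
  have "\<exists>r\<in>words_over B. wd w - r \<in> relation_ideal" if "w \<in> keys t" for w using t(1) that by (intro reduce_word) (auto simp: words_over_def)
  then have "\<forall>w\<in>keys t. \<exists>r. r \<in> words_over B \<and> wd w - r \<in> relation_ideal" by blast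
  from bchoice[OF this] obtain f where f: "\<And>w. w \<in> keys t \<Longrightarrow> f w \<in> words_over B" "\<And>w. w \<in> keys t \<Longrightarrow> wd w - f w \<in> relation_ideal" by blast
  define r where "r = (\<Sum>w\<in>keys t. con (lookup t w) * f w)"
  have rB: "r \<in> words_over B" unfolding r_def using f(1) by (intro words_over_sum words_over_simps) auto
  have "(\<Sum>w\<in>keys t. single w (lookup t w)) - r = (\<Sum>w\<in>keys t. con (lookup t w) * (wd w - f w))"
    unfolding r_def by (simp add: right_diff_distrib single_times sum_subtractf)
  then have "t - r = (\<Sum>w\<in>keys t. con (lookup t w) * (wd w - f w))" unfolding poly_mapping_sum_single[symmetric] .
  also have "\<dots> \<in> relation_ideal" using f(2) by (intro relation_ideal_sum relation_ideal_lmult) auto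
  finally have tr: "t - r \<in> relation_ideal" .
  have "ew r = 0" using relation_ideal_kernel[OF tr] t(2) by (simp add: ew_diff)
  moreover have "length w < Suc (\<Sum>u\<in>keys r. length u)" if "w \<in> keys r" for w
    using member_le_sum[of w "keys r" length] that by simp
  ultimately have "r \<in> relation_ideal" using kernel_basis[OF rB] by blast
  then have "(t - r) + r \<in> relation_ideal" by (rule relation_ideal_add[OF tr])
  then show ?thesis by simp
qed

abbreviation proj :: "'i dimvec \<Rightarrow> 'i coha \<Rightarrow> 'i coha" where "proj \<gamma> f \<equiv> single \<gamma> (lookup f \<gamma>)"

lemma proj_simps: "proj \<gamma> (f + g) = proj \<gamma> f + proj \<gamma> g" "proj \<gamma> (coha_scale c f) = coha_scale c (proj \<gamma> f)"
  "proj \<gamma> (sum h A) = (\<Sum>x\<in>A. proj \<gamma> (h x))"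
proof -
  show add: "proj \<gamma> (f + g) = proj \<gamma> f + proj \<gamma> g" for f g by (simp add: lookup_add single_add)
  show "proj \<gamma> (coha_scale c f) = coha_scale c (proj \<gamma> f)"
    by (rule poly_mapping_eqI) (simp add: lookup_scale lookup_single when_def)
  show "proj \<gamma> (sum h A) = (\<Sum>x\<in>A. proj \<gamma> (h x))"
    by (induction A rule: infinite_finite_induct) (simp_all add: add del: lookup_add)
qed

lemma proj_keys: "keys f \<subseteq> {\<delta>} \<Longrightarrow> proj \<gamma> f = (if \<delta> = \<gamma> then f else 0)"
  by (rule poly_mapping_eqI) (auto simp: lookup_single when_def in_keys_iff)

lemma proj_carrier: "f \<in> coha_carrier \<Longrightarrow> proj \<gamma> f \<in> coha_carrier"
  by (simp add: carrier_lookup)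

lemma ew_image:
  shows ewi_add: "x \<in> ew ` words_over V \<Longrightarrow> y \<in> ew ` words_over V \<Longrightarrow> x + y \<in> ew ` words_over V"
    and ewi_scale: "x \<in> ew ` words_over V \<Longrightarrow> coha_scale c x \<in> ew ` words_over V"
    and ewi_mul: "x \<in> ew ` words_over V \<Longrightarrow> y \<in> ew ` words_over V \<Longrightarrow> x \<star> y \<in> ew ` words_over V"
    and ewi_V: "v \<in> V \<Longrightarrow> v \<in> ew ` words_over V"
    and ewi_one: "coha_one \<in> ew ` words_over V"
    and ewi_0: "0 \<in> ew ` words_over V"
proof -
  show "x \<in> ew ` words_over V \<Longrightarrow> y \<in> ew ` words_over V \<Longrightarrow> x + y \<in> ew ` words_over V"
    by (elim imageE) (simp only: ew_add[symmetric] words_over_simps imageI)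
  show "x \<in> ew ` words_over V \<Longrightarrow> coha_scale c x \<in> ew ` words_over V"
    by (elim imageE) (simp only: ew_con[symmetric] words_over_simps imageI)
  show "x \<in> ew ` words_over V \<Longrightarrow> y \<in> ew ` words_over V \<Longrightarrow> x \<star> y \<in> ew ` words_over V"
    by (elim imageE) (simp only: ew_mult[symmetric] words_over_simps imageI)
  show "v \<in> ew ` words_over V" if v: "v \<in> V"
  proof -
    have "v \<in> coha_carrier" using v V_carrier by blast
    then have "ew (wd [v]) = v" by (simp add: ew_single)
    moreover have "wd [v] \<in> words_over V" using v by simp
    ultimately show ?thesis by (metis imageI)
  qed
  have "ew (con 1) = coha_one" by (simp add: ew_single)
  moreover have "con 1 \<in> words_over V" by simp
  ultimately show "coha_one \<in> ew ` words_over V" by (metis imageI)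
  show "0 \<in> ew ` words_over V" using imageI[of 0 "words_over V" ew] by (simp add: ew_0)
qed

lemma ewi_sum: "(\<And>x. x \<in> A \<Longrightarrow> f x \<in> ew ` words_over V) \<Longrightarrow> sum f A \<in> ew ` words_over V"
proof (induction A rule: infinite_finite_induct)
  case (insert x A)
  then have "f x + sum f A \<in> ew ` words_over V" by (intro ewi_add) auto
  with insert show ?case by simp
qed (simp_all add: ewi_0)

text \<open>Induction on the dimension: modulo \<open>V\<close> an element of \<open>Hplus\<close> is a sum of products of components of smaller dimension.\<close>

lemma proj_generated: "f \<in> coha_carrier \<Longrightarrow> proj \<gamma> f \<in> ew ` words_over V"
proof (induction "dim_size \<gamma>" arbitrary: \<gamma> f rule: less_induct)
  case (less \<gamma> f)
  note f = less.prems
  show ?case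
  proof (cases "\<gamma> = (\<lambda>_. 0)")
    case True
    have "lookup f \<gamma> \<in> hall_comp (\<lambda>_. 0)" using carrier_lookup[OF f, of \<gamma>] True by simp
    then have 1: "lookup f \<gamma> = single 0 (fs (lookup f \<gamma>) bot)" by (rule fs_bot)
    have "single \<gamma> (single 0 c) = coha_scale c coha_one" for c
      by (rule poly_mapping_eqI) (simp add: lookup_scale coha_one_def lookup_single when_def True)
    then have "proj \<gamma> f = coha_scale (fs (lookup f \<gamma>) bot) coha_one" using 1 by metis
    then show ?thesis by (simp only: ewi_scale[OF ewi_one])
  next
    case False
    define g where "g = proj \<gamma> f"
    have "g \<in> Hplus" unfolding Hplus_def g_def using proj_carrier[OF f] False by (auto simp: lookup_single)
    from Hplus_V_Dec[OF this] obtain v d where vd: "v \<in> V" "d \<in> Dec" "g = v + d" by blast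
    have "proj \<gamma> g = g" by (simp add: g_def)
    then have g: "g = proj \<gamma> v + proj \<gamma> d" using vd(3) proj_simps(1)[of \<gamma> v d] by simp
    have "v \<in> coha.span B" using vd(1) B_span by simp
    then have pv: "proj \<gamma> v \<in> ew ` words_over V"
    proof (induction rule: coha.span_induct_alt)
      case base show ?case by (simp add: ewi_0)
    next
      case (step c b y)
      have "proj \<gamma> b \<in> ew ` words_over V"
        using proj_keys[of b "letter_dim b" \<gamma>] keys_B[OF step(1)] ewi_V[OF B_V[OF step(1)]] ewi_0 by auto
      then show ?case unfolding proj_simps by (intro ewi_add ewi_scale step(2))
    qed
    have pd: "proj \<gamma> d \<in> ew ` words_over V"
      using vd(2) unfolding Dec_def
    proof (induction rule: coha.span_induct_alt)
      case base show ?case by (simp add: ewi_0)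
    next
      case (step c x y)
      then obtain p q where pq: "x = p \<star> q" "p \<in> Hplus" "q \<in> Hplus" by blast
      have pc: "p \<in> coha_carrier" "q \<in> coha_carrier" using pq Hplus_carrier by auto
      have "(\<Sum>\<delta>\<in>keys p. proj \<delta> p) \<star> (\<Sum>\<epsilon>\<in>keys q. proj \<epsilon> q) = (\<Sum>\<delta>\<in>keys p. proj \<delta> p \<star> (\<Sum>\<epsilon>\<in>keys q. proj \<epsilon> q))"
        by (intro mul_sum_left carrier_sum proj_carrier pc)
      also have "\<dots> = (\<Sum>\<delta>\<in>keys p. \<Sum>\<epsilon>\<in>keys q. proj \<delta> p \<star> proj \<epsilon> q)"
        by (intro sum.cong refl mul_sum_right proj_carrier pc)
      finally have x: "x = (\<Sum>\<delta>\<in>keys p. \<Sum>\<epsilon>\<in>keys q. proj \<delta> p \<star> proj \<epsilon> q)"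
        unfolding pq(1) poly_mapping_sum_single[symmetric] .
      have "proj \<gamma> (proj \<delta> p \<star> proj \<epsilon> q) \<in> ew ` words_over V" if \<delta>: "\<delta> \<in> keys p" and \<epsilon>: "\<epsilon> \<in> keys q" for \<delta> \<epsilon>
      proof -
        have nz: "\<delta> \<noteq> (\<lambda>_. 0)" "\<epsilon> \<noteq> (\<lambda>_. 0)"
          using pq(2,3) \<delta> \<epsilon> unfolding Hplus_def in_keys_iff by auto
        have "keys (proj \<delta> p \<star> proj \<epsilon> q) \<subseteq> {\<lambda>i. \<delta> i + \<epsilon> i}"
          using keys_mul[of _ "proj \<delta> p" "proj \<epsilon> q"] by (fastforce split: if_splits)
        then have e: "proj \<gamma> (proj \<delta> p \<star> proj \<epsilon> q) = (if (\<lambda>i. \<delta> i + \<epsilon> i) = \<gamma> then proj \<delta> p \<star> proj \<epsilon> q else 0)"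
          by (rule proj_keys)
        show ?thesis
        proof (cases "(\<lambda>i. \<delta> i + \<epsilon> i) = \<gamma>")
          case True
          have pos: "dim_size \<rho> > 0" if "\<rho> \<noteq> (\<lambda>_. 0)" for \<rho> :: "'i dimvec"
            using that by (auto simp: dim_size_def fun_eq_iff sum_pos2 intro: ccontr)
          have "dim_size \<gamma> = dim_size \<delta> + dim_size \<epsilon>" unfolding True[symmetric] by (simp add: dim_size_def sum.distrib)
          then have "dim_size \<delta> < dim_size \<gamma>" "dim_size \<epsilon> < dim_size \<gamma>" using pos nz by auto
          then have "proj \<delta> p \<in> ew ` words_over V" "proj \<epsilon> q \<in> ew ` words_over V" using less.hyps pc by blast+
          then have "proj \<delta> p \<star> proj \<epsilon> q \<in> ew ` words_over V" by (rule ewi_mul)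
          then show ?thesis unfolding e using True by simp
        qed (simp only: e if_False ewi_0)
      qed
      then have "proj \<gamma> x \<in> ew ` words_over V" unfolding x proj_simps(3) by (intro ewi_sum)
      then show ?case unfolding proj_simps(1,2) by (intro ewi_add ewi_scale step(2))
    qed
    have "g \<in> ew ` words_over V" by (subst g) (rule ewi_add[OF pv pd])
    then show ?thesis unfolding g_def .
  qed
qed

lemma ew_surj: "ew ` words_over V = coha_carrier"
proof
  show "ew ` words_over V \<subseteq> coha_carrier" using ew_carrier by blast
  show "coha_carrier \<subseteq> ew ` words_over V"
  proof
    fix f :: "'i coha" assume "f \<in> coha_carrier"
    then have "(\<Sum>\<gamma>\<in>keys f. proj \<gamma> f) \<in> ew ` words_over V" by (intro ewi_sum proj_generated)
    then show "f \<in> ew ` words_over V" unfolding poly_mapping_sum_single[symmetric] .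
  qed
qed

lemma freely_generated: "freely_generated_by a \<psi> V"
proof -
  let ?R = "free_algebra V" and ?S = "twisted_coha a \<psi>"
  have K: "a_kernel ?R ?S ew = relation_ideal"
    unfolding a_kernel_def' using relation_ideal_FA relation_ideal_kernel kernel_RI by (auto simp: twisted_coha_def)
  have F: "free_supercomm a V = ?R Quot (a_kernel ?R ?S ew)" unfolding K unfolding free_supercomm_def relation_ideal_def by (rule refl)
  have c: "canonical_map a \<psi> = (\<lambda>X. the_elem (ew ` X))" by (rule ext) (rule canonical_map_def)
  have surj: "ew ` carrier ?R = carrier ?S"
    unfolding free_algebra_simps ew_surj by (simp add: twisted_coha_def)
  have "(\<lambda>X. the_elem (ew ` X)) \<in> ring_iso (?R Quot (a_kernel ?R ?S ew)) ?S"
    by (rule ring_hom_ring.FactRing_iso_set[OF ew_ring_hom surj])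
  then have iso: "canonical_map a \<psi> \<in> ring_iso (free_supercomm a V) ?S" by (simp only: F c)
  have sing: "is_singleton (ew ` C)" if C: "C \<in> carrier (free_supercomm a V)" for C
  proof -
    have "C \<in> carrier (?R Quot (a_kernel ?R ?S ew))" using C by (simp only: F)
    then have "\<exists>y\<in>carrier ?S. ew ` C = {y}" by (rule ring_hom_ring.the_elem_wf[OF ew_ring_hom])
    then obtain y where "ew ` C = {y}" by (rule bexE)
    then show ?thesis unfolding is_singleton_def by (rule exI)
  qed
  show ?thesis unfolding freely_generated_by_def using sing iso by (intro conjI ballI)
qed

end

context twisted_prim
begin

lemma homogeneous_basis: "\<exists>B. twisted_basis a \<psi> Bp B"
proof -
  let ?H = "\<Union>\<gamma> k. V \<inter> coha_bideg a \<gamma> k"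
  obtain B where B: "B \<subseteq> ?H" "coha.independent B" "?H \<subseteq> coha.span B"
    by (rule coha.maximal_independent_subset[of ?H])
  have V: "V = coha.span ?H" using bigraded_V unfolding bigraded_subspace_def by (rule conjunct2)
  have "coha.span B = V"
  proof
    have "B \<subseteq> V" using B(1) by blast
    then show "coha.span B \<subseteq> V" by (rule coha.span_minimal[OF _ V_subspace])
    show "V \<subseteq> coha.span B"
      by (rule subset_trans[OF equalityD1[OF V] coha.span_minimal[OF B(3) coha.subspace_span]])
  qed
  moreover have "\<exists>\<gamma> k. b \<in> coha_bideg a \<gamma> k" if "b \<in> B" for b using B(1) that by blast
  ultimately have "twisted_basis a \<psi> Bp B" using B(2) by unfold_locales
  then show ?thesis by (rule exI)
qed

lemma freely_generated_V: "freely_generated_by a \<psi> V"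
  using homogeneous_basis by (rule exE) (rule twisted_basis.freely_generated)

end

section \<open>Nilpotency of coordinates modulo an ideal\<close>

definition ring_ideal :: "'r::comm_ring_1 set \<Rightarrow> bool" where
  "ring_ideal J \<longleftrightarrow> 0 \<in> J \<and> (\<forall>x\<in>J. \<forall>y\<in>J. x + y \<in> J) \<and> (\<forall>x\<in>J. \<forall>r. r * x \<in> J)"

lemma ring_idealD:
  assumes "ring_ideal J"
  shows "0 \<in> J" "x \<in> J \<Longrightarrow> y \<in> J \<Longrightarrow> x + y \<in> J" "x \<in> J \<Longrightarrow> r * x \<in> J" "x \<in> J \<Longrightarrow> x * r \<in> J"
    "x \<in> J \<Longrightarrow> - x \<in> J" "x \<in> J \<Longrightarrow> y \<in> J \<Longrightarrow> x - y \<in> J"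
proof -
  note J = assms[unfolded ring_ideal_def]
  show "0 \<in> J" and add: "x \<in> J \<Longrightarrow> y \<in> J \<Longrightarrow> x + y \<in> J" and mult: "x \<in> J \<Longrightarrow> r * x \<in> J" for x y r
    using J by auto
  show "x \<in> J \<Longrightarrow> x * r \<in> J" using mult[of x r] by (simp only: mult.commute)
  show neg: "x \<in> J \<Longrightarrow> - x \<in> J" for x using mult[of x "-1"] by simp
  show "x \<in> J \<Longrightarrow> y \<in> J \<Longrightarrow> x - y \<in> J" using add[of x "- y"] neg[of y] by simp
qed

lemma ring_ideal_sum: "ring_ideal J \<Longrightarrow> (\<And>x. x \<in> A \<Longrightarrow> f x \<in> J) \<Longrightarrow> sum f A \<in> J"
  by (induction A rule: infinite_finite_induct) (auto intro: ring_idealD)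

definition adjoin :: "'r::comm_ring_1 set \<Rightarrow> 'r \<Rightarrow> 'r set" where
  "adjoin J e = {j + e * r | j r. j \<in> J}"

lemma ring_ideal_adjoin: assumes J: "ring_ideal J" shows "ring_ideal (adjoin J e)" "J \<subseteq> adjoin J e" "e \<in> adjoin J e"
proof -
  show "ring_ideal (adjoin J e)"
    unfolding ring_ideal_def
  proof (intro conjI ballI allI)
    have "0 = 0 + e * 0" by simp
    then show "0 \<in> adjoin J e" unfolding adjoin_def using ring_idealD(1)[OF J] by blast
    fix x y assume "x \<in> adjoin J e" "y \<in> adjoin J e"
    then obtain j r j' r' where "x = j + e * r" "y = j' + e * r'" "j \<in> J" "j' \<in> J" unfolding adjoin_def by blast
    moreover from this have "x + y = (j + j') + e * (r + r')" by (simp add: algebra_simps)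
    ultimately show "x + y \<in> adjoin J e" unfolding adjoin_def using ring_idealD(2)[OF J] by blast
  next
    fix x t assume "x \<in> adjoin J e"
    then obtain j r where "x = j + e * r" "j \<in> J" unfolding adjoin_def by blast
    moreover from this have "t * x = t * j + e * (t * r)" by (simp add: algebra_simps)
    ultimately show "t * x \<in> adjoin J e" unfolding adjoin_def using ring_idealD(3)[OF J] by blast
  qed
  show "J \<subseteq> adjoin J e"
  proof
    fix x assume "x \<in> J"
    moreover have "x = x + e * 0" by simp
    ultimately show "x \<in> adjoin J e" unfolding adjoin_def by blast
  qed
  have "e = 0 + e * 1" by simp
  then show "e \<in> adjoin J e" unfolding adjoin_def using ring_idealD(1)[OF J] by blast
qed

text \<open>If \<open>x\<close> vanishes on the part of the zero locus of \<open>J\<close> where \<open>e = 0\<close>, and \<open>x * e\<close> vanishes on all of it, then so does \<open>x\<close>.\<close>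

lemma nilpotent_split:
  assumes J: "ring_ideal J" and 1: "x ^ k \<in> adjoin J e" and 2: "(x * e) ^ l \<in> J"
  shows "\<exists>n. x ^ n \<in> J"
proof -
  obtain j r where j: "x ^ k = j + e * r" "j \<in> J" using 1 unfolding adjoin_def by blast
  have "(j + e * r) ^ m - (e * r) ^ m \<in> J" for m
  proof (induction m)
    case 0 show ?case using ring_idealD(1)[OF J] by simp
  next
    case (Suc m)
    have "(j + e * r) ^ Suc m - (e * r) ^ Suc m = (j + e * r) * ((j + e * r) ^ m - (e * r) ^ m) + j * (e * r) ^ m"
      by (simp add: algebra_simps)
    then show ?case using ring_idealD(2)[OF J] ring_idealD(3)[OF J Suc] ring_idealD(4)[OF J j(2)] by simp
  qed
  then have "x ^ l * ((j + e * r) ^ l - (e * r) ^ l) \<in> J" by (rule ring_idealD(3)[OF J])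
  moreover have "r ^ l * (x * e) ^ l \<in> J" by (rule ring_idealD(3)[OF J 2])
  ultimately have "x ^ l * ((j + e * r) ^ l - (e * r) ^ l) + r ^ l * (x * e) ^ l \<in> J" by (rule ring_idealD(2)[OF J])
  moreover have "x ^ l * ((j + e * r) ^ l - (e * r) ^ l) + r ^ l * (x * e) ^ l = x ^ (l + k * l)"
    unfolding j(1)[symmetric] by (simp add: algebra_simps power_add power_mult power_mult_distrib)
  ultimately have "x ^ (l + k * l) \<in> J" by (simp only:)
  then show ?thesis by (rule exI)
qed

text \<open>Splitting the zero locus of \<open>J\<close> along each of the hypersurfaces \<open>d e = 0\<close> in turn stratifies it; the stratum
  indexed by \<open>F\<close> is the one where exactly the functions \<open>d e\<close> with \<open>e \<in> F\<close> vanish. A function that vanishes on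
  all the strata is nilpotent.\<close>

lemma nilpotent_stratification:
  fixes d :: "'e \<Rightarrow> 'r::comm_ring_1"
  assumes "finite E" "ring_ideal J"
    and "\<And>F K. F \<subseteq> E \<Longrightarrow> ring_ideal K \<Longrightarrow> J \<subseteq> K \<Longrightarrow> (\<And>e. e \<in> F \<Longrightarrow> d e \<in> K) \<Longrightarrow> \<exists>k. (y * (\<Prod>e\<in>E - F. d e)) ^ k \<in> K"
  shows "\<exists>k. y ^ k \<in> J"
  using assms
proof (induction E arbitrary: J y rule: finite_induct)
  case empty
  from empty(2)[of "{}" J] empty(1) show ?case by auto
next
  case (insert e E)
  note J = insert.prems(1)
  have "\<exists>k. y ^ k \<in> adjoin J (d e)"
  proof (rule insert.IH[OF ring_ideal_adjoin(1)[OF J]])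
    fix F K assume F: "F \<subseteq> E" and K: "ring_ideal K" "adjoin J (d e) \<subseteq> K" "\<And>f. f \<in> F \<Longrightarrow> d f \<in> K"
    have "insert e E - insert e F = E - F" using insert.hyps(2) by auto
    moreover have "\<exists>k. (y * (\<Prod>f\<in>insert e E - insert e F. d f)) ^ k \<in> K"
    proof (rule insert.prems(2)[OF _ K(1)])
      show "insert e F \<subseteq> insert e E" using F by auto
      show "J \<subseteq> K" using ring_ideal_adjoin(2)[OF J] K(2) by blast
      show "d f \<in> K" if "f \<in> insert e F" for f using that K(2,3) ring_ideal_adjoin(3)[OF J] by blast
    qed
    ultimately show "\<exists>k. (y * (\<Prod>f\<in>E - F. d f)) ^ k \<in> K" by simp
  qed
  moreover have "\<exists>k. (y * d e) ^ k \<in> J"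
  proof (rule insert.IH[OF J])
    fix F K assume F: "F \<subseteq> E" and K: "ring_ideal K" "J \<subseteq> K" "\<And>f. f \<in> F \<Longrightarrow> d f \<in> K"
    have "insert e E - F = insert e (E - F)" using F insert.hyps(2) by auto
    then have "(\<Prod>f\<in>insert e E - F. d f) = d e * (\<Prod>f\<in>E - F. d f)" using insert.hyps by simp
    moreover have "\<exists>k. (y * (\<Prod>f\<in>insert e E - F. d f)) ^ k \<in> K"
      using F by (intro insert.prems(2)[OF _ K]) auto
    ultimately show "\<exists>k. (y * d e * (\<Prod>f\<in>E - F. d f)) ^ k \<in> K" by (simp add: mult.assoc)
  qed
  ultimately show ?case using nilpotent_split[OF J] by blast
qed

text \<open>Off the small diagonal, the points \<open>x u\<close> can be divided into two clusters without common points; on the small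
  diagonal, all of them are equal to their mean. So if an ideal contains the sum of the points and, for each
  division into two clusters, a power of the product of differences, then its zero locus is the origin.\<close>

lemma nilpotent_coordinates:
  fixes x :: "'u \<Rightarrow> 'r::comm_ring_1"
  assumes U: "finite U" "u \<in> U" and J: "ring_ideal J" and s: "(\<Sum>u\<in>U. x u) \<in> J"
    and D: "\<And>S. S \<subseteq> U \<Longrightarrow> S \<noteq> {} \<Longrightarrow> S \<noteq> U \<Longrightarrow> \<exists>m. (\<Prod>(s, t)\<in>S \<times> (U - S). x t - x s) ^ m \<in> J"
    and div: "\<And>y. of_nat (card U) * y \<in> J \<Longrightarrow> y \<in> J"
  shows "\<exists>k. x u ^ k \<in> J"
proof -
  define y where "y = of_nat (card U) * x u"
  have "\<exists>k. y ^ k \<in> J"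
  proof (rule nilpotent_stratification[where E = "U \<times> U" and d = "\<lambda>(s, t). x t - x s"])
    show "finite (U \<times> U)" using U by auto
    fix F K assume F: "F \<subseteq> U \<times> U" and K: "ring_ideal K" "J \<subseteq> K" "\<And>e. e \<in> F \<Longrightarrow> (case e of (s, t) \<Rightarrow> x t - x s) \<in> K"
    let ?P = "\<Prod>e\<in>U \<times> U - F. case e of (s, t) \<Rightarrow> x t - x s"
    \<comment> \<open>The cluster of the point \<open>x u\<close> on the stratum.\<close>
    define S where "S = {s \<in> U. x s - x u \<in> K}"
    have uS: "u \<in> S" using U ring_idealD(1)[OF K(1)] by (simp add: S_def)
    show "\<exists>k. (y * ?P) ^ k \<in> K"
    proof (cases "S = U")
      case True
      have "y = (\<Sum>v\<in>U. x v) - (\<Sum>v\<in>U. x v - x u)" by (simp add: y_def sum_subtractf)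
      moreover have "(\<Sum>v\<in>U. x v - x u) \<in> K" using True by (intro ring_ideal_sum[OF K(1)]) (auto simp: S_def)
      moreover have "(\<Sum>v\<in>U. x v) \<in> K" using s K(2) by blast
      ultimately have "y \<in> K" using ring_idealD(6)[OF K(1)] by simp
      then have "(y * ?P) ^ 1 \<in> K" using ring_idealD(4)[OF K(1)] by simp
      then show ?thesis by (rule exI)
    next
      case False
      have SU: "S \<subseteq> U" by (auto simp: S_def)
      obtain m where m: "(\<Prod>(s, t)\<in>S \<times> (U - S). x t - x s) ^ m \<in> J" using D[OF SU] uS False by blast
      have "S \<times> (U - S) \<subseteq> U \<times> U - F"
      proof
        fix e assume e: "e \<in> S \<times> (U - S)"
        then obtain s t where st: "e = (s, t)" "s \<in> S" "t \<in> U" "t \<notin> S" by auto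
        have "e \<notin> F"
        proof
          assume "e \<in> F"
          then have "x t - x s \<in> K" using K(3)[of e] st(1) by simp
          moreover have "x s - x u \<in> K" using st(2) by (simp add: S_def)
          ultimately have "(x t - x s) + (x s - x u) \<in> K" by (rule ring_idealD(2)[OF K(1)])
          then show False using st(3,4) by (simp add: S_def)
        qed
        then show "e \<in> U \<times> U - F" using e SU by auto
      qed
      then have "(\<Prod>(s, t)\<in>S \<times> (U - S). x t - x s) dvd ?P" using U by (intro prod_dvd_prod_subset) auto
      then have "(\<Prod>(s, t)\<in>S \<times> (U - S). x t - x s) ^ m dvd (y * ?P) ^ m" by (intro dvd_power_same dvd_mult)
      then obtain r where "(y * ?P) ^ m = (\<Prod>(s, t)\<in>S \<times> (U - S). x t - x s) ^ m * r" by (rule dvdE)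
      then have "(y * ?P) ^ m \<in> J" using ring_idealD(4)[OF J m] by simp
      then show ?thesis using K(2) by blast
    qed
  qed (rule J)
  then obtain k where k: "y ^ k \<in> J" by blast
  have cancel: "of_nat (card U) ^ n * z \<in> J \<Longrightarrow> z \<in> J" for n z
    by (induction n arbitrary: z) (auto simp: mult.assoc dest: div)
  have "x u ^ k \<in> J" using k unfolding y_def power_mult_distrib by (rule cancel)
  then show ?thesis by blast
qed

section \<open>Finiteness of the primitive part\<close>

text \<open>The enumerations of the sets of a family; summing over them symmetrizes. The value \<open>0\<close> at the irrelevant positions makes
  them finite in number.\<close>

definition enums :: "'i dimvec \<Rightarrow> 'i fam \<Rightarrow> ('i \<Rightarrow> nat \<Rightarrow> rat) set" where
  "enums \<gamma> P = {x. \<forall>i. bij_betw (x i) {..<\<gamma> i} (P i) \<and> (\<forall>\<alpha>\<ge>\<gamma> i. x i \<alpha> = 0)}"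

definition tot :: "'i dimvec \<Rightarrow> 'i mpoly \<Rightarrow> 'i fam \<Rightarrow> rat" where
  "tot \<gamma> f P = (\<Sum>x\<in>enums \<gamma> P. ev x f)"

definition perms :: "'i dimvec \<Rightarrow> ('i \<Rightarrow> nat \<Rightarrow> nat) set" where
  "perms \<gamma> = {\<pi>. \<forall>i. \<pi> i permutes {..<\<gamma> i}}"

definition symz :: "'i::finite dimvec \<Rightarrow> 'i mpoly \<Rightarrow> 'i mpoly" where
  "symz \<gamma> f = (\<Sum>\<pi>\<in>perms \<gamma>. subst (\<lambda>i \<alpha>. if \<alpha> < \<gamma> i then pvar i (\<pi> i \<alpha>) else 0) f)"

definition rearrange :: "'i dimvec \<Rightarrow> ('i \<Rightarrow> nat \<Rightarrow> rat) \<Rightarrow> ('i \<Rightarrow> nat \<Rightarrow> nat) \<Rightarrow> 'i \<Rightarrow> nat \<Rightarrow> rat" where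
  "rearrange \<gamma> x \<pi> = (\<lambda>i \<alpha>. if \<alpha> < \<gamma> i then x i (\<pi> i \<alpha>) else 0)"

lemma enumsD:
  assumes "x \<in> enums \<gamma> P"
  shows "bij_betw (x i) {..<\<gamma> i} (P i)" "inj_on (x i) {..<\<gamma> i}" "x i ` {..<\<gamma> i} = P i" "\<gamma> i \<le> \<alpha> \<Longrightarrow> x i \<alpha> = 0"
  using assms unfolding enums_def bij_betw_def by auto

lemma finite_perms: "finite (perms \<gamma>)" for \<gamma> :: "'i::finite dimvec"
proof -
  have "perms \<gamma> = PiE UNIV (\<lambda>i. {p. p permutes {..<\<gamma> i}})" by (auto simp: perms_def PiE_def)
  moreover have "finite \<dots>" by (intro finite_PiE) (auto intro: finite_permutations)
  ultimately show ?thesis by simp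
qed

lemma id_perms: "(\<lambda>_ \<alpha>. \<alpha>) \<in> perms \<gamma>"
  unfolding perms_def by (auto simp: permutes_id[unfolded id_def])

lemma bij_rearrange:
  assumes inj: "\<And>i. inj_on (x i) {..<\<gamma> i}"
  shows "bij_betw (rearrange \<gamma> x) (perms \<gamma>) (enums \<gamma> (\<lambda>i. x i ` {..<\<gamma> i}))"
  unfolding bij_betw_def
proof (intro conjI equalityI subsetI inj_onI)
  fix \<pi> \<rho> assume \<pi>: "\<pi> \<in> perms \<gamma>" and \<rho>: "\<rho> \<in> perms \<gamma>" and e: "rearrange \<gamma> x \<pi> = rearrange \<gamma> x \<rho>"
  have p: "\<pi> i permutes {..<\<gamma> i}" "\<rho> i permutes {..<\<gamma> i}" for i using \<pi> \<rho> by (auto simp: perms_def)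
  show "\<pi> = \<rho>"
  proof (intro ext)
    fix i \<alpha>
    show "\<pi> i \<alpha> = \<rho> i \<alpha>"
    proof (cases "\<alpha> < \<gamma> i")
      case True
      have "x i (\<pi> i \<alpha>) = x i (\<rho> i \<alpha>)" using fun_cong[OF fun_cong[OF e, of i], of \<alpha>] True by (simp add: rearrange_def)
      moreover have "\<pi> i \<alpha> \<in> {..<\<gamma> i}" "\<rho> i \<alpha> \<in> {..<\<gamma> i}" using permutes_in_image[OF p(1)] permutes_in_image[OF p(2)] True by auto
      ultimately show ?thesis by (rule inj_onD[OF inj])
    next
      case False
      then show ?thesis using permutes_not_in[OF p(1), of \<alpha>] permutes_not_in[OF p(2), of \<alpha>] by simp
    qed
  qed
next
  fix y assume "y \<in> rearrange \<gamma> x ` perms \<gamma>"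
  then obtain \<pi> where \<pi>: "\<pi> \<in> perms \<gamma>" "y = rearrange \<gamma> x \<pi>" by blast
  have "bij_betw (x i \<circ> \<pi> i) {..<\<gamma> i} (x i ` {..<\<gamma> i})" for i
    using \<pi>(1) inj by (intro bij_betw_trans[OF permutes_imp_bij] inj_on_imp_bij_betw) (auto simp: perms_def)
  moreover have "bij_betw (y i) {..<\<gamma> i} C \<longleftrightarrow> bij_betw (x i \<circ> \<pi> i) {..<\<gamma> i} C" for i C
    by (rule bij_betw_cong) (simp add: \<pi>(2) rearrange_def)
  ultimately show "y \<in> enums \<gamma> (\<lambda>i. x i ` {..<\<gamma> i})" unfolding enums_def by (simp add: \<pi>(2) rearrange_def)
next
  fix y assume y: "y \<in> enums \<gamma> (\<lambda>i. x i ` {..<\<gamma> i})"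
  have "\<exists>\<pi>. \<pi> permutes {..<\<gamma> i} \<and> (\<forall>\<alpha><\<gamma> i. y i \<alpha> = x i (\<pi> \<alpha>))" for i
    by (rule same_image_permutes[OF inj enumsD(2)[OF y]]) (simp add: enumsD(3)[OF y])
  then have "\<forall>i. \<exists>\<pi>. \<pi> permutes {..<\<gamma> i} \<and> (\<forall>\<alpha><\<gamma> i. y i \<alpha> = x i (\<pi> \<alpha>))" by blast
  from choice[OF this] obtain \<pi> where \<pi>: "\<And>i. \<pi> i permutes {..<\<gamma> i}" "\<And>i \<alpha>. \<alpha> < \<gamma> i \<Longrightarrow> y i \<alpha> = x i (\<pi> i \<alpha>)" by blast
  have "y = rearrange \<gamma> x \<pi>" using \<pi>(2) enumsD(4)[OF y] by (intro ext) (auto simp: rearrange_def not_less)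
  then show "y \<in> rearrange \<gamma> x ` perms \<gamma>" using \<pi>(1) by (auto simp: perms_def)
qed

lemma enums_card:
  assumes "enums \<gamma> P \<noteq> {}" shows "fam_card P = \<gamma>"
proof -
  obtain x where "x \<in> enums \<gamma> P" using assms by blast
  then have "card (P i) = \<gamma> i" for i using bij_betw_same_card[OF enumsD(1)[of x \<gamma> P i]] by simp
  then show ?thesis by (simp add: fam_card_def)
qed

lemma finite_enums: "finite (enums \<gamma> P)" for \<gamma> :: "'i::finite dimvec"
proof (cases "enums \<gamma> P = {}")
  case False
  then obtain x where x: "x \<in> enums \<gamma> P" by blast
  have "bij_betw (rearrange \<gamma> x) (perms \<gamma>) (enums \<gamma> (\<lambda>i. x i ` {..<\<gamma> i}))" by (rule bij_rearrange[OF enumsD(2)[OF x]])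
  then show ?thesis using bij_betw_finite finite_perms enumsD(3)[OF x] by auto
qed simp

lemma card_enums:
  fixes P :: "'i::finite fam"
  assumes P: "ffam P" "fam_card P = \<gamma>"
  shows "card (enums \<gamma> P) = card (perms \<gamma>)"
proof -
  let ?x = "\<lambda>i \<alpha>. sorted_list_of_set (P i) ! \<alpha>"
  have b: "bij_betw (?x i) {..<\<gamma> i} (P i)" for i
    using sorted_list_bij[of "P i"] P unfolding ffam_def fam_card_def by auto
  have "bij_betw (rearrange \<gamma> ?x) (perms \<gamma>) (enums \<gamma> (\<lambda>i. ?x i ` {..<\<gamma> i}))"
    by (rule bij_rearrange) (rule bij_betw_imp_inj_on[OF b])
  moreover have "(\<lambda>i. ?x i ` {..<\<gamma> i}) = P" using bij_betw_imp_surj_on[OF b] by blast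
  ultimately show ?thesis using bij_betw_same_card by fastforce
qed

lemma symz:
  shows symz_hall: "symz \<gamma> f \<in> hall_comp \<gamma>"
    and fs_symz: "ffam P \<Longrightarrow> fam_card P = \<gamma> \<Longrightarrow> fs (symz \<gamma> f) P = tot \<gamma> f P"
proof -
  have iv: "symz \<gamma> f \<in> in_vars \<gamma>"
    unfolding symz_def
  proof (intro in_vars_sum subst_in_vars_all)
    fix \<pi> i \<alpha> assume "\<pi> \<in> perms \<gamma>"
    then have "\<alpha> < \<gamma> i \<Longrightarrow> \<pi> i \<alpha> < \<gamma> i" using permutes_in_image[of "\<pi> i" "{..<\<gamma> i}" \<alpha>] by (auto simp: perms_def)
    then show "(if \<alpha> < \<gamma> i then pvar i (\<pi> i \<alpha>) else 0) \<in> in_vars \<gamma>" by (auto intro: in_vars_pvar)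
  qed
  have e: "ev x (symz \<gamma> f) = tot \<gamma> f (\<lambda>i. x i ` {..<\<gamma> i})" if "generic {} x" for x
  proof -
    have "ev x (symz \<gamma> f) = (\<Sum>\<pi>\<in>perms \<gamma>. ev (rearrange \<gamma> x \<pi>) f)"
      unfolding symz_def ev_simps ev_subst rearrange_def
      by (intro sum.cong refl arg_cong2[of _ _ _ _ ev] ext) simp
    also have "\<dots> = tot \<gamma> f (\<lambda>i. x i ` {..<\<gamma> i})"
      unfolding tot_def by (rule sum.reindex_bij_betw[OF bij_rearrange[OF generic_inj[OF that]]])
    finally show ?thesis .
  qed
  show "symz \<gamma> f \<in> hall_comp \<gamma>" by (rule hall_fsI(1)[OF finite.emptyI iv e])
  show "ffam P \<Longrightarrow> fam_card P = \<gamma> \<Longrightarrow> fs (symz \<gamma> f) P = tot \<gamma> f P"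
    by (rule hall_fsI(2)[OF finite.emptyI iv e]) simp_all
qed

definition symmetrized :: "'i::finite dimvec \<Rightarrow> 'i mpoly \<Rightarrow> 'i coha" where
  "symmetrized \<gamma> f = single \<gamma> (symz \<gamma> f)"

lemma symmetrized_carrier [simp]: "symmetrized \<gamma> f \<in> coha_carrier"
  by (simp add: symmetrized_def symz_hall)

lemma cv_SY: "ffam P \<Longrightarrow> cv (symmetrized \<gamma> f) P = tot \<gamma> f P"
proof (cases "fam_card P = \<gamma>")
  case True
  assume "ffam P" with True show ?thesis by (simp add: symmetrized_def cv_single fs_symz)
next
  case False
  then have "enums \<gamma> P = {}" using enums_card by blast
  then show ?thesis using False by (simp add: symmetrized_def cv_single tot_def)
qed

lemma symmetrized_add: "symmetrized \<gamma> (f + g) = symmetrized \<gamma> f + symmetrized \<gamma> g"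
  by (rule cv_ext[of "{}"]) (simp_all add: cv_SY tot_def sum.distrib)

lemma symmetrized_scale: "symmetrized \<gamma> (single 0 c * f) = coha_scale c (symmetrized \<gamma> f)"
  by (rule cv_ext[of "{}"]) (simp_all add: cv_SY tot_def sum_distrib_left)

lemma symmetrized_symmetric:
  fixes p :: "'i::finite mpoly"
  assumes p: "p \<in> hall_comp \<gamma>"
  shows "symmetrized \<gamma> p = coha_scale (of_nat (card (perms \<gamma>))) (single \<gamma> p)"
proof (rule cv_ext[of "{}"])
  fix P :: "'i fam" assume P: "ffam P"
  show "cv (symmetrized \<gamma> p) P = cv (coha_scale (of_nat (card (perms \<gamma>))) (single \<gamma> p)) P"
  proof (cases "fam_card P = \<gamma>")
    case True
    have "ev x p = fs p P" if "x \<in> enums \<gamma> P" for x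
      using hall_fs[OF p enumsD(2)[OF that]] enumsD(3)[OF that] by simp
    then have "tot \<gamma> p P = of_nat (card (enums \<gamma> P)) * fs p P" by (simp add: tot_def)
    then show ?thesis using True by (simp add: cv_SY[OF P] cv_single card_enums[OF P True])
  next
    case False
    then have "enums \<gamma> P = {}" using enums_card by blast
    then show ?thesis using False by (simp add: cv_SY[OF P] cv_single tot_def)
  qed
qed (use p in simp_all)

text \<open>Splitting the variables into the positions in \<open>S\<close> and the others.\<close>

locale position_split =
  fixes \<gamma> :: "'i::finite dimvec" and S :: "'i \<Rightarrow> nat set"
  assumes S: "S i \<subseteq> {..<\<gamma> i}"
begin

definition "T i = {..<\<gamma> i} - S i"
definition "\<delta> i = card (S i)"
definition "\<epsilon> i = card (T i)"
definition "eS i \<alpha> = sorted_list_of_set (S i) ! \<alpha>"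
definition "eT i \<alpha> = sorted_list_of_set (T i) ! \<alpha>"
definition "rS i = inv_into {..<\<delta> i} (eS i)"
definition "rT i = inv_into {..<\<epsilon> i} (eT i)"

lemma finST: "finite (S i)" "finite (T i)"
  using S[of i] finite_subset by (auto simp: T_def)

lemma bijS: "bij_betw (eS i) {..<\<delta> i} (S i)" and bijT: "bij_betw (eT i) {..<\<epsilon> i} (T i)"
  using sorted_list_bij[OF finST(1)[of i]] sorted_list_bij[OF finST(2)[of i]]
  unfolding eS_def[abs_def] eT_def[abs_def] \<delta>_def \<epsilon>_def by auto

lemma rS: "\<alpha> \<in> S i \<Longrightarrow> eS i (rS i \<alpha>) = \<alpha>" "\<alpha> \<in> S i \<Longrightarrow> rS i \<alpha> < \<delta> i" "\<beta> < \<delta> i \<Longrightarrow> rS i (eS i \<beta>) = \<beta>"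
  "\<beta> < \<delta> i \<Longrightarrow> eS i \<beta> \<in> S i"
  using bij_betw_inv_into_right[OF bijS[of i]] bij_betw_inv_into_left[OF bijS[of i]]
    bij_betwE[OF bij_betw_inv_into[OF bijS[of i]]] bij_betwE[OF bijS[of i]] unfolding rS_def by auto

lemma rT: "\<alpha> \<in> T i \<Longrightarrow> eT i (rT i \<alpha>) = \<alpha>" "\<alpha> \<in> T i \<Longrightarrow> rT i \<alpha> < \<epsilon> i" "\<beta> < \<epsilon> i \<Longrightarrow> rT i (eT i \<beta>) = \<beta>"
  "\<beta> < \<epsilon> i \<Longrightarrow> eT i \<beta> \<in> T i"
  using bij_betw_inv_into_right[OF bijT[of i]] bij_betw_inv_into_left[OF bijT[of i]]
    bij_betwE[OF bij_betw_inv_into[OF bijT[of i]]] bij_betwE[OF bijT[of i]] unfolding rT_def by auto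

definition "resS x = (\<lambda>i \<alpha>. if \<alpha> < \<delta> i then x i (eS i \<alpha>) else (0::rat))"
definition "resT x = (\<lambda>i \<alpha>. if \<alpha> < \<epsilon> i then x i (eT i \<alpha>) else (0::rat))"
definition "combine y z = (\<lambda>i \<alpha>. if \<alpha> \<in> S i then y i (rS i \<alpha>) else if \<alpha> < \<gamma> i then z i (rT i \<alpha>) else (0::rat))"
definition "imS x = (\<lambda>i. (x i :: nat \<Rightarrow> rat) ` S i)"

lemma T_iff: "\<alpha> \<in> T i \<longleftrightarrow> \<alpha> < \<gamma> i \<and> \<alpha> \<notin> S i"
  by (auto simp: T_def)

lemma S_less: "\<alpha> \<in> S i \<Longrightarrow> \<alpha> < \<gamma> i"
  using S by auto

lemma imS_diff:
  assumes x: "x \<in> enums \<gamma> P" shows "imS x \<le> P" "P - imS x = (\<lambda>i. x i ` T i)"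
proof -
  have P: "P i = x i ` {..<\<gamma> i}" for i using enumsD(3)[OF x] by simp
  show "imS x \<le> P" unfolding le_fun_def P imS_def using S by blast
  have "P i - x i ` S i = x i ` T i" for i
    unfolding P T_def using inj_on_image_set_diff[OF enumsD(2)[OF x, of i] _ S[of i]] by auto
  then show "P - imS x = (\<lambda>i. x i ` T i)" by (simp add: imS_def fun_eq_iff)
qed

lemma combine_res:
  assumes x: "x \<in> enums \<gamma> P" shows "combine (resS x) (resT x) = x"
proof (intro ext)
  fix i \<alpha>
  consider "\<alpha> \<in> S i" | "\<alpha> \<in> T i" | "\<gamma> i \<le> \<alpha>" using S_less[of \<alpha> i] T_iff[of \<alpha> i] by fastforce
  then show "combine (resS x) (resT x) i \<alpha> = x i \<alpha>"
  proof cases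
    case 1 then show ?thesis by (simp add: combine_def resS_def rS)
  next
    case 2 then show ?thesis using T_iff[of \<alpha> i] by (simp add: combine_def resT_def rT)
  next
    case 3 then show ?thesis using S_less[of \<alpha> i] enumsD(4)[OF x 3] by (auto simp: combine_def)
  qed
qed

lemma res_enums:
  assumes x: "x \<in> enums \<gamma> P" shows "resS x \<in> enums \<delta> (imS x)" "resT x \<in> enums \<epsilon> (P - imS x)"
proof -
  have iS: "inj_on (x i) (S i)" and iT: "inj_on (x i) (T i)" for i
    using inj_on_subset[OF enumsD(2)[OF x, of i]] S[of i] by (auto simp: T_def)
  have "bij_betw (resS x i) {..<\<delta> i} C \<longleftrightarrow> bij_betw (x i \<circ> eS i) {..<\<delta> i} C" for i C
    by (rule bij_betw_cong) (simp add: resS_def)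
  moreover have "bij_betw (x i \<circ> eS i) {..<\<delta> i} (x i ` S i)" for i
    by (rule bij_betw_trans[OF bijS inj_on_imp_bij_betw[OF iS]])
  ultimately show "resS x \<in> enums \<delta> (imS x)" by (simp add: enums_def imS_def resS_def)
  have "bij_betw (resT x i) {..<\<epsilon> i} C \<longleftrightarrow> bij_betw (x i \<circ> eT i) {..<\<epsilon> i} C" for i C
    by (rule bij_betw_cong) (simp add: resT_def)
  moreover have "bij_betw (x i \<circ> eT i) {..<\<epsilon> i} (x i ` T i)" for i
    by (rule bij_betw_trans[OF bijT inj_on_imp_bij_betw[OF iT]])
  ultimately show "resT x \<in> enums \<epsilon> (P - imS x)" unfolding imS_diff(2)[OF x] by (simp add: enums_def resT_def)
qed

lemma combine_enums:
  assumes A: "A \<le> P" and y: "y \<in> enums \<delta> A" and z: "z \<in> enums \<epsilon> (P - A)"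
  shows "combine y z \<in> enums \<gamma> P" "imS (combine y z) = A" "resS (combine y z) = y" "resT (combine y z) = z"
proof -
  have gS: "combine y z i \<alpha> = y i (rS i \<alpha>)" if "\<alpha> \<in> S i" for i \<alpha> using that by (simp add: combine_def)
  have gT: "combine y z i \<alpha> = z i (rT i \<alpha>)" if "\<alpha> \<in> T i" for i \<alpha> using that T_iff[of \<alpha> i] by (simp add: combine_def)
  have bS: "bij_betw (combine y z i) (S i) (A i)" for i
  proof -
    have "bij_betw (y i \<circ> rS i) (S i) (A i)"
      unfolding rS_def by (rule bij_betw_trans[OF bij_betw_inv_into[OF bijS] enumsD(1)[OF y]])
    moreover have "bij_betw (combine y z i) (S i) (A i) \<longleftrightarrow> bij_betw (y i \<circ> rS i) (S i) (A i)"
      by (rule bij_betw_cong) (simp add: gS)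
    ultimately show ?thesis by simp
  qed
  have bT: "bij_betw (combine y z i) (T i) (P i - A i)" for i
  proof -
    have "bij_betw (z i \<circ> rT i) (T i) ((P - A) i)"
      unfolding rT_def by (rule bij_betw_trans[OF bij_betw_inv_into[OF bijT] enumsD(1)[OF z]])
    moreover have "bij_betw (combine y z i) (T i) (P i - A i) \<longleftrightarrow> bij_betw (z i \<circ> rT i) (T i) (P i - A i)"
      by (rule bij_betw_cong) (simp add: gT)
    ultimately show ?thesis by simp
  qed
  have "bij_betw (combine y z i) (S i \<union> T i) (A i \<union> (P i - A i))" for i
    by (rule bij_betw_combine[OF bS bT]) auto
  moreover have "S i \<union> T i = {..<\<gamma> i}" "A i \<union> (P i - A i) = P i" for i
    using S[of i] A by (auto simp: T_def le_fun_def)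
  moreover have "combine y z i \<alpha> = 0" if "\<gamma> i \<le> \<alpha>" for i \<alpha> using that S_less[of \<alpha> i] by (auto simp: combine_def)
  ultimately show "combine y z \<in> enums \<gamma> P" by (simp add: enums_def)
  show "imS (combine y z) = A" unfolding imS_def using bij_betw_imp_surj_on[OF bS] by blast
  show "resS (combine y z) = y"
  proof (intro ext)
    fix i \<alpha>
    show "resS (combine y z) i \<alpha> = y i \<alpha>"
      using enumsD(4)[OF y, of i \<alpha>] by (cases "\<alpha> < \<delta> i") (simp_all add: resS_def gS rS)
  qed
  show "resT (combine y z) = z"
  proof (intro ext)
    fix i \<alpha>
    show "resT (combine y z) i \<alpha> = z i \<alpha>"
      using enumsD(4)[OF z, of i \<alpha>] by (cases "\<alpha> < \<epsilon> i") (simp_all add: resT_def gT rT)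
  qed
qed

text \<open>An enumeration of \<open>P\<close> amounts to the subfamily of the values at positions in \<open>S\<close>, an enumeration of it, and one of
  its complement.\<close>

lemma sum_enums_split:
  fixes F :: "'i fam \<Rightarrow> _ \<Rightarrow> _ \<Rightarrow> rat"
  assumes P: "ffam P"
  shows "(\<Sum>A\<in>{..P}. \<Sum>y\<in>enums \<delta> A. \<Sum>z\<in>enums \<epsilon> (P - A). F A y z) = (\<Sum>x\<in>enums \<gamma> P. F (imS x) (resS x) (resT x))"
proof -
  have "(\<Sum>A\<in>{..P}. \<Sum>y\<in>enums \<delta> A. \<Sum>z\<in>enums \<epsilon> (P - A). F A y z) =
      (\<Sum>(A, y, z)\<in>(SIGMA A:{..P}. enums \<delta> A \<times> enums \<epsilon> (P - A)). F A y z)"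
    unfolding sum.cartesian_product by (rule sum.Sigma) (auto simp: finite_subfams[OF P] finite_enums)
  also have "\<dots> = (\<Sum>x\<in>enums \<gamma> P. F (imS x) (resS x) (resT x))"
    by (rule sum.reindex_bij_witness[where j = "\<lambda>(A, y, z). combine y z" and i = "\<lambda>x. (imS x, resS x, resT x)"])
      (auto simp: combine_enums combine_res res_enums imS_diff(1))
  finally show ?thesis .
qed

text \<open>A monomial factors into its parts at the positions in \<open>S\<close> and at the others, each renumbered. Variables that do not
  belong to \<open>\<gamma>\<close> are replaced by zero in the second part, in accordance with \<open>enums\<close>.\<close>

definition "polS m = subst (\<lambda>i \<alpha>. if \<alpha> \<in> S i then pvar i (rS i \<alpha>) else 1) (single m (1::rat))"
definition "polT m = subst (\<lambda>i \<alpha>. if \<alpha> \<in> S i then 1 else if \<alpha> < \<gamma> i then pvar i (rT i \<alpha>) else 0) (single m (1::rat))"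

lemma ev_pol:
  assumes x: "x \<in> enums \<gamma> P"
  shows "ev (resS x) (polS m) * ev (resT x) (polT m) = ev x (single m 1)"
proof -
  let ?f = "\<lambda>i \<alpha>. ev (resS x) (if \<alpha> \<in> S i then pvar i (rS i \<alpha>) else 1)"
  let ?g = "\<lambda>i \<alpha>. ev (resT x) (if \<alpha> \<in> S i then 1 else if \<alpha> < \<gamma> i then pvar i (rT i \<alpha>) else 0)"
  have fg: "case_var ?f v * case_var ?g v = case_var x v" for v
  proof (cases v)
    case (X i \<alpha>)
    have "?f i \<alpha> * ?g i \<alpha> = combine (resS x) (resT x) i \<alpha>" by (simp add: combine_def)
    then show ?thesis unfolding X var.case combine_res[OF x] .
  qed
  have "mono_eval (case_var ?f) m * mono_eval (case_var ?g) m = mono_eval (case_var x) m"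
    unfolding mono_eval_def prod.distrib[symmetric] power_mult_distrib[symmetric] fg ..
  then show ?thesis unfolding polS_def polT_def ev_subst ev_single by simp
qed

end

context twisted
begin

lemma symmetrized_Hplus: "\<rho> \<noteq> (\<lambda>_. 0) \<Longrightarrow> symmetrized \<rho> p \<in> Hplus"
  unfolding Hplus_def using symmetrized_carrier[of \<rho> p] by (auto simp: symmetrized_def lookup_single)

end

locale twisted_split = twisted a \<psi> + position_split \<gamma> S
  for a :: "'i::finite quiver" and \<psi> and \<gamma> :: "'i dimvec" and S +
  assumes proper: "\<exists>i. S i \<noteq> {}" "\<exists>i. S i \<noteq> {..<\<gamma> i}"
begin

lemma nonzero: "\<delta> \<noteq> (\<lambda>_. 0)" "\<epsilon> \<noteq> (\<lambda>_. 0)"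
proof -
  obtain i where "S i \<noteq> {}" using proper(1) by blast
  then have "\<delta> i \<noteq> 0" using finST[of i] by (simp add: \<delta>_def)
  then show "\<delta> \<noteq> (\<lambda>_. 0)" by (auto simp: fun_eq_iff)
  obtain j where "S j \<noteq> {..<\<gamma> j}" using proper(2) by blast
  then have "T j \<noteq> {}" using S[of j] by (auto simp: T_def)
  then have "\<epsilon> j \<noteq> 0" using finST[of j] by (simp add: \<epsilon>_def)
  then show "\<epsilon> \<noteq> (\<lambda>_. 0)" by (auto simp: fun_eq_iff)
qed

definition "sgn0 = bit_sign (\<psi> (cls \<delta>) (cls \<epsilon>))"

lemma cv_product:
  assumes P: "ffam P"
  shows "cv (symmetrized \<delta> p \<star> symmetrized \<epsilon> q) P = sgn0 * (\<Sum>x\<in>enums \<gamma> P. kern a (imS x) (P - imS x) * (ev (resS x) p * ev (resT x) q))"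
proof -
  have fA: "ffam A" "ffam (P - A)" if "A \<in> {..P}" for A using that ffam_mono[OF P] P by auto
  have "cv (symmetrized \<delta> p \<star> symmetrized \<epsilon> q) P = (\<Sum>A\<in>{..P}. twisted_kern A (P - A) * tot \<delta> p A * tot \<epsilon> q (P - A))"
    unfolding cv_mul[OF symmetrized_carrier symmetrized_carrier P] by (intro sum.cong refl) (simp add: cv_SY fA)
  also have "\<dots> = (\<Sum>A\<in>{..P}. \<Sum>y\<in>enums \<delta> A. \<Sum>z\<in>enums \<epsilon> (P - A). twisted_kern A (P - A) * (ev y p * ev z q))"
    unfolding tot_def mult.assoc unfolding sum_product unfolding sum_distrib_left ..
  also have "\<dots> = (\<Sum>x\<in>enums \<gamma> P. twisted_kern (imS x) (P - imS x) * (ev (resS x) p * ev (resT x) q))"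
    by (rule sum_enums_split[OF P])
  also have "\<dots> = (\<Sum>x\<in>enums \<gamma> P. sgn0 * (kern a (imS x) (P - imS x) * (ev (resS x) p * ev (resT x) q)))"
  proof (rule sum.cong[OF refl])
    fix x assume x: "x \<in> enums \<gamma> P"
    have "fam_card (imS x) = \<delta>" "fam_card (P - imS x) = \<epsilon>" using enums_card res_enums[OF x] by blast+
    then have "twisted_kern (imS x) (P - imS x) = sgn0 * kern a (imS x) (P - imS x)" unfolding twisted_kern_def sgn0_def by simp
    then show "twisted_kern (imS x) (P - imS x) * (ev (resS x) p * ev (resT x) q) =
      sgn0 * (kern a (imS x) (P - imS x) * (ev (resS x) p * ev (resT x) q))" by (simp only: mult.assoc)
  qed
  finally show ?thesis unfolding sum_distrib_left .
qed

text \<open>Write \<open>h\<close> as a sum of products of a monomial in the variables at \<open>S\<close> and one in the others; symmetrizing such a product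
  together with the kernel gives, up to sign, the product of the two symmetrizations.\<close>

lemma symmetrized_Dec:
  assumes f: "\<And>P x. ffam P \<Longrightarrow> x \<in> enums \<gamma> P \<Longrightarrow> ev x f = kern a (imS x) (P - imS x) * ev x h"
  shows "symmetrized \<gamma> f \<in> Dec"
proof -
  define d where "d = (\<Sum>m\<in>keys h. coha_scale (sgn0 * lookup h m) (symmetrized \<delta> (polS m) \<star> symmetrized \<epsilon> (polT m)))"
  have dD: "d \<in> Dec"
    unfolding d_def by (intro coha.subspace_sum[OF Dec_subspace] coha.subspace_scale[OF Dec_subspace] mul_Dec symmetrized_Hplus nonzero)
  have "symmetrized \<gamma> f = d"
  proof (rule cv_ext[OF finite.emptyI symmetrized_carrier Hplus_carrier[OF subsetD[OF Dec_Hplus dD]]])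
    fix P :: "'i fam" assume P: "ffam P"
    have s: "sgn0 * sgn0 = 1" by (simp add: sgn0_def)
    have evh: "(\<Sum>m\<in>keys h. lookup h m * ev x (single m 1)) = ev x h" for x
    proof -
      have "ev x (\<Sum>m\<in>keys h. single m (lookup h m)) = (\<Sum>m\<in>keys h. lookup h m * ev x (single m 1))"
        unfolding ev_simps ev_single by simp
      then show ?thesis unfolding poly_mapping_sum_single[symmetric] by (rule sym)
    qed
    have "cv d P = (\<Sum>m\<in>keys h. (sgn0 * lookup h m) * (sgn0 * (\<Sum>x\<in>enums \<gamma> P. kern a (imS x) (P - imS x) * ev x (single m 1))))"
      unfolding d_def cv_simps cv_scale cv_product[OF P] by (intro sum.cong refl arg_cong2[of _ _ _ _ "(*)"]) (simp add: ev_pol)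
    also have "\<dots> = (\<Sum>m\<in>keys h. \<Sum>x\<in>enums \<gamma> P. kern a (imS x) (P - imS x) * (lookup h m * ev x (single m 1)))"
    proof (rule sum.cong[OF refl])
      fix m
      let ?X = "\<Sum>x\<in>enums \<gamma> P. kern a (imS x) (P - imS x) * ev x (single m 1)"
      have "(sgn0 * lookup h m) * (sgn0 * ?X) = (sgn0 * sgn0) * (lookup h m * ?X)" by (simp only: mult_ac)
      also have "\<dots> = (\<Sum>x\<in>enums \<gamma> P. kern a (imS x) (P - imS x) * (lookup h m * ev x (single m 1)))"
        unfolding s mult_1_left sum_distrib_left by (intro sum.cong refl mult.left_commute)
      finally show "(sgn0 * lookup h m) * (sgn0 * ?X) =
        (\<Sum>x\<in>enums \<gamma> P. kern a (imS x) (P - imS x) * (lookup h m * ev x (single m 1)))" .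
    qed
    also have "\<dots> = (\<Sum>x\<in>enums \<gamma> P. kern a (imS x) (P - imS x) * ev x h)"
      unfolding evh[symmetric] sum_distrib_left by (rule sum.swap)
    also have "\<dots> = tot \<gamma> f P" unfolding tot_def by (intro sum.cong refl) (simp add: f[OF P])
    finally show "cv (symmetrized \<gamma> f) P = cv d P" by (simp add: cv_SY[OF P])
  qed
  then show ?thesis using dD by simp
qed

definition cross :: "('i \<Rightarrow> 'i \<Rightarrow> nat) \<Rightarrow> ('i \<Rightarrow> nat \<Rightarrow> 'b::comm_ring_1) \<Rightarrow> 'b" where
  "cross n x = (\<Prod>i\<in>UNIV. \<Prod>j\<in>UNIV. \<Prod>\<alpha>\<in>S i. \<Prod>\<beta>\<in>T j. (x j \<beta> - x i \<alpha>) ^ n i j)"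

lemma cross_add: "cross (\<lambda>i j. n i j + m i j) x = cross n x * cross m x"
  by (simp add: cross_def power_add prod.distrib)

lemma ev_cross: "ev x (cross n pvar) = cross n x"
  by (simp add: cross_def)

lemma kern_cross:
  assumes x: "x \<in> enums \<gamma> P"
  shows "kern a (imS x) (P - imS x) = cross a x / cross (\<lambda>i j. if i = j then 1 else 0) x"
    and "cross (\<lambda>i j. if i = j then 1 else 0) x \<noteq> 0"
proof -
  have iS: "inj_on (x i) (S i)" and iT: "inj_on (x i) (T i)" for i
    using inj_on_subset[OF enumsD(2)[OF x, of i]] S[of i] by (auto simp: T_def)
  have 1: "(\<Prod>i\<in>UNIV. \<Prod>j\<in>UNIV. \<Prod>u\<in>x i ` S i. \<Prod>v\<in>x j ` T j. (v - u) ^ a i j) = cross a x"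
    unfolding cross_def prod.reindex[OF iS] prod.reindex[OF iT] by simp
  have 2: "cross (\<lambda>i j. if i = j then 1 else 0) x = (\<Prod>i\<in>UNIV. \<Prod>\<alpha>\<in>S i. \<Prod>\<beta>\<in>T i. x i \<beta> - x i \<alpha>)"
  proof -
    have "(\<Prod>j\<in>UNIV. \<Prod>\<alpha>\<in>S i. \<Prod>\<beta>\<in>T j. (x j \<beta> - x i \<alpha>) ^ (if i = j then 1 else 0)) =
        (\<Prod>j\<in>UNIV. if i = j then \<Prod>\<alpha>\<in>S i. \<Prod>\<beta>\<in>T j. x j \<beta> - x i \<alpha> else 1)" for i
      by (intro prod.cong refl) simp
    then show ?thesis unfolding cross_def by simp
  qed
  show "kern a (imS x) (P - imS x) = cross a x / cross (\<lambda>i j. if i = j then 1 else 0) x"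
    unfolding kern_def imS_diff(2)[OF x] 2 unfolding imS_def prod.reindex[OF iS] prod.reindex[OF iT] by (simp add: cross_def)
  have "x i \<beta> - x i \<alpha> \<noteq> 0" if "\<alpha> \<in> S i" "\<beta> \<in> T i" for i \<alpha> \<beta>
    using inj_onD[OF enumsD(2)[OF x, of i], of \<beta> \<alpha>] that S_less[of \<alpha> i] T_iff[of \<beta> i] by auto
  then show "cross (\<lambda>i j. if i = j then 1 else 0) x \<noteq> 0"
    unfolding 2 by (simp add: finST)
qed

text \<open>The exponent \<open>m\<close> is large enough for the kernel to divide the \<open>m\<close>-th power of the product of differences.\<close>

lemma cross_Dec:
  assumes m: "\<And>i j. a i j \<le> m"
  shows "symmetrized \<gamma> (cross (\<lambda>_ _. m) pvar * g) \<in> Dec"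
proof (rule symmetrized_Dec)
  fix P x assume x: "x \<in> enums \<gamma> P"
  let ?e = "\<lambda>i j. if i = j then 1 else 0 :: nat" and ?n = "\<lambda>i j. m - a i j + (if i = j then 1 else 0 :: nat)"
  have e: "(\<lambda>i j. a i j + ?n i j) = (\<lambda>i j. ?e i j + m)"
  proof (intro ext)
    fix i j
    show "a i j + ?n i j = ?e i j + m" using m[of i j] by simp
  qed
  have "cross a x * cross ?n x = cross ?e x * cross (\<lambda>_ _. m) x"
    unfolding cross_add[symmetric] e ..
  then have "cross (\<lambda>_ _. m) x = kern a (imS x) (P - imS x) * cross ?n x"
    unfolding kern_cross(1)[OF x] using kern_cross(2)[OF x] by (simp add: field_simps)
  then show "ev x (cross (\<lambda>_ _. m) pvar * g) = kern a (imS x) (P - imS x) * ev x (cross ?n pvar * g)"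
    by (simp add: ev_cross)
qed

end

lemma (in position_split) cross_pairs:
  fixes Y :: "'i \<times> nat \<Rightarrow> 'b::comm_ring_1"
  shows "(\<Prod>(s, t)\<in>Sigma UNIV S \<times> Sigma UNIV T. Y t - Y s) ^ m = (\<Prod>i\<in>UNIV. \<Prod>j\<in>UNIV. \<Prod>\<alpha>\<in>S i. \<Prod>\<beta>\<in>T j. (Y (j, \<beta>) - Y (i, \<alpha>)) ^ m)"
proof -
  have 1: "(\<Prod>s\<in>Sigma UNIV S. G s) = (\<Prod>i\<in>UNIV. \<Prod>\<alpha>\<in>S i. G (i, \<alpha>))" for G :: "'i \<times> nat \<Rightarrow> 'b"
    by (subst prod.Sigma) (auto simp: finST)
  have 2: "(\<Prod>s\<in>Sigma UNIV T. G s) = (\<Prod>i\<in>UNIV. \<Prod>\<alpha>\<in>T i. G (i, \<alpha>))" for G :: "'i \<times> nat \<Rightarrow> 'b"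
    by (subst prod.Sigma) (auto simp: finST)
  have "(\<Prod>(s, t)\<in>Sigma UNIV S \<times> Sigma UNIV T. Y t - Y s) = (\<Prod>s\<in>Sigma UNIV S. \<Prod>t\<in>Sigma UNIV T. Y t - Y s)"
    by (rule prod.cartesian_product[symmetric])
  also have "\<dots> = (\<Prod>i\<in>UNIV. \<Prod>\<alpha>\<in>S i. \<Prod>j\<in>UNIV. \<Prod>\<beta>\<in>T j. Y (j, \<beta>) - Y (i, \<alpha>))"
    unfolding 1 2 ..
  also have "\<dots> = (\<Prod>i\<in>UNIV. \<Prod>j\<in>UNIV. \<Prod>\<alpha>\<in>S i. \<Prod>\<beta>\<in>T j. Y (j, \<beta>) - Y (i, \<alpha>))"
    by (intro prod.cong refl prod.swap)
  finally show ?thesis by (simp only: prod_power_distrib)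
qed

context twisted
begin

text \<open>Symmetrization is linear over symmetric polynomials only; asking for all multiples yields an ideal in all polynomials.\<close>

definition sym_ideal :: "'i dimvec \<Rightarrow> 'i mpoly set" where
  "sym_ideal \<gamma> = {f. \<forall>g. symmetrized \<gamma> (f * g) \<in> sig_Dec_sum}"

lemma sym_ideal_D: "f \<in> sym_ideal \<gamma> \<Longrightarrow> symmetrized \<gamma> (f * g) \<in> sig_Dec_sum"
  by (simp add: sym_ideal_def)

lemma ideal_symI: "ring_ideal (sym_ideal \<gamma>)"
  unfolding ring_ideal_def
proof (intro conjI ballI allI)
  have "symmetrized \<gamma> 0 + symmetrized \<gamma> 0 = symmetrized \<gamma> 0 + (0 :: 'i coha)" unfolding symmetrized_add[symmetric] by simp
  then have "symmetrized \<gamma> 0 = (0 :: 'i coha)" by (rule add_left_imp_eq)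
  then show "0 \<in> sym_ideal \<gamma>" unfolding sym_ideal_def using coha.subspace_0[OF sig_Dec_sum_subspace] by simp
  fix x y assume "x \<in> sym_ideal \<gamma>" "y \<in> sym_ideal \<gamma>"
  then show "x + y \<in> sym_ideal \<gamma>"
    unfolding sym_ideal_def mem_Collect_eq distrib_right symmetrized_add
    by (intro allI coha.subspace_add[OF sig_Dec_sum_subspace]) (rule spec, assumption)+
next
  fix x r assume x: "x \<in> sym_ideal \<gamma>"
  show "r * x \<in> sym_ideal \<gamma>"
    unfolding sym_ideal_def mem_Collect_eq
  proof
    fix g
    have "r * x * g = x * (r * g)" by (simp only: mult_ac)
    then show "symmetrized \<gamma> (r * x * g) \<in> sig_Dec_sum" using sym_ideal_D[OF x, of "r * g"] by (simp only:)
  qed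
qed

lemma sym_ideal_cancel: assumes n: "n > 0" and y: "of_nat n * y \<in> sym_ideal \<gamma>" shows "y \<in> sym_ideal \<gamma>"
  unfolding sym_ideal_def mem_Collect_eq
proof
  fix g
  have 1: "single 0 (1 / of_nat n) * of_nat n = (1 :: 'i mpoly)"
    by (rule poly_ext[of "{}"]) (use n in simp_all)
  have "y * g = (single 0 (1 / of_nat n) * of_nat n) * (y * g)" unfolding 1 by simp
  also have "\<dots> = single 0 (1 / of_nat n) * (of_nat n * y * g)" by (simp only: mult.assoc)
  finally have "symmetrized \<gamma> (y * g) = coha_scale (1 / of_nat n) (symmetrized \<gamma> (of_nat n * y * g))" by (simp only: symmetrized_scale)
  then show "symmetrized \<gamma> (y * g) \<in> sig_Dec_sum" using coha.subspace_scale[OF sig_Dec_sum_subspace sym_ideal_D[OF y]] by (simp only:)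
qed

abbreviation positions :: "'i dimvec \<Rightarrow> ('i \<times> nat) set" where "positions \<gamma> \<equiv> (SIGMA i:UNIV. {..<\<gamma> i})"

lemma sum_variables_symI:
  assumes "\<gamma> \<noteq> (\<lambda>_. 0)"
  shows "(\<Sum>u\<in>positions \<gamma>. case_prod pvar u) \<in> sym_ideal \<gamma>"
  unfolding sym_ideal_def mem_Collect_eq
proof
  fix g
  let ?s = "\<Sum>u\<in>positions \<gamma>. case_prod pvar u"
  have "symmetrized \<gamma> (?s * g) = sig (symmetrized \<gamma> g)"
  proof (rule cv_ext[OF finite.emptyI symmetrized_carrier sig_carrier[OF symmetrized_carrier]])
    fix P :: "'i fam" assume P: "ffam P"
    have "ev x ?s = psum P" if x: "x \<in> enums \<gamma> P" for x
    proof -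
      have "?s = (\<Sum>i\<in>UNIV. \<Sum>\<alpha>\<in>{..<\<gamma> i}. pvar i \<alpha>)" by (subst sum.Sigma) (auto intro!: sum.cong)
      then have "ev x ?s = (\<Sum>i\<in>UNIV. \<Sum>\<alpha>\<in>{..<\<gamma> i}. x i \<alpha>)" by (simp only: ev_simps ev_pvar)
      also have "\<dots> = psum P" unfolding psum_def by (intro sum.cong refl sum.reindex_bij_betw enumsD(1)[OF x])
      finally show ?thesis .
    qed
    then have "tot \<gamma> (?s * g) P = (\<Sum>x\<in>enums \<gamma> P. psum P * ev x g)"
      unfolding tot_def ev_simps(4) by (intro sum.cong refl) simp
    then show "cv (symmetrized \<gamma> (?s * g)) P = cv (sig (symmetrized \<gamma> g)) P"
      unfolding cv_sig[OF P] cv_SY[OF P] tot_def sum_distrib_left .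
  qed
  then show "symmetrized \<gamma> (?s * g) \<in> sig_Dec_sum" using sig_sig_Dec_sum[OF symmetrized_Hplus[OF assms]] by (simp only:)
qed

lemma variable_nilpotent:
  assumes \<gamma>: "\<gamma> \<noteq> (\<lambda>_. 0)" and u: "u \<in> positions \<gamma>"
  shows "\<exists>k. case_prod pvar u ^ k \<in> sym_ideal \<gamma>"
proof (rule nilpotent_coordinates[OF _ u ideal_symI sum_variables_symI[OF \<gamma>]])
  show fin: "finite (positions \<gamma>)" by auto
  have "card (positions \<gamma>) > 0" using u fin by (metis card_gt_0_iff empty_iff)
  then show "y \<in> sym_ideal \<gamma>" if "of_nat (card (positions \<gamma>)) * y \<in> sym_ideal \<gamma>" for y by (rule sym_ideal_cancel[OF _ that])
  fix R assume R: "R \<subseteq> positions \<gamma>" "R \<noteq> {}" "R \<noteq> positions \<gamma>"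
  define S where "S i = {\<alpha>. (i, \<alpha>) \<in> R}" for i
  have RS: "R = Sigma UNIV S" by (auto simp: S_def)
  interpret ts: twisted_split a \<psi> \<gamma> S
  proof unfold_locales
    show "S i \<subseteq> {..<\<gamma> i}" for i using R(1) by (auto simp: S_def)
    show "\<exists>i. S i \<noteq> {}" using R(2) unfolding RS by auto
    show "\<exists>i. S i \<noteq> {..<\<gamma> i}"
    proof (rule ccontr)
      assume "\<not> (\<exists>i. S i \<noteq> {..<\<gamma> i})"
      then have "S = (\<lambda>i. {..<\<gamma> i})" by auto
      then show False using R(3) unfolding RS by simp
    qed
  qed
  define m where "m = (\<Sum>i\<in>UNIV. \<Sum>j\<in>UNIV. a i j)"
  have m: "a i j \<le> m" for i j
  proof -
    have "a i j \<le> (\<Sum>j\<in>UNIV. a i j)" by (rule member_le_sum) auto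
    also have "\<dots> \<le> m" unfolding m_def by (rule member_le_sum[of i UNIV "\<lambda>i. \<Sum>j\<in>UNIV. a i j"]) auto
    finally show ?thesis .
  qed
  have T: "positions \<gamma> - R = Sigma UNIV ts.T" by (auto simp: RS ts.T_def)
  have "(\<Prod>(s, t)\<in>R \<times> (positions \<gamma> - R). case_prod pvar t - case_prod pvar s) ^ m = ts.cross (\<lambda>_ _. m) pvar"
    unfolding T unfolding RS ts.cross_pairs ts.cross_def prod.case ..
  moreover have "ts.cross (\<lambda>_ _. m) pvar \<in> sym_ideal \<gamma>"
    unfolding sym_ideal_def mem_Collect_eq by (intro allI Dec_sig_Dec_sum ts.cross_Dec m)
  ultimately show "\<exists>m. (\<Prod>(s, t)\<in>R \<times> (positions \<gamma> - R). case_prod pvar t - case_prod pvar s) ^ m \<in> sym_ideal \<gamma>"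
    by (intro exI[of _ m]) (simp only:)
qed

lemma pvar_power: "pvar i \<alpha> ^ k = single (single (X i \<alpha>) k) (1 :: rat)"
  by (induction k) (simp_all add: pvar_def mult_single single_add[symmetric])

text \<open>A monomial of large degree contains a large power of some variable.\<close>

lemma high_degree_sig_Dec_sum:
  assumes \<gamma>: "\<gamma> \<noteq> (\<lambda>_. 0)"
  shows "\<exists>N. \<forall>p\<in>hall_comp \<gamma>. (\<forall>m\<in>keys p. N \<le> mono_degree m) \<longrightarrow> single \<gamma> p \<in> sig_Dec_sum"
proof -
  let ?U = "positions \<gamma>"
  have "\<forall>u\<in>?U. \<exists>k. case_prod pvar u ^ k \<in> sym_ideal \<gamma>" using variable_nilpotent[OF \<gamma>] by (intro ballI)
  from bchoice[OF this] obtain kk where kk: "\<forall>u\<in>?U. case_prod pvar u ^ kk u \<in> sym_ideal \<gamma>" by (elim exE)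
  define N where "N = Suc (\<Sum>u\<in>?U. kk u)"
  have fin: "finite ?U" by auto
  have mono: "single m c \<in> sym_ideal \<gamma>" if m: "keys m \<subseteq> {X i \<alpha> | i \<alpha>. \<alpha> < \<gamma> i}" "N \<le> mono_degree m" for m and c :: rat
  proof -
    let ?X = "case_prod X :: 'i \<times> nat \<Rightarrow> 'i var"
    have "keys m \<subseteq> ?X ` ?U" using m(1) by force
    then have "mono_degree m = (\<Sum>v\<in>?X ` ?U. lookup m v)" using fin by (intro mono_degree_superset) auto
    also have "\<dots> = (\<Sum>u\<in>?U. lookup m (?X u))" by (subst sum.reindex) (auto simp: inj_on_def)
    finally have d: "mono_degree m = (\<Sum>u\<in>?U. lookup m (?X u))" .
    have "\<exists>u\<in>?U. kk u \<le> lookup m (?X u)"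
    proof (rule ccontr)
      assume "\<not> (\<exists>u\<in>?U. kk u \<le> lookup m (?X u))"
      then have "lookup m (?X u) \<le> kk u" if "u \<in> ?U" for u using that by (meson linear)
      then have "mono_degree m \<le> (\<Sum>u\<in>?U. kk u)" unfolding d by (rule sum_mono)
      then show False using m(2) by (simp add: N_def)
    qed
    then obtain i \<alpha> where u: "(i, \<alpha>) \<in> ?U" "kk (i, \<alpha>) \<le> lookup m (X i \<alpha>)" by auto
    let ?k = "kk (i, \<alpha>)"
    have e: "m = single (X i \<alpha>) ?k + (m - single (X i \<alpha>) ?k)"
      by (rule poly_mapping_eqI) (use u(2) in \<open>auto simp: lookup_add lookup_minus lookup_single when_def\<close>)
    have "pvar i \<alpha> ^ ?k * single (m - single (X i \<alpha>) ?k) c = single (single (X i \<alpha>) ?k + (m - single (X i \<alpha>) ?k)) c"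
      unfolding pvar_power by (simp add: mult_single)
    moreover have "pvar i \<alpha> ^ ?k \<in> sym_ideal \<gamma>" using bspec[OF kk u(1)] by simp
    ultimately have "single (single (X i \<alpha>) ?k + (m - single (X i \<alpha>) ?k)) c \<in> sym_ideal \<gamma>"
      using ring_idealD(4)[OF ideal_symI, of "pvar i \<alpha> ^ ?k" \<gamma> "single (m - single (X i \<alpha>) ?k) c"] by (simp only:)
    then show ?thesis unfolding e[symmetric] .
  qed
  show ?thesis
  proof (intro exI[of _ N] ballI impI)
    fix p assume p: "p \<in> hall_comp \<gamma>" and deg: "\<forall>m\<in>keys p. N \<le> mono_degree m"
    have "(\<Sum>m\<in>keys p. single m (lookup p m)) \<in> sym_ideal \<gamma>"
      using hall_in_vars[OF p] deg by (intro ring_ideal_sum[OF ideal_symI] mono) (auto simp: in_vars_def)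
    then have "p \<in> sym_ideal \<gamma>" unfolding poly_mapping_sum_single[symmetric] .
    from sym_ideal_D[OF this, of 1] have "symmetrized \<gamma> p \<in> sig_Dec_sum" by (simp only: mult_1_right)
    then have "coha_scale (1 / of_nat (card (perms \<gamma>))) (coha_scale (of_nat (card (perms \<gamma>))) (single \<gamma> p)) \<in> sig_Dec_sum"
      unfolding symmetrized_symmetric[OF p] by (rule coha.subspace_scale[OF sig_Dec_sum_subspace])
    moreover have "card (perms \<gamma>) \<noteq> 0"
    proof -
      have "perms \<gamma> \<noteq> {}" using id_perms by blast
      then show ?thesis by (simp add: card_eq_0_iff finite_perms)
    qed
    ultimately show "single \<gamma> p \<in> sig_Dec_sum" by simp
  qed
qed

end

context twisted_prim
begin

lemma finite_Vprim_degrees: "finite {k. Vprim \<inter> coha_bideg a \<gamma> k \<noteq> {0}}"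
proof (cases "\<gamma> = (\<lambda>_. 0)")
  case True
  have "{k. Vprim \<inter> coha_bideg a \<gamma> k \<noteq> {0}} = {}"
    unfolding Vprim_bideg True Bp(3) by (simp add: coha.span_empty)
  then show ?thesis by simp
next
  case False
  obtain N where N: "\<forall>p\<in>hall_comp \<gamma>. (\<forall>m\<in>keys p. N \<le> mono_degree m) \<longrightarrow> single \<gamma> p \<in> sig_Dec_sum"
    using high_degree_sig_Dec_sum[OF False] by (elim exE)
  have "{k. Vprim \<inter> coha_bideg a \<gamma> k \<noteq> {0}} \<subseteq> (\<lambda>d. 2 * int d + euler_dim a \<gamma>) ` {..<N}"
  proof
    fix k assume "k \<in> {k. Vprim \<inter> coha_bideg a \<gamma> k \<noteq> {0}}"
    moreover have "0 \<in> Vprim \<inter> coha_bideg a \<gamma> k"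
      using coha.subspace_0[OF Vprim_subspace] coha.subspace_0[OF bideg_subspace] by (rule IntI)
    ultimately obtain x where x: "x \<in> Vprim" "x \<in> coha_bideg a \<gamma> k" "x \<noteq> 0" by blast
    have kx: "x \<in> coha_carrier" "keys x \<subseteq> {\<gamma>}" "\<And>m. m \<in> keys (lookup x \<gamma>) \<Longrightarrow> 2 * int (mono_degree m) + euler_dim a \<gamma> = k"
      using x(2) unfolding bideg_iff_keys by auto
    have xs: "single \<gamma> (lookup x \<gamma>) = x"
      by (rule poly_mapping_eqI) (use kx(2) in \<open>auto simp: lookup_single when_def in_keys_iff\<close>)
    have "\<not> (\<forall>m\<in>keys (lookup x \<gamma>). N \<le> mono_degree m)"
    proof
      assume "\<forall>m\<in>keys (lookup x \<gamma>). N \<le> mono_degree m"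
      with bspec[OF N carrier_lookup[OF kx(1)]] have "single \<gamma> (lookup x \<gamma>) \<in> sig_Dec_sum" by (rule mp)
      then have "x \<in> sig_Dec_sum" unfolding xs .
      then show False using Vprim_sig_Dec_sum[OF x(1)] x(3) by simp
    qed
    then obtain m where "m \<in> keys (lookup x \<gamma>)" "mono_degree m < N" by (auto simp: not_le)
    then show "k \<in> (\<lambda>d. 2 * int d + euler_dim a \<gamma>) ` {..<N}" using kx(3)[of m] by (intro image_eqI[of _ _ "mono_degree m"]) auto
  qed
  then show ?thesis by (rule finite_subset) simp
qed

end

theorem theorem1p1:
  fixes a :: "'i::finite quiver"
    and \<psi> :: "bit ^ 'i \<Rightarrow> bit ^ 'i \<Rightarrow> bit"
  assumes "symmetric_quiver a"
    and "sign_twist a \<psi>"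
  shows "\<exists>V Vprim \<phi>.
    bigraded_subspace a V \<and> V \<subseteq> coha_carrier \<and>
    freely_generated_by a \<psi> V \<and>
    bigraded_subspace a Vprim \<and> Vprim \<subseteq> coha_carrier \<and>
    bigraded_iso_tensor_Qx a Vprim V \<phi> \<and>
    (\<forall>\<gamma>. finite {k. Vprim \<inter> coha_bideg a \<gamma> k \<noteq> {0}}) \<and>
    (\<forall>\<gamma> k. \<exists>B. finite B \<and> coha.span B = Vprim \<inter> coha_bideg a \<gamma> k)"
proof -
  interpret twisted a \<psi> using assms by unfold_locales
  obtain Bp where Bp: "prim_basis Bp" using prim_basis_exists by (rule exE)
  interpret twisted_prim a \<psi> Bp using Bp by unfold_locales
  have "V \<subseteq> coha_carrier" "Vprim \<subseteq> coha_carrier"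
    using V_Hplus Vprim_Hplus Hplus_carrier by blast+
  then show ?thesis
    by (intro exI[of _ V] exI[of _ Vprim] exI[of _ phi] conjI allI bigraded_V bigraded_Vprim
        freely_generated_V iso_phi finite_Vprim_degrees Vprim_bideg_finite_span)
qed

end
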